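(* Let $f\in S^*(\mathbb{R}^d)$ be an almost periodic distribution. Then the following conditions are equivalent: i) the sum $\sum_{|\lambda|<R}|a(\lambda,f)|$ converges for every $R<\infty$; ii) $\hat f$ is a measure; iii) $\hat f$ is an atomic measure of the form $\hat f=\sum_\lambda a(\lambda,f)\delta_\lambda$.
   Context: $S(\mathbb{R}^d)$ is the Schwartz space and $S^*(\mathbb{R}^d)$ is the space of temperate (tempered) distributions. The Fourier transform of a test function is $\hat\varphi(y)=\int_{\mathbb{R}^d}\varphi(x)e^{-2\pi i\langle x,y\rangle}dx$, and for $f\in S^*(\mathbb{R}^d)$ it is defined by $\hat f(\varphi)=f(\hat\varphi)$. A measure means a complex-valued (locally finite, Radon) measure on $\mathbb{R}^d$; $\delta_\lambda$ is the unit mass at $\lambda$. A continuous function $g$ on $\mathbb{R}^d$ is almost periodic if for every $\varepsilon>0$ the set $\{\tau\in\mathbb{R}^d:\sup_{x}|g(x+\tau)-g(x)|<\varepsilon\}$ is relatively dense (i.e. for some $R<\infty$ it meets every ball of radius $R$). A distribution $f\in S^*(\mathbb{R}^d)$ is almost periodic if $t\mapsto(f\star\psi)(t)=f(\psi(t-\cdot))$ is an almost periodic function for every $C^\infty$ function $\psi$ on $\mathbb{R}^d$ with compact support. Fourier coefficients: for an almost periodic function $g$ and $\lambda\in\mathbb{R}^d$, $a(\lambda,g)=\lim_{R\to\infty}\frac{1}{\omega_dR^d}\int_{B(0,R)}g(t)e^{-2\pi i\langle\lambda,t\rangle}dt$, where $\omega_d$ is the volume of the unit ball in $\mathbb{R}^d$.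 For an almost periodic temperate distribution $f$ and $\lambda\in\mathbb{R}^d$, $a(\lambda,f)=a(\lambda,f\star\phi)/\hat\phi(\lambda)$, where $\phi$ is any $C^\infty$ function with compact support such that $\hat\phi(\lambda)\ne0$ (the value does not depend on the choice of $\phi$). Sums over $\lambda$ run over the $\lambda\in\mathbb{R}^d$ (with $|\lambda|<R$ when indicated) for which $a(\lambda,f)\neq0$. *)

theory Defs
  imports "HOL-Analysis.Analysis"
begin

section \<open>Test functions and the Schwartz space\<close>

text \<open>A list \<open>bs\<close> of basis vectors plays the role of a multi-index: \<open>partials bs \<phi>\<close> is the
  partial derivative of \<open>\<phi>\<close> of order \<open>length bs\<close> along these coordinates. For smooth functions
  the order of the list is irrelevant.\<close>

primrec partials :: "'a list \<Rightarrow> ('a::euclidean_space \<Rightarrow> complex) \<Rightarrow> 'a \<Rightarrow> complex" where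
  "partials [] \<phi> = \<phi>"
| "partials (b # bs) \<phi> = (\<lambda>x. frechet_derivative (partials bs \<phi>) (at x) b)"

definition smooth :: "('a::euclidean_space \<Rightarrow> complex) \<Rightarrow> bool" where
  "smooth \<phi> \<longleftrightarrow> (\<forall>bs x. set bs \<subseteq> Basis \<longrightarrow> partials bs \<phi> differentiable (at x))"

definition test_functions :: "('a::euclidean_space \<Rightarrow> complex) set" where
  "test_functions = {\<phi>. smooth \<phi> \<and> compact (closure {x. \<phi> x \<noteq> 0})}"

definition schwartz_values :: "nat \<Rightarrow> nat \<Rightarrow> ('a::euclidean_space \<Rightarrow> complex) \<Rightarrow> real set" where
  "schwartz_values n m \<phi> =
     {(1 + norm x) ^ n * norm (partials bs \<phi> x) | x bs. set bs \<subseteq> Basis \<and> length bs \<le> m}"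

definition schwartz_space :: "('a::euclidean_space \<Rightarrow> complex) set" where
  "schwartz_space = {\<phi>. smooth \<phi> \<and> (\<forall>n m. bdd_above (schwartz_values n m \<phi>))}"

definition schwartz_norm :: "nat \<Rightarrow> nat \<Rightarrow> ('a::euclidean_space \<Rightarrow> complex) \<Rightarrow> real" where
  "schwartz_norm n m \<phi> = Sup (schwartz_values n m \<phi>)"

definition schwartz_ball ::
    "nat \<Rightarrow> nat \<Rightarrow> ('a::euclidean_space \<Rightarrow> complex) \<Rightarrow> real \<Rightarrow> ('a \<Rightarrow> complex) set" where
  "schwartz_ball n m \<phi> r = {\<psi> \<in> schwartz_space. schwartz_norm n m (\<lambda>x. \<psi> x - \<phi> x) < r}"

definition schwartz_topology :: "('a::euclidean_space \<Rightarrow> complex) topology" where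
  "schwartz_topology =
     topology_generated_by {schwartz_ball n m \<phi> r | n m \<phi> r. \<phi> \<in> schwartz_space \<and> r > 0}"


section \<open>Temperate distributions and the Fourier transform\<close>

text \<open>A distribution is a functional on all functions of which only the values on the
  Schwartz space matter.\<close>

definition temperate :: "(('a::euclidean_space \<Rightarrow> complex) \<Rightarrow> complex) \<Rightarrow> bool" where
  "temperate f \<longleftrightarrow>
     (\<forall>\<phi>\<in>schwartz_space. \<forall>\<psi>\<in>schwartz_space. f (\<lambda>x. \<phi> x + \<psi> x) = f \<phi> + f \<psi>) \<and>
     (\<forall>c. \<forall>\<phi>\<in>schwartz_space. f (\<lambda>x. c * \<phi> x) = c * f \<phi>) \<and>
     continuous_map schwartz_topology euclidean f"

definition fourier :: "('a::euclidean_space \<Rightarrow> complex) \<Rightarrow> 'a \<Rightarrow> complex" where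
  "fourier \<phi> y = (LINT x|lborel. \<phi> x * exp (- 2 * of_real pi * \<i> * of_real (x \<bullet> y)))"

definition fourier_dist ::
    "(('a::euclidean_space \<Rightarrow> complex) \<Rightarrow> complex) \<Rightarrow> ('a \<Rightarrow> complex) \<Rightarrow> complex" where
  "fourier_dist f \<phi> = f (fourier \<phi>)"

definition conv ::
    "(('a::euclidean_space \<Rightarrow> complex) \<Rightarrow> complex) \<Rightarrow> ('a \<Rightarrow> complex) \<Rightarrow> 'a \<Rightarrow> complex" where
  "conv f \<psi> t = f (\<lambda>x. \<psi> (t - x))"


section \<open>Almost periodicity and Fourier coefficients\<close>

definition relatively_dense :: "'a::euclidean_space set \<Rightarrow> bool" where
  "relatively_dense T \<longleftrightarrow> (\<exists>R. \<forall>x. ball x R \<inter> T \<noteq> {})"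

text \<open>The supremum is taken in the extended reals, so that it is \<open>\<infinity>\<close> for unbounded
  differences.\<close>

definition almost_periodic :: "('a::euclidean_space \<Rightarrow> complex) \<Rightarrow> bool" where
  "almost_periodic g \<longleftrightarrow> continuous_on UNIV g \<and>
     (\<forall>\<epsilon>>0. relatively_dense {\<tau>. (SUP x. ereal (norm (g (x + \<tau>) - g x))) < ereal \<epsilon>})"

definition almost_periodic_dist ::
    "(('a::euclidean_space \<Rightarrow> complex) \<Rightarrow> complex) \<Rightarrow> bool" where
  "almost_periodic_dist f \<longleftrightarrow> (\<forall>\<psi>\<in>test_functions. almost_periodic (conv f \<psi>))"

definition mean_coeff :: "'a::euclidean_space \<Rightarrow> ('a \<Rightarrow> complex) \<Rightarrow> complex" where
  "mean_coeff \<xi> g = Lim at_top (\<lambda>R::real.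
     (LINT t:ball 0 R|lborel. g t * exp (- 2 * of_real pi * \<i> * of_real (\<xi> \<bullet> t))) /
       of_real (unit_ball_vol (real DIM('a)) * R ^ DIM('a)))"

text \<open>The quotient does not depend on the choice of \<open>\<phi>\<close> when \<open>f\<close> is temperate and almost
  periodic.\<close>

definition fourier_coeff ::
    "'a::euclidean_space \<Rightarrow> (('a \<Rightarrow> complex) \<Rightarrow> complex) \<Rightarrow> complex" where
  "fourier_coeff \<xi> f = (let \<phi> = (SOME \<phi>. \<phi> \<in> test_functions \<and> fourier \<phi> \<xi> \<noteq> 0)
     in mean_coeff \<xi> (conv f \<phi>) / fourier \<phi> \<xi>)"

definition dist_spectrum :: "(('a::euclidean_space \<Rightarrow> complex) \<Rightarrow> complex) \<Rightarrow> 'a set" where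
  "dist_spectrum f = {\<xi>. fourier_coeff \<xi> f \<noteq> 0}"


section \<open>Complex Radon measures\<close>

text \<open>A locally finite complex measure is in general not defined on unbounded sets. Here it is a
  countably additive set function on the bounded Borel sets (its values on other sets are
  irrelevant) with finite total variation on every compact set. Regularity is automatic
  on a Euclidean space.\<close>

definition complex_radon_measure :: "('a::euclidean_space set \<Rightarrow> complex) \<Rightarrow> bool" where
  "complex_radon_measure \<mu> \<longleftrightarrow>
     (\<forall>A :: nat \<Rightarrow> 'a set. range A \<subseteq> sets borel \<and> disjoint_family A \<and> bounded (\<Union>i. A i) \<longrightarrow>
        (\<lambda>i. \<mu> (A i)) sums \<mu> (\<Union>i. A i)) \<and>
     (\<forall>K. compact K \<longrightarrow>
        bdd_above {\<Sum>B\<in>P. norm (\<mu> B) | P. finite P \<and> disjoint P \<and> P \<subseteq> sets borel \<and> \<Union>P \<subseteq> K})"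

definition simple_integral_cm ::
    "('a::euclidean_space set \<Rightarrow> complex) \<Rightarrow> ('a \<Rightarrow> complex) \<Rightarrow> complex" where
  "simple_integral_cm \<mu> s = (\<Sum>c\<in>range s - {0}. c * \<mu> (s -` {c}))"

text \<open>For \<open>\<phi>\<close> a uniform limit of Borel simple functions supported in a common bounded set, the
  integral is the limit of the integrals of these simple functions. As \<open>\<mu>\<close> has finite
  variation on bounded sets, the limit exists and is the same for all approximating sequences.\<close>

definition has_integral_cm ::
    "('a::euclidean_space \<Rightarrow> complex) \<Rightarrow> complex \<Rightarrow> ('a set \<Rightarrow> complex) \<Rightarrow> bool" where
  "has_integral_cm \<phi> I \<mu> \<longleftrightarrow>
     (\<exists>s :: nat \<Rightarrow> 'a \<Rightarrow> complex.
        (\<forall>n. simple_function borel (s n)) \<and> bounded (\<Union>n. {x. s n x \<noteq> 0}) \<and>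
        uniform_limit UNIV s \<phi> sequentially \<and>
        (\<lambda>n. simple_integral_cm \<mu> (s n)) \<longlonglongrightarrow> I)"

text \<open>As usual for distributions, a temperate distribution is identified with a measure by
  testing on compactly supported smooth functions: the integral of a Schwartz function need
  not converge absolutely.\<close>

definition equals_measure ::
    "(('a::euclidean_space \<Rightarrow> complex) \<Rightarrow> complex) \<Rightarrow> ('a set \<Rightarrow> complex) \<Rightarrow> bool" where
  "equals_measure F \<mu> \<longleftrightarrow> complex_radon_measure \<mu> \<and>
     (\<forall>\<phi>\<in>test_functions. has_integral_cm \<phi> (F \<phi>) \<mu>)"

definition is_radon_measure :: "(('a::euclidean_space \<Rightarrow> complex) \<Rightarrow> complex) \<Rightarrow> bool" where
  "is_radon_measure F \<longleftrightarrow> (\<exists>\<mu>. equals_measure F \<mu>)"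

definition unit_mass :: "'a::euclidean_space \<Rightarrow> 'a set \<Rightarrow> complex" where
  "unit_mass \<xi> A = indicator A \<xi>"

text \<open>\<open>\<mu> = (\<Sum>\<xi>\<in>L. a \<xi> \<cdot> \<delta>\<^sub>\<xi>)\<close>, evaluated on bounded Borel sets; unordered convergence of complex
  sums is absolute.\<close>

definition atomic_sum ::
    "('a::euclidean_space set \<Rightarrow> complex) \<Rightarrow> ('a \<Rightarrow> complex) \<Rightarrow> 'a set \<Rightarrow> bool" where
  "atomic_sum \<mu> a L \<longleftrightarrow>
     (\<forall>A\<in>sets borel. bounded A \<longrightarrow> ((\<lambda>\<xi>. a \<xi> * unit_mass \<xi> A) has_sum \<mu> A) L)"

end

theory Submission
  imports Defs "HOL-Probability.Probability"
begin

text \<open>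
  For test functions \<open>\<gamma>\<close> and \<open>\<beta>\<close> the regularised distribution
  \<open>u t = f (fourier (\<lambda>y. \<beta> y * fourier \<gamma> y * ec (y \<bullet> t)))\<close> is a uniformly almost periodic
  function whose Fourier coefficient at \<open>\<xi>\<close> is \<open>\<beta> \<xi> * fourier \<gamma> \<xi>\<close> times that of \<open>f\<close>, so only
  bounded frequencies occur.

  If the coefficients are locally summable, \<open>u\<close> and the absolutely convergent sum of its Fourier
  series have the same coefficients, hence agree by the uniqueness theorem for almost periodic
  functions. At \<open>t = 0\<close>, and as \<open>\<gamma>\<close> shrinks to a point mass, this says that \<open>fourier_dist f\<close> is
  the asserted sum of point masses.

  If \<open>fourier_dist f\<close> is a measure, it is bounded in the supremum norm on continuous functions
  supported in a fixed ball. For unimodular \<open>c\<close>, a finite sum \<open>\<Sum> c \<xi> * a \<xi>\<close> of coefficients of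
  \<open>u\<close> is a mean of \<open>u\<close> against an exponential polynomial, that is, a limit of values of
  \<open>fourier_dist f\<close> at functions whose supremum stays bounded, because the normalised kernels
  concentrated at separated frequencies hardly overlap. This bounds the sum of \<open>\<bar>a \<xi>\<bar>\<close> over
  each ball.
\<close>

text \<open>Two regularising functions are needed because of a mismatch of supports. Almost
  periodicity of \<open>f\<close> is known only through convolutions with compactly supported
  functions, whereas \<open>fourier_dist f\<close> is tested on compactly supported functions, so
  that \<open>f\<close> itself meets their transforms, which do not have compact support. A product
  \<open>fourier \<gamma> y * \<beta> y\<close> fits both sides. It is a test function, and its
  transform at \<open>x\<close> is the integral of \<open>\<gamma> (s - x)\<close> against the
  rapidly decreasing weight \<open>fourier \<beta> s\<close>. Continuity of \<open>f\<close> in some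
  Schwartz seminorm lets it pass under this integral, and \<open>u\<close> becomes an average of
  translates of \<open>conv f \<gamma>\<close> against an integrable kernel. This gives the almost
  periodicity of \<open>u\<close>, and Fourier inversion turns the kernel into the multiplier
  \<open>\<beta> \<xi>\<close> of the coefficients. The uniqueness theorem rests on Parseval
  estimates damped by a Gaussian: the damping keeps every integral absolutely convergent and becomes
  an approximate identity on the other side.\<close>

definition ec :: "real \<Rightarrow> complex" where
  "ec r = cis (2 * pi * r)"

lemma ec_add: "ec (x + y) = ec x * ec y"
  by (simp add: ec_def cis_mult ring_distribs)

lemma ec_0 [simp]: "ec 0 = 1"
  by (simp add: ec_def)

lemma norm_ec [simp]: "norm (ec r) = 1"
  by (simp add: ec_def)

lemma ec_minus: "ec (- x) = cnj (ec x)"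
  by (simp add: ec_def cis_cnj)

lemma ec_has_vector_derivative:
  "(ec has_vector_derivative (2 * pi * \<i>) * ec t) (at t within S)"
proof -
  have ec_exp: "ec = (\<lambda>r. exp (\<i> * (2 * pi * complex_of_real r)))"
    by (simp add: ec_def cis_conv_exp fun_eq_iff)
  show ?thesis
    unfolding ec_exp
    by (rule has_vector_derivative_real_field) (auto intro!: derivative_eq_intros)
qed

lemma ec_inner_has_derivative:
  "((\<lambda>x. ec (x \<bullet> v)) has_derivative (\<lambda>h. of_real (h \<bullet> v) * ((2 * pi * \<i>) * ec (x \<bullet> v)))) (at x within S)"
proof -
  have "((\<lambda>x. ec (x \<bullet> v)) has_derivative (\<lambda>h. (h \<bullet> v) *\<^sub>R ((2 * pi * \<i>) * ec (x \<bullet> v)))) (at x within S)"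
    by (rule has_derivative_compose [OF has_derivative_inner_left [OF has_derivative_ident]
          ec_has_vector_derivative [unfolded has_vector_derivative_def]])
  then show ?thesis by (simp add: scaleR_conv_of_real)
qed

lemma continuous_on_ec [continuous_intros]:
  assumes "continuous_on S f"
  shows "continuous_on S (\<lambda>x. ec (f x))"
  unfolding ec_def by (intro continuous_intros assms)

lemma ec_measurable [measurable]: "ec \<in> borel_measurable borel"
  by (intro borel_measurable_continuous_onI continuous_on_ec continuous_on_id)

text \<open>The bridge to the exponentials as they are written in \<open>fourier\<close> and
  \<open>mean_coeff\<close>.\<close>

lemma exp_unit: "exp (- 2 * of_real pi * \<i> * of_real r) = ec (- r)"
  by (simp add: ec_def cis_conv_exp mult_ac)

lemma norm_ec_diff_le: "norm (ec x - ec y) \<le> 2 * pi * \<bar>x - y\<bar>"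
proof -
  have "norm (ec x - ec y) \<le> (2 * pi) * norm (x - y)"
    using ec_has_vector_derivative [unfolded has_vector_derivative_def]
    by (intro differentiable_bound [of UNIV ec "\<lambda>t h. h *\<^sub>R ((2 * pi * \<i>) * ec t)"])
       (auto simp: norm_mult intro!: onorm_le)
  then show ?thesis by simp
qed

section \<open>Smooth functions\<close>

text \<open>The classical smooth function exp(-1/t), divided by powers of \<open>t\<close> so that
  the family is closed under differentiation up to linear combinations.\<close>

definition flat :: "nat \<Rightarrow> real \<Rightarrow> real" where
  "flat k t = (if t > 0 then exp (- 1 / t) / t ^ k else 0)"

text \<open>One term of the exponential series at \<open>1 / t\<close>, of index
  \<open>k + 2\<close>, already absorbs \<open>t ^ k\<close> and leaves two powers of
  \<open>t\<close>. Quadratic vanishing at 0 is what the difference quotient there requires.\<close>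

lemma flat_bound:
  assumes "t > 0"
  shows "flat k t \<le> fact (k + 2) * t\<^sup>2"
proof -
  have "(1 / t) ^ (k + 2) / fact (k + 2) \<le> exp (1 / t)"
  proof -
    have "(\<Sum>n\<in>{k+2}. inverse (fact n) * (1 / t) ^ n) \<le> (\<Sum>n. inverse (fact n) * (1 / t) ^ n)"
      using assms by (intro sum_le_suminf summable_exp) auto
    then show ?thesis by (simp add: exp_def divide_inverse scaleR_conv_of_real mult.commute)
  qed
  then have "exp (- 1 / t) \<le> fact (k + 2) * t ^ (k + 2)"
    using assms by (simp add: exp_minus field_simps del: fact_Suc power_Suc)
  then show ?thesis
    using assms by (simp add: flat_def divide_le_eq power_add power2_eq_square mult_ac del: fact_Suc)
qed

text \<open>Away from 0 this is elementary calculus on either branch. At 0 the quadratic bound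
  squeezes the difference quotient, and both functions on the right vanish there by
  definition.\<close>

lemma flat_has_derivative:
  "(flat k has_field_derivative (flat (k + 2) t - real k * flat (k + 1) t)) (at t)"
proof -
  consider "t > 0" | "t < 0" | "t = 0" by linarith
  then show ?thesis
  proof cases
    case 1
    have "((\<lambda>t. exp (- 1 / t) / t ^ k) has_field_derivative
        (flat (k + 2) t - real k * flat (k + 1) t)) (at t)"
      using 1 apply (auto intro!: derivative_eq_intros simp: flat_def field_simps power2_eq_square)
      apply (cases k; simp add: field_simps)
      done
    moreover have "eventually (\<lambda>u. u > 0) (nhds t)"
      using 1 by (intro eventually_nhds_in_open [of "{0<..}", simplified]) auto
    ultimately show ?thesis
      by (subst DERIV_cong_ev [OF refl _ refl]) (auto elim!: eventually_mono simp: flat_def)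
  next
    case 2
    have "((\<lambda>t. 0) has_field_derivative (flat (k + 2) t - real k * flat (k + 1) t)) (at t)"
      using 2 by (simp add: flat_def)
    moreover have "eventually (\<lambda>u. u < 0) (nhds t)"
      using 2 by (intro eventually_nhds_in_open [of "{..<0}", simplified]) auto
    then have "eventually (\<lambda>u. flat k u = 0) (nhds t)"
      by (auto elim!: eventually_mono simp: flat_def)
    ultimately show ?thesis
      by (subst DERIV_cong_ev [OF refl _ refl]) auto
  next
    case 3
    have "((\<lambda>h. (flat k (0 + h) - flat k 0) / h) \<longlongrightarrow> 0) (at 0)"
    proof (rule Lim_null_comparison)
      show "\<forall>\<^sub>F h in at 0. norm ((flat k (0 + h) - flat k 0) / h) \<le> fact (k + 2) * \<bar>h\<bar>"
      proof (intro always_eventually allI)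
        fix h :: real
        show "norm ((flat k (0 + h) - flat k 0) / h) \<le> fact (k + 2) * \<bar>h\<bar>"
        proof (cases "h > 0")
          case True
          have "\<bar>flat k h\<bar> \<le> fact (k + 2) * h\<^sup>2" 
            using flat_bound [OF True, of k] True by (simp add: flat_def del: fact_Suc)
          then show ?thesis using True by (simp add: flat_def field_simps power2_eq_square del: fact_Suc)
        next
          case False
          then have "norm ((flat k (0 + h) - flat k 0) / h) = 0" by (simp add: flat_def)
          also have "0 \<le> fact (k + 2) * \<bar>h\<bar>" by (intro mult_nonneg_nonneg) auto
          finally show ?thesis .
        qed
      qed
      show "((\<lambda>h::real. fact (k + 2) * \<bar>h\<bar>) \<longlongrightarrow> 0) (at 0)"
        by (rule tendsto_eq_intros refl | simp)+
    qed
    then show ?thesis using 3 by (simp add: DERIV_def flat_def)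
  qed
qed

text \<open>Every iterated partial derivative stays in \<open>S\<close>. Smoothness can thus be
  proved by exhibiting a closed class of functions instead of formulas for all higher
  derivatives.\<close>

lemma smooth_coinduct:
  assumes "\<phi> \<in> S"
    and "\<And>\<psi> x. \<psi> \<in> S \<Longrightarrow> \<psi> differentiable (at x)"
    and "\<And>\<psi> b. \<psi> \<in> S \<Longrightarrow> b \<in> Basis \<Longrightarrow> (\<lambda>x. frechet_derivative \<psi> (at x) b) \<in> S"
  shows "smooth \<phi>"
proof -
  have "set bs \<subseteq> Basis \<Longrightarrow> partials bs \<phi> \<in> S" for bs
    by (induction bs) (use assms in auto)
  then show ?thesis using assms(2) by (auto simp: smooth_def)
qed

lemma partials_append: "partials (bs @ cs) \<phi> = partials bs (partials cs \<phi>)"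
  by (induction bs) auto

lemma smooth_partials:
  assumes "smooth \<phi>" "set cs \<subseteq> Basis"
  shows "smooth (partials cs \<phi>)"
  unfolding smooth_def partials_append [symmetric]
  using assms by (auto simp: smooth_def)

lemma smooth_differentiable: "smooth \<phi> \<Longrightarrow> \<phi> differentiable (at x)"
  unfolding smooth_def by (auto dest: spec [of _ "[]"])

lemma smooth_has_derivative:
  "smooth \<phi> \<Longrightarrow> (\<phi> has_derivative frechet_derivative \<phi> (at x)) (at x)"
  by (simp add: smooth_differentiable frechet_derivative_works [symmetric])

lemma smooth_continuous: "smooth \<phi> \<Longrightarrow> continuous_on S \<phi>"
  by (meson continuous_at_imp_continuous_on differentiable_imp_continuous_within smooth_differentiable)

text \<open>The bump functions are built from \<open>flat\<close> inside this class, which is closed under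
  partial derivatives by construction.\<close>

inductive smooth_gen :: "('a::euclidean_space \<Rightarrow> complex) \<Rightarrow> bool" where
  base: "smooth \<phi> \<Longrightarrow> smooth_gen \<phi>"
| const: "smooth_gen (\<lambda>x. c)"
| inner: "smooth_gen (\<lambda>x. of_real (x \<bullet> v))"
| ec: "smooth_gen (\<lambda>x. ec (x \<bullet> v))"
| flat: "smooth_gen (\<lambda>x. of_real (flat k (r - x \<bullet> x)))"
| affine: "smooth_gen \<phi> \<Longrightarrow> smooth_gen (\<lambda>x. \<phi> (c *\<^sub>R x + a))"
| add: "smooth_gen \<phi> \<Longrightarrow> smooth_gen \<psi> \<Longrightarrow> smooth_gen (\<lambda>x. \<phi> x + \<psi> x)"
| mult: "smooth_gen \<phi> \<Longrightarrow> smooth_gen \<psi> \<Longrightarrow> smooth_gen (\<lambda>x. \<phi> x * \<psi> x)"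

text \<open>The derivative is carried as a witness \<open>D\<close>, since each rule can state its
  own formula, while \<open>frechet_derivative\<close> can be computed only after some derivative is
  known. The rule \<open>base\<close> admits arbitrary smooth functions, so that the same induction
  also yields closure of smooth functions under sums and products.\<close>

lemma smooth_gen_derivative:
  assumes "smooth_gen \<phi>"
  shows "\<exists>D. (\<forall>x. (\<phi> has_derivative D x) (at x)) \<and> (\<forall>b\<in>Basis. smooth_gen (\<lambda>x. D x b))"
  using assms
proof induction
  case (base \<phi>)
  then have "smooth (\<lambda>x. frechet_derivative \<phi> (at x) b)" if "b \<in> Basis" for b
    using smooth_partials [of \<phi> "[b]"] that by simp
  with base show ?case
    by (intro exI [of _ "\<lambda>x. frechet_derivative \<phi> (at x)"])
       (auto intro: smooth_gen.base smooth_has_derivative)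
next
  case (const c)
  show ?case by (intro exI [of _ "\<lambda>x h. 0"]) (auto intro: smooth_gen.const)
next
  case (inner v)
  show ?case
    by (intro exI [of _ "\<lambda>x h. of_real (h \<bullet> v)"]) (auto intro!: derivative_eq_intros smooth_gen.const)
next
  case (ec v)
  show ?case
    by (intro exI [of _ "\<lambda>x h. of_real (h \<bullet> v) * ((2 * pi * \<i>) * ec (x \<bullet> v))"])
       (intro conjI allI ballI ec_inner_has_derivative smooth_gen.mult smooth_gen.const smooth_gen.ec)
next
  case (flat k r)
  \<comment> \<open>The formula is arranged as sums and products of generators, with the numerical
    factors as constants, so that the rules of \<open>smooth_gen\<close> apply to it
    literally.\<close>
  have "((\<lambda>x::'a. complex_of_real (flat k (r - x \<bullet> x))) has_derivative
      (\<lambda>h. of_real (- 2) * of_real (h \<bullet> x) * (of_real (flat (k + 2) (r - x \<bullet> x)) +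
          of_real (- real k) * of_real (flat (k + 1) (r - x \<bullet> x))))) (at x)" for x
  proof -
    have "((\<lambda>x::'a. flat k (r - x \<bullet> x)) has_derivative (\<lambda>h. (- (2 * (h \<bullet> x))) *
        (flat (k + 2) (r - x \<bullet> x) - real k * flat (k + 1) (r - x \<bullet> x)))) (at x)"
    proof -
      have "(flat k has_derivative (\<lambda>h. h * (flat (k + 2) t - real k * flat (k + 1) t))) (at t)" for t
        by (rule has_derivative_eq_rhs [OF flat_has_derivative [unfolded has_field_derivative_def]]) auto
      moreover have "((\<lambda>x. r - x \<bullet> x) has_derivative (\<lambda>h. - (2 * (h \<bullet> x)))) (at x)"
        by (auto intro!: derivative_eq_intros simp: inner_commute)
      ultimately show ?thesis by (rule has_derivative_compose [rotated])
    qed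
    then show ?thesis
      by (rule has_derivative_eq_rhs [OF has_derivative_of_real]) (simp add: fun_eq_iff algebra_simps)
  qed
  moreover have "(\<lambda>x::'a. complex_of_real (b \<bullet> x)) = (\<lambda>x. of_real (x \<bullet> b))" for b
    by (simp add: inner_commute)
  then have "smooth_gen (\<lambda>x::'a. complex_of_real (b \<bullet> x))" for b
    using smooth_gen.inner by metis
  then have "smooth_gen (\<lambda>x::'a. of_real (- 2) * of_real (b \<bullet> x) * (of_real (flat (k + 2) (r - x \<bullet> x)) +
          of_real (- real k) * of_real (flat (k + 1) (r - x \<bullet> x))))" for b
    by (intro smooth_gen.add smooth_gen.mult smooth_gen.const smooth_gen.flat)
  ultimately show ?case
    by (intro exI [of _ "\<lambda>x h. of_real (- 2) * of_real (h \<bullet> x) * (of_real (flat (k + 2) (r - x \<bullet> x)) +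
          of_real (- real k) * of_real (flat (k + 1) (r - x \<bullet> x)))"] conjI allI ballI)
next
  case (affine \<phi> c a)
  then obtain D where D: "\<And>x. (\<phi> has_derivative D x) (at x)"
      "\<And>b. b \<in> Basis \<Longrightarrow> smooth_gen (\<lambda>x. D x b)" by blast
  have "((\<lambda>x. \<phi> (c *\<^sub>R x + a)) has_derivative (\<lambda>h. of_real c * D (c *\<^sub>R x + a) h)) (at x)" for x
  proof -
    have "((\<lambda>x. \<phi> (c *\<^sub>R x + a)) has_derivative (\<lambda>h. D (c *\<^sub>R x + a) (c *\<^sub>R h))) (at x)"
      by (rule has_derivative_compose [of "\<lambda>x. c *\<^sub>R x + a" "\<lambda>h. c *\<^sub>R h" x UNIV \<phi>])
         (auto intro!: derivative_eq_intros D)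
    then show ?thesis
      by (rule has_derivative_eq_rhs)
         (simp add: linear_scale [OF has_derivative_linear [OF D(1)]] scaleR_conv_of_real)
  qed
  moreover have "smooth_gen (\<lambda>x. of_real c * D (c *\<^sub>R x + a) b)" if "b \<in> Basis" for b
    using smooth_gen.mult [OF smooth_gen.const smooth_gen.affine [OF D(2) [OF that]]] .
  ultimately show ?case
    by (intro exI [of _ "\<lambda>x h. of_real c * D (c *\<^sub>R x + a) h"] conjI allI ballI)
next
  case (add \<phi> \<psi>)
  then obtain D E where "\<And>x. (\<phi> has_derivative D x) (at x)" "\<And>b. b \<in> Basis \<Longrightarrow> smooth_gen (\<lambda>x. D x b)"
     "\<And>x. (\<psi> has_derivative E x) (at x)" "\<And>b. b \<in> Basis \<Longrightarrow> smooth_gen (\<lambda>x. E x b)" by blast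
  then show ?case
    by (intro exI [of _ "\<lambda>x h. D x h + E x h"])
       (auto intro!: derivative_eq_intros smooth_gen.add)
next
  case (mult \<phi> \<psi>)
  then obtain D E where "\<And>x. (\<phi> has_derivative D x) (at x)" "\<And>b. b \<in> Basis \<Longrightarrow> smooth_gen (\<lambda>x. D x b)"
     "\<And>x. (\<psi> has_derivative E x) (at x)" "\<And>b. b \<in> Basis \<Longrightarrow> smooth_gen (\<lambda>x. E x b)" by blast
  with mult show ?case
    by (intro exI [of _ "\<lambda>x h. \<phi> x * E x h + D x h * \<psi> x"] conjI allI ballI)
       (blast intro: has_derivative_mult | intro smooth_gen.add smooth_gen.mult; blast)+
qed

lemma smooth_gen_imp_smooth:
  assumes "smooth_gen \<phi>"
  shows "smooth \<phi>"
proof (rule smooth_coinduct [of _ "Collect smooth_gen"])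
  fix \<psi> :: "'a \<Rightarrow> complex" and x b :: 'a
  assume "\<psi> \<in> Collect smooth_gen"
  then obtain D where D: "\<And>x. (\<psi> has_derivative D x) (at x)" "\<And>b. b \<in> Basis \<Longrightarrow> smooth_gen (\<lambda>x. D x b)"
    using smooth_gen_derivative by blast
  then show "\<psi> differentiable (at x)" by (auto simp: differentiable_def)
  have "frechet_derivative \<psi> (at x) = D x" for x
    using D(1) frechet_derivative_at by metis
  then show "(\<lambda>x. frechet_derivative \<psi> (at x) b) \<in> Collect smooth_gen" if "b \<in> Basis"
    using D(2) that by simp
qed (use assms in auto)

lemma smooth_const [simp]: "smooth (\<lambda>x. c)"
  and smooth_inner: "smooth (\<lambda>x. of_real (x \<bullet> v))"
  and smooth_ec: "smooth (\<lambda>x. ec (x \<bullet> v))"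
  and smooth_flat: "smooth (\<lambda>x. of_real (flat k (r - x \<bullet> x)))"
  and smooth_affine: "smooth \<phi> \<Longrightarrow> smooth (\<lambda>x. \<phi> (d *\<^sub>R x + a))"
  and smooth_add: "smooth \<phi> \<Longrightarrow> smooth \<psi> \<Longrightarrow> smooth (\<lambda>x. \<phi> x + \<psi> x)"
  and smooth_mult: "smooth \<phi> \<Longrightarrow> smooth \<psi> \<Longrightarrow> smooth (\<lambda>x. \<phi> x * \<psi> x)"
  by (auto intro!: smooth_gen_imp_smooth intro: smooth_gen.intros)

lemma frechet_derivative_eqI:
  "(\<phi> has_derivative D) (at x) \<Longrightarrow> frechet_derivative \<phi> (at x) = D"
  by (metis frechet_derivative_at)

lemma partials_add:
  assumes "smooth \<phi>" "smooth \<psi>" "set bs \<subseteq> Basis"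
  shows "partials bs (\<lambda>x. \<phi> x + \<psi> x) = (\<lambda>x. partials bs \<phi> x + partials bs \<psi> x)"
  using assms(3)
proof (induction bs)
  case (Cons b bs)
  have "frechet_derivative (\<lambda>x. partials bs \<phi> x + partials bs \<psi> x) (at x) =
     (\<lambda>h. frechet_derivative (partials bs \<phi>) (at x) h + frechet_derivative (partials bs \<psi>) (at x) h)" for x
    using Cons assms
    by (intro frechet_derivative_eqI has_derivative_add smooth_has_derivative smooth_partials) auto
  with Cons show ?case by simp
qed simp

lemma partials_affine:
  assumes "smooth \<phi>" "set bs \<subseteq> Basis"
  shows "partials bs (\<lambda>x. \<phi> (c *\<^sub>R x + a)) = (\<lambda>x. of_real c ^ length bs * partials bs \<phi> (c *\<^sub>R x + a))"
  using assms(2)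
proof (induction bs)
  case (Cons b bs)
  let ?p = "partials bs \<phi>"
  have D: "(?p has_derivative frechet_derivative ?p (at x)) (at x)" for x
    using Cons assms by (intro smooth_has_derivative smooth_partials) auto
  have "frechet_derivative (\<lambda>x. of_real c ^ length bs * ?p (c *\<^sub>R x + a)) (at x) =
     (\<lambda>h. of_real c ^ length bs * frechet_derivative ?p (at (c *\<^sub>R x + a)) (c *\<^sub>R h))" for x
    by (intro frechet_derivative_eqI has_derivative_mult_right
         has_derivative_compose [of "\<lambda>x. c *\<^sub>R x + a" "\<lambda>h. c *\<^sub>R h" x UNIV ?p])
       (auto intro!: derivative_eq_intros D)
  then have "frechet_derivative (\<lambda>x. of_real c ^ length bs * ?p (c *\<^sub>R x + a)) (at x) =
     (\<lambda>h. of_real c ^ length bs * (of_real c * frechet_derivative ?p (at (c *\<^sub>R x + a)) h))" for x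
    by (simp add: linear_scale [OF has_derivative_linear [OF D]] scaleR_conv_of_real)
  with Cons show ?case by (simp add: mult_ac)
qed simp

lemma partials_cmult:
  assumes "smooth \<phi>" "set bs \<subseteq> Basis"
  shows "partials bs (\<lambda>x. c * \<phi> x) = (\<lambda>x. c * partials bs \<phi> x)"
  using assms(2)
proof (induction bs)
  case (Cons b bs)
  have "frechet_derivative (\<lambda>x. c * partials bs \<phi> x) (at x) =
     (\<lambda>h. c * frechet_derivative (partials bs \<phi>) (at x) h)" for x
    using Cons assms
    by (intro frechet_derivative_eqI has_derivative_mult_right smooth_has_derivative smooth_partials) auto
  with Cons show ?case by simp
qed simp

lemma partials_outside:
  assumes "closed T" "\<And>x. x \<notin> T \<Longrightarrow> \<phi> x = 0" "x \<notin> T"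
  shows "partials bs \<phi> x = 0"
  using assms(3)
proof (induction bs arbitrary: x)
  case (Cons b bs)
  have "frechet_derivative (partials bs \<phi>) (at x) = (\<lambda>h. 0)"
  proof (rule frechet_derivative_eqI, rule has_derivative_transform_within_open)
    show "((\<lambda>x. 0) has_derivative (\<lambda>h. 0)) (at x)" by simp
    show "open (- T)" using assms by auto
  qed (use Cons in auto)
  then show ?case by simp
qed (use assms in auto)

section \<open>Test functions and Schwartz functions\<close>

lemma lborel_translate:
  fixes a :: "'a::euclidean_space"
  shows "lborel = distr lborel borel (\<lambda>x. a + x)" "lborel = distr lborel borel (\<lambda>x. a - x)"
  using lborel_affine [of 1 a] lborel_affine [of "-1" a] by (simp_all add: density_1)

lemma
  fixes h :: "'a::euclidean_space \<Rightarrow> 'b::{banach, second_countable_topology}"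
  assumes [measurable]: "h \<in> borel_measurable borel"
  shows lborel_integral_translate: "(LINT x|lborel. h (a + x)) = (LINT x|lborel. h x)"
    and lborel_integral_reflect: "(LINT x|lborel. h (a - x)) = (LINT x|lborel. h x)"
    and lborel_integrable_translate: "integrable lborel (\<lambda>x. h (a + x)) = integrable lborel h"
    and lborel_integrable_reflect: "integrable lborel (\<lambda>x. h (a - x)) = integrable lborel h"
  by (subst (2) lborel_translate [of a], subst integral_distr integrable_distr_eq; simp)+

lemma test_functions_iff:
  "\<phi> \<in> test_functions \<longleftrightarrow> smooth \<phi> \<and> (\<exists>R>0. \<forall>x. norm x > R \<longrightarrow> \<phi> x = 0)"
proof -
  have "compact (closure {x. \<phi> x \<noteq> 0}) \<longleftrightarrow> bounded {x. \<phi> x \<noteq> 0}"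
    by (metis bounded_closure bounded_subset closed_closure closure_subset compact_eq_bounded_closed)
  also have "\<dots> \<longleftrightarrow> (\<exists>R>0. \<forall>x. norm x > R \<longrightarrow> \<phi> x = 0)"
    unfolding bounded_pos by (auto simp: not_less [symmetric])
  finally show ?thesis by (simp add: test_functions_def)
qed

lemma test_functions_smooth: "\<phi> \<in> test_functions \<Longrightarrow> smooth \<phi>"
  by (simp add: test_functions_def)

lemma test_functions_add:
  assumes "\<phi> \<in> test_functions" "\<psi> \<in> test_functions"
  shows "(\<lambda>x. \<phi> x + \<psi> x) \<in> test_functions"
proof -
  obtain R S where "R > 0" "S > 0" "\<And>x. norm x > R \<Longrightarrow> \<phi> x = 0" "\<And>x. norm x > S \<Longrightarrow> \<psi> x = 0"
    using assms by (auto simp: test_functions_iff)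
  then show ?thesis
    using assms by (auto simp: test_functions_iff smooth_add intro!: exI [of _ "max R S"])
qed

lemma test_functions_mult_smooth:
  assumes "\<phi> \<in> test_functions" "smooth \<psi>"
  shows "(\<lambda>x. \<psi> x * \<phi> x) \<in> test_functions" "(\<lambda>x. \<phi> x * \<psi> x) \<in> test_functions"
  using assms by (force simp: test_functions_iff smooth_mult)+

lemma test_functions_cmult: "\<phi> \<in> test_functions \<Longrightarrow> (\<lambda>x. c * \<phi> x) \<in> test_functions"
  by (intro test_functions_mult_smooth smooth_const)

lemma test_functions_zero: "(\<lambda>x. 0) \<in> test_functions"
  by (auto simp: test_functions_iff intro: exI [of _ 1])

lemma test_functions_sum:
  "(\<And>i. i \<in> I \<Longrightarrow> \<phi> i \<in> test_functions) \<Longrightarrow> (\<lambda>x. \<Sum>i\<in>I. \<phi> i x) \<in> test_functions"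
  by (induction I rule: infinite_finite_induct) (auto simp: test_functions_zero intro!: test_functions_add)

lemma test_functions_affine:
  assumes "\<phi> \<in> test_functions" "c \<noteq> 0"
  shows "(\<lambda>x. \<phi> (c *\<^sub>R x + a)) \<in> test_functions"
proof -
  obtain R where R: "R > 0" "\<And>x. norm x > R \<Longrightarrow> \<phi> x = 0"
    using assms by (auto simp: test_functions_iff)
  have "\<phi> (c *\<^sub>R x + a) = 0" if "norm x > (R + norm a) / \<bar>c\<bar>" for x
  proof (rule R)
    have "R + norm a < norm (c *\<^sub>R x)" using that assms by (simp add: field_simps)
    also have "\<dots> \<le> norm (c *\<^sub>R x + a) + norm a"
      by (metis add.commute add_diff_cancel_right' norm_triangle_ineq4)
    finally show "R < norm (c *\<^sub>R x + a)" by simp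
  qed
  moreover have "(R + norm a) / \<bar>c\<bar> > 0" using R assms by (auto intro!: divide_pos_pos add_pos_nonneg)
  ultimately show ?thesis
    using assms by (auto simp: test_functions_iff intro: smooth_affine)
qed

lemma test_functions_reflect: "\<phi> \<in> test_functions \<Longrightarrow> (\<lambda>x. \<phi> (t - x)) \<in> test_functions"
  using test_functions_affine [of \<phi> "-1" t] by simp

lemma test_functions_translate: "\<phi> \<in> test_functions \<Longrightarrow> (\<lambda>x. \<phi> (t + x)) \<in> test_functions"
  using test_functions_affine [of \<phi> 1 t] by (simp add: add.commute)

lemma test_functions_partials:
  assumes "\<phi> \<in> test_functions" "set bs \<subseteq> Basis"
  shows "partials bs \<phi> \<in> test_functions"
proof -
  obtain R where R: "R > 0" "\<And>x. norm x > R \<Longrightarrow> \<phi> x = 0"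
    using assms by (auto simp: test_functions_iff)
  have "partials bs \<phi> x = 0" if "norm x > R" for x
    using R that by (intro partials_outside [of "cball 0 R"]) auto
  then show ?thesis
    using assms R by (auto simp: test_functions_iff intro: smooth_partials)
qed

lemma test_functions_compact:
  assumes "\<phi> \<in> test_functions"
  obtains K where "compact K" "\<And>x. x \<notin> K \<Longrightarrow> \<phi> x = 0"
proof -
  obtain R where "R > 0" "\<And>x. norm x > R \<Longrightarrow> \<phi> x = 0"
    using assms by (auto simp: test_functions_iff)
  then show ?thesis by (intro that [of "cball 0 R"]) auto
qed

lemma test_functions_continuous: "\<phi> \<in> test_functions \<Longrightarrow> continuous_on S \<phi>"
  by (intro smooth_continuous test_functions_smooth)

lemma test_functions_measurable: "\<phi> \<in> test_functions \<Longrightarrow> \<phi> \<in> borel_measurable borel"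
  by (intro borel_measurable_continuous_onI test_functions_continuous)

lemma test_functions_integrable:
  assumes "\<phi> \<in> test_functions"
  shows "integrable lborel \<phi>"
proof -
  obtain K where K: "compact K" "\<And>x. x \<notin> K \<Longrightarrow> \<phi> x = 0"
    using test_functions_compact [OF assms] by metis
  have "set_integrable lborel K \<phi>"
    using assms K by (intro borel_integrable_compact [unfolded set_integrable_def [symmetric]] test_functions_continuous)
  moreover have "(\<lambda>x. indicator K x *\<^sub>R \<phi> x) = \<phi>" using K by (auto simp: fun_eq_iff indicator_def)
  ultimately show ?thesis by (simp add: set_integrable_def)
qed

lemma test_functions_bounded:
  assumes "\<phi> \<in> test_functions"
  obtains M where "M > 0" "\<And>x. norm (\<phi> x) \<le> M"
proof -
  obtain K where K: "compact K" "\<And>x. x \<notin> K \<Longrightarrow> \<phi> x = 0"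
    using test_functions_compact [OF assms] by metis
  have "bounded (\<phi> ` K)"
    using K assms by (intro compact_imp_bounded compact_continuous_image test_functions_continuous)
  then obtain M where "M > 0" "\<And>x. x \<in> K \<Longrightarrow> norm (\<phi> x) \<le> M"
    by (auto simp: bounded_pos)
  then show ?thesis using K by (intro that [of M]) (metis less_imp_le norm_zero)+
qed

lemma test_functions_uniformly_continuous:
  assumes "\<phi> \<in> test_functions"
  shows "uniformly_continuous_on UNIV \<phi>"
proof -
  obtain R where R: "R > 0" "\<And>x. norm x > R \<Longrightarrow> \<phi> x = 0"
    using assms by (auto simp: test_functions_iff)
  \<comment> \<open>The margin 1 ensures that two points at distance less than 1 either both lie in
    this ball or both lie where \<open>\<phi>\<close> vanishes.\<close>
  have uc: "uniformly_continuous_on (cball 0 (R + 1)) \<phi>"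
    using assms by (intro compact_uniformly_continuous test_functions_continuous compact_cball)
  show ?thesis
    unfolding uniformly_continuous_on_def
  proof (intro allI impI)
    fix e :: real assume "e > 0"
    with uc obtain d where d: "d > 0"
      "\<And>x y. x \<in> cball 0 (R + 1) \<Longrightarrow> y \<in> cball 0 (R + 1) \<Longrightarrow> dist y x < d \<Longrightarrow> dist (\<phi> y) (\<phi> x) < e"
      unfolding uniformly_continuous_on_def by metis
    have "dist (\<phi> y) (\<phi> x) < e" if xy: "dist y x < min d 1" for x y
    proof (cases "norm x \<le> R + 1 \<and> norm y \<le> R + 1")
      case True with d xy show ?thesis by auto
    next
      case False
      have "norm y \<le> norm x + dist y x" "norm x \<le> norm y + dist y x"
        using norm_triangle_sub [of y x] norm_triangle_sub [of x y]
      by (simp_all add: dist_norm norm_minus_commute)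
      with False xy have "norm x > R \<and> norm y > R" by linarith
      with R(2) [of x] R(2) [of y] \<open>e > 0\<close> show ?thesis by simp
    qed
    with \<open>d > 0\<close> show "\<exists>d>0. \<forall>x\<in>UNIV. \<forall>x'\<in>UNIV. dist x' x < d \<longrightarrow> dist (\<phi> x') (\<phi> x) < e"
      by (intro exI [of _ "min d 1"]) auto
  qed
qed

section \<open>Schwartz seminorms\<close>

text \<open>A pointwise form of the seminorm bound. Unlike an inequality for
  \<open>schwartz_norm\<close>, it does not involve the \<open>Sup\<close> of a set whose
  boundedness would have to be known beforehand.\<close>

definition schwartz_le :: "nat \<Rightarrow> nat \<Rightarrow> ('a::euclidean_space \<Rightarrow> complex) \<Rightarrow> real \<Rightarrow> bool" where
  "schwartz_le n m \<phi> c \<longleftrightarrow>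
    (\<forall>x bs. set bs \<subseteq> Basis \<longrightarrow> length bs \<le> m \<longrightarrow> (1 + norm x) ^ n * norm (partials bs \<phi> x) \<le> c)"

lemma schwartz_leD: "schwartz_le n m \<phi> c \<Longrightarrow> set bs \<subseteq> Basis \<Longrightarrow> length bs \<le> m \<Longrightarrow>
    (1 + norm x) ^ n * norm (partials bs \<phi> x) \<le> c"
  by (simp add: schwartz_le_def)

lemma schwartz_le_nonneg: "schwartz_le n m \<phi> c \<Longrightarrow> 0 \<le> c"
  by (rule order_trans [OF _ schwartz_leD [of n m \<phi> c "[]" 0]]) auto

lemma schwartz_norm_le: "schwartz_le n m \<phi> c \<Longrightarrow> schwartz_norm n m \<phi> \<le> c"
  unfolding schwartz_norm_def schwartz_values_def
  by (rule cSup_least) (auto simp: schwartz_le_def intro: exI [of _ "[]"])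

lemma schwartz_le_norm: "\<phi> \<in> schwartz_space \<Longrightarrow> schwartz_le n m \<phi> (schwartz_norm n m \<phi>)"
  unfolding schwartz_norm_def schwartz_le_def schwartz_space_def
  by (auto simp: schwartz_values_def intro!: cSup_upper)

text \<open>The bound may depend on the multi-index, because there are only finitely many lists of
  bounded length over the basis and the maximum of their bounds serves all of them.\<close>

lemma schwartz_spaceI:
  assumes "smooth \<phi>"
    and "\<And>n bs. set bs \<subseteq> Basis \<Longrightarrow> \<exists>c. \<forall>x. (1 + norm x) ^ n * norm (partials bs \<phi> x) \<le> c"
  shows "\<phi> \<in> schwartz_space"
proof -
  have "bdd_above (schwartz_values n m \<phi>)" for n m
  proof -
    obtain c where c: "\<And>bs x. set bs \<subseteq> Basis \<Longrightarrow> (1 + norm x) ^ n * norm (partials bs \<phi> x) \<le> c bs"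
      using assms(2) [of _ n] by metis
    let ?B = "{bs :: 'a list. set bs \<subseteq> Basis \<and> length bs \<le> m}"
    have "finite ?B" by (rule finite_lists_length_le) simp
    then have "c bs \<le> Max (c ` ?B)" if "bs \<in> ?B" for bs
      using that by (intro Max_ge) auto
    then have "(1 + norm x) ^ n * norm (partials bs \<phi> x) \<le> Max (c ` ?B)"
      if "set bs \<subseteq> Basis" "length bs \<le> m" for bs x
      using that by (intro order_trans [OF c]) auto
    then show ?thesis
      unfolding schwartz_values_def
      by (intro bdd_aboveI [of _ "Max (c ` ?B)"]) (elim CollectE exE conjE, simp)
  qed
  with assms show ?thesis by (simp add: schwartz_space_def)
qed

lemma schwartz_smooth: "\<phi> \<in> schwartz_space \<Longrightarrow> smooth \<phi>"
  by (simp add: schwartz_space_def)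

lemma schwartz_le_add:
  assumes "smooth \<phi>" "smooth \<psi>" "schwartz_le n m \<phi> c" "schwartz_le n m \<psi> d"
  shows "schwartz_le n m (\<lambda>x. \<phi> x + \<psi> x) (c + d)"
  unfolding schwartz_le_def
proof (intro allI impI)
  fix x :: 'a and bs :: "'a list" assume bs: "set bs \<subseteq> Basis" "length bs \<le> m"
  have "(1 + norm x) ^ n * norm (partials bs (\<lambda>x. \<phi> x + \<psi> x) x) \<le>
      (1 + norm x) ^ n * (norm (partials bs \<phi> x) + norm (partials bs \<psi> x))"
    using assms bs by (intro mult_left_mono) (auto simp: partials_add norm_triangle_ineq)
  also have "\<dots> \<le> c + d"
    using schwartz_leD [OF assms(3) bs, of x] schwartz_leD [OF assms(4) bs, of x] by (simp add: ring_distribs)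
  finally show "(1 + norm x) ^ n * norm (partials bs (\<lambda>x. \<phi> x + \<psi> x) x) \<le> c + d" .
qed

lemma schwartz_le_cmult:
  assumes "smooth \<phi>" "schwartz_le n m \<phi> c"
  shows "schwartz_le n m (\<lambda>x. a * \<phi> x) (norm a * c)"
  unfolding schwartz_le_def
proof (intro allI impI)
  fix x :: 'a and bs :: "'a list" assume bs: "set bs \<subseteq> Basis" "length bs \<le> m"
  have "norm a * ((1 + norm x) ^ n * norm (partials bs \<phi> x)) \<le> norm a * c"
    by (intro mult_left_mono schwartz_leD [OF assms(2) bs]) auto
  then show "(1 + norm x) ^ n * norm (partials bs (\<lambda>x. a * \<phi> x) x) \<le> norm a * c"
    using assms bs by (simp add: partials_cmult norm_mult mult_ac)
qed

lemma schwartz_space_iff: "\<phi> \<in> schwartz_space \<longleftrightarrow> smooth \<phi> \<and> (\<forall>n m. \<exists>c. schwartz_le n m \<phi> c)"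
proof
  assume "smooth \<phi> \<and> (\<forall>n m. \<exists>c. schwartz_le n m \<phi> c)"
  then show "\<phi> \<in> schwartz_space" by (intro schwartz_spaceI) (metis order_refl schwartz_leD)+
qed (auto intro: schwartz_le_norm schwartz_smooth)

lemma schwartz_add: "\<phi> \<in> schwartz_space \<Longrightarrow> \<psi> \<in> schwartz_space \<Longrightarrow> (\<lambda>x. \<phi> x + \<psi> x) \<in> schwartz_space"
  unfolding schwartz_space_iff by (blast intro: schwartz_le_add smooth_add)

lemma schwartz_cmult: "\<phi> \<in> schwartz_space \<Longrightarrow> (\<lambda>x. a * \<phi> x) \<in> schwartz_space"
  unfolding schwartz_space_iff
  using schwartz_le_cmult [of \<phi> _ _ _ a] smooth_mult [OF smooth_const, of \<phi> a] by meson

lemma schwartz_diff: 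
  assumes "\<phi> \<in> schwartz_space" "\<psi> \<in> schwartz_space" 
  shows "(\<lambda>x. \<phi> x - \<psi> x) \<in> schwartz_space"
  using schwartz_add [OF assms(1) schwartz_cmult [OF assms(2), of "-1"]] by simp

lemma test_imp_schwartz:
  assumes "\<phi> \<in> test_functions"
  shows "\<phi> \<in> schwartz_space"
proof (rule schwartz_spaceI)
  fix n and bs :: "'a list" assume bs: "set bs \<subseteq> Basis"
  have t: "partials bs \<phi> \<in> test_functions" by (intro test_functions_partials assms bs)
  obtain R where R: "R > 0" "\<And>x. norm x > R \<Longrightarrow> partials bs \<phi> x = 0"
    using t by (auto simp: test_functions_iff)
  obtain M where M: "M > 0" "\<And>x. norm (partials bs \<phi> x) \<le> M" using test_functions_bounded [OF t] by metis
  have "(1 + norm x) ^ n * norm (partials bs \<phi> x) \<le> (1 + R) ^ n * M" for x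
  proof (cases "norm x > R")
    case False
    with R M show ?thesis by (intro mult_mono power_mono) auto
  qed (use R M in auto)
  then show "\<exists>c. \<forall>x. (1 + norm x) ^ n * norm (partials bs \<phi> x) \<le> c" by blast
qed (use assms test_functions_smooth in auto)

section \<open>Temperate distributions\<close>

lemma temperate_add: "temperate f \<Longrightarrow> \<phi> \<in> schwartz_space \<Longrightarrow> \<psi> \<in> schwartz_space \<Longrightarrow>
    f (\<lambda>x. \<phi> x + \<psi> x) = f \<phi> + f \<psi>"
  and temperate_cmult: "temperate f \<Longrightarrow> \<phi> \<in> schwartz_space \<Longrightarrow> f (\<lambda>x. c * \<phi> x) = c * f \<phi>"
  by (auto simp: temperate_def)

lemma temperate_diff: "temperate f \<Longrightarrow> \<phi> \<in> schwartz_space \<Longrightarrow> \<psi> \<in> schwartz_space \<Longrightarrow>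
    f (\<lambda>x. \<phi> x - \<psi> x) = f \<phi> - f \<psi>"
  using temperate_add [of f \<phi> "\<lambda>x. - 1 * \<psi> x"] temperate_cmult [of f \<psi> "- 1"] schwartz_cmult [of \<psi> "- 1"]
  by simp

lemma temperate_zero: "temperate f \<Longrightarrow> f (\<lambda>x. 0) = 0"
  using temperate_cmult [of f "\<lambda>x. 0" 0] test_imp_schwartz [OF test_functions_zero] by simp

lemma schwartz_sum:
  "(\<And>i. i \<in> I \<Longrightarrow> \<phi> i \<in> schwartz_space) \<Longrightarrow> (\<lambda>x. \<Sum>i\<in>I. \<phi> i x) \<in> schwartz_space"
  by (induction I rule: infinite_finite_induct)
     (auto simp: test_imp_schwartz [OF test_functions_zero] intro!: schwartz_add)

lemma temperate_sum:
  assumes "temperate f" "\<And>i. i \<in> I \<Longrightarrow> \<phi> i \<in> schwartz_space"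
  shows "f (\<lambda>x. \<Sum>i\<in>I. c i * \<phi> i x) = (\<Sum>i\<in>I. c i * f (\<phi> i))"
  using assms(2)
proof (induction I rule: infinite_finite_induct)
  case (insert i I)
  have "(\<lambda>x. \<Sum>i\<in>I. c i * \<phi> i x) \<in> schwartz_space" by (intro schwartz_sum schwartz_cmult insert) auto
  with insert show ?case
    by (simp add: temperate_add [OF assms(1)] schwartz_cmult temperate_cmult [OF assms(1)])
qed (use assms in \<open>auto simp: temperate_zero\<close>)

lemma schwartz_norm_mono:
  assumes "\<phi> \<in> schwartz_space" "n \<le> n'" "m \<le> m'"
  shows "schwartz_norm n m \<phi> \<le> schwartz_norm n' m' \<phi>"
proof (rule schwartz_norm_le)
  have "(1 + norm x) ^ n * norm (partials bs \<phi> x) \<le> (1 + norm x) ^ n' * norm (partials bs \<phi> x)" for x bs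
    using assms by (intro mult_right_mono power_increasing) auto
  then show "schwartz_le n m \<phi> (schwartz_norm n' m' \<phi>)"
    unfolding schwartz_le_def
    using schwartz_le_norm [OF assms(1), of n' m'] assms by (meson order_trans schwartz_leD)
qed

lemma schwartz_norm_triangle:
  assumes "\<phi> \<in> schwartz_space" "\<psi> \<in> schwartz_space"
  shows "schwartz_norm n m (\<lambda>x. \<phi> x + \<psi> x) \<le> schwartz_norm n m \<phi> + schwartz_norm n m \<psi>"
  using assms by (intro schwartz_norm_le schwartz_le_add schwartz_le_norm schwartz_smooth)

text \<open>Induction on the generation of open sets. Intersections are handled by monotonicity of
  the seminorms in both indices. A subbasic ball around another centre contains a ball around
  \<open>\<phi>\<^sub>0\<close> with the remaining radius, by the triangle inequality.\<close>

lemma schwartz_topology_nhd: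
  assumes "generate_topology_on {schwartz_ball n m \<phi> r | n m \<phi> r. \<phi> \<in> schwartz_space \<and> r > 0} U"
    and "\<phi>\<^sub>0 \<in> U" "\<phi>\<^sub>0 \<in> schwartz_space"
  shows "\<exists>n m r. r > 0 \<and> schwartz_ball n m \<phi>\<^sub>0 r \<subseteq> U"
  using assms(1,2)
proof (induction rule: generate_topology_on.induct)
  case (Int a b)
  then obtain n m r n' m' r' where *: "r > 0" "schwartz_ball n m \<phi>\<^sub>0 r \<subseteq> a"
      "r' > 0" "schwartz_ball n' m' \<phi>\<^sub>0 r' \<subseteq> b" by blast
  have "schwartz_ball (max n n') (max m m') \<phi>\<^sub>0 (min r r') \<subseteq> schwartz_ball n m \<phi>\<^sub>0 r \<inter> schwartz_ball n' m' \<phi>\<^sub>0 r'"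
  proof
    fix \<psi> assume "\<psi> \<in> schwartz_ball (max n n') (max m m') \<phi>\<^sub>0 (min r r')"
    then have \<psi>: "\<psi> \<in> schwartz_space"
        "schwartz_norm (max n n') (max m m') (\<lambda>x. \<psi> x - \<phi>\<^sub>0 x) < min r r'"
      by (auto simp: schwartz_ball_def)
    have "schwartz_norm k l (\<lambda>x. \<psi> x - \<phi>\<^sub>0 x) \<le> schwartz_norm (max n n') (max m m') (\<lambda>x. \<psi> x - \<phi>\<^sub>0 x)"
      if "k \<le> max n n'" "l \<le> max m m'" for k l
      using that by (intro schwartz_norm_mono schwartz_diff \<psi> assms(3))
    from this [of n m] this [of n' m'] \<psi>
    show "\<psi> \<in> schwartz_ball n m \<phi>\<^sub>0 r \<inter> schwartz_ball n' m' \<phi>\<^sub>0 r'"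
      by (simp add: schwartz_ball_def)
  qed
  with * show ?case by (intro exI [of _ "max n n'"] exI [of _ "max m m'"] exI [of _ "min r r'"]) auto
next
  case (UN K)
  then show ?case by (meson Union_iff Sup_upper order_trans)
next
  case (Basis s)
  then obtain n m \<phi> r where s: "s = schwartz_ball n m \<phi> r" "\<phi> \<in> schwartz_space" "r > 0" by blast
  define r' where "r' = r - schwartz_norm n m (\<lambda>x. \<phi>\<^sub>0 x - \<phi> x)"
  have "r' > 0" using Basis s by (simp add: r'_def schwartz_ball_def)
  moreover have "schwartz_ball n m \<phi>\<^sub>0 r' \<subseteq> s"
  proof
    fix \<psi> assume \<psi>: "\<psi> \<in> schwartz_ball n m \<phi>\<^sub>0 r'"
    then have "schwartz_norm n m (\<lambda>x. (\<psi> x - \<phi>\<^sub>0 x) + (\<phi>\<^sub>0 x - \<phi> x)) \<le>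
        schwartz_norm n m (\<lambda>x. \<psi> x - \<phi>\<^sub>0 x) + schwartz_norm n m (\<lambda>x. \<phi>\<^sub>0 x - \<phi> x)"
      using assms(3) s by (intro schwartz_norm_triangle schwartz_diff) (auto simp: schwartz_ball_def)
    with \<psi> show "\<psi> \<in> s" by (simp add: s schwartz_ball_def r'_def)
  qed
  ultimately show ?case by blast
qed auto

text \<open>Continuity at 0 gives one seminorm ball on which \<open>f\<close> has modulus less than
  1, and homogeneity extends this to a global bound. All later uses of continuity of
  \<open>f\<close> go through this inequality.\<close>

lemma temperate_bound:
  fixes f :: "('a::euclidean_space \<Rightarrow> complex) \<Rightarrow> complex"
  assumes "temperate f"
  obtains C n m where "C > 0"
    "\<And>\<phi> c. \<phi> \<in> schwartz_space \<Longrightarrow> schwartz_le n m \<phi> c \<Longrightarrow> norm (f \<phi>) \<le> C * c"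
proof -
  let ?\<S> = "{schwartz_ball n m \<phi> r | n m \<phi> r. \<phi> \<in> schwartz_space \<and> r > 0} :: ('a \<Rightarrow> complex) set set"
  have zero: "(\<lambda>x. 0) \<in> (schwartz_space :: ('a \<Rightarrow> complex) set)"
    by (rule test_imp_schwartz [OF test_functions_zero])
  have "continuous_map schwartz_topology euclidean f" using assms by (simp add: temperate_def)
  then have "openin schwartz_topology {\<phi> \<in> topspace schwartz_topology. f \<phi> \<in> ball 0 1}"
    by (rule openin_continuous_map_preimage) simp
  then have "generate_topology_on ?\<S> {\<phi> \<in> topspace schwartz_topology. f \<phi> \<in> ball 0 1}"
    by (simp add: schwartz_topology_def openin_topology_generated_by_iff)
  moreover have "(\<lambda>x. 0) \<in> topspace (schwartz_topology :: ('a \<Rightarrow> complex) topology)"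
  proof -
    have "(\<lambda>x. 0) \<in> schwartz_ball 0 0 (\<lambda>x::'a. 0) 1"
      using zero schwartz_norm_le [OF schwartz_le_cmult [OF schwartz_smooth [OF zero] schwartz_le_norm [OF zero], of 0 0 0]]
      by (simp add: schwartz_ball_def)
    with zero show ?thesis unfolding schwartz_topology_def topology_generated_by_topspace
      by (intro UnionI [of "schwartz_ball 0 0 (\<lambda>x::'a. 0) 1"]) (auto intro!: exI zero_less_one)
  qed
  ultimately obtain n m r where r: "r > 0"
    "schwartz_ball n m (\<lambda>x. 0) r \<subseteq> {\<phi> \<in> topspace schwartz_topology. f \<phi> \<in> ball 0 1}"
    using schwartz_topology_nhd [OF _ _ zero, of "{\<phi> \<in> topspace schwartz_topology. f \<phi> \<in> ball 0 1}"]
      temperate_zero [OF assms] by auto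
  show ?thesis
  proof (rule that [of "2 / r" n m])
    fix \<phi> :: "'a \<Rightarrow> complex" and c assume \<phi>: "\<phi> \<in> schwartz_space" "schwartz_le n m \<phi> c"
    \<comment> \<open>Scaling into the ball divides by the seminorm bound. A strictly larger
      \<open>c'\<close> avoids the division by zero at \<open>c = 0\<close>, and density of the
      reals then gives the bound with \<open>c\<close>.\<close>
    have "norm (f \<phi>) \<le> 2 / r * c'" if "c' > c" for c'
    proof -
      have c: "c \<ge> 0" "c' > 0" using \<phi> that schwartz_le_nonneg by force+
      define a where "a = r / (2 * c')"
      have a: "a > 0" using r c by (simp add: a_def)
      have "schwartz_norm n m (\<lambda>x. of_real a * \<phi> x) \<le> norm (complex_of_real a) * c"
        using \<phi> by (intro schwartz_norm_le schwartz_le_cmult schwartz_smooth)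
      also have "\<dots> = a * c" using a by simp
      also have "\<dots> < r" using r c that by (simp add: a_def field_simps)
      finally have "(\<lambda>x. of_real a * \<phi> x) \<in> schwartz_ball n m (\<lambda>x. 0) r"
        using \<phi> by (simp add: schwartz_ball_def schwartz_cmult)
      with r(2) have "norm (f (\<lambda>x. of_real a * \<phi> x)) < 1" by auto
      then have "a * norm (f \<phi>) < 1"
        using \<phi> a by (simp add: temperate_cmult [OF assms] norm_mult)
      then show ?thesis using r c by (simp add: a_def field_simps)
    qed
    then have "norm (f \<phi>) / (2 / r) \<le> c'" if "c' > c" for c'
      using that r by (simp add: field_simps)
    then have "norm (f \<phi>) / (2 / r) \<le> c" by (rule dense_ge)
    then show "norm (f \<phi>) \<le> 2 / r * c" using r by (simp add: field_simps)
  qed (use r in simp)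
qed

section \<open>The Fourier transform of a test function\<close>

lemma fourier_ec: "fourier \<phi> y = (LINT x|lborel. \<phi> x * ec (- (x \<bullet> y)))"
  by (simp only: fourier_def exp_unit)

lemma integrable_mult_ec:
  fixes \<phi> :: "'a::euclidean_space \<Rightarrow> complex"
  assumes "integrable lborel \<phi>" and [measurable]: "g \<in> borel_measurable borel"
  shows "integrable lborel (\<lambda>x. \<phi> x * ec (g x))"
proof -
  have [measurable]: "\<phi> \<in> borel_measurable borel" using assms by auto
  show ?thesis by (rule Bochner_Integration.integrable_bound [OF assms(1)]) (auto simp: norm_mult)
qed

lemma norm_fourier_le: "norm (fourier \<phi> y) \<le> (LINT x|lborel. norm (\<phi> x))"
  unfolding fourier_ec by (rule order_trans [OF integral_norm_bound]) (simp add: norm_mult)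

lemma fourier_add:
  assumes "integrable lborel \<phi>" "integrable lborel \<psi>"
  shows "fourier (\<lambda>x. \<phi> x + \<psi> x) y = fourier \<phi> y + fourier \<psi> y"
  unfolding fourier_ec using assms
  by (simp add: ring_distribs integrable_mult_ec)

lemma fourier_cmult: "fourier (\<lambda>x. c * \<phi> x) y = c * fourier \<phi> y"
  unfolding fourier_ec by (simp add: mult.assoc)

lemma fourier_sum:
  assumes "finite I" "\<And>i. i \<in> I \<Longrightarrow> integrable lborel (\<phi> i)"
  shows "fourier (\<lambda>x. \<Sum>i\<in>I. \<phi> i x) y = (\<Sum>i\<in>I. fourier (\<phi> i) y)"
  unfolding fourier_ec using assms
  by (simp add: sum_distrib_right integrable_mult_ec)

lemma norm_ec_taylor: "norm (ec r - 1 - (2 * pi * \<i>) * of_real r) \<le> 2 * pi\<^sup>2 * r\<^sup>2"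
  using iexp_approx1 [of "2 * pi * r" 1]
  by (simp add: ec_def cis_conv_exp power2_eq_square algebra_simps)

text \<open>The multiplication on the space side that the Fourier transform turns into
  differentiation along \<open>b\<close>.\<close>

definition coord_mult :: "'a::euclidean_space \<Rightarrow> ('a \<Rightarrow> complex) \<Rightarrow> 'a \<Rightarrow> complex" where
  "coord_mult b \<phi> x = - (2 * pi * \<i>) * of_real (x \<bullet> b) * \<phi> x"

lemma coord_mult_test: "\<phi> \<in> test_functions \<Longrightarrow> coord_mult b \<phi> \<in> test_functions"
  unfolding coord_mult_def [abs_def]
  by (intro test_functions_mult_smooth(1) smooth_mult smooth_inner smooth_const)

lemma test_power_integrable:
  assumes "\<phi> \<in> test_functions"
  shows "integrable lborel (\<lambda>x. norm x ^ k * norm (\<phi> x))"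
proof -
  obtain R where R: "R > 0" "\<And>x. norm x > R \<Longrightarrow> \<phi> x = 0"
    using assms by (auto simp: test_functions_iff)
  have [measurable]: "\<phi> \<in> borel_measurable borel" using test_functions_measurable [OF assms] .
  have "norm x ^ k * norm (\<phi> x) \<le> R ^ k * norm (\<phi> x)" for x
    using R by (cases "norm x > R") (auto intro!: mult_right_mono power_mono)
  then show ?thesis
    by (intro Bochner_Integration.integrable_bound [OF integrable_mult_right [OF integrable_norm [OF
            test_functions_integrable [OF assms]], of "R ^ k"]]) (auto intro: order_trans [OF _ abs_ge_self])
qed

text \<open>The second-order Taylor estimate for the character, integrated against
  \<open>\<phi>\<close>, leaves a remainder that is quadratic in the increment.\<close>

lemma fourier_has_derivative:
  assumes "\<phi> \<in> test_functions"
  shows "(fourier \<phi> has_derivative (\<lambda>h. fourier (coord_mult h \<phi>) y)) (at y)"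
proof -
  \<comment> \<open>The first absolute moment bounds the linear map, the second one
    (\<open>K2\<close>) the Taylor remainder.\<close>
  define K where "K = 2 * pi * (LINT x|lborel. norm x ^ 1 * norm (\<phi> x))"
  define K2 where "K2 = 2 * pi\<^sup>2 * (LINT x|lborel. norm x ^ 2 * norm (\<phi> x))"
  note [simp] = test_functions_integrable [OF assms] test_functions_integrable [OF coord_mult_test [OF assms]]
    integrable_mult_ec test_power_integrable [OF assms] test_power_integrable [OF assms, of 1, simplified]
  show ?thesis
  proof (rule has_derivativeI_sandwich [of 1])
    show "bounded_linear (\<lambda>h. fourier (coord_mult h \<phi>) y)"
    proof (rule bounded_linear_intro [of _ K])
      fix h k :: 'a and r :: real
      have "coord_mult (h + k) \<phi> = (\<lambda>x. coord_mult h \<phi> x + coord_mult k \<phi> x)"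
        by (auto simp: coord_mult_def inner_add_right algebra_simps)
      then show "fourier (coord_mult (h + k) \<phi>) y = fourier (coord_mult h \<phi>) y + fourier (coord_mult k \<phi>) y"
        by (simp add: fourier_add)
      have "coord_mult (r *\<^sub>R h) \<phi> = (\<lambda>x. of_real r * coord_mult h \<phi> x)"
        by (auto simp: coord_mult_def)
      then show "fourier (coord_mult (r *\<^sub>R h) \<phi>) y = r *\<^sub>R fourier (coord_mult h \<phi>) y"
        by (simp add: fourier_cmult scaleR_conv_of_real)
      have "norm (fourier (coord_mult h \<phi>) y) \<le> (LINT x|lborel. norm (coord_mult h \<phi> x))"
        by (rule norm_fourier_le)
      also have "\<dots> \<le> (LINT x|lborel. (2 * pi * norm h) * (norm x ^ 1 * norm (\<phi> x)))"
      proof (intro integral_mono integrable_mult_right integrable_norm)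
        fix x :: 'a
        have "\<bar>x \<bullet> h\<bar> * norm (\<phi> x) \<le> (norm x * norm h) * norm (\<phi> x)"
          by (intro mult_right_mono Cauchy_Schwarz_ineq2) auto
        then show "norm (coord_mult h \<phi> x) \<le> 2 * pi * norm h * (norm x ^ 1 * norm (\<phi> x))"
          by (simp add: coord_mult_def norm_mult mult_ac)
      qed auto
      also have "\<dots> = norm h * K" by (simp add: K_def)
      finally show "norm (fourier (coord_mult h \<phi>) y) \<le> norm h * K" .
    qed
    show "norm (fourier \<phi> z - fourier \<phi> y - fourier (coord_mult (z - y) \<phi>) y) / norm (z - y)
        \<le> K2 * norm (z - y)" if "z \<noteq> y" for z
    proof -
      let ?h = "z - y"
      have "fourier \<phi> z - fourier \<phi> y - fourier (coord_mult ?h \<phi>) y =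
          (LINT x|lborel. \<phi> x * ec (- (x \<bullet> z)) - \<phi> x * ec (- (x \<bullet> y)) - coord_mult ?h \<phi> x * ec (- (x \<bullet> y)))"
        unfolding fourier_ec by simp
      also have "\<dots> = (LINT x|lborel. \<phi> x * ec (- (x \<bullet> y)) *
          (ec (- (x \<bullet> ?h)) - 1 - (2 * pi * \<i>) * of_real (- (x \<bullet> ?h))))"
      proof (intro Bochner_Integration.integral_cong refl)
        fix x
        have "ec (- (x \<bullet> z)) = ec (- (x \<bullet> y)) * ec (- (x \<bullet> ?h))"
          by (simp add: ec_add [symmetric] inner_diff_right)
        then show "\<phi> x * ec (- (x \<bullet> z)) - \<phi> x * ec (- (x \<bullet> y)) - coord_mult ?h \<phi> x * ec (- (x \<bullet> y)) =
          \<phi> x * ec (- (x \<bullet> y)) * (ec (- (x \<bullet> ?h)) - 1 - (2 * pi * \<i>) * of_real (- (x \<bullet> ?h)))"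
          by (simp add: coord_mult_def algebra_simps)
      qed
      also have "norm \<dots> \<le> (LINT x|lborel. (2 * pi\<^sup>2 * (norm ?h)\<^sup>2) * (norm x ^ 2 * norm (\<phi> x)))"
      proof (rule Bochner_Integration.integral_norm_bound_integral)
        let ?F = "\<lambda>x. \<phi> x * ec (- (x \<bullet> y)) * (ec (- (x \<bullet> ?h)) - 1 - (2 * pi * \<i>) * of_real (- (x \<bullet> ?h)))"
        have le: "norm (?F x) \<le> (2 * pi\<^sup>2 * (norm ?h)\<^sup>2) * (norm x ^ 2 * norm (\<phi> x))" for x
        proof -
          have "norm (?F x) \<le> norm (\<phi> x) * (2 * pi\<^sup>2 * (- (x \<bullet> ?h))\<^sup>2)"
            unfolding norm_mult norm_ec mult_1_right by (intro mult_left_mono norm_ec_taylor) auto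
          also have "\<dots> \<le> norm (\<phi> x) * (2 * pi\<^sup>2 * (norm x * norm ?h)\<^sup>2)"
            by (intro mult_left_mono)
               (auto, metis Cauchy_Schwarz_ineq2 abs_ge_zero power2_abs power_mono)
          also have "\<dots> = (2 * pi\<^sup>2 * (norm ?h)\<^sup>2) * (norm x ^ 2 * norm (\<phi> x))"
            by (simp add: power_mult_distrib)
          finally show ?thesis .
        qed
        then show "\<And>x. norm (?F x) \<le> (2 * pi\<^sup>2 * (norm ?h)\<^sup>2) * (norm x ^ 2 * norm (\<phi> x))" by simp
        have [measurable]: "\<phi> \<in> borel_measurable borel" using test_functions_measurable [OF assms] .
        show "integrable lborel (\<lambda>x. (2 * pi\<^sup>2 * (norm ?h)\<^sup>2) * (norm x ^ 2 * norm (\<phi> x)))" by simp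
        from this show "integrable lborel ?F"
          by (rule Bochner_Integration.integrable_bound) (use le in \<open>auto intro: order_trans [OF _ abs_ge_self]\<close>)
      qed
      also have "\<dots> = K2 * norm ?h * norm ?h" by (simp add: K2_def power2_eq_square)
      finally show ?thesis using that by (simp add: field_simps)
    qed
    show "((\<lambda>z. K2 * norm (z - y)) \<longlongrightarrow> 0) (at y within UNIV)"
      by (rule tendsto_eq_intros refl | simp)+
  qed simp
qed

lemma fourier_partials:
  assumes "\<phi> \<in> test_functions"
  shows "partials bs (fourier \<phi>) = fourier (foldr coord_mult bs \<phi>)" "foldr coord_mult bs \<phi> \<in> test_functions"
proof -
  have "partials bs (fourier \<phi>) = fourier (foldr coord_mult bs \<phi>) \<and> foldr coord_mult bs \<phi> \<in> test_functions"
    by (induction bs)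
      (auto simp: assms coord_mult_test frechet_derivative_eqI [OF fourier_has_derivative])
  then show "partials bs (fourier \<phi>) = fourier (foldr coord_mult bs \<phi>)" "foldr coord_mult bs \<phi> \<in> test_functions"
    by auto
qed

lemma fourier_smooth:
  assumes "\<phi> \<in> test_functions"
  shows "smooth (fourier \<phi>)"
proof (rule smooth_coinduct [of _ "fourier ` test_functions"])
  fix \<psi> :: "'a \<Rightarrow> complex" and x b :: 'a
  assume "\<psi> \<in> fourier ` test_functions"
  then obtain \<eta> where \<eta>: "\<eta> \<in> test_functions" "\<psi> = fourier \<eta>" by auto
  show "\<psi> differentiable (at x)"
    using fourier_has_derivative [OF \<eta>(1)] \<eta> by (auto simp: differentiable_def)
  show "(\<lambda>x. frechet_derivative \<psi> (at x) b) \<in> fourier ` test_functions"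
    using \<eta> coord_mult_test by (auto simp: frechet_derivative_eqI [OF fourier_has_derivative])
qed (use assms in auto)

text \<open>Difference quotients of \<open>\<phi>\<close> have integral zero by translation
  invariance. They converge to the derivative and are dominated by a constant on a fixed ball, so
  the limit has integral zero too.\<close>

lemma integral_partial_zero:
  assumes "\<phi> \<in> test_functions" "b \<in> Basis"
  shows "(LINT x|lborel. frechet_derivative \<phi> (at x) b) = 0"
proof -
  let ?D = "\<lambda>x. frechet_derivative \<phi> (at x) b"
  have D: "?D \<in> test_functions" using test_functions_partials [of \<phi> "[b]"] assms by simp
  obtain M where M: "M > 0" "\<And>x. norm (?D x) \<le> M" using test_functions_bounded [OF D] by metis
  obtain R where R: "R > 0" "\<And>x. norm x > R \<Longrightarrow> \<phi> x = 0"
    using assms by (auto simp: test_functions_iff)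
  have [measurable]: "\<phi> \<in> borel_measurable borel" "?D \<in> borel_measurable borel"
    using test_functions_measurable assms D by auto
  define q where "q n x = of_real (Suc n) * (\<phi> ((1 / Suc n) *\<^sub>R b + x) - \<phi> x)" for n x
  have der: "((\<lambda>t. \<phi> (t *\<^sub>R b + x)) has_vector_derivative ?D (t *\<^sub>R b + x)) (at t)" for t x
  proof -
    have "((\<lambda>t. \<phi> (t *\<^sub>R b + x)) has_derivative (\<lambda>h. frechet_derivative \<phi> (at (t *\<^sub>R b + x)) (h *\<^sub>R b))) (at t)"
      by (rule has_derivative_compose [of "\<lambda>t. t *\<^sub>R b + x" "\<lambda>h. h *\<^sub>R b" t UNIV \<phi>])
         (auto intro!: derivative_eq_intros smooth_has_derivative test_functions_smooth assms)
    then show ?thesis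
      by (simp add: has_vector_derivative_def linear_scale [OF has_derivative_linear [OF
              smooth_has_derivative [OF test_functions_smooth [OF assms(1)]]]])
  qed
  have "(\<lambda>n. LINT x|lborel. q n x) \<longlonglongrightarrow> (LINT x|lborel. ?D x)"
  proof (rule integral_dominated_convergence)
    show "integrable lborel (\<lambda>x. M * indicator (cball 0 (R + 1)) x)"
      by (intro integrable_mult_right) (auto intro!: integrable_real_indicator emeasure_lborel_cball_finite)
    show "AE x in lborel. (\<lambda>n. q n x) \<longlonglongrightarrow> ?D x"
    proof (rule AE_I2)
      fix x
      have "((\<lambda>t. \<phi> (t *\<^sub>R b + x)) has_vector_derivative ?D x) (at 0)" using der [of x 0] by simp
      then have lim: "((\<lambda>t. norm (\<phi> (t *\<^sub>R b + x) - \<phi> x - t *\<^sub>R ?D x) / \<bar>t\<bar>) \<longlongrightarrow> 0) (at 0)"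
        by (simp add: has_vector_derivative_def has_derivative_at)
      have "norm (\<phi> (t *\<^sub>R b + x) - \<phi> x - t *\<^sub>R ?D x) / \<bar>t\<bar> = norm ((\<phi> (t *\<^sub>R b + x) - \<phi> x) /\<^sub>R t - ?D x)"
        if "t \<noteq> 0" for t
      proof -
        have "(\<phi> (t *\<^sub>R b + x) - \<phi> x) /\<^sub>R t - ?D x = (\<phi> (t *\<^sub>R b + x) - \<phi> x - t *\<^sub>R ?D x) /\<^sub>R t"
          using that by (simp add: scaleR_right_diff_distrib)
        then show ?thesis by (simp add: divide_inverse mult.commute)
      qed
      then have "((\<lambda>t. norm ((\<phi> (t *\<^sub>R b + x) - \<phi> x) /\<^sub>R t - ?D x)) \<longlongrightarrow> 0) (at 0)"
        by (intro Lim_transform_eventually [OF lim]) (auto simp: eventually_at_filter)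
      then have "((\<lambda>t. (\<phi> (t *\<^sub>R b + x) - \<phi> x) /\<^sub>R t) \<longlongrightarrow> ?D x) (at 0)"
        by (rule LIM_zero_cancel [OF tendsto_norm_zero_cancel])
      moreover have "filterlim (\<lambda>n. 1 / real (Suc n)) (at 0) sequentially"
        using LIMSEQ_inverse_real_of_nat by (simp add: filterlim_at inverse_eq_divide del: of_nat_Suc)
      ultimately have "(\<lambda>n. (\<phi> ((1 / Suc n) *\<^sub>R b + x) - \<phi> x) /\<^sub>R (1 / Suc n)) \<longlonglongrightarrow> ?D x"
        by (rule filterlim_compose)
      then show "(\<lambda>n. q n x) \<longlonglongrightarrow> ?D x" by (simp add: q_def scaleR_conv_of_real del: of_nat_Suc)
    qed
    show "AE x in lborel. norm (q n x) \<le> M * indicator (cball 0 (R + 1)) x" for n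
    proof (rule AE_I2)
      fix x
      have "norm (\<phi> ((1 / Suc n) *\<^sub>R b + x) - \<phi> (0 *\<^sub>R b + x)) \<le> M * norm (1 / real (Suc n) - 0)"
      proof (rule differentiable_bound [of UNIV "\<lambda>t. \<phi> (t *\<^sub>R b + x)" "\<lambda>t h. h *\<^sub>R ?D (t *\<^sub>R b + x)"])
        show "onorm (\<lambda>h. h *\<^sub>R ?D (t *\<^sub>R b + x)) \<le> M" for t
          using M by (intro onorm_le) (simp add: mult.commute [of M] mult_left_mono)
      qed (use der in \<open>auto simp: has_vector_derivative_def\<close>)
      moreover have "norm (q n x) = real (Suc n) * norm (\<phi> ((1 / Suc n) *\<^sub>R b + x) - \<phi> x)"
        by (simp add: q_def norm_mult del: of_nat_Suc)
      ultimately have 1: "norm (q n x) \<le> M" by (simp add: field_simps del: of_nat_Suc)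
      have "q n x = 0" if "norm x > R + 1"
      proof -
        have "norm ((1 / Suc n) *\<^sub>R b + x) \<ge> norm x - norm ((1 / Suc n) *\<^sub>R b)"
          by (metis add.commute norm_diff_ineq)
        moreover have "norm ((1 / Suc n) *\<^sub>R b) \<le> 1" using assms by simp
        ultimately have "norm ((1 / Suc n) *\<^sub>R b + x) > R" using that by linarith
        then show ?thesis using that R(2) [of x] R(2) [of "(1 / Suc n) *\<^sub>R b + x"] by (simp add: q_def)
      qed
      with 1 M show "norm (q n x) \<le> M * indicator (cball 0 (R + 1)) x" by (auto simp: indicator_def)
    qed
  qed (auto simp: q_def)
  moreover have "(LINT x|lborel. q n x) = 0" for n
    using test_functions_integrable [OF assms(1)]
    by (simp add: q_def lborel_integral_translate [of \<phi>] lborel_integrable_translate [of \<phi>] del: of_nat_Suc)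
  ultimately have "(\<lambda>n. 0) \<longlonglongrightarrow> (LINT x|lborel. ?D x)" by simp
  then show ?thesis by (simp add: LIMSEQ_const_iff)
qed

text \<open>Integration by parts: the derivative of \<open>\<phi>\<close> times the character has
  integral zero, and the product rule separates the two terms.\<close>

lemma fourier_partial:
  assumes "\<phi> \<in> test_functions" "b \<in> Basis"
  shows "fourier (\<lambda>x. frechet_derivative \<phi> (at x) b) y = (2 * pi * \<i>) * of_real (y \<bullet> b) * fourier \<phi> y"
proof -
  let ?D = "\<lambda>x. frechet_derivative \<phi> (at x) b"
  have D: "?D \<in> test_functions" using test_functions_partials [of \<phi> "[b]"] assms by simp
  have e: "ec (- (x \<bullet> y)) = ec (x \<bullet> (- y))" for x by simp
  have t: "(\<lambda>x. \<phi> x * ec (- (x \<bullet> y))) \<in> test_functions"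
    unfolding e by (intro test_functions_mult_smooth assms smooth_ec)
  have "frechet_derivative (\<lambda>x. \<phi> x * ec (- (x \<bullet> y))) (at x) =
      (\<lambda>h. \<phi> x * (of_real (h \<bullet> (- y)) * ((2 * pi * \<i>) * ec (x \<bullet> (- y)))) + frechet_derivative \<phi> (at x) h * ec (x \<bullet> (- y)))" for x
    unfolding e
    by (intro frechet_derivative_eqI has_derivative_mult smooth_has_derivative ec_inner_has_derivative
        test_functions_smooth assms)
  then have "0 = (LINT x|lborel. - (2 * pi * \<i>) * of_real (y \<bullet> b) * (\<phi> x * ec (- (x \<bullet> y))) + ?D x * ec (- (x \<bullet> y)))"
    using integral_partial_zero [OF t assms(2)] by (simp add: algebra_simps inner_commute)
  also have "\<dots> = - (2 * pi * \<i>) * of_real (y \<bullet> b) * fourier \<phi> y + fourier ?D y"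
    unfolding fourier_ec
    using integrable_mult_ec [OF test_functions_integrable [OF assms(1)], of "\<lambda>x. - (x \<bullet> y)"]
      integrable_mult_ec [OF test_functions_integrable [OF D], of "\<lambda>x. - (x \<bullet> y)"]
    by (subst Bochner_Integration.integral_add) auto
  finally show ?thesis by (simp add: algebra_simps)
qed

text \<open>Multiplying the transform by \<open>1 + \<parallel>y\<parallel>\<^sup>2\<close> amounts to applying \<open>1 - \<Delta> / 4\<pi>\<^sup>2\<close> to \<open>\<phi>\<close>,
  which gives the decay.\<close>

lemma fourier_mult_norm_power:
  fixes \<phi> :: "'a::euclidean_space \<Rightarrow> complex"
  assumes "\<phi> \<in> test_functions"
  shows "\<exists>\<psi>\<in>test_functions. \<forall>y. fourier \<psi> y = of_real ((1 + (norm y)\<^sup>2) ^ n) * fourier \<phi> y"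
proof (induction n)
  case 0
  with assms show ?case by auto
next
  case (Suc n)
  then obtain \<psi> where \<psi>: "\<psi> \<in> test_functions" "\<And>y. fourier \<psi> y = of_real ((1 + (norm y)\<^sup>2) ^ n) * fourier \<phi> y"
    by auto
  have D: "partials bs \<psi> \<in> test_functions" if "set bs \<subseteq> Basis" for bs
    by (intro test_functions_partials \<psi> that)
  define \<Delta> where "\<Delta> x = (\<Sum>b\<in>Basis. partials [b, b] \<psi> x)" for x
  have \<Delta>: "\<Delta> \<in> test_functions"
    unfolding \<Delta>_def [abs_def] by (intro test_functions_sum D) auto
  have *: "fourier (partials [b, b] \<psi>) y = - of_real (4 * pi\<^sup>2 * (y \<bullet> b)\<^sup>2) * fourier \<psi> y" if "b \<in> Basis" for b y
    using D [of "[b]"] \<psi> that by (simp add: fourier_partial) (simp add: power2_eq_square algebra_simps)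
  then have f\<Delta>: "fourier \<Delta> y = - of_real (4 * pi\<^sup>2 * (norm y)\<^sup>2) * fourier \<psi> y" for y
    unfolding \<Delta>_def [abs_def]
  proof (subst fourier_sum)
    have "(norm y)\<^sup>2 = (\<Sum>b\<in>Basis. (y \<bullet> b)\<^sup>2)"
      by (subst power2_norm_eq_inner, subst euclidean_inner) (simp add: power2_eq_square)
    then show "(\<Sum>b\<in>Basis. fourier (partials [b, b] \<psi>) y) = - of_real (4 * pi\<^sup>2 * (norm y)\<^sup>2) * fourier \<psi> y"
      using * [of _ y] by (simp add: sum_distrib_left sum_distrib_right sum_negf mult_ac)
  qed (auto intro!: test_functions_integrable D simp del: partials.simps)
  define c :: complex where "c = - of_real (1 / (4 * pi\<^sup>2))"
  have c: "c * - of_real (4 * pi\<^sup>2 * r) = of_real r" for r by (simp add: c_def)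
  define \<eta> where "\<eta> x = \<psi> x + c * \<Delta> x" for x
  have "fourier \<eta> y = fourier \<psi> y + c * fourier \<Delta> y" for y
    unfolding \<eta>_def [abs_def]
    by (simp add: fourier_add fourier_cmult test_functions_integrable \<psi> \<Delta>)
  then have "fourier \<eta> y = of_real (1 + (norm y)\<^sup>2) * fourier \<psi> y" for y
    by (simp only: f\<Delta> mult.assoc [symmetric] c of_real_add of_real_1 ring_distribs mult_1_left)
  moreover have "\<eta> \<in> test_functions"
    unfolding \<eta>_def [abs_def] by (intro test_functions_add test_functions_cmult \<psi> \<Delta>)
  ultimately show ?case using \<psi>(2) by (intro bexI [of _ \<eta>]) (auto simp: algebra_simps)
qed

lemma fourier_decay:
  fixes \<phi> :: "'a::euclidean_space \<Rightarrow> complex"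
  assumes "\<phi> \<in> test_functions"
  shows "\<exists>c. \<forall>y. (1 + norm y) ^ n * norm (fourier \<phi> y) \<le> c"
proof -
  obtain \<psi> where \<psi>: "\<psi> \<in> test_functions" "\<And>y. fourier \<psi> y = of_real ((1 + (norm y)\<^sup>2) ^ n) * fourier \<phi> y"
    using fourier_mult_norm_power [OF assms] by blast
  have "(1 + norm y) ^ n * norm (fourier \<phi> y) \<le> 2 ^ n * (LINT x|lborel. norm (\<psi> x))" for y
  proof -
    have "2 * norm y \<le> 1 + (norm y)\<^sup>2" using sum_squares_bound [of 1 "norm y"] by simp
    then have "1 + norm y \<le> 2 * (1 + (norm y)\<^sup>2)" by (smt (verit) zero_le_power2)
    then have "(1 + norm y) ^ n * norm (fourier \<phi> y) \<le> (2 * (1 + (norm y)\<^sup>2)) ^ n * norm (fourier \<phi> y)"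
      by (intro mult_right_mono power_mono) auto
    also have "\<dots> = 2 ^ n * norm (fourier \<psi> y)"
      by (simp only: \<psi>(2) norm_mult norm_of_real power_mult_distrib abs_of_nonneg zero_le_power
           add_nonneg_nonneg zero_le_one zero_le_power2 mult.assoc)
    also have "\<dots> \<le> 2 ^ n * (LINT x|lborel. norm (\<psi> x))"
      by (intro mult_left_mono norm_fourier_le) auto
    finally show ?thesis .
  qed
  then show ?thesis by blast
qed

lemma fourier_schwartz:
  assumes "\<phi> \<in> test_functions"
  shows "fourier \<phi> \<in> schwartz_space"
  using assms by (intro schwartz_spaceI fourier_smooth) (auto simp: fourier_partials intro!: fourier_decay)

lemma fourier_continuous: "\<phi> \<in> test_functions \<Longrightarrow> continuous_on S (fourier \<phi>)"
  by (intro smooth_continuous fourier_smooth)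

lemma fourier_measurable: "\<phi> \<in> test_functions \<Longrightarrow> fourier \<phi> \<in> borel_measurable borel"
  by (intro borel_measurable_continuous_onI fourier_continuous)

section \<open>Fubini\<close>

text \<open>A majorant of product form makes the iterated integral of the absolute value finite at
  once, which is the criterion for exchanging the integrals.\<close>

lemma
  fixes F :: "'a::euclidean_space \<Rightarrow> 'b::euclidean_space \<Rightarrow> complex"
  assumes meas: "(\<lambda>(x, y). F x y) \<in> borel_measurable (borel \<Otimes>\<^sub>M borel)"
    and le: "\<And>x y. norm (F x y) \<le> u x * v y"
    and u: "integrable lborel u" and v: "integrable lborel v"
  shows fubini_swap: "(LINT x|lborel. LINT y|lborel. F x y) = (LINT y|lborel. LINT x|lborel. F x y)"
    and fubini_integrable: "integrable lborel (\<lambda>x. LINT y|lborel. F x y)"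
    and fubini_bound: "norm (LINT x|lborel. LINT y|lborel. F x y) \<le> (LINT x|lborel. u x) * (LINT y|lborel. v y)"
proof -
  have m1 [measurable]: "case_prod F \<in> borel_measurable (lborel \<Otimes>\<^sub>M lborel)"
    using meas by (simp cong: measurable_cong_sets sets_pair_measure_cong)
  have my: "F x \<in> borel_measurable borel" for x
    using measurable_Pair2 [OF m1, of x] by simp
  have iy: "integrable lborel (F x)" for x
    using my by (intro Bochner_Integration.integrable_bound [OF integrable_mult_right [OF v, of "u x"]])
       (auto intro!: order_trans [OF le] )
  have "integrable (lborel \<Otimes>\<^sub>M lborel) (case_prod F)"
  proof (rule lborel_pair.Fubini_integrable [OF m1])
    show "integrable lborel (\<lambda>x. LINT y|lborel. norm (case_prod F (x, y)))"
    proof (rule Bochner_Integration.integrable_bound [OF integrable_mult_left [OF u, of "LINT y|lborel. v y"]])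
      show "(\<lambda>x. LINT y|lborel. norm (case_prod F (x, y))) \<in> borel_measurable lborel" by measurable
      show "AE x in lborel. norm (LINT y|lborel. norm (case_prod F (x, y))) \<le> norm (u x * (LINT y|lborel. v y))"
      proof (rule AE_I2)
        fix x
        have "(LINT y|lborel. norm (F x y)) \<le> (LINT y|lborel. u x * v y)"
          by (intro integral_mono integrable_norm iy integrable_mult_right v le)
        then show "norm (LINT y|lborel. norm (case_prod F (x, y))) \<le> norm (u x * (LINT y|lborel. v y))"
          by (simp add: integral_nonneg_AE)
      qed
    qed
    show "AE x in lborel. integrable lborel (\<lambda>y. case_prod F (x, y))" using iy by simp
  qed
  note int = this
  show "(LINT x|lborel. LINT y|lborel. F x y) = (LINT y|lborel. LINT x|lborel. F x y)"
    using lborel_pair.Fubini_integral [OF int] by simp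
  show i: "integrable lborel (\<lambda>x. LINT y|lborel. F x y)"
    using lborel_pair.integrable_fst [OF int] by simp
  have "norm (LINT x|lborel. LINT y|lborel. F x y) \<le> (LINT x|lborel. u x * (LINT y|lborel. v y))"
  proof (rule Bochner_Integration.integral_norm_bound_integral [OF i integrable_mult_left [OF u]])
    fix x
    have "norm (LINT y|lborel. F x y) \<le> (LINT y|lborel. u x * v y)"
      by (intro Bochner_Integration.integral_norm_bound_integral iy integrable_mult_right v le)
    then show "norm (LINT y|lborel. F x y) \<le> u x * (LINT y|lborel. v y)" by simp
  qed
  then show "norm (LINT x|lborel. LINT y|lborel. F x y) \<le> (LINT x|lborel. u x) * (LINT y|lborel. v y)" by simp
qed

text \<open>Only \<open>fourier \<phi>\<close> is expanded and the integrals are exchanged, so this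
  convolution formula does not presuppose Fourier inversion.\<close>

lemma fourier_fourier_mult:
  assumes "\<phi> \<in> test_functions" "\<eta> \<in> test_functions"
  shows "fourier (\<lambda>y. fourier \<phi> y * \<eta> y) x = (LINT r|lborel. \<phi> r * fourier \<eta> (r + x))"
proof -
  have [measurable]: "\<phi> \<in> borel_measurable borel" "\<eta> \<in> borel_measurable borel"
    using test_functions_measurable assms by auto
  have "fourier (\<lambda>y. fourier \<phi> y * \<eta> y) x =
      (LINT y|lborel. LINT r|lborel. \<phi> r * ec (- (r \<bullet> y)) * \<eta> y * ec (- (y \<bullet> x)))"
    unfolding fourier_ec by (simp only: integral_mult_left_zero)
  also have "\<dots> = (LINT r|lborel. LINT y|lborel. \<phi> r * ec (- (r \<bullet> y)) * \<eta> y * ec (- (y \<bullet> x)))"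
    by (rule fubini_swap [where u = "\<lambda>y. norm (\<eta> y)" and v = "\<lambda>r. norm (\<phi> r)"])
       (auto simp: norm_mult intro!: integrable_norm test_functions_integrable assms)
  also have "\<dots> = (LINT r|lborel. \<phi> r * fourier \<eta> (r + x))"
    unfolding fourier_ec
    by (subst integral_mult_right_zero [symmetric], rule Bochner_Integration.integral_cong [OF refl])
       (auto simp: ec_add [symmetric] inner_add_right inner_commute mult_ac intro!: Bochner_Integration.integral_cong)
  finally show ?thesis .
qed

section \<open>Gaussians and Fourier inversion\<close>

lemma
  fixes f :: "'a::euclidean_space \<Rightarrow> real \<Rightarrow> 'c::{real_normed_field, banach, second_countable_topology}"
  assumes f: "\<And>b. b \<in> Basis \<Longrightarrow> integrable lborel (f b)"
  shows lborel_integral_prod: "(LINT x|lborel. (\<Prod>b\<in>Basis. f b (x \<bullet> b))) = (\<Prod>b\<in>Basis. LINT t|lborel. f b t)"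
    and lborel_integrable_prod: "integrable lborel (\<lambda>x. \<Prod>b\<in>Basis. f b (x \<bullet> b))"
proof -
  interpret product_sigma_finite "\<lambda>_::'a. lborel :: real measure" ..
  have [measurable]: "f b \<in> borel_measurable borel" if "b \<in> Basis" for b
    using borel_measurable_integrable [OF f [OF that]] by simp
  have sel: "(\<Prod>b\<in>Basis. f b ((\<Sum>c\<in>Basis. g c *\<^sub>R c) \<bullet> b)) = (\<Prod>b\<in>Basis. f b (g b))" for g :: "'a \<Rightarrow> real"
    by (intro prod.cong refl) (simp add: inner_sum_left_Basis)
  have m: "(\<lambda>x::'a. \<Prod>b\<in>Basis. f b (x \<bullet> b)) \<in> borel_measurable borel" by measurable
  show "(LINT x|lborel. (\<Prod>b\<in>Basis. f b (x \<bullet> b))) = (\<Prod>b\<in>Basis. LINT t|lborel. f b t)"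
    by (subst lborel_eq, subst integral_distr) (use m in \<open>auto simp: sel f product_integral_prod\<close>)
  show "integrable lborel (\<lambda>x. \<Prod>b\<in>Basis. f b (x \<bullet> b))"
    by (subst lborel_eq, subst integrable_distr_eq) (use m in \<open>auto simp: sel f product_integrable_prod\<close>)
qed

lemma inner_self_Basis: "(x::'a::euclidean_space) \<bullet> x = (\<Sum>b\<in>Basis. (x \<bullet> b)\<^sup>2)"
  by (subst euclidean_inner) (simp add: power2_eq_square)

text \<open>The one-dimensional formula is the characteristic function of the standard normal law
  after a linear substitution.\<close>

lemma
  assumes e: "e > 0"
  shows gauss1_fourier: "(LINT u|lborel. of_real (exp (- pi * e * u\<^sup>2)) * ec (- (u * y)))
      = complex_of_real (exp (- pi * y\<^sup>2 / e) / sqrt e)"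
    and gauss1_integrable: "integrable lborel (\<lambda>u. exp (- pi * e * u\<^sup>2))"
proof -
  \<comment> \<open>\<open>c\<close> rescales the standard normal density to the exponent
    \<open>- pi * e * u\<^sup>2\<close>, and \<open>t\<close> is the frequency that matches
    \<open>y\<close> under this substitution.\<close>
  define c where "c = sqrt (2 * pi * e)"
  have c: "c > 0" "c\<^sup>2 = 2 * pi * e" using e by (auto simp: c_def)
  define t where "t = - (2 * pi * y / c)"
  let ?g = "\<lambda>x. std_normal_density x *\<^sub>R iexp (t * x)"
  have d: "std_normal_density (0 + c * u) = exp (- pi * e * u\<^sup>2) / sqrt (2 * pi)" for u
    unfolding std_normal_density_def by (simp add: power_mult_distrib c)
  have i: "iexp (t * (0 + c * u)) = ec (- (u * y))" for u
    using c by (simp add: t_def ec_def cis_conv_exp mult_ac)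
  have t2: "t\<^sup>2 / 2 = pi * y\<^sup>2 / e"
    using e by (simp add: t_def power_divide power_mult_distrib c) (simp add: power2_eq_square field_simps)
  have "char std_normal_distribution t = (LINT x|lborel. ?g x)"
    unfolding char_def by (subst integral_density) auto
  also have "\<dots> = \<bar>c\<bar> *\<^sub>R (LINT u|lborel. ?g (0 + c * u))"
    by (rule lborel_integral_real_affine) (use c in auto)
  also have "\<dots> = c *\<^sub>R (LINT u|lborel. of_real (1 / sqrt (2 * pi)) * (of_real (exp (- pi * e * u\<^sup>2)) * ec (- (u * y))))"
    unfolding d i using c by (simp add: scaleR_conv_of_real)
  also have "\<dots> = of_real (c / sqrt (2 * pi)) * (LINT u|lborel. of_real (exp (- pi * e * u\<^sup>2)) * ec (- (u * y)))"
    by (subst integral_mult_right_zero) (simp add: scaleR_conv_of_real)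
  also have "c / sqrt (2 * pi) = sqrt e" by (simp add: c_def real_sqrt_mult)
  finally have "of_real (sqrt e) * (LINT u|lborel. of_real (exp (- pi * e * u\<^sup>2)) * ec (- (u * y))) = complex_of_real (exp (- (t\<^sup>2 / 2)))"
    by (simp add: char_std_normal_distribution)
  then show "(LINT u|lborel. of_real (exp (- pi * e * u\<^sup>2)) * ec (- (u * y))) = complex_of_real (exp (- pi * y\<^sup>2 / e) / sqrt e)"
    unfolding t2 using e by (simp add: field_simps)
  have "integrable lborel (\<lambda>x. std_normal_density x)"
    by (intro integrable_normal_density) auto
  then have "integrable lborel (\<lambda>u. sqrt (2 * pi) * std_normal_density (0 + c * u))"
    using c lborel_integrable_real_affine [of std_normal_density c 0] by (intro integrable_mult_right) auto
  then show "integrable lborel (\<lambda>u. exp (- pi * e * u\<^sup>2))" unfolding d by simp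
qed

text \<open>The transform of the damping factor \<open>exp (- pi * e * (s \<bullet> s))\<close>: a
  Gaussian of mass 1 and width of order sqrt(e), hence an approximate identity as \<open>e\<close>
  tends to 0.\<close>

definition gauss :: "real \<Rightarrow> 'a::euclidean_space \<Rightarrow> real" where
  "gauss e x = exp (- pi * (x \<bullet> x) / e) / sqrt e ^ DIM('a)"

lemma exp_inner_prod: "exp (- pi * e * (x \<bullet> x)) = (\<Prod>b\<in>Basis. exp (- pi * e * (x \<bullet> b)\<^sup>2))"
  for x :: "'a::euclidean_space"
  by (subst inner_self_Basis) (simp add: exp_sum [symmetric] sum_distrib_left)

lemma ec_sum: "ec (\<Sum>i\<in>I. r i) = (\<Prod>i\<in>I. ec (r i))"
  by (induction I rule: infinite_finite_induct) (auto simp: ec_add)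

lemma gauss_fourier:
  fixes y :: "'a::euclidean_space"
  assumes "e > 0"
  shows "(LINT s|lborel. of_real (exp (- pi * e * (s \<bullet> s))) * ec (- (s \<bullet> y))) = complex_of_real (gauss e y)"
proof -
  have "of_real (exp (- pi * e * (s \<bullet> s))) * ec (- (s \<bullet> y)) =
      (\<Prod>b\<in>Basis. complex_of_real (exp (- pi * e * (s \<bullet> b)\<^sup>2)) * ec (- ((s \<bullet> b) * (y \<bullet> b))))" for s
    unfolding exp_inner_prod prod.distrib of_real_prod ec_sum [symmetric]
    by (subst euclidean_inner [of s y]) (simp add: sum_negf)
  then have "(LINT s|lborel. of_real (exp (- pi * e * (s \<bullet> s))) * ec (- (s \<bullet> y))) =
      (\<Prod>b\<in>Basis. LINT t|lborel. complex_of_real (exp (- pi * e * t\<^sup>2)) * ec (- (t * (y \<bullet> b))))"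
    using assms by (simp only:) (intro lborel_integral_prod integrable_mult_ec integrable_of_real gauss1_integrable; simp)
  also have "\<dots> = (\<Prod>b\<in>Basis. complex_of_real (exp (- pi * (y \<bullet> b)\<^sup>2 / e) / sqrt e))"
    using gauss1_fourier [OF assms] by simp
  also have "\<dots> = complex_of_real (gauss e y)"
    unfolding gauss_def inner_self_Basis of_real_prod [symmetric] prod_dividef
    by (simp add: exp_sum [symmetric] sum_distrib_left sum_divide_distrib)
  finally show ?thesis .
qed

lemma exp_inner_integrable:
  assumes "e > 0"
  shows "integrable lborel (\<lambda>x::'a::euclidean_space. exp (- pi * e * (x \<bullet> x)))"
  unfolding exp_inner_prod by (intro lborel_integrable_prod gauss1_integrable assms)

lemma gauss_eq: "gauss e x = exp (- pi * (1 / e) * (x \<bullet> x)) / sqrt e ^ DIM('a)" for x :: "'a::euclidean_space"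
  by (simp add: gauss_def)

lemma gauss_nonneg [simp]: "e > 0 \<Longrightarrow> gauss e x \<ge> 0"
  by (simp add: gauss_def)

lemma gauss_measurable [measurable]: "gauss e \<in> borel_measurable borel"
  unfolding gauss_def [abs_def] by measurable

lemma gauss_integrable:
  assumes "e > 0"
  shows "integrable lborel (gauss e :: 'a::euclidean_space \<Rightarrow> real)"
  unfolding gauss_eq [abs_def] using assms by (intro integrable_divide exp_inner_integrable) simp

lemma gauss_integral:
  assumes "e > 0"
  shows "(LINT x|lborel. gauss e (x::'a::euclidean_space)) = 1"
proof -
  have "complex_of_real (LINT s::'a|lborel. exp (- pi * (1 / e) * (s \<bullet> s))) = of_real (gauss (1 / e) (0::'a))"
    using gauss_fourier [of "1 / e" "0::'a"] assms by (simp flip: integral_complex_of_real)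
  then have "(LINT s::'a|lborel. exp (- pi * (1 / e) * (s \<bullet> s))) = sqrt e ^ DIM('a)"
    using assms by (simp only: of_real_eq_iff) (simp add: gauss_def real_sqrt_divide power_divide)
  then show ?thesis unfolding gauss_eq using assms by simp
qed

text \<open>Half of the exponent is spent on the small factor. The other half remains as a Gaussian
  of twice the variance, which again has mass 1, and the power of \<open>sqrt 2\<close> corrects its
  normalisation.\<close>

lemma gauss_far:
  assumes "e > 0" "\<delta> \<le> norm x" "\<delta> > 0"
  shows "gauss e x \<le> (sqrt 2 ^ DIM('a) * exp (- pi * \<delta>\<^sup>2 / (2 * e))) * gauss (2 * e) (x::'a::euclidean_space)"
proof -
  have "\<delta>\<^sup>2 \<le> x \<bullet> x" using assms by (simp add: power2_norm_eq_inner [symmetric] power_mono)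
  then have "- pi * (x \<bullet> x) / e \<le> - pi * \<delta>\<^sup>2 / (2 * e) + - pi * (x \<bullet> x) / (2 * e)"
    using assms by (simp add: field_simps)
  then have "exp (- pi * (x \<bullet> x) / e) \<le> exp (- pi * \<delta>\<^sup>2 / (2 * e)) * exp (- pi * (x \<bullet> x) / (2 * e))"
    by (simp only: exp_add [symmetric] exp_le_cancel_iff)
  then show ?thesis
    using assms by (simp add: gauss_def real_sqrt_mult power_mult_distrib field_simps)
qed

text \<open>The type argument only supplies the dimension.\<close>

definition gauss_tail :: "'a::euclidean_space itself \<Rightarrow> real \<Rightarrow> real \<Rightarrow> real" where
  "gauss_tail _ \<delta> e = sqrt 2 ^ DIM('a) * exp (- pi * \<delta>\<^sup>2 / (2 * e))"

lemma gauss_tail_le: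
  assumes "e > 0" "\<delta> > 0"
  shows "(LINT x|lborel. indicator (- ball 0 \<delta>) x * gauss e (x::'a::euclidean_space)) \<le> gauss_tail TYPE('a) \<delta> e"
proof -
  have "(LINT x|lborel. indicator (- ball 0 \<delta>) x * gauss e (x::'a)) \<le> (LINT x|lborel. gauss_tail TYPE('a) \<delta> e * gauss (2 * e) (x::'a))"
  proof (rule integral_mono)
    show "integrable lborel (\<lambda>x. indicator (- ball 0 \<delta>) x * gauss e (x::'a))"
      by (rule Bochner_Integration.integrable_bound [OF gauss_integrable [OF assms(1)]])
         (auto simp: indicator_def)
    show "integrable lborel (\<lambda>x. gauss_tail TYPE('a) \<delta> e * gauss (2 * e) (x::'a))"
      using assms by (intro integrable_mult_right gauss_integrable) auto
    show "indicator (- ball 0 \<delta>) x * gauss e x \<le> gauss_tail TYPE('a) \<delta> e * gauss (2 * e) x" for x :: 'a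
      using gauss_far [OF assms(1) _ assms(2), of x] assms
      by (auto simp: gauss_tail_def indicator_def)
  qed
  also have "\<dots> = gauss_tail TYPE('a) \<delta> e" using assms by (simp add: gauss_integral)
  finally show ?thesis .
qed

lemma gauss_tail_tendsto:
  assumes "\<delta> > 0"
  shows "(\<lambda>n. gauss_tail TYPE('a::euclidean_space) \<delta> (1 / real (Suc n))) \<longlonglongrightarrow> 0"
proof -
  have "filterlim (\<lambda>n. - pi * \<delta>\<^sup>2 / (2 * (1 / real (Suc n)))) at_bot sequentially"
  proof -
    have "filterlim (\<lambda>n. (pi * \<delta>\<^sup>2 / 2) * real (Suc n)) at_top sequentially"
      using assms by (intro filterlim_tendsto_pos_mult_at_top [OF tendsto_const]
        filterlim_compose [OF filterlim_real_sequentially filterlim_Suc]) auto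
    then show ?thesis by (simp add: filterlim_uminus_at_bot)
  qed
  then have "(\<lambda>n. exp (- pi * \<delta>\<^sup>2 / (2 * (1 / real (Suc n))))) \<longlonglongrightarrow> 0"
    by (rule filterlim_compose [OF exp_at_bot])
  from tendsto_mult_right_zero [OF this] show ?thesis unfolding gauss_tail_def by blast
qed

text \<open>The mass within \<open>\<delta>\<close> of 0 sees values close to \<open>w 0\<close>.
  The mass beyond is at most \<open>gauss_tail\<close>, and there the values differ by at most
  \<open>2 * M\<close>.\<close>

lemma gauss_approx:
  fixes w :: "'a::euclidean_space \<Rightarrow> complex"
  assumes [measurable]: "w \<in> borel_measurable borel" and M: "\<And>x. norm (w x) \<le> M" and c: "isCont w 0"
  shows "(\<lambda>n. LINT x|lborel. w x * of_real (gauss (1 / real (Suc n)) x)) \<longlonglongrightarrow> w 0"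
proof (rule LIMSEQ_I)
  fix \<epsilon> :: real assume \<epsilon>: "\<epsilon> > 0"
  obtain \<delta> where \<delta>: "\<delta> > 0" "\<And>x. norm x < \<delta> \<Longrightarrow> norm (w x - w 0) < \<epsilon> / 2"
    using c \<epsilon> unfolding continuous_at_eps_delta dist_norm by (metis diff_zero half_gt_zero)
  have M0: "M \<ge> 0" using M [of 0] norm_ge_zero order_trans by blast
  have lim: "(\<lambda>n. 2 * M * gauss_tail TYPE('a) \<delta> (1 / real (Suc n))) \<longlonglongrightarrow> 0"
    by (intro tendsto_mult_right_zero gauss_tail_tendsto \<delta>)
  then obtain N where N: "\<And>n. n \<ge> N \<Longrightarrow> 2 * M * gauss_tail TYPE('a) \<delta> (1 / real (Suc n)) < \<epsilon> / 2"
    using order_tendstoD(2) [OF lim half_gt_zero [OF \<epsilon>]] unfolding eventually_sequentially by blast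
  show "\<exists>no. \<forall>n\<ge>no. norm ((LINT x|lborel. w x * of_real (gauss (1 / real (Suc n)) x)) - w 0) < \<epsilon>"
  proof (intro exI [of _ N] allI impI)
    fix n assume n: "n \<ge> N"
    define e where "e = 1 / real (Suc n)"
    have e: "e > 0" by (simp add: e_def)
    note g = gauss_integrable [OF e, where 'a='a]
    have i1: "integrable lborel (\<lambda>x. w x * of_real (gauss e x))"
      by (rule Bochner_Integration.integrable_bound [OF integrable_mult_right [OF g, of M]])
         (use e M M0 in \<open>auto simp: norm_mult intro!: AE_I2 mult_right_mono\<close>)
    have i2: "integrable lborel (\<lambda>x. indicator (- ball 0 \<delta>) x * gauss e (x::'a))"
      by (rule Bochner_Integration.integrable_bound [OF g]) (auto simp: indicator_def)
    have "(LINT x|lborel. w x * of_real (gauss e x)) - w 0 = (LINT x|lborel. (w x - w 0) * of_real (gauss e x))"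
      using i1 g by (simp add: left_diff_distrib gauss_integral [OF e])
    also have "norm \<dots> \<le> (LINT x::'a|lborel. \<epsilon> / 2 * gauss e x + 2 * M * (indicator (- ball 0 \<delta>) x * gauss e x))"
    proof (rule Bochner_Integration.integral_norm_bound_integral)
      show "integrable lborel (\<lambda>x. (w x - w 0) * of_real (gauss e x))"
        using i1 g by (simp add: left_diff_distrib)
      show "integrable lborel (\<lambda>x::'a. \<epsilon> / 2 * gauss e x + 2 * M * (indicator (- ball 0 \<delta>) x * gauss e x))"
        using g i2 by (intro Bochner_Integration.integrable_add integrable_mult_right)
      fix x :: 'a
      have "norm (w x - w 0) \<le> \<epsilon> / 2 + 2 * M * indicator (- ball 0 \<delta>) x"
      proof (cases "norm x < \<delta>")
        case True with \<delta>(2) [of x] show ?thesis by (simp add: indicator_def)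
      next
        case False
        have "norm (w x - w 0) \<le> M + M" using M [of x] M [of 0] norm_triangle_ineq4 [of "w x" "w 0"] by linarith
        with False \<epsilon> show ?thesis by (simp add: indicator_def)
      qed
      then have "norm (w x - w 0) * gauss e x \<le> (\<epsilon> / 2 + 2 * M * indicator (- ball 0 \<delta>) x) * gauss e x"
        using e by (intro mult_right_mono) auto
      then show "norm ((w x - w 0) * of_real (gauss e x)) \<le> \<epsilon> / 2 * gauss e x + 2 * M * (indicator (- ball 0 \<delta>) x * gauss e x)"
        using e by (simp only: norm_mult norm_of_real abs_of_nonneg gauss_nonneg) (simp add: ring_distribs mult_ac)
    qed
    also have "\<dots> = \<epsilon> / 2 + 2 * M * (LINT x|lborel. indicator (- ball 0 \<delta>) x * gauss e (x::'a))"
      using g i2 by (simp add: gauss_integral [OF e])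
    also have "\<dots> \<le> \<epsilon> / 2 + 2 * M * gauss_tail TYPE('a) \<delta> e"
      using M0 by (intro add_left_mono mult_left_mono gauss_tail_le e \<delta>) auto
    also have "\<dots> < \<epsilon>" using N [OF n] by (simp add: e_def)
    finally show "norm ((LINT x|lborel. w x * of_real (gauss (1 / real (Suc n)) x)) - w 0) < \<epsilon>"
      by (simp add: e_def)
  qed
qed

text \<open>Comparison with the product of the one-dimensional densities
  \<open>inverse (1 + t\<^sup>2)\<close>. Each factor \<open>1 + (x \<bullet> b)\<^sup>2\<close> is
  at most \<open>(1 + norm x)\<^sup>2\<close>, which explains the exponent.\<close>

lemma integrable_decay: "integrable lborel (\<lambda>x::'a::euclidean_space. 1 / (1 + norm x) ^ (2 * DIM('a)))"
proof (rule Bochner_Integration.integrable_bound)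
  have "integrable lborel (\<lambda>t::real. inverse (1 + t\<^sup>2))"
    using integrable_inverse_1_plus_square by (simp add: set_integrable_def einterval_def)
  then show "integrable lborel (\<lambda>x::'a. \<Prod>b\<in>Basis. inverse (1 + (x \<bullet> b)\<^sup>2))"
    by (rule lborel_integrable_prod)
  show "AE x in lborel. norm (1 / (1 + norm (x::'a)) ^ (2 * DIM('a))) \<le> norm (\<Prod>b\<in>Basis. inverse (1 + (x \<bullet> b)\<^sup>2))"
  proof (rule AE_I2)
    fix x :: 'a
    have "(\<Prod>b\<in>Basis. 1 + (x \<bullet> b)\<^sup>2) \<le> (\<Prod>b\<in>(Basis::'a set). (1 + norm x)\<^sup>2)"
    proof (intro prod_mono conjI)
      fix b :: 'a assume "b \<in> Basis"
      then have "(x \<bullet> b)\<^sup>2 \<le> (norm x)\<^sup>2"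
        by (metis Basis_le_norm abs_ge_zero power2_abs power_mono)
      then show "1 + (x \<bullet> b)\<^sup>2 \<le> (1 + norm x)\<^sup>2" using norm_ge_zero [of x] by (simp add: power2_sum add_increasing2)
    qed (auto intro: add_nonneg_nonneg)
    also have "\<dots> = (1 + norm x) ^ (2 * DIM('a))" by (simp add: power_mult)
    finally have le: "(\<Prod>b\<in>Basis. 1 + (x \<bullet> b)\<^sup>2) \<le> (1 + norm x) ^ (2 * DIM('a))" .
    have pos: "(\<Prod>b\<in>Basis. 1 + (x \<bullet> b)\<^sup>2) > 0" by (intro prod_pos) (auto intro: add_pos_nonneg)
    have "(\<Prod>b\<in>Basis. inverse (1 + (x \<bullet> b)\<^sup>2)) = inverse (\<Prod>b\<in>Basis. 1 + (x \<bullet> b)\<^sup>2)"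
      using prod_inversef [of "\<lambda>b. 1 + (x \<bullet> b)\<^sup>2" Basis] by (simp add: comp_def)
    then show "norm (1 / (1 + norm x) ^ (2 * DIM('a))) \<le> norm (\<Prod>b\<in>Basis. inverse (1 + (x \<bullet> b)\<^sup>2))"
      using le pos by (simp only:) (simp add: le_imp_inverse_le inverse_eq_divide [symmetric])
  qed
qed simp

text \<open>The decay estimate is used with \<open>2 * DIM('a)\<close> additional powers, which pay
  for integrability.\<close>

lemma fourier_weighted_integrable:
  assumes "\<phi> \<in> test_functions"
  shows "integrable lborel (\<lambda>s::'a::euclidean_space. (1 + norm s) ^ n * norm (fourier \<phi> s))"
proof -
  obtain c where c: "\<And>y. (1 + norm y) ^ (n + 2 * DIM('a)) * norm (fourier \<phi> y) \<le> c"
    using fourier_decay [OF assms] by metis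
  have [measurable]: "fourier \<phi> \<in> borel_measurable borel" by (rule fourier_measurable [OF assms])
  have "(1 + norm s) ^ n * norm (fourier \<phi> s) \<le> \<bar>c\<bar> * (1 / (1 + norm s) ^ (2 * DIM('a)))" for s
  proof -
    have "(1 + norm s) ^ (2 * DIM('a)) > 0" by (intro zero_less_power) (simp add: add_pos_nonneg)
    moreover have "(1 + norm s) ^ (n + 2 * DIM('a)) * norm (fourier \<phi> s) \<le> \<bar>c\<bar>"
      using c [of s] by linarith
    ultimately show ?thesis by (simp add: power_add field_simps)
  qed
  then show ?thesis
    by (intro Bochner_Integration.integrable_bound [OF integrable_mult_right [OF integrable_decay, of "\<bar>c\<bar>"]]) auto
qed

lemma fourier_integrable:
  assumes "\<phi> \<in> test_functions"
  shows "integrable lborel (fourier \<phi>)"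
proof -
  have [measurable]: "fourier \<phi> \<in> borel_measurable borel" by (rule fourier_measurable [OF assms])
  show ?thesis using fourier_weighted_integrable [OF assms, of 0] by (simp add: integrable_norm_iff)
qed

text \<open>The integral is damped by a Gaussian. By Fubini the damped integral is the mean of
  \<open>\<phi>\<close> around \<open>l\<close> against \<open>gauss\<close>. Removing the damping
  is dominated convergence on one side and the approximate identity on the other.\<close>

lemma fourier_inversion:
  fixes \<phi> :: "'a::euclidean_space \<Rightarrow> complex"
  assumes "\<phi> \<in> test_functions"
  shows "(LINT s|lborel. fourier \<phi> s * ec (l \<bullet> s)) = \<phi> l"
proof (rule LIMSEQ_unique)
  have [measurable]: "fourier \<phi> \<in> borel_measurable borel" "\<phi> \<in> borel_measurable borel"
    using fourier_measurable test_functions_measurable assms by auto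
  let ?I = "\<lambda>n. LINT s::'a|lborel. fourier \<phi> s * ec (l \<bullet> s) * of_real (exp (- pi * (1 / real (Suc n)) * (s \<bullet> s)))"
  show "?I \<longlonglongrightarrow> (LINT s|lborel. fourier \<phi> s * ec (l \<bullet> s))"
  proof (rule integral_dominated_convergence)
    show "integrable lborel (\<lambda>s. norm (fourier \<phi> s))" by (intro integrable_norm fourier_integrable assms)
    show "AE s in lborel. norm (fourier \<phi> s * ec (l \<bullet> s) * of_real (exp (- pi * (1 / real (Suc n)) * (s \<bullet> s)))) \<le> norm (fourier \<phi> s)" for n
      by (auto simp: norm_mult intro!: AE_I2 mult_left_le)
    show "AE s in lborel. (\<lambda>n. fourier \<phi> s * ec (l \<bullet> s) * of_real (exp (- pi * (1 / real (Suc n)) * (s \<bullet> s)))) \<longlonglongrightarrow> fourier \<phi> s * ec (l \<bullet> s)"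
    proof (rule AE_I2)
      fix s :: 'a
      have "(\<lambda>n. exp (- pi * (1 / real (Suc n)) * (s \<bullet> s))) \<longlonglongrightarrow> exp (- pi * 0 * (s \<bullet> s))"
        using LIMSEQ_inverse_real_of_nat by (intro tendsto_intros) (simp add: inverse_eq_divide del: of_nat_Suc)
      from tendsto_mult [OF tendsto_const tendsto_of_real [OF this], of "fourier \<phi> s * ec (l \<bullet> s)"]
      show "(\<lambda>n. fourier \<phi> s * ec (l \<bullet> s) * of_real (exp (- pi * (1 / real (Suc n)) * (s \<bullet> s)))) \<longlonglongrightarrow> fourier \<phi> s * ec (l \<bullet> s)"
        by simp
    qed
  qed measurable
  have "?I n = (LINT x|lborel. \<phi> (l + x) * of_real (gauss (1 / real (Suc n)) x))" for n
  proof -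
    define e where "e = 1 / real (Suc n)"
    have e: "e > 0" by (simp add: e_def)
    let ?G = "\<lambda>s::'a. complex_of_real (exp (- pi * e * (s \<bullet> s)))"
    have "?I n = (LINT s|lborel. LINT x|lborel. \<phi> x * ec (- (x \<bullet> s)) * ec (l \<bullet> s) * ?G s)"
      unfolding fourier_ec e_def [symmetric] by (simp only: integral_mult_left_zero)
    also have "\<dots> = (LINT x|lborel. LINT s|lborel. \<phi> x * ec (- (x \<bullet> s)) * ec (l \<bullet> s) * ?G s)"
      by (rule fubini_swap [where u = "\<lambda>s. exp (- pi * e * (s \<bullet> s))" and v = "\<lambda>x. norm (\<phi> x)"])
         (use exp_inner_integrable [OF e, where 'a='a] in
           \<open>auto simp: norm_mult assms intro!: integrable_norm test_functions_integrable\<close>)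
    also have "\<dots> = (LINT x|lborel. LINT s|lborel. \<phi> x * (?G s * ec (- (s \<bullet> (x - l)))))"
    proof (intro Bochner_Integration.integral_cong refl)
      fix x s :: 'a
      have "ec (- (x \<bullet> s)) * ec (l \<bullet> s) = ec (- (s \<bullet> (x - l)))"
        by (simp add: ec_add [symmetric] inner_diff_right inner_commute)
      then show "\<phi> x * ec (- (x \<bullet> s)) * ec (l \<bullet> s) * ?G s = \<phi> x * (?G s * ec (- (s \<bullet> (x - l))))"
        by (metis mult.assoc mult.commute)
    qed
    also have "\<dots> = (LINT x|lborel. \<phi> x * of_real (gauss e (x - l)))"
      by (simp only: integral_mult_right_zero gauss_fourier [OF e])
    also have "\<dots> = (LINT x|lborel. \<phi> (l + x) * of_real (gauss e x))"
      using lborel_integral_translate [of "\<lambda>x. \<phi> x * of_real (gauss e (x - l))" l] by simp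
    finally show ?thesis by (simp add: e_def)
  qed
  moreover have "(\<lambda>n. LINT x|lborel. \<phi> (l + x) * of_real (gauss (1 / real (Suc n)) x)) \<longlonglongrightarrow> \<phi> (l + 0)"
  proof -
    obtain M where M: "\<And>x. norm (\<phi> x) \<le> M" using test_functions_bounded [OF assms] by metis
    have "isCont (\<lambda>x. \<phi> (l + x)) 0"
      using test_functions_continuous [OF test_functions_translate [OF assms], of UNIV l]
      by (simp add: continuous_on_eq_continuous_at)
    with M show ?thesis by (intro gauss_approx) auto
  qed
  ultimately show "?I \<longlonglongrightarrow> \<phi> l" by simp
qed

section \<open>Uniformly almost periodic functions and their means\<close>

text \<open>Bochner's form of almost periodicity: the translates of \<open>g\<close> are totally bounded in the
  uniform norm. Unlike Bohr's definition, it is evidently stable under sums and products.\<close>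

definition apu :: "('a::euclidean_space \<Rightarrow> complex) \<Rightarrow> bool" where
  "apu g \<longleftrightarrow> uniformly_continuous_on UNIV g \<and>
     (\<forall>\<epsilon>>0. \<exists>F. finite F \<and> (\<forall>s. \<exists>r\<in>F. \<forall>x. norm (g (x + s) - g (x + r)) \<le> \<epsilon>))"

lemma compact_finite_net:
  fixes S :: "'b::metric_space set"
  assumes "compact S" "e > 0"
  shows "\<exists>k. finite k \<and> k \<subseteq> S \<and> S \<subseteq> (\<Union>x\<in>k. ball x e)"
  using seq_compact_imp_totally_bounded [OF compact_imp_seq_compact [OF assms(1)]] assms(2) by simp

lemma apuE:
  assumes "apu g" "\<epsilon> > 0"
  obtains F where "finite F" "\<And>s. \<exists>r\<in>F. \<forall>x. norm (g (x + s) - g (x + r)) \<le> \<epsilon>"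
  using assms unfolding apu_def by blast

lemma uniformly_continuousD:
  fixes g :: "'a::euclidean_space \<Rightarrow> complex"
  assumes "uniformly_continuous_on UNIV g" "\<epsilon> > 0"
  obtains \<delta> where "\<delta> > 0" "\<And>x y. norm (x - y) < \<delta> \<Longrightarrow> norm (g x - g y) < \<epsilon>"
  using assms unfolding uniformly_continuous_on_def dist_norm by (metis UNIV_I)

lemma uniformly_continuousI:
  fixes g :: "'a::euclidean_space \<Rightarrow> complex"
  assumes "\<And>\<epsilon>. \<epsilon> > 0 \<Longrightarrow> \<exists>\<delta>>0. \<forall>x y. norm (x - y) < \<delta> \<longrightarrow> norm (g x - g y) < \<epsilon>"
  shows "uniformly_continuous_on UNIV g"
  using assms unfolding uniformly_continuous_on_def dist_norm by (metis UNIV_I)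

lemma apu_uniformly_continuous: "apu g \<Longrightarrow> uniformly_continuous_on UNIV g"
  by (simp add: apu_def)

lemma apu_continuous: "apu g \<Longrightarrow> continuous_on UNIV g"
  by (simp add: apu_def uniformly_continuous_imp_continuous)

lemma apu_measurable: "apu g \<Longrightarrow> g \<in> borel_measurable borel"
  by (intro borel_measurable_continuous_onI apu_continuous)

lemma apu_bounded:
  assumes "apu g"
  obtains C where "C > 0" "\<And>x. norm (g x) \<le> C"
proof -
  obtain F where F: "finite F" "\<And>s. \<exists>r\<in>F. \<forall>x. norm (g (x + s) - g (x + r)) \<le> 1"
    using apuE [OF assms, of 1] by auto
  define C where "C = 1 + (\<Sum>r\<in>F. norm (g r))"
  have "norm (g s) \<le> C" for s
  proof -
    obtain r where r: "r \<in> F" "norm (g (0 + s) - g (0 + r)) \<le> 1" using F(2) by blast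
    have "norm (g s) \<le> norm (g r) + norm (g s - g r)" by (rule norm_triangle_sub)
    also have "norm (g r) \<le> (\<Sum>r\<in>F. norm (g r))" using F r by (intro member_le_sum) auto
    finally show ?thesis using r by (simp add: C_def)
  qed
  moreover have "C > 0" by (simp add: C_def add_pos_nonneg sum_nonneg)
  ultimately show ?thesis using that by blast
qed

text \<open>Every shift \<open>s\<close> is moved by an almost period into a fixed ball at the cost
  of \<open>\<epsilon> / 2\<close>, and compactness of that ball provides the finite net. Uniform
  continuity is transported from a compact ball to the whole space in the same way.\<close>

lemma almost_periodic_imp_apu:
  fixes g :: "'a::euclidean_space \<Rightarrow> complex"
  assumes "almost_periodic g"
  shows "apu g"
proof -
  have cont: "continuous_on UNIV g" using assms by (simp add: almost_periodic_def)
  \<comment> \<open>Relative density is applied at \<open>- s\<close>, so that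
    \<open>s + \<tau>\<close> lies in a ball around 0 whose radius does not depend on
    \<open>s\<close>.\<close>
  have per: "\<exists>R>0. \<forall>s. \<exists>\<tau>. norm (s + \<tau>) < R \<and> (\<forall>x. norm (g (x + \<tau>) - g x) < \<epsilon>)" if "\<epsilon> > 0" for \<epsilon>
  proof -
    define T where "T = {\<tau>. (SUP x. ereal (norm (g (x + \<tau>) - g x))) < ereal \<epsilon>}"
    have "relatively_dense T" using assms that by (simp add: almost_periodic_def T_def)
    then obtain R where R: "\<And>x. ball x R \<inter> T \<noteq> {}" unfolding relatively_dense_def by metis
    obtain x\<^sub>0 :: 'a where "x\<^sub>0 \<in> ball 0 R" using R [of 0] by blast
    then have "R > 0" using norm_ge_zero [of x\<^sub>0] unfolding mem_ball_0 by linarith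
    moreover have "\<exists>\<tau>. norm (s + \<tau>) < R \<and> (\<forall>x. norm (g (x + \<tau>) - g x) < \<epsilon>)" for s
    proof -
      obtain \<tau> where "\<tau> \<in> ball (- s) R" "\<tau> \<in> T" using R [of "- s"] by blast
      then have \<tau>: "\<tau> \<in> ball (- s) R" "(SUP x. ereal (norm (g (x + \<tau>) - g x))) < ereal \<epsilon>"
        by (simp_all add: T_def)
      have "ereal (norm (g (x + \<tau>) - g x)) < ereal \<epsilon>" for x
        by (rule le_less_trans [OF SUP_upper \<tau>(2)]) simp
      moreover have "norm (s + \<tau>) < R"
        using \<tau>(1) by (simp add: dist_norm norm_minus_commute [of "- s"] add.commute)
      ultimately show ?thesis by auto
    qed
    ultimately show ?thesis by blast
  qed
  have uc: "uniformly_continuous_on UNIV g"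
  proof (rule uniformly_continuousI)
    fix \<epsilon> :: real assume \<epsilon>: "\<epsilon> > 0"
    then obtain R where R: "R > 0" "\<And>s. \<exists>\<tau>. norm (s + \<tau>) < R \<and> (\<forall>x. norm (g (x + \<tau>) - g x) < \<epsilon> / 3)"
      using per [of "\<epsilon> / 3"] by auto
    have "uniformly_continuous_on (cball 0 (R + 1)) g"
      by (intro compact_uniformly_continuous continuous_on_subset [OF cont]) auto
    then obtain d where d: "d > 0" "\<And>x y. x \<in> cball 0 (R + 1) \<Longrightarrow> y \<in> cball 0 (R + 1) \<Longrightarrow>
        dist y x < d \<Longrightarrow> dist (g y) (g x) < \<epsilon> / 3"
      unfolding uniformly_continuous_on_def using \<epsilon> by (metis divide_pos_pos zero_less_numeral)
    have "norm (g x - g y) < \<epsilon>" if xy: "norm (x - y) < min d 1" for x y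
    proof -
      obtain \<tau> where \<tau>: "norm (x + \<tau>) < R" "\<And>z. norm (g (z + \<tau>) - g z) < \<epsilon> / 3" using R(2) by blast
      have "norm (y + \<tau>) \<le> norm (x + \<tau>) + norm (x - y)"
        using norm_triangle_ineq4 [of "x + \<tau>" "x - y"] by (simp add: add.commute)
      with \<tau>(1) xy have "x + \<tau> \<in> cball 0 (R + 1)" "y + \<tau> \<in> cball 0 (R + 1)"
        by (simp_all del: mem_cball add: mem_cball_0)
      from d(2) [OF this(2,1)] xy have "dist (g (x + \<tau>)) (g (y + \<tau>)) < \<epsilon> / 3"
        by (simp add: dist_norm)
      moreover have "g x - g y = (g (x + \<tau>) - g (y + \<tau>)) - (g (x + \<tau>) - g x) + (g (y + \<tau>) - g y)" by simp
      then have "norm (g x - g y) \<le> norm (g (x + \<tau>) - g (y + \<tau>)) + norm (g (x + \<tau>) - g x) + norm (g (y + \<tau>) - g y)"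
        by (metis add_right_mono norm_triangle_ineq norm_triangle_ineq4 order_trans)
      ultimately show ?thesis using \<tau>(2) [of x] \<tau>(2) [of y] by (simp add: dist_norm)
    qed
    with d(1) show "\<exists>\<delta>>0. \<forall>x y. norm (x - y) < \<delta> \<longrightarrow> norm (g x - g y) < \<epsilon>"
      by (intro exI [of _ "min d 1"]) auto
  qed
  have "\<exists>F. finite F \<and> (\<forall>s. \<exists>r\<in>F. \<forall>x. norm (g (x + s) - g (x + r)) \<le> \<epsilon>)" if \<epsilon>: "\<epsilon> > 0" for \<epsilon>
  proof -
    obtain R where R: "R > 0" "\<And>s. \<exists>\<tau>. norm (s + \<tau>) < R \<and> (\<forall>x. norm (g (x + \<tau>) - g x) < \<epsilon> / 2)"
      using per [of "\<epsilon> / 2"] \<epsilon> by auto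
    obtain d where d: "d > 0" "\<And>x y. norm (x - y) < d \<Longrightarrow> norm (g x - g y) < \<epsilon> / 2"
      using uniformly_continuousD [OF uc, of "\<epsilon> / 2"] \<epsilon> by auto
    obtain F :: "'a set" where F: "finite F" "cball 0 R \<subseteq> (\<Union>r\<in>F. ball r d)"
      using compact_finite_net [OF compact_cball d(1), of "0::'a" R] by auto
    have "\<exists>r\<in>F. \<forall>x. norm (g (x + s) - g (x + r)) \<le> \<epsilon>" for s
    proof -
      obtain \<tau> where \<tau>: "norm (s + \<tau>) < R" "\<And>z. norm (g (z + \<tau>) - g z) < \<epsilon> / 2" using R(2) by blast
      have "s + \<tau> \<in> cball 0 R" using \<tau>(1) unfolding mem_cball_0 by simp
      then obtain r where r: "r \<in> F" "dist r (s + \<tau>) < d" using F(2) by auto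
      have "norm (g (x + s) - g (x + r)) \<le> \<epsilon>" for x
      proof -
        have "norm ((x + s + \<tau>) - (x + r)) < d"
          using r by (simp add: dist_norm norm_minus_commute algebra_simps)
        from d(2) [OF this] \<tau>(2) [of "x + s"]
          norm_triangle_ineq4 [of "g (x + s + \<tau>) - g (x + r)" "g (x + s + \<tau>) - g (x + s)"]
        show ?thesis by simp
      qed
      with r show ?thesis by blast
    qed
    with F show ?thesis by blast
  qed
  with uc show ?thesis by (simp add: apu_def)
qed

lemma apu_const: "apu (\<lambda>x. c)"
  by (auto simp: apu_def uniformly_continuous_on_const intro!: exI [of _ "{0}"])

text \<open>The nets of \<open>g\<close> and \<open>h\<close> need not share any shift. Each pair of
  net points defines a class of shifts that follow both, and a common net takes one representative
  of each class. Passing through the class costs twice \<open>\<epsilon> / 2\<close>.\<close>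

lemma apu_pair:
  assumes "apu g" "apu h" "\<epsilon> > 0"
  shows "\<exists>F. finite F \<and> (\<forall>s. \<exists>r\<in>F. \<forall>x. norm (g (x + s) - g (x + r)) \<le> \<epsilon> \<and> norm (h (x + s) - h (x + r)) \<le> \<epsilon>)"
proof -
  obtain G where G: "finite G" "\<And>s. \<exists>r\<in>G. \<forall>x. norm (g (x + s) - g (x + r)) \<le> \<epsilon> / 2"
    using apuE [OF assms(1), of "\<epsilon> / 2"] assms(3) by (metis half_gt_zero)
  obtain H where H: "finite H" "\<And>s. \<exists>r\<in>H. \<forall>x. norm (h (x + s) - h (x + r)) \<le> \<epsilon> / 2"
    using apuE [OF assms(2), of "\<epsilon> / 2"] assms(3) by (metis half_gt_zero)
  define P where "P p s \<longleftrightarrow> (\<forall>x. norm (g (x + s) - g (x + fst p)) \<le> \<epsilon> / 2) \<and> (\<forall>x. norm (h (x + s) - h (x + snd p)) \<le> \<epsilon> / 2)" for p s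
  \<comment> \<open>Pairs that no shift realises contribute an arbitrary point, which is
    harmless.\<close>
  define F where "F = (\<lambda>p. SOME s. P p s) ` (G \<times> H)"
  have "\<exists>r\<in>F. \<forall>x. norm (g (x + s) - g (x + r)) \<le> \<epsilon> \<and> norm (h (x + s) - h (x + r)) \<le> \<epsilon>" for s
  proof -
    obtain p where p: "p \<in> G \<times> H" "P p s" using G(2) [of s] H(2) [of s] by (auto simp: P_def)
    define r where "r = (SOME s. P p s)"
    have r: "P p r" unfolding r_def using p(2) by (rule someI)
    have "norm (g (x + s) - g (x + r)) \<le> \<epsilon> \<and> norm (h (x + s) - h (x + r)) \<le> \<epsilon>" for x
      using p(2) r norm_diff_triangle_le [of "g (x + s)" "g (x + fst p)" "\<epsilon> / 2" "g (x + r)" "\<epsilon> / 2"]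
        norm_diff_triangle_le [of "h (x + s)" "h (x + snd p)" "\<epsilon> / 2" "h (x + r)" "\<epsilon> / 2"]
      by (simp add: P_def norm_minus_commute)
    moreover have "r \<in> F" using p by (auto simp: F_def r_def)
    ultimately show ?thesis by blast
  qed
  then show ?thesis using G H by (intro exI [of _ F]) (auto simp: F_def)
qed

lemma apu_add:
  assumes "apu g" "apu h"
  shows "apu (\<lambda>x. g x + h x)"
  unfolding apu_def
proof (intro conjI allI impI)
  show "uniformly_continuous_on UNIV (\<lambda>x. g x + h x)"
    using assms by (intro uniformly_continuous_on_add apu_uniformly_continuous)
  fix \<epsilon> :: real assume "\<epsilon> > 0"
  then obtain F where F: "finite F"
    "\<And>s. \<exists>r\<in>F. \<forall>x. norm (g (x + s) - g (x + r)) \<le> \<epsilon> / 2 \<and> norm (h (x + s) - h (x + r)) \<le> \<epsilon> / 2"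
    using apu_pair [OF assms, of "\<epsilon> / 2"] by auto
  have "\<exists>r\<in>F. \<forall>x. norm (g (x + s) + h (x + s) - (g (x + r) + h (x + r))) \<le> \<epsilon>" for s
  proof -
    obtain r where r: "r \<in> F" "\<And>x. norm (g (x + s) - g (x + r)) \<le> \<epsilon> / 2 \<and> norm (h (x + s) - h (x + r)) \<le> \<epsilon> / 2"
      using F(2) by blast
    have "norm (g (x + s) + h (x + s) - (g (x + r) + h (x + r))) \<le> \<epsilon>" for x
      using r(2) [of x] norm_diff_triangle_ineq [of "g (x + s)" "h (x + s)" "g (x + r)" "h (x + r)"] by linarith
    with r show ?thesis by blast
  qed
  with F show "\<exists>F. finite F \<and> (\<forall>s. \<exists>r\<in>F. \<forall>x. norm (g (x + s) + h (x + s) - (g (x + r) + h (x + r))) \<le> \<epsilon>)"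
    by blast
qed

lemma norm_mult_diff_le:
  fixes a b c d :: complex
  assumes "norm a \<le> C" "norm d \<le> D"
  shows "norm (a * b - c * d) \<le> C * norm (b - d) + D * norm (a - c)"
proof -
  have "a * b - c * d = a * (b - d) + (a - c) * d" by (simp add: algebra_simps)
  then have "norm (a * b - c * d) \<le> norm a * norm (b - d) + norm (a - c) * norm d"
    by (metis norm_mult norm_triangle_ineq)
  also have "\<dots> \<le> C * norm (b - d) + norm (a - c) * D"
    by (intro add_mono mult_right_mono mult_left_mono assms) auto
  finally show ?thesis by (simp add: mult.commute)
qed

lemma apu_mult:
  assumes "apu g" "apu h"
  shows "apu (\<lambda>x. g x * h x)"
proof -
  obtain C where C: "C > 0" "\<And>x. norm (g x) \<le> C" using apu_bounded [OF assms(1)] by metis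
  obtain D where D: "D > 0" "\<And>x. norm (h x) \<le> D" using apu_bounded [OF assms(2)] by metis
  have le: "norm (g x * h x - g y * h y) \<le> \<epsilon>"
    if "norm (g x - g y) \<le> \<epsilon> / (2 * (C + D))" "norm (h x - h y) \<le> \<epsilon> / (2 * (C + D))" for x y \<epsilon>
  proof -
    have "\<epsilon> \<ge> 0" using order_trans [OF norm_ge_zero that(1)] C D by (simp add: zero_le_divide_iff)
    have "norm (g x * h x - g y * h y) \<le> C * norm (h x - h y) + D * norm (g x - g y)"
      by (intro norm_mult_diff_le C D)
    also have "\<dots> \<le> C * (\<epsilon> / (2 * (C + D))) + D * (\<epsilon> / (2 * (C + D)))"
      using that C D by (intro add_mono mult_left_mono) auto
    also have "\<dots> = (C + D) * (\<epsilon> / (2 * (C + D)))" by (simp only: distrib_right)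
    also have "\<dots> = \<epsilon> / 2"
    proof -
      have "C + D \<noteq> 0" using C D by simp
      then show ?thesis by (metis nonzero_mult_divide_mult_cancel_left mult.commute times_divide_eq_right)
    qed
    finally show ?thesis using \<open>\<epsilon> \<ge> 0\<close> by simp
  qed
  show ?thesis
    unfolding apu_def
  proof (intro conjI allI impI)
    show "uniformly_continuous_on UNIV (\<lambda>x. g x * h x)"
    proof (rule uniformly_continuousI)
      fix \<epsilon> :: real assume \<epsilon>: "\<epsilon> > 0"
      then have e: "(\<epsilon> / 2) / (2 * (C + D)) > 0" using C D by simp
      obtain d1 where d1: "d1 > 0" "\<And>x y. norm (x - y) < d1 \<Longrightarrow> norm (g x - g y) < (\<epsilon> / 2) / (2 * (C + D))"
        using uniformly_continuousD [OF apu_uniformly_continuous [OF assms(1)] e] by metis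
      obtain d2 where d2: "d2 > 0" "\<And>x y. norm (x - y) < d2 \<Longrightarrow> norm (h x - h y) < (\<epsilon> / 2) / (2 * (C + D))"
        using uniformly_continuousD [OF apu_uniformly_continuous [OF assms(2)] e] by metis
      have "norm (g x * h x - g y * h y) < \<epsilon>" if "norm (x - y) < min d1 d2" for x y
        using le [of x y "\<epsilon> / 2"] d1(2) [of x y] d2(2) [of x y] that \<epsilon> by simp
      with d1 d2 show "\<exists>\<delta>>0. \<forall>x y. norm (x - y) < \<delta> \<longrightarrow> norm (g x * h x - g y * h y) < \<epsilon>"
        by (intro exI [of _ "min d1 d2"]) auto
    qed
    fix \<epsilon> :: real assume "\<epsilon> > 0"
    then have "\<epsilon> / (2 * (C + D)) > 0" using C D by simp
    from apu_pair [OF assms this] show "\<exists>F. finite F \<and> (\<forall>s. \<exists>r\<in>F. \<forall>x. norm (g (x + s) * h (x + s) - g (x + r) * h (x + r)) \<le> \<epsilon>)"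
      by (meson le)
  qed
qed

lemma apu_cmult: "apu g \<Longrightarrow> apu (\<lambda>x. c * g x)"
  by (intro apu_mult apu_const)

lemma apu_diff: "apu g \<Longrightarrow> apu h \<Longrightarrow> apu (\<lambda>x. g x - h x)"
  using apu_add [of g "\<lambda>x. - 1 * h x"] apu_cmult [of h "- 1"] by simp

lemma apu_sum: "(\<And>i. i \<in> I \<Longrightarrow> apu (g i)) \<Longrightarrow> apu (\<lambda>x. \<Sum>i\<in>I. g i x)"
  by (induction I rule: infinite_finite_induct) (auto intro: apu_const apu_add)

text \<open>A shift by \<open>s\<close> multiplies the character by the unimodular number
  \<open>ec (\<xi> \<bullet> s)\<close>. A finite net of the unit circle, pulled back to shifts, is
  therefore a net of translates.\<close>

lemma apu_ec:
  fixes \<xi> :: "'a::euclidean_space"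
  shows "apu (\<lambda>x. ec (\<xi> \<bullet> x))"
  unfolding apu_def
proof (intro conjI allI impI)
  show "uniformly_continuous_on UNIV (\<lambda>x. ec (\<xi> \<bullet> x))"
  proof (rule uniformly_continuousI)
    fix \<epsilon> :: real assume \<epsilon>: "\<epsilon> > 0"
    have pos: "2 * pi * norm \<xi> + 1 > 0" by (intro add_nonneg_pos) auto
    have "norm (ec (\<xi> \<bullet> x) - ec (\<xi> \<bullet> y)) < \<epsilon>" if "norm (x - y) < \<epsilon> / (2 * pi * norm \<xi> + 1)" for x y
    proof -
      have "norm (ec (\<xi> \<bullet> x) - ec (\<xi> \<bullet> y)) \<le> 2 * pi * \<bar>\<xi> \<bullet> (x - y)\<bar>"
        using norm_ec_diff_le [of "\<xi> \<bullet> x" "\<xi> \<bullet> y"] by (simp add: inner_diff_right)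
      also have "\<dots> \<le> 2 * pi * (norm \<xi> * norm (x - y))"
        by (intro mult_left_mono Cauchy_Schwarz_ineq2) auto
      also have "\<dots> \<le> (2 * pi * norm \<xi> + 1) * norm (x - y)" by (simp add: algebra_simps)
      also have "\<dots> < \<epsilon>" using that pos by (simp add: field_simps)
      finally show ?thesis .
    qed
    with \<epsilon> pos show "\<exists>\<delta>>0. \<forall>x y. norm (x - y) < \<delta> \<longrightarrow> norm (ec (\<xi> \<bullet> x) - ec (\<xi> \<bullet> y)) < \<epsilon>"
      by (intro exI [of _ "\<epsilon> / (2 * pi * norm \<xi> + 1)"]) auto
  qed
  fix \<epsilon> :: real assume \<epsilon>: "\<epsilon> > 0"
  obtain k where k: "finite k" "sphere (0::complex) 1 \<subseteq> (\<Union>x\<in>k. ball x (\<epsilon> / 2))"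
    using compact_finite_net [OF compact_sphere half_gt_zero [OF \<epsilon>], of "0::complex" 1] by auto
  define F where "F = (\<lambda>z. SOME s. ec (\<xi> \<bullet> s) \<in> ball z (\<epsilon> / 2)) ` k"
  have "\<exists>r\<in>F. \<forall>x. norm (ec (\<xi> \<bullet> (x + s)) - ec (\<xi> \<bullet> (x + r))) \<le> \<epsilon>" for s
  proof -
    have "ec (\<xi> \<bullet> s) \<in> sphere 0 1" by simp
    with k(2) obtain z where z: "z \<in> k" "ec (\<xi> \<bullet> s) \<in> ball z (\<epsilon> / 2)" by blast
    define r where "r = (SOME s. ec (\<xi> \<bullet> s) \<in> ball z (\<epsilon> / 2))"
    have "ec (\<xi> \<bullet> r) \<in> ball z (\<epsilon> / 2)" unfolding r_def using z(2) by (rule someI)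
    with z(2) have "norm (ec (\<xi> \<bullet> s) - ec (\<xi> \<bullet> r)) < \<epsilon>"
      using norm_triangle_ineq4 [of "z - ec (\<xi> \<bullet> r)" "z - ec (\<xi> \<bullet> s)"] by (simp add: dist_norm)
    moreover have "norm (ec (\<xi> \<bullet> (x + s)) - ec (\<xi> \<bullet> (x + r))) = norm (ec (\<xi> \<bullet> s) - ec (\<xi> \<bullet> r))" for x
      by (simp add: inner_add_right ec_add right_diff_distrib [symmetric] norm_mult)
    moreover have "r \<in> F" using z by (auto simp: F_def r_def)
    ultimately show ?thesis by (metis less_imp_le)
  qed
  with k show "\<exists>F. finite F \<and> (\<forall>s. \<exists>r\<in>F. \<forall>x. norm (ec (\<xi> \<bullet> (x + s)) - ec (\<xi> \<bullet> (x + r))) \<le> \<epsilon>)"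
    by (intro exI [of _ F]) (auto simp: F_def)
qed

lemma apu_uniform_limit:
  assumes "\<And>\<epsilon>. \<epsilon> > 0 \<Longrightarrow> \<exists>h. apu h \<and> (\<forall>x. norm (g x - h x) \<le> \<epsilon>)"
  shows "apu g"
  unfolding apu_def
proof (intro conjI allI impI)
  have le: "norm (g x - g y) \<le> \<epsilon> / 3 + \<epsilon> / 3 + \<epsilon> / 3"
    if "\<And>x. norm (g x - h x) \<le> \<epsilon> / 3" "norm (h x - h y) \<le> \<epsilon> / 3" for h x y \<epsilon>
    using that norm_triangle_ineq4 [of "g x - h x" "g y - h y"]
      norm_triangle_ineq [of "(g x - h x) - (g y - h y)" "h x - h y"]
    by (smt (verit) add_diff_cancel_left' add_diff_eq diff_add_cancel diff_diff_eq2)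
  show "uniformly_continuous_on UNIV g"
  proof (rule uniformly_continuousI)
    fix \<epsilon> :: real assume \<epsilon>: "\<epsilon> > 0"
    then obtain h where h: "apu h" "\<And>x. norm (g x - h x) \<le> (\<epsilon> / 2) / 3"
      using assms [of "(\<epsilon> / 2) / 3"] by auto
    obtain d where d: "d > 0" "\<And>x y. norm (x - y) < d \<Longrightarrow> norm (h x - h y) < (\<epsilon> / 2) / 3"
      using uniformly_continuousD [OF apu_uniformly_continuous [OF h(1)], of "(\<epsilon> / 2) / 3"] \<epsilon> by auto
    have "norm (g x - g y) < \<epsilon>" if "norm (x - y) < d" for x y
      using le [OF h(2) less_imp_le [OF d(2) [OF that]]] \<epsilon> by simp
    with d show "\<exists>\<delta>>0. \<forall>x y. norm (x - y) < \<delta> \<longrightarrow> norm (g x - g y) < \<epsilon>" by blast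
  qed
  fix \<epsilon> :: real assume \<epsilon>: "\<epsilon> > 0"
  then obtain h where h: "apu h" "\<And>x. norm (g x - h x) \<le> \<epsilon> / 3"
    using assms [of "\<epsilon> / 3"] by auto
  obtain F where F: "finite F" "\<And>s. \<exists>r\<in>F. \<forall>x. norm (h (x + s) - h (x + r)) \<le> \<epsilon> / 3"
    using apuE [OF h(1), of "\<epsilon> / 3"] \<epsilon> by (metis divide_pos_pos zero_less_numeral)
  have "\<exists>r\<in>F. \<forall>x. norm (g (x + s) - g (x + r)) \<le> \<epsilon>" for s
  proof -
    obtain r where r: "r \<in> F" "\<And>x. norm (h (x + s) - h (x + r)) \<le> \<epsilon> / 3" using F(2) by blast
    have "norm (g (x + s) - g (x + r)) \<le> \<epsilon>" for x using le [OF h(2) r(2)] by simp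
    with r show ?thesis by blast
  qed
  with F show "\<exists>F. finite F \<and> (\<forall>s. \<exists>r\<in>F. \<forall>x. norm (g (x + s) - g (x + r)) \<le> \<epsilon>)" by blast
qed

lemma integrable_bounded_mult:
  fixes g k :: "'a::euclidean_space \<Rightarrow> complex"
  assumes [measurable]: "g \<in> borel_measurable borel" and C: "\<And>x. norm (g x) \<le> C" and k: "integrable lborel k"
  shows "integrable lborel (\<lambda>s. g s * k s)"
proof -
  have [measurable]: "k \<in> borel_measurable borel" using k by auto
  have "C \<ge> 0" using C [of 0] norm_ge_zero order_trans by blast
  then show ?thesis
    by (intro Bochner_Integration.integrable_bound [OF integrable_mult_right [OF integrable_norm [OF k], of C]])
       (auto simp: norm_mult C mult_right_mono)
qed

lemma apu_conv:
  assumes g: "apu g" and k: "integrable lborel k"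
  shows "apu (\<lambda>t. LINT s|lborel. g (t + s) * k s)"
proof -
  note [measurable] = apu_measurable [OF g]
  obtain C where C: "\<And>x. norm (g x) \<le> C" using apu_bounded [OF g] by metis
  \<comment> \<open>The added 1 keeps \<open>K\<close> positive even when \<open>k\<close> vanishes
    almost everywhere.\<close>
  define K where "K = (LINT s|lborel. norm (k s)) + 1"
  have K: "K > 0" "(LINT s|lborel. norm (k s)) \<le> K"
    by (auto simp: K_def intro!: add_nonneg_pos)
  have i: "integrable lborel (\<lambda>s. g (t + s) * k s)" for t
    by (rule integrable_bounded_mult [OF _ C k]) simp
  have le: "norm ((LINT s|lborel. g (t + s) * k s) - (LINT s|lborel. g (u + s) * k s)) \<le> \<epsilon>"
    if "\<And>x. norm (g (t + x) - g (u + x)) \<le> \<epsilon> / K" "\<epsilon> > 0" for t u \<epsilon>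
  proof -
    have iD: "integrable lborel (\<lambda>x. (g (t + x) - g (u + x)) * k x)"
      using i [of t] i [of u] by (simp add: left_diff_distrib)
    have "(LINT s|lborel. g (t + s) * k s) - (LINT s|lborel. g (u + s) * k s) =
        (LINT s|lborel. (g (t + s) - g (u + s)) * k s)"
      using i by (simp add: left_diff_distrib)
    also have "norm \<dots> \<le> (LINT s|lborel. \<epsilon> / K * norm (k s))"
      using iD k that(1) by (intro Bochner_Integration.integral_norm_bound_integral)
        (auto simp: left_diff_distrib [symmetric] norm_mult simp del: times_divide_eq_left intro!: mult_right_mono)
    also have "\<dots> = \<epsilon> / K * (LINT s|lborel. norm (k s))" by simp
    also have "\<dots> \<le> \<epsilon> / K * K" using K that by (intro mult_left_mono) auto
    finally show ?thesis using K by simp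
  qed
  show ?thesis
    unfolding apu_def
  proof (intro conjI allI impI)
    show "uniformly_continuous_on UNIV (\<lambda>t. LINT s|lborel. g (t + s) * k s)"
    proof (rule uniformly_continuousI)
      fix \<epsilon> :: real assume \<epsilon>: "\<epsilon> > 0"
      obtain d where d: "d > 0" "\<And>x y. norm (x - y) < d \<Longrightarrow> norm (g x - g y) < (\<epsilon> / 2) / K"
        using uniformly_continuousD [OF apu_uniformly_continuous [OF g], of "(\<epsilon> / 2) / K"] \<epsilon> K by auto
      have "norm ((LINT s|lborel. g (x + s) * k s) - (LINT s|lborel. g (y + s) * k s)) < \<epsilon>"
        if "norm (x - y) < d" for x y
      proof -
        have "norm (g (x + s) - g (y + s)) \<le> (\<epsilon> / 2) / K" for s
          using that d(2) [of "x + s" "y + s"] by simp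
        from le [OF this] \<epsilon> show ?thesis by simp
      qed
      with d show "\<exists>\<delta>>0. \<forall>x y. norm (x - y) < \<delta> \<longrightarrow>
          norm ((LINT s|lborel. g (x + s) * k s) - (LINT s|lborel. g (y + s) * k s)) < \<epsilon>" by blast
    qed
    fix \<epsilon> :: real assume \<epsilon>: "\<epsilon> > 0"
    then obtain F where F: "finite F" "\<And>s. \<exists>r\<in>F. \<forall>x. norm (g (x + s) - g (x + r)) \<le> \<epsilon> / K"
      using apuE [OF g, of "\<epsilon> / K"] K by (metis divide_pos_pos)
    have "\<exists>r\<in>F. \<forall>x. norm ((LINT t|lborel. g (x + s + t) * k t) - (LINT t|lborel. g (x + r + t) * k t)) \<le> \<epsilon>" for s
    proof -
      obtain r where r: "r \<in> F" "\<And>x. norm (g (x + s) - g (x + r)) \<le> \<epsilon> / K" using F(2) by blast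
      have "norm (g (x + s + t) - g (x + r + t)) \<le> \<epsilon> / K" for x t
        using r(2) [of "x + t"] by (simp add: ac_simps)
      with r \<epsilon> show ?thesis by (intro bexI [of _ r] allI le) auto
    qed
    with F show "\<exists>F. finite F \<and> (\<forall>s. \<exists>r\<in>F. \<forall>x. norm ((LINT t|lborel. g (x + s + t) * k t) - (LINT t|lborel. g (x + r + t) * k t)) \<le> \<epsilon>)"
      by blast
  qed
qed

section \<open>Averages over balls\<close>

text \<open>Written exactly like the denominator in \<open>mean_coeff\<close>, so that the two agree
  after unfolding.\<close>

definition bvol :: "'a::euclidean_space itself \<Rightarrow> real \<Rightarrow> real" where
  "bvol _ R = unit_ball_vol (real DIM('a)) * R ^ DIM('a)"

definition bavg :: "('a::euclidean_space \<Rightarrow> complex) \<Rightarrow> real \<Rightarrow> 'a \<Rightarrow> complex" where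
  "bavg g R s = (LINT t:ball 0 R|lborel. g (t + s)) / of_real (bvol TYPE('a) R)"

lemma bvol_pos: "R > 0 \<Longrightarrow> bvol TYPE('a::euclidean_space) R > 0"
  by (simp add: bvol_def)

lemma measure_ball: "R \<ge> 0 \<Longrightarrow> measure lborel (ball (c::'a::euclidean_space) R) = bvol TYPE('a) R"
  by (simp add: bvol_def content_ball)

lemma ball_borel [measurable]: "ball (c::'a::euclidean_space) R \<in> sets borel"
  by simp

lemma integrable_ball: "integrable lborel (indicator (ball (c::'a::euclidean_space) R) :: 'a \<Rightarrow> real)"
  by (intro integrable_real_indicator emeasure_lborel_ball_finite) simp

lemma set_integrable_ball:
  fixes g :: "'a::euclidean_space \<Rightarrow> complex"
  assumes [measurable]: "g \<in> borel_measurable borel" and C: "\<And>x. norm (g x) \<le> C"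
  shows "set_integrable lborel (ball c R) g"
  unfolding set_integrable_def
proof (rule Bochner_Integration.integrable_bound)
  show "integrable lborel (\<lambda>x. C * indicator (ball c R) x)"
    by (intro integrable_mult_right integrable_ball)
  show "AE x in lborel. norm (indicator (ball c R) x *\<^sub>R g x) \<le> norm (C * indicator (ball c R) x)"
    using C by (auto simp: indicator_def intro!: AE_I2 order_trans [OF C abs_ge_self])
qed simp

lemma norm_bavg_le:
  fixes g :: "'a::euclidean_space \<Rightarrow> complex"
  assumes C: "\<And>x. norm x < R \<Longrightarrow> norm (g (x + s)) \<le> C" and "R > 0"
    and [measurable]: "g \<in> borel_measurable borel"
  shows "norm (bavg g R s) \<le> C"
proof -
  have "C \<ge> 0" using order_trans [OF norm_ge_zero C [of 0]] \<open>R > 0\<close> by simp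
  have bi: "integrable lborel (\<lambda>x. C * indicator (ball (0::'a) R) x)"
    by (intro integrable_mult_right integrable_ball)
  have le: "norm (indicator (ball 0 R) x *\<^sub>R g (x + s)) \<le> C * indicator (ball 0 R) x" for x
    using C by (auto simp: indicator_def)
  have "integrable lborel (\<lambda>x. indicator (ball 0 R) x *\<^sub>R g (x + s))"
    by (rule Bochner_Integration.integrable_bound [OF bi], simp, rule AE_I2, unfold real_norm_def,
        rule order_trans [OF le abs_ge_self])
  then have "norm (LINT t:ball 0 R|lborel. g (t + s)) \<le> (LINT x|lborel. C * indicator (ball (0::'a) R) x)"
    unfolding set_lebesgue_integral_def using bi le
    by (intro Bochner_Integration.integral_norm_bound_integral) auto
  also have "\<dots> = C * bvol TYPE('a) R"
    using \<open>R > 0\<close> measure_ball [of R "0::'a"] by simp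
  finally show ?thesis
    using bvol_pos [OF \<open>R > 0\<close>, where 'a='a] by (simp add: bavg_def norm_divide field_simps)
qed

lemma bavg_diff:
  fixes g h :: "'a::euclidean_space \<Rightarrow> complex"
  assumes "g \<in> borel_measurable borel" "\<And>x. norm (g x) \<le> C"
    and "h \<in> borel_measurable borel" "\<And>x. norm (h x) \<le> D"
  shows "bavg (\<lambda>x. g x - h x) R s = bavg g R s - bavg h R s"
    and "bavg (\<lambda>x. g x + h x) R s = bavg g R s + bavg h R s"
proof -
  have [measurable]: "g \<in> borel_measurable borel" "h \<in> borel_measurable borel" by fact+
  have "set_integrable lborel (ball 0 R) (\<lambda>t. g (t + s))" "set_integrable lborel (ball 0 R) (\<lambda>t. h (t + s))"
    using assms(2,4) by (auto intro!: set_integrable_ball [of "\<lambda>t. g (t + s)" C] set_integrable_ball [of "\<lambda>t. h (t + s)" D])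
  then show "bavg (\<lambda>x. g x - h x) R s = bavg g R s - bavg h R s"
    "bavg (\<lambda>x. g x + h x) R s = bavg g R s + bavg h R s"
    by (simp_all add: bavg_def set_integral_diff set_integral_add diff_divide_distrib add_divide_distrib)
qed

lemma bavg_cmult: "bavg (\<lambda>x. c * g x) R s = c * bavg g R s"
  by (simp add: bavg_def)

lemma bavg_const: "R > 0 \<Longrightarrow> bavg (\<lambda>x::'a::euclidean_space. c) R s = c"
  using measure_ball [of R "0::'a"] bvol_pos [of R, where 'a='a] emeasure_lborel_ball_finite [of "0::'a" R]
  by (simp add: bavg_def set_integral_const scaleR_conv_of_real)

text \<open>\<open>(1 + h)\<^sup>d - (1 - h)\<^sup>d\<close> is the relative volume of the shell containing the symmetric
  difference of a ball and its translate.\<close>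

lemma shell_power_le:
  fixes h :: real
  assumes "0 \<le> h" "h \<le> 1"
  shows "(1 + h) ^ d - (1 - h) ^ d \<le> real d * 2 ^ d * h"
proof (induction d)
  case (Suc d)
  have "(1 + h) ^ Suc d - (1 - h) ^ Suc d = (1 + h) * ((1 + h) ^ d - (1 - h) ^ d) + (1 - h) ^ d * (2 * h)"
    by (simp add: algebra_simps)
  also have "\<dots> \<le> 2 * (real d * 2 ^ d * h) + 1 * (2 * h)"
  proof (intro add_mono mult_mono)
    show "(1 - h) ^ d \<le> 1" using assms by (intro power_le_one) auto
    show "0 \<le> (1 + h) ^ d - (1 - h) ^ d" using assms by (simp add: power_mono)
  qed (use assms Suc in auto)
  also have "\<dots> \<le> 2 * (real d * 2 ^ d * h) + 2 ^ d * (2 * h)"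
    using assms by (intro add_left_mono mult_right_mono) auto
  also have "\<dots> = real (Suc d) * 2 ^ Suc d * h" by (simp add: algebra_simps)
  finally show ?case .
qed simp

definition shell_const :: "'a::euclidean_space itself \<Rightarrow> real" where
  "shell_const _ = real DIM('a) * 2 ^ DIM('a)"

lemma shell_const_ge: "shell_const TYPE('a::euclidean_space) \<ge> 2"
proof -
  have "(2::real) ^ 1 \<le> 2 ^ DIM('a)" by (intro power_increasing) (auto simp: Suc_le_eq)
  then have "1 * (2::real) \<le> real DIM('a) * 2 ^ DIM('a)" by (intro mult_mono) (auto simp: Suc_le_eq)
  then show ?thesis by (simp add: shell_const_def)
qed

lemma bvol_shell:
  assumes "0 \<le> a" "a \<le> R" "R > 0"
  shows "bvol TYPE('a::euclidean_space) (R + a) - bvol TYPE('a) (R - a) \<le> shell_const TYPE('a) * a / R * bvol TYPE('a) R"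
proof -
  have "R + a = R * (1 + a / R)" "R - a = R * (1 - a / R)" using assms by (simp_all add: field_simps)
  then have "(R + a) ^ DIM('a) = R ^ DIM('a) * (1 + a / R) ^ DIM('a)"
    "(R - a) ^ DIM('a) = R ^ DIM('a) * (1 - a / R) ^ DIM('a)"
    by (metis power_mult_distrib)+
  then have "bvol TYPE('a) (R + a) - bvol TYPE('a) (R - a) =
      bvol TYPE('a) R * ((1 + a / R) ^ DIM('a) - (1 - a / R) ^ DIM('a))"
    by (simp add: bvol_def right_diff_distrib)
  also have "\<dots> \<le> bvol TYPE('a) R * (shell_const TYPE('a) * (a / R))"
    using assms bvol_pos [of R, where 'a='a] unfolding shell_const_def
    by (intro mult_left_mono shell_power_le) auto
  finally show ?thesis by (simp add: mult_ac)
qed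

text \<open>The two integrals differ only over the symmetric difference of the balls, which lies in
  the shell between the radii \<open>R - norm s\<close> and \<open>R + norm s\<close>.\<close>

lemma bavg_shift:
  fixes g :: "'a::euclidean_space \<Rightarrow> complex"
  assumes [measurable]: "g \<in> borel_measurable borel" and C: "\<And>x. norm (g x) \<le> C" and R: "R > 0"
  shows "norm (bavg g R s - bavg g R 0) \<le> C * shell_const TYPE('a) * norm s / R"
proof -
  have "C \<ge> 0" using C [of 0] norm_ge_zero order_trans by blast
  show ?thesis
  proof (cases "norm s \<le> R")
    case True
    let ?A = "ball (0::'a) (R + norm s)" and ?B = "ball (0::'a) (R - norm s)"
    have i: "integrable lborel (\<lambda>t. indicator (ball c R) t *\<^sub>R g t)" for c
      using set_integrable_ball [OF assms(1) C] by (simp add: set_integrable_def)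
    have "(LINT t:ball 0 R|lborel. g (t + s)) = (LINT t|lborel. indicator (ball s R) (s + t) *\<^sub>R g (s + t))"
      unfolding set_lebesgue_integral_def
      by (intro Bochner_Integration.integral_cong) (auto simp: indicator_def dist_norm add.commute)
    also have "\<dots> = (LINT t|lborel. indicator (ball s R) t *\<^sub>R g t)"
      by (rule lborel_integral_translate) simp
    finally have "(LINT t:ball 0 R|lborel. g (t + s)) - (LINT t:ball 0 R|lborel. g (t + 0)) =
        (LINT t|lborel. indicator (ball s R) t *\<^sub>R g t - indicator (ball 0 R) t *\<^sub>R g t)"
      using i by (simp add: set_lebesgue_integral_def)
    also have "norm \<dots> \<le> (LINT t|lborel. C * indicator ?A t - C * indicator ?B t)"
    proof (rule Bochner_Integration.integral_norm_bound_integral)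
      show "integrable lborel (\<lambda>t. C * indicator ?A t - C * indicator ?B t)"
        by (intro Bochner_Integration.integrable_diff integrable_mult_right integrable_real_indicator
            emeasure_lborel_ball_finite) auto
      fix t
      have "norm t \<le> norm (t - s) + norm s" "norm (t - s) \<le> norm t + norm s"
        using norm_triangle_sub [of t s] norm_triangle_ineq4 [of t s] by (auto simp: norm_minus_commute)
      then have "t \<in> ball s R \<Longrightarrow> t \<in> ?A" "t \<in> ball 0 R \<Longrightarrow> t \<in> ?A" "t \<in> ?B \<Longrightarrow> t \<in> ball s R" "t \<in> ?B \<Longrightarrow> t \<in> ball 0 R"
        using norm_ge_zero [of s] by (auto simp: dist_norm norm_minus_commute)
      then show "norm (indicator (ball s R) t *\<^sub>R g t - indicator (ball 0 R) t *\<^sub>R g t) \<le> C * indicator ?A t - C * indicator ?B t"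
        using C [of t] \<open>C \<ge> 0\<close> unfolding indicator_def by (auto simp del: mem_ball mem_ball_0)
    qed (use i in auto)
    also have "\<dots> = C * (bvol TYPE('a) (R + norm s) - bvol TYPE('a) (R - norm s))"
      using True R measure_ball [of "R + norm s" "0::'a"] measure_ball [of "R - norm s" "0::'a"]
        emeasure_lborel_ball_finite [of "0::'a" "R + norm s"] emeasure_lborel_ball_finite [of "0::'a" "R - norm s"]
      by (subst Bochner_Integration.integral_diff)
         (auto simp: right_diff_distrib intro!: integrable_mult_right integrable_real_indicator)
    also have "\<dots> \<le> C * (shell_const TYPE('a) * norm s / R * bvol TYPE('a) R)"
      using True R \<open>C \<ge> 0\<close> by (intro mult_left_mono bvol_shell) auto
    finally show ?thesis
      using bvol_pos [OF R, where 'a='a]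
      by (simp add: bavg_def diff_divide_distrib [symmetric] norm_divide divide_le_eq mult_ac)
  next
    \<comment> \<open>For a shift longer than the radius the trivial bound \<open>C + C\<close> is
      enough, since \<open>shell_const\<close> is at least 2.\<close>
    case False
    have "norm (bavg g R s - bavg g R 0) \<le> C + C"
      using C R assms(1) by (intro order_trans [OF norm_triangle_ineq4 add_mono] norm_bavg_le) auto
    also have "\<dots> \<le> C * shell_const TYPE('a) * 1"
      using mult_left_mono [OF shell_const_ge [where 'a='a] \<open>C \<ge> 0\<close>] by simp
    also have "\<dots> \<le> C * shell_const TYPE('a) * (norm s / R)"
      using False R \<open>C \<ge> 0\<close> shell_const_ge [where 'a='a] by (intro mult_left_mono) auto
    finally show ?thesis by simp
  qed
qed

lemma bavg_measurable [measurable]: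
  fixes g :: "'a::euclidean_space \<Rightarrow> complex"
  assumes [measurable]: "g \<in> borel_measurable borel"
  shows "bavg g R \<in> borel_measurable borel"
proof -
  have "(\<lambda>s. LINT t|lborel. indicator (ball 0 R) t *\<^sub>R g (t + s)) \<in> borel_measurable lborel"
    by measurable
  then show ?thesis unfolding bavg_def [abs_def] set_lebesgue_integral_def by simp
qed

text \<open>Fubini exchanges the two averagings, and then the large ball is only shifted by less
  than \<open>R\<close>. This allows an average over a large ball to be estimated through averages
  over balls of a fixed radius.\<close>

lemma bavg_bavg:
  fixes g :: "'a::euclidean_space \<Rightarrow> complex"
  assumes [measurable]: "g \<in> borel_measurable borel" and C: "\<And>x. norm (g x) \<le> C"
    and R: "R > 0" and S: "S > 0"
  shows "norm (bavg (bavg g R) S 0 - bavg g S 0) \<le> C * shell_const TYPE('a) * R / S"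
proof -
  have "C \<ge> 0" using C [of 0] norm_ge_zero order_trans by blast
  have "(LINT s:ball 0 S|lborel. LINT t:ball 0 R|lborel. g (t + s)) =
      (LINT s|lborel. LINT t|lborel. (indicator (ball 0 S) s * indicator (ball 0 R) t) *\<^sub>R g (t + s))"
    unfolding set_lebesgue_integral_def by (simp flip: integral_scaleR_right)
  also have "\<dots> = (LINT t|lborel. LINT s|lborel. (indicator (ball 0 S) s * indicator (ball 0 R) t) *\<^sub>R g (t + s))"
    by (rule fubini_swap [where u = "\<lambda>s. C * indicator (ball 0 S) s" and v = "\<lambda>t. indicator (ball 0 R) t"])
       (auto simp: C intro!: integrable_mult_right integrable_ball split: split_indicator)
  also have "\<dots> = (LINT t:ball 0 R|lborel. LINT s:ball 0 S|lborel. g (s + t))"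
    unfolding set_lebesgue_integral_def by (simp add: add.commute mult.commute flip: integral_scaleR_right)
  finally have "bavg (bavg g R) S 0 = bavg (bavg g S) R 0"
    by (simp add: bavg_def divide_divide_eq_left mult.commute)
  also have "\<dots> - bavg g S 0 = bavg (\<lambda>t. bavg g S t - bavg g S 0) R 0"
    using R S C by (subst bavg_diff(1) [of _ C _ C]) (auto simp: bavg_const intro!: norm_bavg_le)
  also have "norm \<dots> \<le> C * shell_const TYPE('a) * R / S"
  proof (rule norm_bavg_le)
    fix x :: 'a assume x: "norm x < R"
    have "norm (bavg g S (x + 0) - bavg g S 0) \<le> C * shell_const TYPE('a) * norm x / S"
      using bavg_shift [OF assms(1) C S, of x] by simp
    also have "\<dots> \<le> C * shell_const TYPE('a) * R / S"
      using x S \<open>C \<ge> 0\<close> shell_const_ge [where 'a='a] by (intro divide_right_mono mult_left_mono) auto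
    finally show "norm (bavg g S (x + 0) - bavg g S 0) \<le> C * shell_const TYPE('a) * R / S" .
  qed (use R in auto)
  finally show ?thesis .
qed

section \<open>Means of almost periodic functions\<close>

text \<open>Uniformity in the centre \<open>s\<close> is built in: it makes the coefficients of
  averaged translates computable and lets the uniqueness proof treat all balls of one radius at
  once.\<close>

definition has_mean :: "('a::euclidean_space \<Rightarrow> complex) \<Rightarrow> complex \<Rightarrow> bool" where
  "has_mean g M \<longleftrightarrow> (\<forall>\<epsilon>>0. \<exists>R\<^sub>0>0. \<forall>R\<ge>R\<^sub>0. \<forall>s. norm (bavg g R s - M) \<le> \<epsilon>)"

text \<open>Each translate is uniformly close to one of finitely many, and each of these finitely
  many shifts has negligible effect on the average once the radius is large.\<close>

lemma apu_bavg_shift: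
  assumes g: "apu g" and "\<epsilon> > 0"
  shows "\<exists>R\<^sub>0>0. \<forall>R\<ge>R\<^sub>0. \<forall>s. norm (bavg g R s - bavg g R 0) \<le> \<epsilon>"
proof -
  note [measurable] = apu_measurable [OF g]
  obtain C where C: "C > 0" "\<And>x. norm (g x) \<le> C" using apu_bounded [OF g] by metis
  obtain F where F: "finite F" "\<And>s. \<exists>r\<in>F. \<forall>x. norm (g (x + s) - g (x + r)) \<le> \<epsilon> / 2"
    using apuE [OF g, of "\<epsilon> / 2"] assms by (metis half_gt_zero)
  define T where "T = 1 + (\<Sum>r\<in>F. norm r)"
  have T: "T > 0" "\<And>r. r \<in> F \<Longrightarrow> norm r \<le> T"
    using F(1) member_le_sum [of _ F norm] by (auto simp: T_def intro!: add_pos_nonneg sum_nonneg add_increasing)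
  define R\<^sub>0 where "R\<^sub>0 = C * shell_const TYPE('a) * T * 2 / \<epsilon>"
  have sc: "shell_const TYPE('a) > 0" using shell_const_ge [where 'a='a] by simp
  then have pos: "C * shell_const TYPE('a) > 0" using C by simp
  have R0: "R\<^sub>0 > 0" using pos T assms by (simp add: R\<^sub>0_def)
  have "norm (bavg g R s - bavg g R 0) \<le> \<epsilon>" if R: "R \<ge> R\<^sub>0" for R s
  proof -
    have Rp: "R > 0" using R R0 by simp
    obtain r where r: "r \<in> F" "\<And>x. norm (g (x + s) - g (x + r)) \<le> \<epsilon> / 2" using F(2) by blast
    have "bavg g R s - bavg g R r = bavg (\<lambda>x. g (x + s) - g (x + r)) R 0"
      using bavg_diff(1) [of "\<lambda>x. g (x + s)" C "\<lambda>x. g (x + r)" C R 0] C by (simp add: bavg_def)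
    also have "norm \<dots> \<le> \<epsilon> / 2" using r Rp by (intro norm_bavg_le) auto
    finally have 1: "norm (bavg g R s - bavg g R r) \<le> \<epsilon> / 2" .
    have "norm (bavg g R r - bavg g R 0) \<le> C * shell_const TYPE('a) * norm r / R"
      by (rule bavg_shift [OF _ C(2) Rp]) simp
    also have "\<dots> \<le> C * shell_const TYPE('a) * T / R"
      using T(2) [OF r(1)] Rp C(1) sc by (intro divide_right_mono mult_left_mono) auto
    also have "\<dots> \<le> C * shell_const TYPE('a) * T / R\<^sub>0"
      using R R0 Rp C(1) sc T by (intro divide_left_mono mult_nonneg_nonneg mult_pos_pos) auto
    also have "\<dots> = \<epsilon> / 2" using C(1) sc T assms by (simp add: R\<^sub>0_def)
    finally show ?thesis using 1 norm_diff_triangle_le [of "bavg g R s" "bavg g R r" "\<epsilon> / 2" "bavg g R 0" "\<epsilon> / 2"] by simp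
  qed
  with R0 show ?thesis by blast
qed

text \<open>Averages at two radii are compared through an average at a third, much larger radius:
  that one nearly equals the average of averages at either radius, and these hardly depend on their
  centre.\<close>

lemma apu_has_mean:
  assumes g: "apu g"
  shows "\<exists>M. has_mean g M"
proof -
  note [measurable] = apu_measurable [OF g]
  obtain C where C: "C > 0" "\<And>x. norm (g x) \<le> C" using apu_bounded [OF g] by metis
  have sc: "shell_const TYPE('a) > 0" using shell_const_ge [where 'a='a] by simp
  then have pos: "C * shell_const TYPE('a) > 0" using C by simp
  have close: "norm (bavg g R 0 - bavg g S 0) \<le> 4 * \<epsilon>"
    if R0: "R\<^sub>0 > 0" "\<And>R s. R \<ge> R\<^sub>0 \<Longrightarrow> norm (bavg g R s - bavg g R 0) \<le> \<epsilon>" and "\<epsilon> > 0" "R \<ge> R\<^sub>0" "S \<ge> R\<^sub>0" for \<epsilon> R\<^sub>0 R S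
  proof -
    \<comment> \<open>Large enough for the boundary error of \<open>bavg_bavg\<close> to be at most
      \<open>\<epsilon>\<close> for every inner radius up to \<open>max R S\<close>.\<close>
    define Q where "Q = C * shell_const TYPE('a) * max R S / \<epsilon>"
    have Q: "Q > 0" using pos that by (simp add: Q_def)
    have *: "norm (bavg g Q 0 - bavg g P 0) \<le> 2 * \<epsilon>" if P: "P \<ge> R\<^sub>0" "P \<le> max R S" for P
    proof -
      have Pp: "P > 0" using P R0 by simp
      have "norm (bavg (bavg g P) Q 0 - bavg g Q 0) \<le> C * shell_const TYPE('a) * P / Q"
        by (rule bavg_bavg [OF _ C(2) Pp Q]) simp
      also have "\<dots> \<le> C * shell_const TYPE('a) * max R S / Q"
        using P C(1) sc Q by (intro divide_right_mono mult_left_mono) auto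
      also have "\<dots> = \<epsilon>" using C(1) sc Pp P \<open>\<epsilon> > 0\<close> by (simp add: Q_def)
      finally have 1: "norm (bavg g Q 0 - bavg (bavg g P) Q 0) \<le> \<epsilon>" by (simp add: norm_minus_commute)
      have "bavg (bavg g P) Q 0 - bavg g P 0 = bavg (\<lambda>s. bavg g P s - bavg g P 0) Q 0"
        using Q Pp C by (subst bavg_diff(1) [of _ C _ C]) (auto simp: bavg_const intro!: norm_bavg_le)
      also have "norm \<dots> \<le> \<epsilon>" using R0(2) [OF P(1)] Q by (intro norm_bavg_le) auto
      finally show ?thesis
        using norm_diff_triangle_le [OF 1, of "bavg g P 0" \<epsilon>] by (simp only: mult_2)
    qed
    show ?thesis
      using norm_diff_triangle_le [of "bavg g R 0" "bavg g Q 0" "2 * \<epsilon>" "bavg g S 0" "2 * \<epsilon>"]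
        *[of R] *[of S] that by (simp add: norm_minus_commute)
  qed
  have "Cauchy (\<lambda>n. bavg g (real n) 0)"
  proof (rule CauchyI)
    fix \<epsilon> :: real assume \<epsilon>: "\<epsilon> > 0"
    obtain R\<^sub>0 where R0: "R\<^sub>0 > 0" "\<And>R s. R \<ge> R\<^sub>0 \<Longrightarrow> norm (bavg g R s - bavg g R 0) \<le> \<epsilon> / 8"
      using apu_bavg_shift [OF g, of "\<epsilon> / 8"] \<epsilon> by auto
    obtain N where N: "real N \<ge> R\<^sub>0" using real_arch_simple by blast
    have "norm (bavg g (real m) 0 - bavg g (real n) 0) \<le> 4 * (\<epsilon> / 8)" if "m \<ge> N" "n \<ge> N" for m n
      by (rule close [OF R0]) (use that N \<epsilon> in auto)
    then show "\<exists>M. \<forall>m\<ge>M. \<forall>n\<ge>M. norm (bavg g (real m) 0 - bavg g (real n) 0) < \<epsilon>"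
      using \<epsilon> by (intro exI [of _ N]) force
  qed
  then obtain M where M: "(\<lambda>n. bavg g (real n) 0) \<longlonglongrightarrow> M"
    using Cauchy_convergent convergent_def by blast
  have "has_mean g M"
    unfolding has_mean_def
  proof (intro allI impI)
    fix \<epsilon> :: real assume \<epsilon>: "\<epsilon> > 0"
    obtain R\<^sub>0 where R0: "R\<^sub>0 > 0" "\<And>R s. R \<ge> R\<^sub>0 \<Longrightarrow> norm (bavg g R s - bavg g R 0) \<le> \<epsilon> / 8"
      using apu_bavg_shift [OF g, of "\<epsilon> / 8"] \<epsilon> by auto
    have "norm (bavg g R s - M) \<le> \<epsilon>" if R: "R \<ge> R\<^sub>0" for R s
    proof -
      have "norm (bavg g R 0 - M) \<le> 4 * (\<epsilon> / 8)"
      proof (rule tendsto_upperbound)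
        show "(\<lambda>n. norm (bavg g R 0 - bavg g (real n) 0)) \<longlonglongrightarrow> norm (bavg g R 0 - M)"
          by (intro tendsto_intros M)
        obtain N where N: "real N \<ge> R\<^sub>0" using real_arch_simple by blast
        show "\<forall>\<^sub>F n in sequentially. norm (bavg g R 0 - bavg g (real n) 0) \<le> 4 * (\<epsilon> / 8)"
          unfolding eventually_sequentially
          by (intro exI [of _ N] allI impI close [OF R0]) (use R N \<epsilon> in auto)
      qed simp
      with R0(2) [OF R, of s] norm_diff_triangle_le [of "bavg g R s" "bavg g R 0" "\<epsilon> / 8" M "4 * (\<epsilon> / 8)"] \<epsilon>
      show ?thesis by simp
    qed
    with R0(1) show "\<exists>R\<^sub>0>0. \<forall>R\<ge>R\<^sub>0. \<forall>s. norm (bavg g R s - M) \<le> \<epsilon>" by blast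
  qed
  then show ?thesis ..
qed

lemma has_mean_tendsto:
  assumes "has_mean g M"
  shows "((\<lambda>R. bavg g R s) \<longlongrightarrow> M) at_top"
proof (rule tendstoI)
  fix \<epsilon> :: real assume "\<epsilon> > 0"
  then obtain R\<^sub>0 where "\<And>R. R \<ge> R\<^sub>0 \<Longrightarrow> norm (bavg g R s - M) \<le> \<epsilon> / 2"
    using assms unfolding has_mean_def by (metis half_gt_zero)
  then show "\<forall>\<^sub>F R in at_top. dist (bavg g R s) M < \<epsilon>"
    unfolding eventually_at_top_linorder dist_norm using \<open>\<epsilon> > 0\<close> by (intro exI [of _ R\<^sub>0]) force
qed

lemma has_mean_unique: "has_mean g M \<Longrightarrow> has_mean g N \<Longrightarrow> M = N"
  using tendsto_unique [OF _ has_mean_tendsto has_mean_tendsto] by (metis trivial_limit_at_top_linorder)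

section \<open>Fourier coefficients of almost periodic functions\<close>

lemma has_mean_imp_mean_coeff:
  assumes "has_mean (\<lambda>t. g t * ec (- (\<xi> \<bullet> t))) M"
  shows "mean_coeff \<xi> g = M"
proof -
  have "mean_coeff \<xi> g = Lim at_top (\<lambda>R. bavg (\<lambda>t. g t * ec (- (\<xi> \<bullet> t))) R 0)"
    unfolding mean_coeff_def bavg_def bvol_def exp_unit by simp
  also have "\<dots> = M" by (intro tendsto_Lim has_mean_tendsto assms) simp
  finally show ?thesis .
qed

lemma apu_modulate: "apu g \<Longrightarrow> apu (\<lambda>t. g t * ec (- (\<xi> \<bullet> t)))"
  using apu_mult [OF _ apu_ec [of "- \<xi>"], of g] by simp

lemma apu_mean_coeff: "apu g \<Longrightarrow> has_mean (\<lambda>t. g t * ec (- (\<xi> \<bullet> t))) (mean_coeff \<xi> g)"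
  using apu_has_mean [OF apu_modulate] has_mean_imp_mean_coeff by metis

lemma mean_coeff_add:
  assumes g: "apu g" and h: "apu h"
  shows "mean_coeff \<xi> (\<lambda>x. g x + h x) = mean_coeff \<xi> g + mean_coeff \<xi> h"
proof -
  let ?m = "\<lambda>g t. g t * ec (- (\<xi> \<bullet> t))"
  obtain C D where C: "\<And>x. norm (?m g x) \<le> C" "\<And>x. norm (?m h x) \<le> D"
    using apu_bounded [OF apu_modulate [OF g]] apu_bounded [OF apu_modulate [OF h]] by metis
  have "((\<lambda>R. bavg (?m g) R 0 + bavg (?m h) R 0) \<longlongrightarrow> mean_coeff \<xi> g + mean_coeff \<xi> h) at_top"
    by (intro tendsto_add has_mean_tendsto apu_mean_coeff g h)
  also have "(\<lambda>R. bavg (?m g) R 0 + bavg (?m h) R 0) = (\<lambda>R. bavg (?m (\<lambda>x. g x + h x)) R 0)"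
    using C by (subst bavg_diff(2) [symmetric, of _ C _ D])
      (auto simp: ring_distribs intro!: apu_measurable apu_modulate g h)
  finally show ?thesis
    using has_mean_tendsto [OF apu_mean_coeff [OF apu_add [OF g h]], of \<xi> 0]
    by (intro tendsto_unique [OF trivial_limit_at_top_linorder]) auto
qed

lemma mean_coeff_cmult:
  assumes g: "apu g"
  shows "mean_coeff \<xi> (\<lambda>x. c * g x) = c * mean_coeff \<xi> g"
proof -
  have "((\<lambda>R. c * bavg (\<lambda>t. g t * ec (- (\<xi> \<bullet> t))) R 0) \<longlongrightarrow> c * mean_coeff \<xi> g) at_top"
    by (intro tendsto_mult_left has_mean_tendsto apu_mean_coeff g)
  then show ?thesis
    using has_mean_tendsto [OF apu_mean_coeff [OF apu_cmult [OF g, of c]], of \<xi> 0]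
    by (intro tendsto_unique [OF trivial_limit_at_top_linorder]) (auto simp: bavg_cmult mult.assoc)
qed

lemma mean_coeff_diff: "apu g \<Longrightarrow> apu h \<Longrightarrow> mean_coeff \<xi> (\<lambda>x. g x - h x) = mean_coeff \<xi> g - mean_coeff \<xi> h"
  using mean_coeff_add [of g "\<lambda>x. - 1 * h x" \<xi>] mean_coeff_cmult [of h \<xi> "- 1"] apu_cmult [of h "- 1"] by simp

lemma mean_coeff_le:
  assumes g: "apu g" and le: "\<And>x. norm (g x) \<le> C"
  shows "norm (mean_coeff \<xi> g) \<le> C"
proof (rule tendsto_upperbound)
  show "((\<lambda>R. norm (bavg (\<lambda>t. g t * ec (- (\<xi> \<bullet> t))) R 0)) \<longlongrightarrow> norm (mean_coeff \<xi> g)) at_top"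
    by (intro tendsto_norm has_mean_tendsto apu_mean_coeff g)
  show "\<forall>\<^sub>F R in at_top. norm (bavg (\<lambda>t. g t * ec (- (\<xi> \<bullet> t))) R 0) \<le> C"
    using eventually_gt_at_top [of 0]
    by eventually_elim (auto intro!: norm_bavg_le apu_measurable apu_modulate g simp: norm_mult le)
qed simp

text \<open>Orthogonality by invariance: moving the centre by \<open>s\<close> multiplies the
  averages of \<open>ec (?z \<bullet> t)\<close> by \<open>ec (?z \<bullet> s)\<close> but leaves
  their limit unchanged.\<close>

lemma mean_coeff_ec: "mean_coeff \<xi> (\<lambda>x::'a::euclidean_space. ec (\<eta> \<bullet> x)) = (if \<xi> = \<eta> then 1 else 0)"
proof -
  let ?z = "\<eta> - \<xi>"
  have eq: "(\<lambda>t. ec (\<eta> \<bullet> t) * ec (- (\<xi> \<bullet> t))) = (\<lambda>t. ec (?z \<bullet> t))"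
    by (simp add: ec_add [symmetric] inner_diff_left)
  have hm: "has_mean (\<lambda>t. ec (?z \<bullet> t)) (mean_coeff \<xi> (\<lambda>x. ec (\<eta> \<bullet> x)))" (is "has_mean _ ?M")
    using apu_mean_coeff [OF apu_ec, of \<eta> \<xi>] by (simp add: eq)
  have shift: "bavg (\<lambda>t. ec (?z \<bullet> t)) R s = ec (?z \<bullet> s) * bavg (\<lambda>t. ec (?z \<bullet> t)) R 0" for R s
    by (simp add: bavg_def inner_add_right ec_add mult.commute)
  have "?M = ec (?z \<bullet> s) * ?M" for s
  proof (rule tendsto_unique [OF trivial_limit_at_top_linorder])
    show "((\<lambda>R. bavg (\<lambda>t. ec (?z \<bullet> t)) R s) \<longlongrightarrow> ?M) at_top" by (rule has_mean_tendsto [OF hm])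
    show "((\<lambda>R. bavg (\<lambda>t. ec (?z \<bullet> t)) R s) \<longlongrightarrow> ec (?z \<bullet> s) * ?M) at_top"
      by (subst shift) (intro tendsto_mult_left has_mean_tendsto hm)
  qed
  note inv = this
  show ?thesis
  proof (cases "\<xi> = \<eta>")
    case True
    have "has_mean (\<lambda>t. ec (?z \<bullet> t)) 1"
      using True by (auto simp: has_mean_def bavg_const intro!: exI [of _ 1])
    with hm True show ?thesis using has_mean_unique by metis
  next
    case False
    \<comment> \<open>Half a period of the character: the factor becomes -1, which forces the mean
      to vanish.\<close>
    define s where "s = (1 / (2 * (?z \<bullet> ?z))) *\<^sub>R ?z"
    have "?z \<bullet> s = 1 / 2" using False by (simp add: s_def)
    then have "ec (?z \<bullet> s) = ec (1 / 2)" by (simp only:)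
    then have "ec (?z \<bullet> s) = - 1" by (simp add: ec_def)
    with inv [of s] False show ?thesis by simp
  qed
qed

lemma mean_coeff_sum:
  "(\<And>i. i \<in> I \<Longrightarrow> apu (g i)) \<Longrightarrow> mean_coeff \<xi> (\<lambda>x. \<Sum>i\<in>I. g i x) = (\<Sum>i\<in>I. mean_coeff \<xi> (g i))"
proof (induction I rule: infinite_finite_induct)
  case (insert i I)
  then show ?case by (simp add: mean_coeff_add apu_sum)
qed (use mean_coeff_cmult [OF apu_const, of \<xi> 0 0] in simp_all)

text \<open>By Fubini the average of the modulated integral is an integral of averages of
  \<open>g\<close> centred at \<open>s\<close>. These converge uniformly in \<open>s\<close>, so the
  limit passes under the integral.\<close>

lemma mean_coeff_conv:
  fixes g :: "'a::euclidean_space \<Rightarrow> complex"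
  assumes g: "apu g" and k: "integrable lborel k"
  shows "mean_coeff \<xi> (\<lambda>t. LINT s|lborel. g (t + s) * k s) = mean_coeff \<xi> g * (LINT s|lborel. k s * ec (\<xi> \<bullet> s))"
    (is "mean_coeff \<xi> ?u = _ * ?I")
proof (rule tendsto_unique [OF trivial_limit_at_top_linorder])
  let ?g = "\<lambda>t. g t * ec (- (\<xi> \<bullet> t))"
  let ?a = "mean_coeff \<xi> g"
  have u: "apu ?u" by (rule apu_conv [OF g k])
  show "((\<lambda>R. bavg (\<lambda>t. ?u t * ec (- (\<xi> \<bullet> t))) R 0) \<longlongrightarrow> mean_coeff \<xi> ?u) at_top"
    by (intro has_mean_tendsto apu_mean_coeff u)
  have [measurable]: "g \<in> borel_measurable borel" "k \<in> borel_measurable borel"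
    using apu_measurable [OF g] k by auto
  obtain C where C: "C > 0" "\<And>x. norm (g x) \<le> C" using apu_bounded [OF g] by metis
  define K where "K = (LINT s|lborel. norm (k s)) + 1"
  have K: "K > 0" "(LINT s|lborel. norm (k s)) \<le> K" by (auto simp: K_def intro!: add_nonneg_pos)
  have eq: "bavg (\<lambda>t. ?u t * ec (- (\<xi> \<bullet> t))) R 0 = (LINT s|lborel. bavg ?g R s * (k s * ec (\<xi> \<bullet> s)))" for R
  proof -
    have "(LINT t:ball 0 R|lborel. ?u t * ec (- (\<xi> \<bullet> t))) =
        (LINT t|lborel. LINT s|lborel. of_real (indicator (ball 0 R) t) * (g (t + s) * k s * ec (- (\<xi> \<bullet> t))))"
      by (simp add: set_lebesgue_integral_def scaleR_conv_of_real)
    also have "\<dots> = (LINT s|lborel. LINT t|lborel. of_real (indicator (ball 0 R) t) * (g (t + s) * k s * ec (- (\<xi> \<bullet> t))))"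
      by (rule fubini_swap [where u = "\<lambda>t. C * indicator (ball 0 R) t" and v = "\<lambda>s. norm (k s)"])
         (auto simp: norm_mult C k intro!: mult_right_mono integrable_mult_right integrable_ball
           split: split_indicator)
    also have "\<dots> = (LINT s|lborel. (LINT t:ball 0 R|lborel. ?g (t + s)) * (k s * ec (\<xi> \<bullet> s)))"
    proof (rule Bochner_Integration.integral_cong [OF refl])
      fix s :: 'a
      have e: "ec (- (\<xi> \<bullet> t)) = ec (- (\<xi> \<bullet> (t + s))) * ec (\<xi> \<bullet> s)" for t
        by (simp add: ec_add [symmetric] inner_add_right)
      have "of_real (indicator (ball 0 R) t) * (g (t + s) * k s * ec (- (\<xi> \<bullet> t))) =
          (indicator (ball 0 R) t *\<^sub>R ?g (t + s)) * (k s * ec (\<xi> \<bullet> s))" for t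
        unfolding e [of t] by (simp add: scaleR_conv_of_real mult_ac)
      then show "(LINT t|lborel. of_real (indicator (ball 0 R) t) * (g (t + s) * k s * ec (- (\<xi> \<bullet> t)))) =
          (LINT t:ball 0 R|lborel. ?g (t + s)) * (k s * ec (\<xi> \<bullet> s))"
        unfolding set_lebesgue_integral_def integral_mult_left_zero [symmetric]
        by (intro Bochner_Integration.integral_cong refl)
    qed
    finally show ?thesis by (simp add: bavg_def)
  qed
  show "((\<lambda>R. bavg (\<lambda>t. ?u t * ec (- (\<xi> \<bullet> t))) R 0) \<longlongrightarrow> ?a * ?I) at_top"
  proof (rule tendstoI)
    fix \<epsilon> :: real assume \<epsilon>: "\<epsilon> > 0"
    then obtain R\<^sub>0 where R0: "R\<^sub>0 > 0" "\<And>R s. R \<ge> R\<^sub>0 \<Longrightarrow> norm (bavg ?g R s - ?a) \<le> \<epsilon> / (2 * K)"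
      using apu_mean_coeff [OF g, of \<xi>] K unfolding has_mean_def
      by (metis divide_pos_pos mult_pos_pos zero_less_numeral)
    have "dist (bavg (\<lambda>t. ?u t * ec (- (\<xi> \<bullet> t))) R 0) (?a * ?I) < \<epsilon>" if R: "R \<ge> R\<^sub>0" for R
    proof -
      have ik: "integrable lborel (\<lambda>s. k s * ec (\<xi> \<bullet> s))" by (rule integrable_mult_ec [OF k]) simp
      have ib: "integrable lborel (\<lambda>s. bavg ?g R s * (k s * ec (\<xi> \<bullet> s)))"
        using R R0(1) C by (intro integrable_bounded_mult [OF _ _ ik, of _ C] norm_bavg_le) (auto simp: norm_mult)
      have "bavg (\<lambda>t. ?u t * ec (- (\<xi> \<bullet> t))) R 0 - ?a * ?I = (LINT s|lborel. (bavg ?g R s - ?a) * (k s * ec (\<xi> \<bullet> s)))"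
        using ik ib by (simp add: eq left_diff_distrib)
      also have "norm \<dots> \<le> (LINT s|lborel. \<epsilon> / (2 * K) * norm (k s))"
      proof (rule Bochner_Integration.integral_norm_bound_integral)
        show "integrable lborel (\<lambda>s. (bavg ?g R s - ?a) * (k s * ec (\<xi> \<bullet> s)))"
          using ik ib by (simp add: left_diff_distrib)
        show "norm ((bavg ?g R s - ?a) * (k s * ec (\<xi> \<bullet> s))) \<le> \<epsilon> / (2 * K) * norm (k s)" for s
          unfolding norm_mult norm_ec mult_1_right by (intro mult_right_mono R0(2) [OF R]) simp
      qed (use k in simp)
      also have "\<dots> = \<epsilon> / (2 * K) * (LINT s|lborel. norm (k s))" by simp
      also have "\<dots> \<le> \<epsilon> / (2 * K) * K" using K \<epsilon> by (intro mult_left_mono) auto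
      also have "\<dots> < \<epsilon>" using K \<epsilon> by simp
      finally show ?thesis by (simp add: dist_norm)
    qed
    then show "\<forall>\<^sub>F R in at_top. dist (bavg (\<lambda>t. ?u t * ec (- (\<xi> \<bullet> t))) R 0) (?a * ?I) < \<epsilon>"
      unfolding eventually_at_top_linorder by blast
  qed
qed

section \<open>The uniqueness theorem\<close>

text \<open>If all Fourier coefficients of \<open>v\<close> vanish, its averages against characters tend to zero
  uniformly in the frequency: locally because the means are uniform in translations, for large
  frequencies because \<open>v\<close> is uniformly continuous.\<close>

lemma bavg_modulate_local:
  fixes v :: "'a::euclidean_space \<Rightarrow> complex"
  assumes v: "apu v" and zero: "mean_coeff \<xi> v = 0" and \<kappa>: "\<kappa> > 0"
  shows "\<exists>\<delta>>0. \<exists>R\<^sub>1>0. \<forall>\<eta>\<in>ball \<xi> \<delta>. \<forall>R\<ge>R\<^sub>1. norm (bavg (\<lambda>t. v t * ec (- (\<eta> \<bullet> t))) R 0) \<le> \<kappa>"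
proof -
  note [measurable] = apu_measurable [OF v]
  obtain C where C: "C > 0" "\<And>x. norm (v x) \<le> C" using apu_bounded [OF v] by metis
  have sc: "shell_const TYPE('a) > 0" using shell_const_ge [where 'a='a] by simp
  obtain S where S: "S > 0" "\<And>s. norm (bavg (\<lambda>t. v t * ec (- (\<xi> \<bullet> t))) S s) \<le> \<kappa> / 4"
  proof -
    have "\<kappa> / 4 > 0" using \<kappa> by simp
    then obtain S where "S > 0" "\<forall>R\<ge>S. \<forall>s. norm (bavg (\<lambda>t. v t * ec (- (\<xi> \<bullet> t))) R s - 0) \<le> \<kappa> / 4"
      using apu_mean_coeff [OF v, of \<xi>] unfolding has_mean_def zero by blast
    then show ?thesis using that by auto
  qed
  \<comment> \<open>\<open>\<delta>\<close> limits the effect of changing the frequency on a ball of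
    radius \<open>S\<close> to \<open>\<kappa> / 4\<close>, and \<open>R\<^sub>1\<close> limits the
    error of \<open>bavg_bavg\<close> to \<open>\<kappa> / 2\<close>.\<close>
  define \<delta> where "\<delta> = \<kappa> / (4 * (2 * pi * C * S))"
  define R\<^sub>1 where "R\<^sub>1 = 2 * C * shell_const TYPE('a) * S / \<kappa>"
  have pos: "\<delta> > 0" "R\<^sub>1 > 0" using \<kappa> C S sc by (auto simp: \<delta>_def R\<^sub>1_def)
  have "norm (bavg (\<lambda>t. v t * ec (- (\<eta> \<bullet> t))) R 0) \<le> \<kappa>" if \<eta>: "\<eta> \<in> ball \<xi> \<delta>" and R: "R \<ge> R\<^sub>1" for \<eta> R
  proof -
    let ?V = "\<lambda>\<eta> t. v t * ec (- (\<eta> \<bullet> t))"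
    have half: "norm (bavg (?V \<eta>) S s) \<le> \<kappa> / 2" for s
    proof -
      \<comment> \<open>The constant phase aligns the two characters at the centre \<open>s\<close>.
        Their remaining difference depends only on the distance from \<open>s\<close>, so the
        estimate is uniform in \<open>s\<close>.\<close>
      let ?c = "ec (- ((\<eta> - \<xi>) \<bullet> s))"
      have "bavg (?V \<eta>) S s - ?c * bavg (?V \<xi>) S s = bavg (\<lambda>t. ?V \<eta> t - ?c * ?V \<xi> t) S s"
        using C by (subst bavg_diff(1) [of _ C _ C]) (auto simp: bavg_cmult norm_mult)
      also have "norm \<dots> \<le> \<kappa> / 4"
      proof (rule norm_bavg_le)
        fix x :: 'a assume x: "norm x < S"
        have "ec (- (\<eta> \<bullet> (x + s))) = ec (- (\<xi> \<bullet> (x + s))) * ?c * ec (- ((\<eta> - \<xi>) \<bullet> x))"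
          by (simp add: ec_add [symmetric] inner_diff_left inner_add_right algebra_simps)
        then have "?V \<eta> (x + s) - ?c * ?V \<xi> (x + s) =
            v (x + s) * ec (- (\<xi> \<bullet> (x + s))) * ?c * (ec (- ((\<eta> - \<xi>) \<bullet> x)) - ec 0)"
          by (simp add: algebra_simps)
        then have "norm (?V \<eta> (x + s) - ?c * ?V \<xi> (x + s)) = norm (v (x + s)) * norm (ec (- ((\<eta> - \<xi>) \<bullet> x)) - ec 0)"
          by (simp only: norm_mult norm_ec mult_1_right)
        also have "\<dots> \<le> C * (2 * pi * \<bar>- ((\<eta> - \<xi>) \<bullet> x) - 0\<bar>)"
          using C(1) by (intro mult_mono C norm_ec_diff_le) auto
        also have "\<dots> \<le> C * (2 * pi * (norm (\<eta> - \<xi>) * norm x))"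
          using C(1) Cauchy_Schwarz_ineq2 [of "\<eta> - \<xi>" x] by (intro mult_left_mono) auto
        also have "\<dots> \<le> C * (2 * pi * (\<delta> * S))"
          using C(1) x \<eta> pos by (intro mult_left_mono mult_mono) (auto simp: dist_norm norm_minus_commute)
        also have "\<dots> = \<kappa> / 4" using C S by (simp add: \<delta>_def)
        finally show "norm (?V \<eta> (x + s) - ?c * ?V \<xi> (x + s)) \<le> \<kappa> / 4" .
      qed (use S in auto)
      finally have "norm (bavg (?V \<eta>) S s - ?c * bavg (?V \<xi>) S s) \<le> \<kappa> / 4" .
      moreover have "norm (?c * bavg (?V \<xi>) S s) \<le> \<kappa> / 4" using S(2) by (simp add: norm_mult)
      ultimately show ?thesis
        using norm_triangle_sub [of "bavg (?V \<eta>) S s" "?c * bavg (?V \<xi>) S s"] by linarith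
    qed
    have Rp: "R > 0" using R pos by simp
    have "norm (bavg (bavg (?V \<eta>) S) R 0 - bavg (?V \<eta>) R 0) \<le> C * shell_const TYPE('a) * S / R"
      using C by (intro bavg_bavg S Rp) (auto simp: norm_mult)
    also have "\<dots> \<le> C * shell_const TYPE('a) * S / R\<^sub>1"
      using R pos Rp C(1) S(1) sc by (intro divide_left_mono) auto
    also have "\<dots> = \<kappa> / 2" using C S sc \<kappa> by (simp add: R\<^sub>1_def)
    finally have "norm (bavg (bavg (?V \<eta>) S) R 0 - bavg (?V \<eta>) R 0) \<le> \<kappa> / 2" .
    moreover have "norm (bavg (bavg (?V \<eta>) S) R 0) \<le> \<kappa> / 2"
      by (rule norm_bavg_le [of R "bavg (?V \<eta>) S" 0 "\<kappa> / 2", OF half Rp]) simp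
    ultimately show ?thesis
      using norm_triangle_sub [of "bavg (?V \<eta>) R 0" "bavg (bavg (?V \<eta>) S) R 0"]
      by (simp add: norm_minus_commute)
  qed
  with pos show ?thesis by blast
qed

lemma bavg_modulate_far:
  fixes v :: "'a::euclidean_space \<Rightarrow> complex"
  assumes v: "apu v" and \<kappa>: "\<kappa> > 0"
  shows "\<exists>\<Lambda>>0. \<forall>\<xi>. norm \<xi> \<ge> \<Lambda> \<longrightarrow> (\<forall>R\<ge>1. norm (bavg (\<lambda>t. v t * ec (- (\<xi> \<bullet> t))) R 0) \<le> \<kappa>)"
proof -
  note [measurable] = apu_measurable [OF v]
  obtain C where C: "C > 0" "\<And>x. norm (v x) \<le> C" using apu_bounded [OF v] by metis
  have sc: "C * shell_const TYPE('a) > 0" using shell_const_ge [where 'a='a] C by simp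
  obtain d where d: "d > 0" "\<And>x y. norm (x - y) < d \<Longrightarrow> norm (v x - v y) < \<kappa>"
    using uniformly_continuousD [OF apu_uniformly_continuous [OF v] \<kappa>] by metis
  \<comment> \<open>The first bound serves uniform continuity of \<open>v\<close>, the second the
    boundary error of \<open>bavg_shift\<close>.\<close>
  define h\<^sub>0 where "h\<^sub>0 = min (d / 2) (\<kappa> / (C * shell_const TYPE('a)))"
  have h0: "h\<^sub>0 > 0" using d \<kappa> sc by (simp add: h\<^sub>0_def)
  have "norm (bavg (\<lambda>t. v t * ec (- (\<xi> \<bullet> t))) R 0) \<le> \<kappa>" if \<xi>: "norm \<xi> \<ge> 1 / (2 * h\<^sub>0)" and R: "R \<ge> 1" for \<xi> R
  proof -
    let ?G = "\<lambda>t. v t * ec (- (\<xi> \<bullet> t))"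
    have n\<xi>: "norm \<xi> > 0" using \<xi> h0 by (meson divide_pos_pos less_le_trans mult_pos_pos zero_less_numeral zero_less_one)
    \<comment> \<open>Half a period of the character: shifting by \<open>h\<close> changes its sign
      but hardly changes \<open>v\<close>. The averages at 0 and \<open>h\<close> are thus nearly
      opposite and also nearly equal, hence small.\<close>
    define h where "h = (1 / (2 * (norm \<xi>)\<^sup>2)) *\<^sub>R \<xi>"
    have \<xi>h: "\<xi> \<bullet> h = 1 / 2" using n\<xi> by (simp add: h_def power2_norm_eq_inner)
    have "norm h = 1 / (2 * norm \<xi>)" using n\<xi> by (simp add: h_def power2_eq_square)
    also have "\<dots> \<le> h\<^sub>0" using \<xi> n\<xi> h0 by (simp add: field_simps)
    finally have nh: "norm h \<le> h\<^sub>0" .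
    have "ec (- (\<xi> \<bullet> (x + h))) = - ec (- (\<xi> \<bullet> x))" for x
    proof -
      have "ec (- (\<xi> \<bullet> (x + h))) = ec (- (\<xi> \<bullet> x)) * ec (- (\<xi> \<bullet> h))"
        by (simp add: ec_add [symmetric] inner_add_right)
      also have "ec (- (\<xi> \<bullet> h)) = cnj (ec (1 / 2))" by (simp only: \<xi>h ec_minus)
      also have "\<dots> = - 1" by (simp add: ec_def)
      finally show ?thesis by simp
    qed
    then have "bavg ?G R h = bavg (\<lambda>t. - (v (t + h) * ec (- (\<xi> \<bullet> t)))) R 0"
      by (simp add: bavg_def)
    then have "bavg ?G R 0 + bavg ?G R h = bavg (\<lambda>t. v t * ec (- (\<xi> \<bullet> t)) + - (v (t + h) * ec (- (\<xi> \<bullet> t)))) R 0"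
      using C by (subst bavg_diff(2) [of _ C _ C]) (auto simp: norm_mult)
    also have "norm \<dots> \<le> \<kappa>"
    proof (rule norm_bavg_le)
      fix x
      have "norm (v x - v (x + h)) < \<kappa>" using nh d(1) by (intro d) (simp add: h\<^sub>0_def)
      moreover have "v x * ec (- (\<xi> \<bullet> x)) + - (v (x + h) * ec (- (\<xi> \<bullet> x))) = (v x - v (x + h)) * ec (- (\<xi> \<bullet> x))"
        by (simp add: algebra_simps)
      ultimately show "norm (v (x + 0) * ec (- (\<xi> \<bullet> (x + 0))) + - (v (x + 0 + h) * ec (- (\<xi> \<bullet> (x + 0))))) \<le> \<kappa>"
        by (simp add: norm_mult)
    qed (use R in auto)
    finally have 1: "norm (bavg ?G R 0 + bavg ?G R h) \<le> \<kappa>" .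
    have "norm (bavg ?G R h - bavg ?G R 0) \<le> C * shell_const TYPE('a) * norm h / R"
      using C R by (intro bavg_shift) (auto simp: norm_mult)
    also have "\<dots> \<le> C * shell_const TYPE('a) * norm h / 1"
      using R sc by (intro divide_left_mono) auto
    also have "\<dots> \<le> C * shell_const TYPE('a) * (\<kappa> / (C * shell_const TYPE('a)))"
      using nh sc unfolding div_by_1 by (intro mult_left_mono) (auto simp: h\<^sub>0_def)
    also have "\<dots> = \<kappa>" using C(1) shell_const_ge [where 'a='a] by simp
    finally have 2: "norm (bavg ?G R h - bavg ?G R 0) \<le> \<kappa>" .
    have "2 * bavg ?G R 0 = (bavg ?G R 0 + bavg ?G R h) - (bavg ?G R h - bavg ?G R 0)" by simp
    then have "norm (2 * bavg ?G R 0) \<le> \<kappa> + \<kappa>"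
      using norm_triangle_ineq4 [of "bavg ?G R 0 + bavg ?G R h" "bavg ?G R h - bavg ?G R 0"] 1 2 by simp
    then show ?thesis by (simp add: norm_mult)
  qed
  moreover have "1 / (2 * h\<^sub>0) > 0" using h0 by simp
  ultimately show ?thesis by blast
qed

text \<open>The frequencies that are not large form a compact ball, which finitely many of the local
  neighbourhoods cover.\<close>

lemma bavg_modulate_uniform:
  fixes v :: "'a::euclidean_space \<Rightarrow> complex"
  assumes v: "apu v" and zero: "\<And>\<xi>. mean_coeff \<xi> v = 0" and \<kappa>: "\<kappa> > 0"
  shows "\<exists>R\<^sub>1>0. \<forall>R\<ge>R\<^sub>1. \<forall>\<xi>. norm (bavg (\<lambda>t. v t * ec (- (\<xi> \<bullet> t))) R 0) \<le> \<kappa>"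
proof -
  let ?P = "\<lambda>\<xi> R. norm (bavg (\<lambda>t. v t * ec (- (\<xi> \<bullet> t))) R 0) \<le> \<kappa>"
  obtain \<Lambda> where \<Lambda>: "\<Lambda> > 0" "\<And>\<xi> R. norm \<xi> \<ge> \<Lambda> \<Longrightarrow> R \<ge> 1 \<Longrightarrow> ?P \<xi> R"
    using bavg_modulate_far [OF v \<kappa>] by blast
  have "\<exists>\<delta> R\<^sub>1. \<delta> > 0 \<and> R\<^sub>1 > 0 \<and> (\<forall>\<eta>\<in>ball \<xi> \<delta>. \<forall>R\<ge>R\<^sub>1. ?P \<eta> R)" for \<xi>
    using bavg_modulate_local [OF v zero [of \<xi>] \<kappa>] by blast
  then obtain \<delta> S where \<delta>: "\<And>\<xi>. \<delta> \<xi> > 0" "\<And>\<xi>. S \<xi> > 0" "\<And>\<xi> \<eta> R. \<eta> \<in> ball \<xi> (\<delta> \<xi>) \<Longrightarrow> R \<ge> S \<xi> \<Longrightarrow> ?P \<eta> R"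
    by metis
  have "cball 0 \<Lambda> \<subseteq> (\<Union>\<xi>\<in>cball 0 \<Lambda>. ball \<xi> (\<delta> \<xi>))" using \<delta>(1) by fastforce
  then obtain K where K: "K \<subseteq> cball 0 \<Lambda>" "finite K" "cball 0 \<Lambda> \<subseteq> (\<Union>\<xi>\<in>K. ball \<xi> (\<delta> \<xi>))"
    by (rule compactE_image [OF compact_cball open_ball])
  \<comment> \<open>The sum dominates each of the finitely many radii, and the added 1 meets the
    condition \<open>R \<ge> 1\<close> of the estimate for large frequencies.\<close>
  define R\<^sub>1 where "R\<^sub>1 = 1 + (\<Sum>\<xi>\<in>K. S \<xi>)"
  have "(\<Sum>\<xi>\<in>K. S \<xi>) \<ge> 0" by (intro sum_nonneg less_imp_le \<delta>(2))
  then have R1: "R\<^sub>1 \<ge> 1" by (simp add: R\<^sub>1_def)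
  have "?P \<eta> R" if R: "R \<ge> R\<^sub>1" for \<eta> R
  proof (cases "norm \<eta> \<ge> \<Lambda>")
    case True with \<Lambda>(2) R R1 show ?thesis by simp
  next
    case False
    then have "\<eta> \<in> cball 0 \<Lambda>" unfolding mem_cball_0 by simp
    then obtain \<xi> where \<xi>: "\<xi> \<in> K" "\<eta> \<in> ball \<xi> (\<delta> \<xi>)" using K by blast
    have "S \<xi> \<le> (\<Sum>\<xi>\<in>K. S \<xi>)" using K \<xi> \<delta>(2) by (intro member_le_sum) (auto intro: less_imp_le)
    then show ?thesis using \<delta>(3) [OF \<xi>(2)] R by (simp add: R\<^sub>1_def)
  qed
  with R1 show ?thesis by (intro exI [of _ R\<^sub>1]) auto
qed

section \<open>Parseval's identity with a Gaussian weight\<close>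

lemma cnj_measurable [measurable]: "cnj \<in> borel_measurable borel"
  by (intro borel_measurable_continuous_onI continuous_intros)

lemma cnj_fourier: "cnj (fourier b l) = (LINT y|lborel. cnj (b y) * ec (y \<bullet> l))"
proof -
  have "(LINT y|lborel. cnj (b y) * ec (y \<bullet> l)) = (LINT y|lborel. cnj (b y * ec (- (y \<bullet> l))))"
    by (simp add: ec_minus)
  then show ?thesis by (simp only: Bochner_Integration.integral_cnj fourier_ec)
qed

text \<open>The product on the left is the transform of the cross-correlation of \<open>a\<close>
  and \<open>b\<close>. The Gaussian weight justifies every use of Fubini and reappears on the right
  as \<open>gauss e\<close> averaging that correlation, so no square-integrable theory is
  involved.\<close>

lemma gauss_parseval:
  fixes a b :: "'a::euclidean_space \<Rightarrow> complex"
  assumes e: "e > 0" and a: "integrable lborel a" and b: "integrable lborel b" and M: "\<And>x. norm (b x) \<le> M"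
  shows "(LINT l|lborel. fourier a l * cnj (fourier b l) * of_real (exp (- pi * e * (l \<bullet> l)))) =
    (LINT z|lborel. (LINT x|lborel. a x * cnj (b (x - z))) * of_real (gauss e z))"
proof -
  have [measurable]: "a \<in> borel_measurable borel" "b \<in> borel_measurable borel" using a b by auto
  let ?G = "\<lambda>l::'a. complex_of_real (exp (- pi * e * (l \<bullet> l)))"
  have iG: "integrable lborel (\<lambda>l::'a. exp (- pi * e * (l \<bullet> l)))" by (rule exp_inner_integrable [OF e])
  have fm [measurable]: "fourier b \<in> borel_measurable borel" 
  proof -
    have "(\<lambda>y. LINT x|lborel. b x * ec (- (x \<bullet> y))) \<in> borel_measurable lborel" by measurable
    then show ?thesis by (simp add: fourier_ec [abs_def])
  qed
  define B where "B = (LINT x|lborel. norm (b x))"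
  have B: "norm (fourier b l) \<le> B" for l unfolding B_def by (rule norm_fourier_le)
  have M0: "M \<ge> 0" using M [of 0] norm_ge_zero order_trans by blast
  have inner: "(LINT l|lborel. ec (- (x \<bullet> l)) * cnj (fourier b l) * ?G l) = (LINT z|lborel. cnj (b (x - z)) * of_real (gauss e z))" for x
  proof -
    have "(LINT l|lborel. ec (- (x \<bullet> l)) * cnj (fourier b l) * ?G l) =
        (LINT l|lborel. LINT y|lborel. ec (- (x \<bullet> l)) * (cnj (b y) * ec (y \<bullet> l)) * ?G l)"
      by (simp add: cnj_fourier)
    also have "\<dots> = (LINT y|lborel. LINT l|lborel. ec (- (x \<bullet> l)) * (cnj (b y) * ec (y \<bullet> l)) * ?G l)"
      by (rule fubini_swap [where u = "\<lambda>l. exp (- pi * e * (l \<bullet> l))" and v = "\<lambda>y. norm (b y)"])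
         (use iG b in \<open>auto simp: norm_mult\<close>)
    also have "\<dots> = (LINT y|lborel. cnj (b y) * of_real (gauss e (x - y)))"
    proof (rule Bochner_Integration.integral_cong [OF refl])
      fix y
      have "ec (- (x \<bullet> l)) * (cnj (b y) * ec (y \<bullet> l)) * ?G l = cnj (b y) * (?G l * ec (- (l \<bullet> (x - y))))" for l
      proof -
        have "ec (- (l \<bullet> (x - y))) = ec (- (x \<bullet> l)) * ec (y \<bullet> l)"
          by (simp add: ec_add [symmetric] inner_diff_right inner_commute)
        then show ?thesis by (simp add: mult_ac)
      qed
      then show "(LINT l|lborel. ec (- (x \<bullet> l)) * (cnj (b y) * ec (y \<bullet> l)) * ?G l) = cnj (b y) * of_real (gauss e (x - y))"
        by (simp only: integral_mult_right_zero gauss_fourier [OF e])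
    qed
    also have "\<dots> = (LINT z|lborel. cnj (b (x - z)) * of_real (gauss e z))"
      using lborel_integral_reflect [of "\<lambda>y. cnj (b y) * of_real (gauss e (x - y))" x] by simp
    finally show ?thesis .
  qed
  have "(LINT l|lborel. fourier a l * cnj (fourier b l) * ?G l) =
      (LINT l|lborel. LINT x|lborel. a x * ec (- (x \<bullet> l)) * cnj (fourier b l) * ?G l)"
    unfolding fourier_ec [of a] by (simp only: integral_mult_left_zero)
  also have "\<dots> = (LINT x|lborel. LINT l|lborel. a x * ec (- (x \<bullet> l)) * cnj (fourier b l) * ?G l)"
  proof (rule fubini_swap [where u = "\<lambda>l. B * exp (- pi * e * (l \<bullet> l))" and v = "\<lambda>x. norm (a x)"])
    show "norm (a x * ec (- (x \<bullet> l)) * cnj (fourier b l) * ?G l) \<le> B * exp (- pi * e * (l \<bullet> l)) * norm (a x)" for x l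
      using mult_right_mono [OF B [of l], of "norm (a x) * exp (- pi * e * (l \<bullet> l))"] by (simp add: norm_mult mult_ac)
  qed (use iG a in auto)
  also have "\<dots> = (LINT x|lborel. a x * (LINT l|lborel. ec (- (x \<bullet> l)) * cnj (fourier b l) * ?G l))"
    by (simp only: mult.assoc integral_mult_right_zero)
  also have "\<dots> = (LINT x|lborel. LINT z|lborel. a x * cnj (b (x - z)) * of_real (gauss e z))"
    unfolding inner by (simp add: mult.assoc)
  also have "\<dots> = (LINT z|lborel. LINT x|lborel. a x * cnj (b (x - z)) * of_real (gauss e z))"
  proof (rule fubini_swap [where u = "\<lambda>x. norm (a x)" and v = "\<lambda>z. M * gauss e z"])
    show "norm (a x * cnj (b (x - z)) * of_real (gauss e z)) \<le> norm (a x) * (M * gauss e z)" for x z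
      using mult_right_mono [OF M [of "x - z"], of "norm (a x) * gauss e z"] e by (simp add: norm_mult mult_ac)
  qed (use a e gauss_integrable [OF e, where 'a='a] in auto)
  finally show ?thesis by simp
qed

text \<open>By the inequality of arithmetic and geometric means the autocorrelation of
  \<open>a\<close> is everywhere bounded by its value at 0, and \<open>gauss e\<close> has mass
  1.\<close>

lemma gauss_parseval_le:
  fixes a :: "'a::euclidean_space \<Rightarrow> complex"
  assumes e: "e > 0" and a: "integrable lborel a" and M: "\<And>x. norm (a x) \<le> M"
  shows "(LINT l|lborel. (norm (fourier a l))\<^sup>2 * exp (- pi * e * (l \<bullet> l))) \<le> (LINT x|lborel. (norm (a x))\<^sup>2)"
proof -
  have [measurable]: "a \<in> borel_measurable borel" using a by auto
  let ?Q = "LINT x|lborel. (norm (a x))\<^sup>2"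
  have M0: "M \<ge> 0" using M [of 0] norm_ge_zero order_trans by blast
  have iq: "integrable lborel (\<lambda>x. (norm (a x))\<^sup>2)"
    by (rule Bochner_Integration.integrable_bound [OF integrable_mult_right [OF integrable_norm [OF a], of M]])
       (auto simp: power2_eq_square M M0 abs_mult intro!: AE_I2 mult_right_mono)
  have iqz: "integrable lborel (\<lambda>x. (norm (a (x - z)))\<^sup>2)" "(LINT x|lborel. (norm (a (x - z)))\<^sup>2) = ?Q" for z
    using lborel_integrable_translate [of "\<lambda>x. (norm (a x))\<^sup>2" "- z"] iq
      lborel_integral_translate [of "\<lambda>x. (norm (a x))\<^sup>2" "- z"] by simp_all
  have Qz: "norm (LINT x|lborel. a x * cnj (a (x - z))) \<le> ?Q" for z
  proof -
    have "norm (LINT x|lborel. a x * cnj (a (x - z))) \<le> (LINT x|lborel. ((norm (a x))\<^sup>2 + (norm (a (x - z)))\<^sup>2) / 2)"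
    proof (rule Bochner_Integration.integral_norm_bound_integral)
      have [measurable]: "(\<lambda>x. a x * cnj (a (x - z))) \<in> borel_measurable borel" by measurable
      show "integrable lborel (\<lambda>x. a x * cnj (a (x - z)))"
        by (rule Bochner_Integration.integrable_bound [OF integrable_mult_right [OF integrable_norm [OF a], of M]])
           (auto simp: norm_mult M M0 mult.commute [of M] intro!: mult_left_mono)
      show "norm (a x * cnj (a (x - z))) \<le> ((norm (a x))\<^sup>2 + (norm (a (x - z)))\<^sup>2) / 2" for x
        using sum_squares_bound [of "norm (a x)" "norm (a (x - z))"] by (simp add: norm_mult)
    qed (use iq iqz in auto)
    also have "\<dots> = ?Q" using iq iqz by simp
    finally show ?thesis .
  qed
  have "complex_of_real (LINT l|lborel. (norm (fourier a l))\<^sup>2 * exp (- pi * e * (l \<bullet> l))) =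
      (LINT l|lborel. fourier a l * cnj (fourier a l) * of_real (exp (- pi * e * (l \<bullet> l))))"
    by (simp add: complex_norm_square [symmetric] flip: integral_complex_of_real)
  also have "\<dots> = (LINT z|lborel. (LINT x|lborel. a x * cnj (a (x - z))) * of_real (gauss e z))"
    by (rule gauss_parseval [OF e a a M])
  also have "norm \<dots> \<le> (LINT z|lborel. ?Q * gauss e (z::'a))"
  proof (rule Bochner_Integration.integral_norm_bound_integral)
    have "(\<lambda>z. LINT x|lborel. a x * cnj (a (x - z))) \<in> borel_measurable lborel" by measurable
    then have [measurable]: "(\<lambda>z. LINT x|lborel. a x * cnj (a (x - z))) \<in> borel_measurable borel" by simp
    show ig: "integrable lborel (\<lambda>z::'a. ?Q * gauss e z)" by (intro integrable_mult_right gauss_integrable e)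
    show le: "norm ((LINT x|lborel. a x * cnj (a (x - z))) * of_real (gauss e z)) \<le> ?Q * gauss e z" for z
      using mult_right_mono [OF Qz [of z] gauss_nonneg [OF e]] e by (simp add: norm_mult)
    show "integrable lborel (\<lambda>z. (LINT x|lborel. a x * cnj (a (x - z))) * complex_of_real (gauss e z))"
      by (rule Bochner_Integration.integrable_bound [OF ig], measurable, rule AE_I2, unfold real_norm_def,
          rule order_trans [OF le abs_ge_self])
  qed
  also have "\<dots> = ?Q" by (simp add: gauss_integral [OF e])
  finally show ?thesis by simp
qed

text \<open>Pigeonhole on a finite net of translates: almost periods have positive density.\<close>

lemma almost_period_density:
  fixes v :: "'a::euclidean_space \<Rightarrow> complex"
  assumes v: "apu v" and \<eta>: "\<eta> > 0"
  shows "\<exists>c>0. \<exists>T>0. \<forall>R>0. \<exists>N. N \<in> sets borel \<and> N \<subseteq> ball 0 (R + T) \<and> measure lborel N \<ge> c * bvol TYPE('a) R \<and>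
    (\<forall>\<tau>\<in>N. \<forall>x. norm (v (x + \<tau>) - v x) \<le> \<eta>)"
proof -
  obtain F where F: "finite F" "\<And>s. \<exists>r\<in>F. \<forall>x. norm (v (x + s) - v (x + r)) \<le> \<eta>"
    using apuE [OF v \<eta>] by metis
  have Fne: "F \<noteq> {}" using F(2) by blast
  then have card: "card F > 0" using F(1) by (simp add: card_gt_0_iff)
  define T where "T = 1 + (\<Sum>r\<in>F. norm r)"
  have T: "T > 0" "\<And>r. r \<in> F \<Longrightarrow> norm r \<le> T"
    using F(1) member_le_sum [of _ F norm] by (auto simp: T_def intro!: add_pos_nonneg sum_nonneg add_increasing)
  \<comment> \<open>The shifts assigned to the net point \<open>r\<close>. As an intersection of
    closed conditions over all \<open>x\<close> this set is closed, hence Borel.\<close>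
  define S where "S r = (\<Inter>x. {s. norm (v (x + s) - v (x + r)) \<le> \<eta>})" for r
  have cont: "continuous_on UNIV (\<lambda>s. v (x + s))" for x
    by (rule continuous_on_compose2 [OF apu_continuous [OF v]]) (auto intro!: continuous_intros)
  have S: "S r \<in> sets borel" for r
    unfolding S_def by (intro borel_closed closed_INT ballI closed_Collect_le continuous_intros cont)
  have "\<exists>N. N \<in> sets borel \<and> N \<subseteq> ball 0 (R + T) \<and> measure lborel N \<ge> 1 / real (card F) * bvol TYPE('a) R \<and>
    (\<forall>\<tau>\<in>N. \<forall>x. norm (v (x + \<tau>) - v x) \<le> \<eta>)" if R: "R > 0" for R
  proof -
    have fin: "emeasure lborel (S r \<inter> ball 0 R) < \<infinity>" for r
      using emeasure_mono [of "S r \<inter> ball 0 R" "ball 0 R" lborel] emeasure_lborel_ball_finite [of "0::'a" R]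
      by (simp add: order_le_less_trans)
    have "\<exists>r\<in>F. measure lborel (S r \<inter> ball 0 R) \<ge> bvol TYPE('a) R / real (card F)"
    proof (rule ccontr)
      assume "\<not> ?thesis"
      then have lt: "measure lborel (S r \<inter> ball 0 R) < bvol TYPE('a) R / real (card F)" if "r \<in> F" for r
        using that by (simp add: not_le)
      have "ball 0 R = (\<Union>r\<in>F. S r \<inter> ball 0 R)" using F(2) by (fastforce simp: S_def)
      then have "bvol TYPE('a) R = measure lborel (\<Union>r\<in>F. S r \<inter> ball 0 R)"
        using measure_ball [of R "0::'a"] R by simp
      also have "\<dots> \<le> (\<Sum>r\<in>F. measure lborel (S r \<inter> ball 0 R))"
        using fin S F(1) by (intro measure_subadditive_finite) (auto simp: less_top[symmetric])
      also have "\<dots> < (\<Sum>r\<in>F. bvol TYPE('a) R / real (card F))"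
        using lt F(1) Fne by (intro sum_strict_mono) auto
      also have "\<dots> = bvol TYPE('a) R" using card by simp
      finally show False by simp
    qed
    then obtain r where r: "r \<in> F" "measure lborel (S r \<inter> ball 0 R) \<ge> bvol TYPE('a) R / real (card F)" by blast
    \<comment> \<open>If \<open>r + \<tau>\<close> belongs to the class of \<open>r\<close>, then
      \<open>\<tau>\<close> is an almost period, as the substitution of \<open>x - r\<close> for
      \<open>x\<close> shows. Translation preserves the measure of the class.\<close>
    define N where "N = (\<lambda>\<tau>. r + \<tau>) -` (S r \<inter> ball 0 R)"
    have N: "N \<in> sets borel"
      unfolding N_def using S by (intro measurable_sets_borel [of "\<lambda>\<tau>. r + \<tau>" borel]) auto
    have "measure lborel (S r \<inter> ball 0 R) = (LINT x|lborel. indicator (S r \<inter> ball 0 R) x)" by simp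
    also have "\<dots> = (LINT x|lborel. indicator (S r \<inter> ball 0 R) (r + x))"
      using S by (intro lborel_integral_translate [symmetric]) simp
    also have "\<dots> = (LINT x|lborel. indicator N x)"
      by (intro Bochner_Integration.integral_cong) (auto simp: N_def indicator_def)
    finally have "measure lborel N = measure lborel (S r \<inter> ball 0 R)" by simp
    moreover have "N \<subseteq> ball 0 (R + T)"
    proof
      fix \<tau> assume "\<tau> \<in> N"
      then have "norm (r + \<tau>) < R" by (simp add: N_def)
      then show "\<tau> \<in> ball 0 (R + T)"
        using T(2) [OF r(1)] norm_triangle_ineq4 [of "r + \<tau>" r] unfolding mem_ball_0 by simp
    qed
    moreover have "norm (v (x + \<tau>) - v x) \<le> \<eta>" if "\<tau> \<in> N" for \<tau> x
    proof -
      have "norm (v ((x - r) + (r + \<tau>)) - v ((x - r) + r)) \<le> \<eta>"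
        using that unfolding N_def S_def by blast
      then show ?thesis by (simp add: algebra_simps)
    qed
    ultimately show ?thesis using N r(2) by (intro exI [of _ N]) auto
  qed
  then show ?thesis using T(1) card by (intro exI [of _ "1 / real (card F)"]) auto
qed

lemma bvol_scale: "bvol TYPE('a::euclidean_space) (c * R) = c ^ DIM('a) * bvol TYPE('a) R"
  by (simp add: bvol_def power_mult_distrib)

text \<open>For an almost period \<open>\<tau>\<close> at precision half of
  \<open>norm (v x\<^sub>0)\<close>, the value at \<open>x\<^sub>0 + \<tau>\<close> still has at
  least half the modulus, and such \<open>\<tau>\<close> fill a positive proportion of the
  ball.\<close>

lemma integral_square_lower:
  fixes v :: "'a::euclidean_space \<Rightarrow> complex"
  assumes v: "apu v" and "v x\<^sub>0 \<noteq> 0"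
  shows "\<exists>c>0. \<exists>R\<^sub>0>0. \<forall>R\<ge>R\<^sub>0. c * bvol TYPE('a) R \<le> (LINT x|lborel. indicator (ball 0 R) x * (norm (v x))\<^sup>2)"
proof -
  note [measurable] = apu_measurable [OF v]
  obtain C where C: "C > 0" "\<And>x. norm (v x) \<le> C" using apu_bounded [OF v] by metis
  define c\<^sub>0 where "c\<^sub>0 = norm (v x\<^sub>0) / 2"
  have c0: "c\<^sub>0 > 0" using assms by (simp add: c\<^sub>0_def)
  obtain c T where cT: "c > 0" "T > 0" "\<And>R. R > 0 \<Longrightarrow> \<exists>N. N \<in> sets borel \<and> N \<subseteq> ball 0 (R + T) \<and>
      measure lborel N \<ge> c * bvol TYPE('a) R \<and> (\<forall>\<tau>\<in>N. \<forall>x. norm (v (x + \<tau>) - v x) \<le> c\<^sub>0)"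
    using almost_period_density [OF v c0] by blast
  \<comment> \<open>Chosen so that the almost periods in the ball of radius
    \<open>R / 2 + T\<close>, shifted by \<open>x\<^sub>0\<close>, stay within radius
    \<open>R\<close>.\<close>
  define R\<^sub>0 where "R\<^sub>0 = 2 * (T + norm x\<^sub>0)"
  have "c\<^sub>0\<^sup>2 * c * (1 / 2) ^ DIM('a) * bvol TYPE('a) R \<le> (LINT x|lborel. indicator (ball 0 R) x * (norm (v x))\<^sup>2)"
    if R: "R \<ge> R\<^sub>0" for R
  proof -
    have Rp: "R > 0" using R cT(2) by (simp add: R\<^sub>0_def) (metis add.commute add_pos_nonneg less_le_trans mult_pos_pos norm_ge_zero zero_less_numeral distrib_left)
    then obtain N where N: "N \<in> sets borel" "N \<subseteq> ball 0 (R / 2 + T)" "measure lborel N \<ge> c * bvol TYPE('a) (R / 2)"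
      "\<And>\<tau> x. \<tau> \<in> N \<Longrightarrow> norm (v (x + \<tau>) - v x) \<le> c\<^sub>0"
      using cT(3) [of "R / 2"] by auto
    note [measurable] = N(1)
    have fin: "emeasure lborel N < \<infinity>"
      using emeasure_mono [OF N(2), of lborel] emeasure_lborel_ball_finite [of "0::'a" "R / 2 + T"]
      by (simp add: order_le_less_trans)
    have "c\<^sub>0\<^sup>2 * c * (1 / 2) ^ DIM('a) * bvol TYPE('a) R = c\<^sub>0\<^sup>2 * (c * bvol TYPE('a) (1 / 2 * R))"
      by (subst bvol_scale) (simp only: mult_ac)
    also have "\<dots> \<le> c\<^sub>0\<^sup>2 * measure lborel N"
      using N(3) by (intro mult_left_mono) auto
    also have "\<dots> = (LINT x|lborel. c\<^sub>0\<^sup>2 * indicator N x)" by simp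
    also have "\<dots> = (LINT x|lborel. c\<^sub>0\<^sup>2 * indicator N (- x\<^sub>0 + x))"
      by (rule lborel_integral_translate [symmetric]) simp
    also have "\<dots> \<le> (LINT x|lborel. indicator (ball 0 R) x * (norm (v x))\<^sup>2)"
    proof (rule integral_mono)
      have "integrable lborel (indicator N :: 'a \<Rightarrow> real)" using fin by (intro integrable_real_indicator) auto
      then show "integrable lborel (\<lambda>x. c\<^sub>0\<^sup>2 * indicator N (- x\<^sub>0 + x))"
        using lborel_integrable_translate [of "indicator N :: 'a \<Rightarrow> real" "- x\<^sub>0"] by (intro integrable_mult_right) simp
      have "(norm (v x))\<^sup>2 \<le> C\<^sup>2" for x using C by (intro power_mono) auto
      then show "integrable lborel (\<lambda>x. indicator (ball 0 R) x * (norm (v x))\<^sup>2)"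
        by (intro Bochner_Integration.integrable_bound [OF integrable_mult_right [OF integrable_ball, of "C\<^sup>2" 0 R]])
           (auto split: split_indicator)
      fix x
      show "c\<^sub>0\<^sup>2 * indicator N (- x\<^sub>0 + x) \<le> indicator (ball 0 R) x * (norm (v x))\<^sup>2"
      proof (cases "- x\<^sub>0 + x \<in> N")
        case True
        then have "norm (- x\<^sub>0 + x) < R / 2 + T" using N(2) unfolding mem_ball_0 [symmetric] by blast
        then have "norm x < R"
          using norm_triangle_ineq [of "- x\<^sub>0 + x" x\<^sub>0] R by (simp add: R\<^sub>0_def)
        moreover have "norm (v (x\<^sub>0 + (- x\<^sub>0 + x)) - v x\<^sub>0) \<le> c\<^sub>0" by (rule N(4) [OF True])
        then have "c\<^sub>0 \<le> norm (v x)"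
          using norm_triangle_ineq3 [of "v x" "v x\<^sub>0"] by (simp add: c\<^sub>0_def)
        then have "c\<^sub>0\<^sup>2 \<le> (norm (v x))\<^sup>2" using c0 by (intro power_mono) auto
        ultimately show ?thesis using True by simp
      qed simp
    qed
    finally show ?thesis .
  qed
  moreover have "R\<^sub>0 > 0" using cT(2) by (simp add: R\<^sub>0_def add_pos_nonneg)
  moreover have "c\<^sub>0\<^sup>2 * c * (1 / 2) ^ DIM('a) > 0" using c0 cT by simp
  ultimately show ?thesis by blast
qed

text \<open>Let \<open>h\<close> be \<open>v\<close> cut off to a large ball and \<open>m\<close> the indicator of a set of almost periods.
  The integral \<open>I\<close> of \<open>\<bar>fourier h\<bar>\<^sup>2 * fourier m\<close> against a wide Gaussian is small since
  \<open>fourier h\<close> is uniformly small, but it is also the mean correlation of \<open>v\<close> with its almost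
  equal translates, hence comparable to the square of the volume.\<close>

lemma apu_eq_zero:
  fixes v :: "'a::euclidean_space \<Rightarrow> complex"
  assumes v: "apu v" and zero: "\<And>\<xi>. mean_coeff \<xi> v = 0"
  shows "v x\<^sub>0 = 0"
proof (rule ccontr)
  assume nz: "v x\<^sub>0 \<noteq> 0"
  note [measurable] = apu_measurable [OF v]
  obtain C where C: "C > 0" "\<And>x. norm (v x) \<le> C" using apu_bounded [OF v] by metis
  obtain c\<^sub>1 R\<^sub>1 where c1: "c\<^sub>1 > 0" "R\<^sub>1 > 0"
    "\<And>R. R \<ge> R\<^sub>1 \<Longrightarrow> c\<^sub>1 * bvol TYPE('a) R \<le> (LINT x|lborel. indicator (ball 0 R) x * (norm (v x))\<^sup>2)"
    using integral_square_lower [OF v nz] by blast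
  \<comment> \<open>The volume ratio for the cut-off radius \<open>5 * R\<close>. That ball contains
    \<open>x - z - \<tau>\<close> whenever \<open>norm x < R\<close>,
    \<open>norm z < \<delta> \<le> R\<close> and \<open>norm \<tau> < 2 * R\<close>.\<close>
  define D where "D = (5::real) ^ DIM('a)"
  have D: "D \<ge> 1" by (simp add: D_def)
  \<comment> \<open>Makes the loss \<open>2 * \<eta> * C * D * V\<close> in the correlation equal to
    half of the main term \<open>c\<^sub>1 * V\<close>.\<close>
  define \<eta> where "\<eta> = c\<^sub>1 / (4 * C * D)"
  have \<eta>: "\<eta> > 0" using c1 C D by (simp add: \<eta>_def)
  obtain c T where cT: "c > 0" "T > 0" "\<And>R. R > 0 \<Longrightarrow> \<exists>N. N \<in> sets borel \<and> N \<subseteq> ball 0 (R + T) \<and>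
      measure lborel N \<ge> c * bvol TYPE('a) R \<and> (\<forall>\<tau>\<in>N. \<forall>x. norm (v (x + \<tau>) - v x) \<le> \<eta>)"
    using almost_period_density [OF v \<eta>] by blast
  obtain \<delta> where \<delta>: "\<delta> > 0" "\<And>x y. norm (x - y) < \<delta> \<Longrightarrow> norm (v x - v y) < \<eta>"
    using uniformly_continuousD [OF apu_uniformly_continuous [OF v] \<eta>] by metis
  \<comment> \<open>Chosen so that the upper bound for \<open>norm I\<close>, after
    \<open>n \<le> D * V\<close>, is half of its lower bound.\<close>
  define \<kappa> where "\<kappa> = c * c\<^sub>1 / (8 * (C\<^sup>2 + 1) * D\<^sup>2)"
  have C21: "C\<^sup>2 + 1 > 0" by (simp add: add_nonneg_pos)
  have \<kappa>: "\<kappa> > 0" using cT c1 C21 D unfolding \<kappa>_def by (intro divide_pos_pos mult_pos_pos) auto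
  obtain R\<^sub>2 where R2: "R\<^sub>2 > 0" "\<And>R \<xi>. R \<ge> R\<^sub>2 \<Longrightarrow> norm (bavg (\<lambda>t. v t * ec (- (\<xi> \<bullet> t))) R 0) \<le> \<kappa>"
    using bavg_modulate_uniform [OF v zero \<kappa>] by blast
  define R where "R = R\<^sub>1 + R\<^sub>2 + T + \<delta>"
  have R: "R > 0" "R \<ge> R\<^sub>1" "R \<ge> R\<^sub>2" "R \<ge> T" "R \<ge> \<delta>" using c1 R2 cT \<delta> by (auto simp: R_def)
  define V where "V = bvol TYPE('a) R"
  have V: "V > 0" using R by (simp add: V_def bvol_pos)
  have V5: "bvol TYPE('a) (5 * R) = D * V" by (simp add: V_def D_def bvol_scale)
  obtain N where N: "N \<in> sets borel" "N \<subseteq> ball 0 (R + T)" "measure lborel N \<ge> c * V"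
      "\<And>\<tau> x. \<tau> \<in> N \<Longrightarrow> norm (v (x + \<tau>) - v x) \<le> \<eta>"
    using cT(3) [OF R(1)] unfolding V_def by blast
  note [measurable] = N(1)
  have Nball: "norm \<tau> < 2 * R" if "\<tau> \<in> N" for \<tau>
  proof -
    have "\<tau> \<in> ball 0 (R + T)" using that N(2) by blast
    then have "norm \<tau> < R + T" unfolding mem_ball_0 .
    with R(4) show ?thesis by linarith
  qed
  have finN: "emeasure lborel N < \<infinity>"
    using emeasure_mono [OF N(2), of lborel] emeasure_lborel_ball_finite [of "0::'a" "R + T"]
    by (simp add: order_le_less_trans)
  have iN: "integrable lborel (indicator N :: 'a \<Rightarrow> real)" using finN by (intro integrable_real_indicator) auto
  define n where "n = measure lborel N"
  have n: "n \<ge> c * V" "n > 0" using N(3) mult_pos_pos [OF cT(1) V] by (auto simp: n_def)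
  have n5: "n \<le> D * V"
  proof -
    have "N \<subseteq> ball 0 (5 * R)" using Nball R by (fastforce simp: mem_ball_0 simp del: mem_ball)
    then have "n \<le> measure lborel (ball (0::'a) (5 * R))"
      unfolding n_def by (intro measure_mono_fmeasurable) (use emeasure_lborel_ball_finite [of "0::'a" "5 * R"] in \<open>auto simp: fmeasurable_def\<close>)
    then show ?thesis using R measure_ball [of "5 * R" "0::'a"] V5 by simp
  qed
  let ?B = "ball (0::'a) (5 * R)"
  define h where "h x = indicator ?B x *\<^sub>R v x" for x
  have hm [measurable]: "h \<in> borel_measurable borel" unfolding h_def [abs_def] by measurable
  have hC: "norm (h x) \<le> C * indicator ?B x" for x using C by (auto simp: h_def indicator_def)
  have hC': "norm (h x) \<le> C" for x using C by (auto simp: h_def indicator_def)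
  have iB: "integrable lborel (\<lambda>x. C * indicator ?B x)" by (intro integrable_mult_right integrable_ball)
  have hi: "integrable lborel h"
    using set_integrable_ball [OF apu_measurable [OF v] C(2), of 0 "5 * R"] by (simp add: set_integrable_def h_def [abs_def])
  have IB: "(LINT x|lborel. indicator ?B x) = D * V" using R measure_ball [of "5 * R" "0::'a"] V5 by simp
  have small: "norm (fourier h l) \<le> \<kappa> * (D * V)" for l
  proof -
    have eq: "fourier h l = bavg (\<lambda>t. v t * ec (- (l \<bullet> t))) (5 * R) 0 * of_real (D * V)"
      using D V by (simp add: bavg_def V5 fourier_ec h_def set_lebesgue_integral_def inner_commute)
    then have "norm (fourier h l) = norm (bavg (\<lambda>t. v t * ec (- (l \<bullet> t))) (5 * R) 0) * (D * V)"
      using D V by (simp only: eq norm_mult norm_of_real) simp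
    also have "\<dots> \<le> \<kappa> * (D * V)"
      using D V R by (intro mult_right_mono R2) auto
    finally show ?thesis .
  qed
  define m where "m x = complex_of_real (indicator N x)" for x
  have mm [measurable]: "m \<in> borel_measurable borel" unfolding m_def [abs_def] by measurable
  have mi: "integrable lborel m" unfolding m_def [abs_def] using iN by simp
  \<comment> \<open>The first bound lets the Gaussian tail cost at most half of the near part
    \<open>c\<^sub>1 * V / 2\<close>. The second bounds the contribution of the far part by
    \<open>c\<^sub>1 * V / 8\<close>.\<close>
  obtain e where e: "e > 0" "gauss_tail TYPE('a) \<delta> e \<le> 1 / 2" "gauss_tail TYPE('a) \<delta> e \<le> c\<^sub>1 / (8 * C\<^sup>2 * D)"
  proof -
    have "min (1 / 2) (c\<^sub>1 / (8 * C\<^sup>2 * D)) > 0" using c1 C D by simp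
    from order_tendstoD(2) [OF gauss_tail_tendsto [OF \<delta>(1), where 'a='a] this]
    obtain k where "gauss_tail TYPE('a) \<delta> (1 / real (Suc k)) < min (1 / 2) (c\<^sub>1 / (8 * C\<^sup>2 * D))"
      unfolding eventually_sequentially by blast
    then show ?thesis by (intro that [of "1 / real (Suc k)"]) auto
  qed
  let ?G = "\<lambda>l::'a. exp (- pi * e * (l \<bullet> l))"
  define Q where "Q \<tau> z = (LINT x|lborel. h x * cnj (h (x - z - \<tau>)))" for \<tau> z
  define I where "I = (LINT l|lborel. fourier h l * cnj (fourier h l) * cnj (fourier m l) * of_real (?G l))"

  have fmeas [measurable]: "fourier h \<in> borel_measurable borel" "fourier m \<in> borel_measurable borel"
  proof -
    have "(\<lambda>y. LINT x|lborel. h x * ec (- (x \<bullet> y))) \<in> borel_measurable lborel"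
      "(\<lambda>y. LINT x|lborel. m x * ec (- (x \<bullet> y))) \<in> borel_measurable lborel" by measurable
    then show "fourier h \<in> borel_measurable borel" "fourier m \<in> borel_measurable borel"
      by (simp_all add: fourier_ec [abs_def])
  qed
  have iG: "integrable lborel ?G" by (rule exp_inner_integrable [OF e(1)])
  have i2: "integrable lborel (\<lambda>l. (norm (fourier a l))\<^sup>2 * ?G l)"
    if [measurable]: "fourier a \<in> borel_measurable borel" for a
  proof (rule Bochner_Integration.integrable_bound [OF integrable_mult_right [OF iG, of "(LINT x|lborel. norm (a x))\<^sup>2"]])
    have "(norm (fourier a l))\<^sup>2 \<le> (LINT x|lborel. norm (a x))\<^sup>2" for l
      by (intro power_mono norm_fourier_le) auto
    then show "AE l in lborel. norm ((norm (fourier a l))\<^sup>2 * ?G l) \<le> norm ((LINT x|lborel. norm (a x))\<^sup>2 * ?G l)"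
      by (auto simp: norm_mult intro!: AE_I2 mult_right_mono)
  qed simp

  \<comment> \<open>One factor \<open>fourier h\<close> is replaced by its uniform bound. The
    product of the other one with \<open>fourier m\<close> is split into squares, to which
    \<open>gauss_parseval_le\<close> applies.\<close>
  have upper: "norm I \<le> \<kappa> * (D * V) * ((C\<^sup>2 * (D * V) + n) / 2)"
  proof -
    have "norm I \<le> (LINT l|lborel. \<kappa> * (D * V) * (((norm (fourier h l))\<^sup>2 * ?G l + (norm (fourier m l))\<^sup>2 * ?G l) / 2))"
      unfolding I_def
    proof (rule Bochner_Integration.integral_norm_bound_integral)
      show ir: "integrable lborel (\<lambda>l. \<kappa> * (D * V) * (((norm (fourier h l))\<^sup>2 * ?G l + (norm (fourier m l))\<^sup>2 * ?G l) / 2))"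
        using i2 [of h] i2 [of m] by (intro integrable_mult_right integrable_divide Bochner_Integration.integrable_add) auto
      show le: "norm (fourier h l * cnj (fourier h l) * cnj (fourier m l) * of_real (?G l)) \<le>
          \<kappa> * (D * V) * (((norm (fourier h l))\<^sup>2 * ?G l + (norm (fourier m l))\<^sup>2 * ?G l) / 2)" for l
      proof -
        have "norm (fourier h l) * norm (fourier m l) \<le> ((norm (fourier h l))\<^sup>2 + (norm (fourier m l))\<^sup>2) / 2"
          using sum_squares_bound [of "norm (fourier h l)" "norm (fourier m l)"] by simp
        then have "norm (fourier h l) * (norm (fourier h l) * norm (fourier m l)) \<le>
            \<kappa> * (D * V) * (((norm (fourier h l))\<^sup>2 + (norm (fourier m l))\<^sup>2) / 2)"
          using \<kappa> D V by (intro mult_mono small) auto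
        then have "norm (fourier h l) * (norm (fourier h l) * norm (fourier m l)) * ?G l \<le>
            \<kappa> * (D * V) * (((norm (fourier h l))\<^sup>2 + (norm (fourier m l))\<^sup>2) / 2) * ?G l"
          by (intro mult_right_mono) auto
        then show ?thesis by (simp add: norm_mult algebra_simps add_divide_distrib)
      qed
      show "integrable lborel (\<lambda>l. fourier h l * cnj (fourier h l) * cnj (fourier m l) * complex_of_real (?G l))"
        by (rule Bochner_Integration.integrable_bound [OF ir], measurable, rule AE_I2, unfold real_norm_def,
            rule order_trans [OF le abs_ge_self])
    qed
    also have "\<dots> = \<kappa> * (D * V) * (((LINT l|lborel. (norm (fourier h l))\<^sup>2 * ?G l) + (LINT l|lborel. (norm (fourier m l))\<^sup>2 * ?G l)) / 2)"
      using i2 [of h] i2 [of m] by simp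
    also have "\<dots> \<le> \<kappa> * (D * V) * ((C\<^sup>2 * (D * V) + n) / 2)"
    proof (intro mult_left_mono divide_right_mono add_mono)
      have "(LINT l|lborel. (norm (fourier h l))\<^sup>2 * ?G l) \<le> (LINT x|lborel. (norm (h x))\<^sup>2)"
        by (rule gauss_parseval_le [OF e(1) hi hC'])
      also have "\<dots> \<le> (LINT x|lborel. C\<^sup>2 * indicator ?B x)"
      proof (rule integral_mono')
        show "integrable lborel (\<lambda>x. C\<^sup>2 * indicator ?B x)" by (intro integrable_mult_right integrable_ball)
        show "(norm (h x))\<^sup>2 \<le> C\<^sup>2 * indicator ?B x" for x
          using power_mono [OF hC [of x], of 2] by (auto simp: indicator_def)
      qed auto
      also have "\<dots> = C\<^sup>2 * (D * V)" by (simp only: integral_mult_right_zero IB)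
      finally show "(LINT l|lborel. (norm (fourier h l))\<^sup>2 * ?G l) \<le> C\<^sup>2 * (D * V)" .
      have "(LINT l|lborel. (norm (fourier m l))\<^sup>2 * ?G l) \<le> (LINT x|lborel. (norm (m x))\<^sup>2)"
        by (rule gauss_parseval_le [OF e(1) mi, of 1]) (simp add: m_def indicator_def)
      also have "\<dots> = (LINT x|lborel. indicator N x)"
        by (intro Bochner_Integration.integral_cong) (auto simp: m_def indicator_def)
      also have "\<dots> = n" by (simp add: n_def)
      finally show "(LINT l|lborel. (norm (fourier m l))\<^sup>2 * ?G l) \<le> n" .
    qed (use \<kappa> D V in auto)
    finally show ?thesis .
  qed

  \<comment> \<open>\<open>fourier m\<close> is written as an integral of characters over
    \<open>\<tau>\<close>. Each character, multiplied with the transform of \<open>h\<close>,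
    amounts to a translation of \<open>h\<close> by \<open>\<tau>\<close>, so
    \<open>gauss_parseval\<close> applies for every fixed \<open>\<tau>\<close>.\<close>
  have I_eq: "I = (LINT \<tau>|lborel. m \<tau> * (LINT z|lborel. Q \<tau> z * of_real (gauss e z)))"
  proof -
    have "cnj (fourier m l) = (LINT \<tau>|lborel. m \<tau> * ec (\<tau> \<bullet> l))" for l
      unfolding cnj_fourier by (simp add: m_def)
    then have "I = (LINT l|lborel. LINT \<tau>|lborel. fourier h l * cnj (fourier h l) * (m \<tau> * ec (\<tau> \<bullet> l)) * of_real (?G l))"
      by (simp add: I_def)
    also have "\<dots> = (LINT \<tau>|lborel. LINT l|lborel. fourier h l * cnj (fourier h l) * (m \<tau> * ec (\<tau> \<bullet> l)) * of_real (?G l))"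
    proof (rule fubini_swap [where u = "\<lambda>l. (norm (fourier h l))\<^sup>2 * ?G l" and v = "\<lambda>\<tau>. norm (m \<tau>)"])
      show "norm (fourier h l * cnj (fourier h l) * (m \<tau> * ec (\<tau> \<bullet> l)) * of_real (?G l)) \<le> (norm (fourier h l))\<^sup>2 * ?G l * norm (m \<tau>)" for l \<tau>
        by (simp add: norm_mult power2_eq_square mult_ac)
    qed (use i2 [of h] mi in auto)
    also have "\<dots> = (LINT \<tau>|lborel. m \<tau> * (LINT z|lborel. Q \<tau> z * of_real (gauss e z)))"
    proof (rule Bochner_Integration.integral_cong [OF refl])
      fix \<tau> :: 'a
      let ?h = "\<lambda>x. h (x - \<tau>)"
      have ht: "fourier ?h l = ec (- (\<tau> \<bullet> l)) * fourier h l" for l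
      proof -
        have "fourier ?h l = (LINT x|lborel. h (\<tau> + x - \<tau>) * ec (- ((\<tau> + x) \<bullet> l)))"
          unfolding fourier_ec by (rule lborel_integral_translate [symmetric]) simp
        also have "\<dots> = (LINT x|lborel. ec (- (\<tau> \<bullet> l)) * (h x * ec (- (x \<bullet> l))))"
          by (intro Bochner_Integration.integral_cong refl) (simp add: inner_add_left ec_add [symmetric] mult_ac add.commute diff_conv_add_uminus [symmetric])
        finally show ?thesis by (simp add: fourier_ec)
      qed
      have hi': "integrable lborel ?h" using lborel_integrable_translate [of h "- \<tau>"] hi by simp
      have "(LINT l|lborel. fourier h l * cnj (fourier h l) * (m \<tau> * ec (\<tau> \<bullet> l)) * of_real (?G l)) =
          (LINT l|lborel. m \<tau> * (fourier h l * cnj (fourier ?h l) * of_real (?G l)))"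
        unfolding ht by (simp add: ec_minus mult_ac)
      also have "\<dots> = m \<tau> * (LINT z|lborel. (LINT x|lborel. h x * cnj (?h (x - z))) * of_real (gauss e z))"
        by (simp only: integral_mult_right_zero gauss_parseval [OF e(1) hi hi' hC'])
      finally show "(LINT l|lborel. fourier h l * cnj (fourier h l) * (m \<tau> * ec (\<tau> \<bullet> l)) * of_real (?G l)) =
          m \<tau> * (LINT z|lborel. Q \<tau> z * of_real (gauss e z))" by (simp add: Q_def)
    qed
    finally show ?thesis .
  qed

  have ihh: "integrable lborel (\<lambda>x. h x * cnj (h (x - z - \<tau>)))" for z \<tau>
  proof -
    have "(\<lambda>x. h x * cnj (h (x - z - \<tau>))) \<in> borel_measurable borel" by measurable
    moreover have "norm (h x * cnj (h (x - z - \<tau>))) \<le> norm (C * (C * indicator ?B x))" for x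
      using mult_mono [OF hC [of x] hC' [of "x - z - \<tau>"]] C by (simp add: norm_mult abs_mult mult_ac)
    ultimately show ?thesis
      by (intro Bochner_Integration.integrable_bound [OF integrable_mult_right [OF iB, of C]]) auto
  qed
  have Qle: "norm (Q \<tau> z) \<le> C\<^sup>2 * (D * V)" for \<tau> z
  proof -
    have "norm (Q \<tau> z) \<le> (LINT x|lborel. C\<^sup>2 * indicator ?B x)"
      unfolding Q_def
    proof (rule Bochner_Integration.integral_norm_bound_integral [OF ihh])
      show "integrable lborel (\<lambda>x. C\<^sup>2 * indicator ?B x)" by (intro integrable_mult_right integrable_ball)
      show "norm (h x * cnj (h (x - z - \<tau>))) \<le> C\<^sup>2 * indicator ?B x" for x
        using mult_mono [OF hC [of x] hC' [of "x - z - \<tau>"]] C by (simp add: norm_mult power2_eq_square mult_ac)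
    qed
    then show ?thesis by (simp only: integral_mult_right_zero IB)
  qed
  \<comment> \<open>\<open>v (x - z - \<tau>)\<close> is within \<open>2 * \<eta>\<close> of
    \<open>v x\<close>, by uniform continuity for \<open>z\<close> and almost periodicity for
    \<open>\<tau>\<close>. Hence the correlation is nearly the integral of the squared modulus, with
    an error that may be charged to the whole cut-off ball.\<close>
  have Qge: "Re (Q \<tau> z) \<ge> c\<^sub>1 * V / 2" if \<tau>: "\<tau> \<in> N" and z: "norm z < \<delta>" for \<tau> z
  proof -
    have iv: "integrable lborel (\<lambda>x. indicator (ball 0 R) x * (norm (v x))\<^sup>2)"
    proof -
      have "(norm (v x))\<^sup>2 \<le> C\<^sup>2" for x using C by (intro power_mono) auto
      then show ?thesis
        by (intro Bochner_Integration.integrable_bound [OF integrable_mult_right [OF integrable_ball, of "C\<^sup>2" 0 R]])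
           (auto split: split_indicator)
    qed
    have pt: "indicator (ball 0 R) x * (norm (v x))\<^sup>2 - 2 * \<eta> * (C * indicator ?B x) \<le> Re (h x * cnj (h (x - z - \<tau>)))" for x
    proof -
      have near: "norm (v x - v (x - z - \<tau>)) \<le> 2 * \<eta>"
      proof -
        have "norm (v x - v (x - z)) \<le> \<eta>" using \<delta>(2) [of x "x - z"] z by simp
        moreover have "norm (v (x - z - \<tau> + \<tau>) - v (x - z - \<tau>)) \<le> \<eta>" by (rule N(4) [OF \<tau>])
        ultimately show ?thesis
          using norm_triangle_ineq [of "v x - v (x - z)" "v (x - z) - v (x - z - \<tau>)"] by simp
      qed
      have re: "Re (v x * cnj (v (x - z - \<tau>))) \<ge> (norm (v x))\<^sup>2 - 2 * \<eta> * C"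
      proof -
        have "v x * cnj (v (x - z - \<tau>)) = of_real ((norm (v x))\<^sup>2) - v x * cnj (v x - v (x - z - \<tau>))"
          by (simp only: complex_norm_square complex_cnj_diff) (simp add: algebra_simps)
        then have "Re (v x * cnj (v (x - z - \<tau>))) = (norm (v x))\<^sup>2 - Re (v x * cnj (v x - v (x - z - \<tau>)))" by simp
        moreover have "Re (v x * cnj (v x - v (x - z - \<tau>))) \<le> norm (v x * cnj (v x - v (x - z - \<tau>)))"
          by (rule complex_Re_le_cmod)
        moreover have "norm (v x * cnj (v x - v (x - z - \<tau>))) \<le> C * (2 * \<eta>)"
          unfolding norm_mult complex_mod_cnj using C near \<eta> by (intro mult_mono) auto
        ultimately show ?thesis by (simp add: mult_ac)
      qed
      have in1: "x \<in> ball 0 R \<Longrightarrow> x \<in> ?B" using R(1) by (simp del: mem_ball add: mem_ball_0)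
      have in2: "x - z - \<tau> \<in> ?B" if "x \<in> ball 0 R"
      proof -
        have "norm x < R" using that unfolding mem_ball_0 .
        moreover have "norm (x - z - \<tau>) \<le> norm x + norm z + norm \<tau>"
          using norm_triangle_ineq4 [of "x - z" \<tau>] norm_triangle_ineq4 [of x z] by linarith
        ultimately show ?thesis using Nball [OF \<tau>] z R(1,5) unfolding mem_ball_0 by linarith
      qed
      have \<eta>C: "2 * \<eta> * C \<ge> 0" using \<eta> C by simp
      show ?thesis
      proof (cases "x \<in> ?B \<and> x - z - \<tau> \<in> ?B")
        case True
        then have "Re (h x * cnj (h (x - z - \<tau>))) = Re (v x * cnj (v (x - z - \<tau>)))" by (simp add: h_def)
        moreover have "indicator (ball 0 R) x * (norm (v x))\<^sup>2 \<le> (norm (v x))\<^sup>2" by (simp add: indicator_def)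
        moreover have "2 * \<eta> * (C * indicator ?B x) = 2 * \<eta> * C" using True by simp
        ultimately show ?thesis using re by linarith
      next
        case False
        then have "Re (h x * cnj (h (x - z - \<tau>))) = 0" by (auto simp: h_def)
        moreover have "indicator (ball 0 R) x * (norm (v x))\<^sup>2 = 0" using False in1 in2 by (auto simp: indicator_def)
        moreover have "2 * \<eta> * (C * indicator ?B x) \<ge> 0" using \<eta> C by simp
        ultimately show ?thesis by linarith
      qed
    qed
    have "c\<^sub>1 * V - 2 * \<eta> * (C * (D * V)) \<le> (LINT x|lborel. indicator (ball 0 R) x * (norm (v x))\<^sup>2) - 2 * \<eta> * (C * (D * V))"
      using c1(3) [OF R(2)] by (simp add: V_def)
    also have "\<dots> = (LINT x|lborel. indicator (ball 0 R) x * (norm (v x))\<^sup>2 - 2 * \<eta> * (C * indicator ?B x))"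
      using iv iB by (simp only: Bochner_Integration.integral_diff integrable_mult_right integral_mult_right_zero IB)
    also have "\<dots> \<le> (LINT x|lborel. Re (h x * cnj (h (x - z - \<tau>))))"
      using iv iB ihh by (intro integral_mono pt Bochner_Integration.integrable_diff integrable_mult_right integrable_Re) auto
    also have "\<dots> = Re (Q \<tau> z)" unfolding Q_def by (rule integral_Re [OF ihh])
    finally have "c\<^sub>1 * V - 2 * \<eta> * (C * (D * V)) \<le> Re (Q \<tau> z)" .
    moreover have "2 * \<eta> * (C * (D * V)) = c\<^sub>1 * V / 2" using C D by (simp add: \<eta>_def)
    ultimately show ?thesis by linarith
  qed

  have Qmeas: "(\<lambda>z. Q \<tau> z) \<in> borel_measurable borel" for \<tau>
  proof -
    have "(\<lambda>z. LINT x|lborel. h x * cnj (h (x - z - \<tau>))) \<in> borel_measurable lborel" by measurable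
    then show ?thesis by (simp add: Q_def)
  qed
  \<comment> \<open>Near 0 the correlation is at least \<open>?q\<close>, elsewhere at least
    \<open>- ?K\<close>. The average against \<open>gauss\<close> then loses at most
    \<open>(?q + ?K)\<close> times the tail mass.\<close>
  have inner: "c\<^sub>1 * V / 8 \<le> Re (LINT z|lborel. Q \<tau> z * of_real (gauss e z))" if \<tau>: "\<tau> \<in> N" for \<tau>
  proof -
    note [measurable] = Qmeas
    note g = gauss_integrable [OF e(1), where 'a='a]
    let ?t = "\<lambda>z::'a. indicator (- ball 0 \<delta>) z * gauss e z"
    have it: "integrable lborel ?t"
      by (rule Bochner_Integration.integrable_bound [OF g]) (auto simp: indicator_def)
    have iQ: "integrable lborel (\<lambda>z. Q \<tau> z * of_real (gauss e z))"
      using Qle g by (intro integrable_bounded_mult [OF Qmeas Qle]) simp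
    let ?q = "c\<^sub>1 * V / 2"
    let ?K = "C\<^sup>2 * (D * V)"
    have K: "?K \<ge> 0" "?q \<ge> 0" using D V c1 by auto
    have "?q - (?q + ?K) * gauss_tail TYPE('a) \<delta> e \<le> ?q - (?q + ?K) * (LINT z|lborel. ?t z)"
      using K gauss_tail_le [OF e(1) \<delta>(1), where 'a='a] by (intro diff_left_mono mult_left_mono) auto
    also have "\<dots> = (LINT z|lborel. ?q * gauss e z - (?q + ?K) * ?t z)"
      using g it by (simp add: gauss_integral [OF e(1)])
    also have "\<dots> \<le> (LINT z|lborel. Re (Q \<tau> z * of_real (gauss e z)))"
    proof (rule integral_mono)
      show "integrable lborel (\<lambda>z. ?q * gauss e z - (?q + ?K) * ?t z)"
        using g it by (intro Bochner_Integration.integrable_diff integrable_mult_right)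
      show "integrable lborel (\<lambda>z. Re (Q \<tau> z * of_real (gauss e z)))" using iQ by (rule integrable_Re)
      fix z :: 'a
      show "?q * gauss e z - (?q + ?K) * ?t z \<le> Re (Q \<tau> z * of_real (gauss e z))"
      proof (cases "norm z < \<delta>")
        case True
        then have "?q * gauss e z \<le> Re (Q \<tau> z) * gauss e z"
          using e(1) by (intro mult_right_mono Qge \<tau>) auto
        with True show ?thesis by (simp add: indicator_def)
      next
        case False
        have "\<bar>Re (Q \<tau> z)\<bar> \<le> ?K" using abs_Re_le_cmod [of "Q \<tau> z"] Qle [of \<tau> z] by linarith
        then have "- ?K * gauss e z \<le> Re (Q \<tau> z) * gauss e z"
          using e(1) by (intro mult_right_mono) auto
        with False show ?thesis by (simp add: indicator_def algebra_simps)
      qed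
    qed
    also have "\<dots> = Re (LINT z|lborel. Q \<tau> z * of_real (gauss e z))" by (rule integral_Re [OF iQ])
    finally have le: "?q - (?q + ?K) * gauss_tail TYPE('a) \<delta> e \<le> Re (LINT z|lborel. Q \<tau> z * of_real (gauss e z))" .
    have "?q * gauss_tail TYPE('a) \<delta> e \<le> ?q * (1 / 2)" using K e(2) by (intro mult_left_mono) auto
    moreover have "?K * gauss_tail TYPE('a) \<delta> e \<le> ?K * (c\<^sub>1 / (8 * C\<^sup>2 * D))" using K e(3) by (intro mult_left_mono) auto
    moreover have "?K * (c\<^sub>1 / (8 * C\<^sup>2 * D)) = c\<^sub>1 * V / 8" using C D by simp
    ultimately show ?thesis using le unfolding distrib_right by linarith
  qed

  have lower: "n * (c\<^sub>1 * V / 8) \<le> norm I"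
  proof -
    let ?J = "\<lambda>\<tau>. LINT z|lborel. Q \<tau> z * of_real (gauss e z)"
    have Jle: "norm (?J \<tau>) \<le> C\<^sup>2 * (D * V)" for \<tau>
    proof -
      note g = gauss_integrable [OF e(1), where 'a='a]
      have "norm (?J \<tau>) \<le> (LINT z|lborel. C\<^sup>2 * (D * V) * gauss e (z::'a))"
      proof (rule Bochner_Integration.integral_norm_bound_integral)
        show "integrable lborel (\<lambda>z. Q \<tau> z * of_real (gauss e z))"
          using g by (intro integrable_bounded_mult [OF Qmeas Qle]) simp
        show "integrable lborel (\<lambda>z::'a. C\<^sup>2 * (D * V) * gauss e z)" using g by (rule integrable_mult_right)
        show "norm (Q \<tau> z * of_real (gauss e z)) \<le> C\<^sup>2 * (D * V) * gauss e z" for z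
          using mult_right_mono [OF Qle [of \<tau> z] gauss_nonneg [OF e(1), of z]] e(1) by (simp add: norm_mult)
      qed
      then show ?thesis by (simp add: gauss_integral [OF e(1)])
    qed
    have Jm: "?J \<in> borel_measurable borel"
    proof -
      have "(\<lambda>\<tau>. LINT z|lborel. (LINT x|lborel. h x * cnj (h (x - z - \<tau>))) * of_real (gauss e z)) \<in> borel_measurable lborel"
        by measurable
      then show ?thesis by (simp add: Q_def)
    qed
    have iJ: "integrable lborel (\<lambda>\<tau>. ?J \<tau> * m \<tau>)" by (rule integrable_bounded_mult [OF Jm Jle mi])
    have "n * (c\<^sub>1 * V / 8) = (LINT \<tau>|lborel. indicator N \<tau> * (c\<^sub>1 * V / 8))" by (simp add: n_def)
    also have "\<dots> \<le> (LINT \<tau>|lborel. Re (?J \<tau> * m \<tau>))"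
    proof (rule integral_mono)
      show "integrable lborel (\<lambda>\<tau>. indicator N \<tau> * (c\<^sub>1 * V / 8))" by (rule integrable_mult_left) (use iN in simp)
      show "integrable lborel (\<lambda>\<tau>. Re (?J \<tau> * m \<tau>))" by (rule integrable_Re [OF iJ])
      show "indicator N \<tau> * (c\<^sub>1 * V / 8) \<le> Re (?J \<tau> * m \<tau>)" for \<tau>
        using inner [of \<tau>] by (auto simp: m_def indicator_def)
    qed
    also have "\<dots> = Re (LINT \<tau>|lborel. ?J \<tau> * m \<tau>)" by (rule integral_Re [OF iJ])
    also have "\<dots> = Re I" by (simp add: I_eq mult.commute)
    also have "\<dots> \<le> norm I" by (rule complex_Re_le_cmod)
    finally show ?thesis .
  qed

  have "c * V * (c\<^sub>1 * V / 8) \<le> n * (c\<^sub>1 * V / 8)" using n(1) c1 V by (intro mult_right_mono) auto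
  also have "\<dots> \<le> \<kappa> * (D * V) * ((C\<^sup>2 * (D * V) + n) / 2)" using lower upper by linarith
  also have "\<dots> \<le> \<kappa> * (D * V) * ((C\<^sup>2 * (D * V) + D * V) / 2)"
    using n5 \<kappa> D V by (intro mult_left_mono divide_right_mono add_left_mono) auto
  also have "\<dots> = (\<kappa> * ((C\<^sup>2 + 1) * D\<^sup>2)) * V\<^sup>2 / 2" by (simp add: power2_eq_square algebra_simps)
  also have "\<kappa> * ((C\<^sup>2 + 1) * D\<^sup>2) = c * c\<^sub>1 / 8"
  proof -
    have *: "c * c\<^sub>1 / (8 * E) * E = c * c\<^sub>1 / 8" if "E \<noteq> 0" for E :: real using that by simp
    have "(C\<^sup>2 + 1) * D\<^sup>2 \<noteq> 0" using C21 D by auto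
    from * [OF this] show ?thesis by (simp only: \<kappa>_def mult.assoc)
  qed
  finally have "c * c\<^sub>1 * V\<^sup>2 \<le> c * c\<^sub>1 * V\<^sup>2 / 2" by (simp add: power2_eq_square)
  moreover have "c * c\<^sub>1 * V\<^sup>2 > 0" using cT(1) c1(1) V by simp
  ultimately show False by linarith
qed

section \<open>Regularisation of an almost periodic distribution\<close>

text \<open>The derivatives are moved onto \<open>\<phi>\<close>, up to a sign, so that every
  partial derivative has the same shape with another test function. One estimate for Riemann sums
  then controls all seminorms.\<close>

lemma partials_fourier_mult:
  assumes "\<phi> \<in> test_functions" "\<eta> \<in> test_functions" "set bs \<subseteq> Basis"
  shows "partials bs (fourier (\<lambda>y. fourier \<phi> y * \<eta> y)) =
    fourier (\<lambda>y. fourier (\<lambda>x. (- 1) ^ length bs * partials bs \<phi> x) y * \<eta> y)"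
  using assms(3)
proof (induction bs)
  case (Cons b bs)
  let ?\<psi> = "\<lambda>x. (- 1) ^ length bs * partials bs \<phi> x"
  have \<psi>: "?\<psi> \<in> test_functions"
    using Cons assms by (intro test_functions_cmult test_functions_partials) auto
  have t: "(\<lambda>y. fourier ?\<psi> y * \<eta> y) \<in> test_functions"
    by (intro test_functions_mult_smooth(1) assms fourier_smooth \<psi>)
  have "frechet_derivative ?\<psi> (at x) b = (- 1) ^ length bs * partials (b # bs) \<phi> x" for x
  proof -
    have "partials [b] ?\<psi> = (\<lambda>x. (- 1) ^ length bs * partials [b] (partials bs \<phi>) x)"
      using Cons assms by (intro partials_cmult smooth_partials test_functions_smooth) auto
    from fun_cong [OF this, of x] show ?thesis by simp
  qed
  then have "(\<lambda>x. (- 1) ^ length (b # bs) * partials (b # bs) \<phi> x) = (\<lambda>x. - 1 * frechet_derivative ?\<psi> (at x) b)"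
    by auto
  then have "fourier (\<lambda>x. (- 1) ^ length (b # bs) * partials (b # bs) \<phi> x) y = - (2 * pi * \<i>) * of_real (y \<bullet> b) * fourier ?\<psi> y" for y
    using Cons by (simp only: fourier_cmult) (simp add: fourier_partial [OF \<psi>] fourier_cmult)
  then have "(\<lambda>y. fourier (\<lambda>x. (- 1) ^ length (b # bs) * partials (b # bs) \<phi> x) y * \<eta> y) = coord_mult b (\<lambda>y. fourier ?\<psi> y * \<eta> y)"
    by (auto simp: coord_mult_def)
  then show ?case using Cons by (simp add: frechet_derivative_eqI [OF fourier_has_derivative [OF t]])
qed simp

text \<open>In this form the transform is a superposition of the functions
  \<open>\<lambda>x. \<phi> (s - x)\<close>, whose images under \<open>f\<close> are the values
  \<open>conv f \<phi> s\<close>.\<close>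

lemma fourier_fourier_mult':
  assumes "\<phi> \<in> test_functions" "\<eta> \<in> test_functions"
  shows "fourier (\<lambda>y. fourier \<phi> y * \<eta> y) x = (LINT s|lborel. \<phi> (s - x) * fourier \<eta> s)"
proof -
  have [measurable]: "\<phi> \<in> borel_measurable borel" "fourier \<eta> \<in> borel_measurable borel"
    using test_functions_measurable fourier_measurable assms by auto
  show ?thesis
    using lborel_integral_translate [of "\<lambda>s. \<phi> (s - x) * fourier \<eta> s" x]
    by (simp add: fourier_fourier_mult [OF assms] add.commute)
qed

section \<open>Riemann sums in the Schwartz seminorms\<close>

text \<open>Selecting the first suitable entry of a list makes the selection evidently measurable.
  The default 0 is returned for points that no entry approximates.\<close>

primrec pick :: "real \<Rightarrow> 'a::euclidean_space list \<Rightarrow> 'a \<Rightarrow> 'a" where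
  "pick \<delta> [] s = 0"
| "pick \<delta> (p # ps) s = (if norm (p - s) < \<delta> then p else pick \<delta> ps s)"

text \<open>The map rounds the points of a ball to finitely many nodes, and its fibres serve as the
  cells of a Riemann sum.\<close>

lemma finite_valued_approx:
  assumes "\<delta> > 0"
  shows "\<exists>r :: 'a::euclidean_space \<Rightarrow> 'a. r \<in> borel_measurable borel \<and> finite (range r) \<and> (\<forall>s\<in>ball 0 S. norm (r s - s) < \<delta>)"
proof -
  obtain k :: "'a set" where k: "finite k" "cball 0 S \<subseteq> (\<Union>x\<in>k. ball x \<delta>)"
    using compact_finite_net [OF compact_cball assms, of "0::'a" S] by auto
  then obtain ps where ps: "set ps = k" using finite_list by blast
  have "pick \<delta> ps \<in> borel_measurable borel"
  proof (induction ps)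
    case Nil
    have "pick \<delta> ([] :: 'a list) = (\<lambda>s. 0)" by auto
    then show ?case by simp
  next
    case (Cons p ps)
    note [measurable] = Cons
    have "pick \<delta> (p # ps) = (\<lambda>s. if norm (p - s) < \<delta> then p else pick \<delta> ps s)" by auto
    then show ?case by simp
  qed
  moreover have "range (pick \<delta> ps) \<subseteq> insert 0 (set ps)"
    by (induction ps) (auto split: if_splits)
  then have "finite (range (pick \<delta> ps))" by (rule finite_subset) simp
  moreover have "norm (pick \<delta> ps s - s) < \<delta>" if "s \<in> ball 0 S" for s
  proof -
    have "s \<in> cball 0 S" using that by simp
    then obtain p where "p \<in> set ps" "s \<in> ball p \<delta>" using k(2) ps by blast
    then have "\<exists>p\<in>set ps. norm (p - s) < \<delta>" by (auto simp: dist_norm)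
    then show ?thesis by (induction ps) auto
  qed
  ultimately show ?thesis by blast
qed

text \<open>A Riemann sum weighted by the integrals of \<open>k\<close> over the cells is itself an
  integral with rounded argument. Linearity applies to the left side and dominated convergence to
  the right side.\<close>

lemma integral_finite_valued:
  fixes k :: "'a::euclidean_space \<Rightarrow> complex" and r :: "'a \<Rightarrow> 'a"
  assumes [measurable]: "r \<in> borel_measurable borel" and fin: "finite (range r)"
    and k: "integrable lborel k" and [measurable]: "B \<in> sets borel"
  shows "(\<Sum>p\<in>range r. (LINT s|lborel. indicator (B \<inter> r -` {p}) s *\<^sub>R k s) * \<Phi> p) = (LINT s|lborel. indicator B s *\<^sub>R (\<Phi> (r s) * k s))"
proof -
  have [measurable]: "r -` {p} \<in> sets borel" for p
    by (rule measurable_sets_borel [OF assms(1)]) (rule borel_closed [OF closed_singleton])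
  have "(\<Sum>p\<in>range r. (LINT s|lborel. indicator (B \<inter> r -` {p}) s *\<^sub>R k s) * \<Phi> p) =
      (\<Sum>p\<in>range r. (LINT s|lborel. indicator (B \<inter> r -` {p}) s *\<^sub>R k s * \<Phi> p))"
    by (simp only: integral_mult_left_zero)
  also have "\<dots> = (LINT s|lborel. (\<Sum>p\<in>range r. indicator (B \<inter> r -` {p}) s *\<^sub>R k s * \<Phi> p))"
    by (intro Bochner_Integration.integral_sum [symmetric] integrable_mult_left integrable_mult_indicator k) auto
  also have "\<dots> = (LINT s|lborel. indicator B s *\<^sub>R (\<Phi> (r s) * k s))"
  proof (rule Bochner_Integration.integral_cong [OF refl])
    fix s
    have "(\<Sum>p\<in>range r. indicator (B \<inter> r -` {p}) s *\<^sub>R k s * \<Phi> p) =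
        (\<Sum>p\<in>range r. if p = r s then indicator B s *\<^sub>R (\<Phi> p * k s) else 0)"
      by (intro sum.cong) (auto simp: indicator_def)
    also have "\<dots> = indicator B s *\<^sub>R (\<Phi> (r s) * k s)" using fin by (subst sum.delta) auto
    finally show "(\<Sum>p\<in>range r. indicator (B \<inter> r -` {p}) s *\<^sub>R k s * \<Phi> p) = indicator B s *\<^sub>R (\<Phi> (r s) * k s)" .
  qed
  finally show ?thesis .
qed

text \<open>An inequality of Peetre type: polynomial weights at points of bounded distance are
  comparable.\<close>

lemma weight_le:
  fixes x s :: "'a::euclidean_space"
  assumes "norm (s - x) \<le> \<rho>" "\<rho> \<ge> 0"
  shows "(1 + norm x) ^ n \<le> (1 + \<rho>) ^ n * (1 + norm s) ^ n"
proof -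
  have "norm x \<le> norm s + \<rho>" using assms norm_triangle_sub [of x s] by (simp add: norm_minus_commute)
  then have "1 + norm x \<le> (1 + \<rho>) * (1 + norm s)"
  proof -
    have "(1 + \<rho>) * (1 + norm s) = 1 + norm s + \<rho> + \<rho> * norm s" by (simp add: algebra_simps)
    moreover have "\<rho> * norm s \<ge> 0" using assms by simp
    ultimately show ?thesis using \<open>norm x \<le> norm s + \<rho>\<close> by linarith
  qed
  then have "(1 + norm x) ^ n \<le> ((1 + \<rho>) * (1 + norm s)) ^ n" by (intro power_mono) auto
  then show ?thesis by (simp add: power_mult_distrib)
qed

text \<open>The compact support of \<open>\<psi>\<close> ties \<open>s\<close> to \<open>x\<close>,
  so the weight in \<open>x\<close> may be moved to \<open>s\<close>, where \<open>k\<close> has a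
  finite weighted integral. Inside the ball the error is small by uniform continuity of
  \<open>\<psi>\<close>, outside it by the vanishing tail of that integral.\<close>

lemma riemann_sum_weighted:
  fixes \<psi> k :: "'a::euclidean_space \<Rightarrow> complex"
  assumes \<psi>: "\<psi> \<in> test_functions" and k [measurable]: "k \<in> borel_measurable borel"
    and kn: "integrable lborel (\<lambda>s. (1 + norm s) ^ n * norm (k s))" and ki: "integrable lborel k"
    and r [measurable]: "\<And>N. r N \<in> borel_measurable borel"
    and rN: "\<And>N s. s \<in> ball 0 (real N) \<Longrightarrow> norm (r N s - s) < 1 / real (Suc N)"
    and \<epsilon>: "\<epsilon> > 0"
  shows "\<forall>\<^sub>F N in sequentially. \<forall>x. (1 + norm x) ^ n * norm ((LINT s|lborel. \<psi> (s - x) * k s) -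
      (LINT s|lborel. indicator (ball 0 (real N)) s *\<^sub>R (\<psi> (r N s - x) * k s))) \<le> \<epsilon>"
proof -
  note [measurable] = test_functions_measurable [OF \<psi>]
  obtain \<rho> where \<rho>: "\<rho> > 0" "\<And>x. norm x > \<rho> \<Longrightarrow> \<psi> x = 0" using \<psi> by (auto simp: test_functions_iff)
  obtain M where M: "M > 0" "\<And>x. norm (\<psi> x) \<le> M" using test_functions_bounded [OF \<psi>] by metis
  let ?w = "\<lambda>s::'a. (1 + norm s) ^ n * norm (k s)"
  define K where "K = (LINT s|lborel. ?w s) + 1"
  have K: "K > 0" "(LINT s|lborel. ?w s) \<le> K" by (auto simp: K_def intro!: add_nonneg_pos)
  \<comment> \<open>The comparison distance is \<open>1 + \<rho>\<close>: the rounded point may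
    still lie in the support of \<open>\<psi>\<close> when \<open>s\<close> itself misses it by less
    than 1.\<close>
  define L where "L = (2 + \<rho>) ^ n"
  have L: "L > 0" using \<rho> by (simp add: L_def)
  define \<epsilon>\<^sub>1 where "\<epsilon>\<^sub>1 = \<epsilon> / (2 * L * K)"
  define \<epsilon>\<^sub>2 where "\<epsilon>\<^sub>2 = \<epsilon> / (2 * L * M)"
  have \<epsilon>12: "\<epsilon>\<^sub>1 > 0" "\<epsilon>\<^sub>2 > 0" using \<epsilon> L K M by (auto simp: \<epsilon>\<^sub>1_def \<epsilon>\<^sub>2_def)
  obtain d where d: "d > 0" "\<And>x y. norm (x - y) < d \<Longrightarrow> norm (\<psi> x - \<psi> y) < \<epsilon>\<^sub>1"
    using uniformly_continuousD [OF test_functions_uniformly_continuous [OF \<psi>] \<epsilon>12(1)] by metis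
  let ?T = "\<lambda>N. LINT s|lborel. indicator (- ball 0 (real N)) s * ?w s"
  have iT: "integrable lborel (\<lambda>s. indicator (- ball 0 (real N)) s * ?w s)" for N
    by (rule Bochner_Integration.integrable_bound [OF kn]) (auto simp: indicator_def)
  have "?T \<longlonglongrightarrow> (LINT s::'a|lborel. 0)"
  proof (rule integral_dominated_convergence [OF _ _ kn])
    show "AE s in lborel. (\<lambda>N. indicator (- ball 0 (real N)) s * ?w s) \<longlonglongrightarrow> 0"
    proof (rule AE_I2)
      fix s :: 'a
      obtain N where N: "norm s < real N" using reals_Archimedean2 by blast
      have "\<forall>\<^sub>F N in sequentially. indicator (- ball 0 (real N)) s * ?w s = 0"
        unfolding eventually_sequentially using N by (intro exI [of _ N]) (auto simp: indicator_def)
      then show "(\<lambda>N. indicator (- ball 0 (real N)) s * ?w s) \<longlonglongrightarrow> 0" by (rule tendsto_eventually)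
    qed
    show "AE s in lborel. norm (indicator (- ball 0 (real N)) s * ?w s) \<le> ?w s" for N
      by (auto simp: indicator_def)
  qed auto
  then have "\<forall>\<^sub>F N in sequentially. ?T N < \<epsilon>\<^sub>2"
    using \<epsilon>12(2) by (intro order_tendstoD(2)) auto
  moreover have "\<forall>\<^sub>F N in sequentially. 1 / real (Suc N) < d"
    using order_tendstoD(2) [OF LIMSEQ_inverse_real_of_nat d(1)] by (simp add: inverse_eq_divide)
  ultimately show ?thesis
  proof eventually_elim
    case (elim N)
    show ?case
    proof
      fix x :: 'a
      let ?B = "ball (0::'a) (real N)"
      let ?F = "\<lambda>s. \<psi> (s - x) * k s - indicator ?B s *\<^sub>R (\<psi> (r N s - x) * k s)"
      have i1: "integrable lborel (\<lambda>s. \<psi> (s - x) * k s)" "integrable lborel (\<lambda>s. \<psi> (r N s - x) * k s)"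
        using ki M by (auto intro!: integrable_bounded_mult [of _ M])
      have i2: "integrable lborel (\<lambda>s. indicator ?B s *\<^sub>R (\<psi> (r N s - x) * k s))"
        by (rule integrable_mult_indicator [OF _ i1(2)]) simp
      have pt: "(1 + norm x) ^ n * norm (?F s) \<le> L * \<epsilon>\<^sub>1 * ?w s + L * M * (indicator (- ?B) s * ?w s)" for s
      proof (cases "s \<in> ?B")
        case True
        have "1 / real (Suc N) \<le> 1" by simp
        then have rs: "norm (r N s - s) < d" "norm (r N s - s) < 1"
          using rN [OF True] elim(2) by linarith+
        have F: "norm (?F s) = norm (\<psi> (s - x) - \<psi> (r N s - x)) * norm (k s)"
          using True by (simp add: norm_mult [symmetric] algebra_simps)
        have "norm (\<psi> (s - x) - \<psi> (r N s - x)) < \<epsilon>\<^sub>1"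
          using rs by (intro d) (simp add: norm_minus_commute)
        have "(1 + norm x) ^ n * norm (\<psi> (s - x) - \<psi> (r N s - x)) \<le> L * (1 + norm s) ^ n * \<epsilon>\<^sub>1"
        proof (cases "norm (s - x) \<le> 1 + \<rho>")
          case True
          have "(1 + norm x) ^ n \<le> (1 + (1 + \<rho>)) ^ n * (1 + norm s) ^ n"
            using True \<rho> by (intro weight_le) auto
          then show ?thesis
            using \<open>norm (\<psi> (s - x) - \<psi> (r N s - x)) < \<epsilon>\<^sub>1\<close> L by (intro mult_mono) (auto simp: L_def)
        next
          case False
          have "norm (s - x) \<le> norm (r N s - x) + norm (r N s - s)"
            using norm_triangle_ineq4 [of "r N s - x" "r N s - s"] by simp
          with False rs have "norm (r N s - x) > \<rho>" by linarith
          with False \<rho>(2) [of "s - x"] \<rho>(2) [of "r N s - x"] show ?thesis using L \<epsilon>12 by simp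
        qed
        from mult_right_mono [OF this, of "norm (k s)"] True show ?thesis
          unfolding F by (simp add: mult_ac)
      next
        case False
        have "(1 + norm x) ^ n * norm (\<psi> (s - x)) \<le> L * (1 + norm s) ^ n * M"
        proof (cases "norm (s - x) \<le> 1 + \<rho>")
          case True
          have "(1 + norm x) ^ n \<le> (1 + (1 + \<rho>)) ^ n * (1 + norm s) ^ n"
            using True \<rho> by (intro weight_le) auto
          then show ?thesis using M L by (intro mult_mono) (auto simp: L_def)
        next
          case False
          with \<rho>(2) [of "s - x"] show ?thesis using L M by simp
        qed
        from mult_right_mono [OF this, of "norm (k s)"]
        have "(1 + norm x) ^ n * norm (?F s) \<le> L * M * ?w s" using False by (simp add: norm_mult mult_ac)
        moreover have "L * \<epsilon>\<^sub>1 * ?w s \<ge> 0" using L \<epsilon>12 by simp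
        ultimately show ?thesis using False by simp
      qed
      have "(1 + norm x) ^ n * norm ((LINT s|lborel. \<psi> (s - x) * k s) - (LINT s|lborel. indicator ?B s *\<^sub>R (\<psi> (r N s - x) * k s))) =
          norm (LINT s|lborel. of_real ((1 + norm x) ^ n) * ?F s)"
        by (simp only: integral_mult_right_zero norm_mult norm_of_real
             Bochner_Integration.integral_diff [OF i1(1) i2]) simp
      also have "\<dots> \<le> (LINT s|lborel. L * \<epsilon>\<^sub>1 * ?w s + L * M * (indicator (- ?B) s * ?w s))"
      proof (rule Bochner_Integration.integral_norm_bound_integral)
        show "integrable lborel (\<lambda>s. of_real ((1 + norm x) ^ n) * ?F s)"
          using i1 i2 by (intro integrable_mult_right Bochner_Integration.integrable_diff)
        show "integrable lborel (\<lambda>s. L * \<epsilon>\<^sub>1 * ?w s + L * M * (indicator (- ?B) s * ?w s))"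
          using kn iT by (intro integrable_mult_right Bochner_Integration.integrable_add)
        show "norm (of_real ((1 + norm x) ^ n) * ?F s) \<le> L * \<epsilon>\<^sub>1 * ?w s + L * M * (indicator (- ?B) s * ?w s)" for s
          using pt [of s] by (simp only: norm_mult norm_of_real) simp
      qed
      also have "\<dots> = L * \<epsilon>\<^sub>1 * (LINT s|lborel. ?w s) + L * M * ?T N"
        using kn iT by (simp only: Bochner_Integration.integral_add integrable_mult_right integral_mult_right_zero)
      also have "\<dots> \<le> L * \<epsilon>\<^sub>1 * K + L * M * \<epsilon>\<^sub>2"
        using elim(1) K L M \<epsilon>12 by (intro add_mono mult_left_mono) auto
      also have "\<dots> = \<epsilon>" using L K M by (simp add: \<epsilon>\<^sub>1_def \<epsilon>\<^sub>2_def)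
      finally show "(1 + norm x) ^ n * norm ((LINT s|lborel. \<psi> (s - x) * k s) - (LINT s|lborel. indicator ?B s *\<^sub>R (\<psi> (r N s - x) * k s))) \<le> \<epsilon>" .
    qed
  qed
qed

text \<open>\<open>f\<close> passes under the integral of \<open>fourier_fourier_mult'\<close>. The
  Riemann sums converge in the seminorm that controls \<open>f\<close>, while their images under
  \<open>f\<close> are Riemann sums of \<open>conv f \<phi>\<close> and converge by dominated
  convergence.\<close>

lemma temperate_fourier_conv:
  fixes f :: "('a::euclidean_space \<Rightarrow> complex) \<Rightarrow> complex"
  assumes f: "temperate f" and \<phi>: "\<phi> \<in> test_functions" and \<eta>: "\<eta> \<in> test_functions" and g: "apu (conv f \<phi>)"
  shows "f (fourier (\<lambda>y. fourier \<phi> y * \<eta> y)) = (LINT s|lborel. conv f \<phi> s * fourier \<eta> s)"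
proof -
  let ?k = "fourier \<eta>" and ?g = "conv f \<phi>"
  let ?\<Psi> = "fourier (\<lambda>y. fourier \<phi> y * \<eta> y)"
  note [measurable] = apu_measurable [OF g] fourier_measurable [OF \<eta>]
  obtain C where C: "C > 0" "\<And>x. norm (?g x) \<le> C" using apu_bounded [OF g] by metis
  obtain A n m where A: "A > 0" "\<And>\<phi> c. \<phi> \<in> schwartz_space \<Longrightarrow> schwartz_le n m \<phi> c \<Longrightarrow> norm (f \<phi>) \<le> A * c"
    using temperate_bound [OF f] by metis
  have ki: "integrable lborel ?k" by (rule fourier_integrable [OF \<eta>])
  have kn: "integrable lborel (\<lambda>s. (1 + norm s) ^ n * norm (?k s))" by (rule fourier_weighted_integrable [OF \<eta>])
  have "\<exists>r :: 'a \<Rightarrow> 'a. r \<in> borel_measurable borel \<and> finite (range r) \<and> (\<forall>s\<in>ball 0 (real N). norm (r s - s) < 1 / real (Suc N))" for N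
    by (rule finite_valued_approx) simp
  then obtain r :: "nat \<Rightarrow> 'a \<Rightarrow> 'a" where r: "\<And>N. r N \<in> borel_measurable borel" "\<And>N. finite (range (r N))"
    "\<And>N s. s \<in> ball 0 (real N) \<Longrightarrow> norm (r N s - s) < 1 / real (Suc N)"
    by metis
  note [measurable] = r(1)
  let ?B = "\<lambda>N. ball (0::'a) (real N)"
  define w where "w N p = (LINT s|lborel. indicator (?B N \<inter> r N -` {p}) s *\<^sub>R ?k s)" for N p
  define \<Phi> where "\<Phi> N x = (\<Sum>p\<in>range (r N). w N p * \<phi> (p - x))" for N x
  have w: "(\<Sum>p\<in>range (r N). w N p * h p) = (LINT s|lborel. indicator (?B N) s *\<^sub>R (h (r N s) * ?k s))" for N h
    unfolding w_def by (rule integral_finite_valued [OF r(1,2) ki]) simp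
  have \<Phi>t: "\<Phi> N \<in> test_functions" for N
    unfolding \<Phi>_def [abs_def] by (intro test_functions_sum test_functions_cmult test_functions_reflect \<phi>)
  have \<Psi>t: "(\<lambda>y. fourier \<phi> y * \<eta> y) \<in> test_functions"
    by (intro test_functions_mult_smooth(1) \<eta> fourier_smooth \<phi>)
  have f\<Phi>: "f (\<Phi> N) = (LINT s|lborel. indicator (?B N) s *\<^sub>R (?g (r N s) * ?k s))" for N
  proof -
    have "f (\<Phi> N) = (\<Sum>p\<in>range (r N). w N p * f (\<lambda>x. \<phi> (p - x)))"
      unfolding \<Phi>_def [abs_def] by (intro temperate_sum [OF f] test_imp_schwartz test_functions_reflect \<phi>)
    also have "\<dots> = (LINT s|lborel. indicator (?B N) s *\<^sub>R (?g (r N s) * ?k s))"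
      by (subst w [symmetric]) (simp add: conv_def)
    finally show ?thesis .
  qed
  have r_lim: "(\<lambda>N. r N s) \<longlonglongrightarrow> s" for s
  proof (rule LIM_zero_cancel, rule Lim_null_comparison)
    obtain N\<^sub>0 where N0: "norm s < real N\<^sub>0" using reals_Archimedean2 by blast
    show "\<forall>\<^sub>F N in sequentially. norm (r N s - s) \<le> inverse (real (Suc N))"
      unfolding eventually_sequentially
    proof (intro exI [of _ N\<^sub>0] allI impI)
      fix N assume "N \<ge> N\<^sub>0"
      then have "s \<in> ball 0 (real N)" using N0 by simp
      from r(3) [OF this] show "norm (r N s - s) \<le> inverse (real (Suc N))" by (simp add: inverse_eq_divide)
    qed
  qed (rule LIMSEQ_inverse_real_of_nat)
  have "(\<lambda>N. LINT s|lborel. indicator (?B N) s *\<^sub>R (?g (r N s) * ?k s)) \<longlonglongrightarrow> (LINT s|lborel. ?g s * ?k s)"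
  proof (rule integral_dominated_convergence)
    show "integrable lborel (\<lambda>s. C * norm (?k s))" using ki by (intro integrable_mult_right integrable_norm)
    show "AE s in lborel. (\<lambda>N. indicator (?B N) s *\<^sub>R (?g (r N s) * ?k s)) \<longlonglongrightarrow> ?g s * ?k s"
    proof (rule AE_I2)
      fix s :: 'a
      have "isCont ?g s" using apu_continuous [OF g] by (simp add: continuous_on_eq_continuous_at)
      then have lim: "(\<lambda>N. ?g (r N s) * ?k s) \<longlonglongrightarrow> ?g s * ?k s"
        by (intro tendsto_mult_right isCont_tendsto_compose [OF _ r_lim])
      obtain N\<^sub>0 where "norm s < real N\<^sub>0" using reals_Archimedean2 by blast
      then have "\<forall>\<^sub>F N in sequentially. ?g (r N s) * ?k s = indicator (?B N) s *\<^sub>R (?g (r N s) * ?k s)"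
        unfolding eventually_sequentially by (intro exI [of _ N\<^sub>0]) (auto simp: indicator_def)
      with lim show "(\<lambda>N. indicator (?B N) s *\<^sub>R (?g (r N s) * ?k s)) \<longlonglongrightarrow> ?g s * ?k s"
        by (rule Lim_transform_eventually)
    qed
    show "AE s in lborel. norm (indicator (?B N) s *\<^sub>R (?g (r N s) * ?k s)) \<le> C * norm (?k s)" for N
      using C by (auto simp: indicator_def norm_mult intro!: mult_right_mono)
  qed measurable
  then have lim1: "(\<lambda>N. f (\<Phi> N)) \<longlonglongrightarrow> (LINT s|lborel. ?g s * ?k s)" by (simp only: f\<Phi>)
  have "(\<lambda>N. f (\<Phi> N)) \<longlonglongrightarrow> f ?\<Psi>"
  proof (rule LIMSEQ_I)
    fix \<epsilon> :: real assume \<epsilon>: "\<epsilon> > 0"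
    define \<epsilon>' where "\<epsilon>' = \<epsilon> / (2 * A)"
    have \<epsilon>': "\<epsilon>' > 0" using \<epsilon> A by (simp add: \<epsilon>'_def)
    \<comment> \<open>Each multi-index is treated separately. The seminorm involves only finitely
      many of them, so the eventual bounds can be combined afterwards.\<close>
    have ev: "\<forall>\<^sub>F N in sequentially. \<forall>x. (1 + norm x) ^ n * norm (partials bs (\<lambda>x. ?\<Psi> x - \<Phi> N x) x) \<le> \<epsilon>'"
      if bs: "set bs \<subseteq> Basis" for bs
    proof -
      \<comment> \<open>The sign accounts for the reflected argument in
        \<open>\<phi> (p - x)\<close>.\<close>
      let ?\<psi> = "\<lambda>x. (- 1) ^ length bs * partials bs \<phi> x"
      have \<psi>: "?\<psi> \<in> test_functions" by (intro test_functions_cmult test_functions_partials \<phi> bs)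
      have p1: "partials bs ?\<Psi> x = (LINT s|lborel. ?\<psi> (s - x) * ?k s)" for x
        by (simp only: partials_fourier_mult [OF \<phi> \<eta> bs] fourier_fourier_mult' [OF \<psi> \<eta>])
      have p2: "partials bs (\<Phi> N) x = (LINT s|lborel. indicator (?B N) s *\<^sub>R (?\<psi> (r N s - x) * ?k s))" for N x
      proof -
        have "partials bs (\<lambda>x. \<Sum>p\<in>P. w N p * \<phi> (p - x)) = (\<lambda>x. \<Sum>p\<in>P. w N p * ?\<psi> (p - x))" if "finite P" for P
          using that
        proof (induction P)
          case empty
          have "partials bs (\<lambda>x::'a. 0 * (0::complex)) = (\<lambda>x. 0 * partials bs (\<lambda>x. 0) x)"
            by (rule partials_cmult) (use bs in auto)
          then show ?case by simp
        next
          case (insert p P)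
          have s1: "smooth (\<lambda>x. w N p * \<phi> (p - x))" "smooth (\<lambda>x. \<phi> (p - x))"
            "smooth (\<lambda>x. \<Sum>p\<in>P. w N p * \<phi> (p - x))"
            by (intro test_functions_smooth test_functions_sum test_functions_cmult test_functions_reflect \<phi>)+
          have "partials bs (\<lambda>x. \<phi> (p - x)) = (\<lambda>x. ?\<psi> (p - x))"
            using partials_affine [OF test_functions_smooth [OF \<phi>] bs, of "- 1" p] by simp
          with insert s1 show ?case
            by (simp add: partials_add [OF s1(1,3) bs] partials_cmult [OF s1(2) bs])
        qed
        from this [OF r(2) [of N]] show ?thesis
          unfolding \<Phi>_def [abs_def] by (simp only: w [of N "\<lambda>p. ?\<psi> (p - x)"])
      qed
      have "partials bs (\<lambda>x. ?\<Psi> x - \<Phi> N x) x = partials bs ?\<Psi> x - partials bs (\<Phi> N) x" for N x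
        using partials_add [OF fourier_smooth [OF \<Psi>t] smooth_mult [OF smooth_const test_functions_smooth [OF \<Phi>t]] bs, of "- 1" N]
          partials_cmult [OF test_functions_smooth [OF \<Phi>t] bs, of "- 1" N] by simp
      then show ?thesis
        unfolding p1 p2 using riemann_sum_weighted [OF \<psi> fourier_measurable [OF \<eta>] kn ki r(1,3) \<epsilon>'] by simp
    qed
    let ?L = "{bs :: 'a list. set bs \<subseteq> Basis \<and> length bs \<le> m}"
    have "\<forall>\<^sub>F N in sequentially. \<forall>bs\<in>?L. \<forall>x. (1 + norm x) ^ n * norm (partials bs (\<lambda>x. ?\<Psi> x - \<Phi> N x) x) \<le> \<epsilon>'"
      by (rule eventually_ball_finite) (use finite_lists_length_le [of Basis m] ev in auto)
    then have "\<forall>\<^sub>F N in sequentially. norm (f (\<Phi> N) - f ?\<Psi>) < \<epsilon>"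
    proof eventually_elim
      case (elim N)
      have s: "?\<Psi> \<in> schwartz_space" "\<Phi> N \<in> schwartz_space"
        by (intro fourier_schwartz \<Psi>t test_imp_schwartz \<Phi>t)+
      have "schwartz_le n m (\<lambda>x. ?\<Psi> x - \<Phi> N x) \<epsilon>'" unfolding schwartz_le_def using elim by blast
      then have "norm (f (\<lambda>x. ?\<Psi> x - \<Phi> N x)) \<le> A * \<epsilon>'" by (intro A(2) schwartz_diff s)
      also have "\<dots> < \<epsilon>" using A \<epsilon> by (simp add: \<epsilon>'_def)
      finally show ?case by (simp add: temperate_diff [OF f s] norm_minus_commute)
    qed
    then show "\<exists>no. \<forall>N\<ge>no. norm (f (\<Phi> N) - f ?\<Psi>) < \<epsilon>" by (simp add: eventually_sequentially)
  qed
  with lim1 show ?thesis using LIMSEQ_unique by blast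
qed

lemma fourier_translate:
  assumes "\<phi> \<in> test_functions"
  shows "fourier (\<lambda>x. \<phi> (t + x)) y = fourier \<phi> y * ec (y \<bullet> t)"
proof -
  have [measurable]: "\<phi> \<in> borel_measurable borel" by (rule test_functions_measurable [OF assms])
  have "fourier \<phi> y = (LINT x|lborel. \<phi> (t + x) * ec (- ((t + x) \<bullet> y)))"
    unfolding fourier_ec by (rule lborel_integral_translate [symmetric]) simp
  also have "\<dots> * ec (y \<bullet> t) = (LINT x|lborel. \<phi> (t + x) * ec (- (x \<bullet> y)))"
    unfolding integral_mult_left_zero [symmetric]
    by (intro Bochner_Integration.integral_cong refl)
       (simp add: mult.assoc ec_add [symmetric] inner_add_left inner_add_right inner_commute algebra_simps)
  finally show ?thesis by (simp add: fourier_ec)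
qed

lemma temperate_fourier_conv_translate:
  fixes f :: "('a::euclidean_space \<Rightarrow> complex) \<Rightarrow> complex"
  assumes f: "temperate f" and ap: "almost_periodic_dist f" and \<phi>: "\<phi> \<in> test_functions" and \<eta>: "\<eta> \<in> test_functions"
  shows "f (fourier (\<lambda>y. fourier \<phi> y * \<eta> y * ec (y \<bullet> t))) = (LINT s|lborel. conv f \<phi> (t + s) * fourier \<eta> s)"
proof -
  let ?\<phi> = "\<lambda>x. \<phi> (t + x)"
  have t: "?\<phi> \<in> test_functions" by (rule test_functions_translate [OF \<phi>])
  have "apu (conv f ?\<phi>)" using ap t by (auto simp: almost_periodic_dist_def intro: almost_periodic_imp_apu)
  from temperate_fourier_conv [OF f t \<eta> this]
  show ?thesis by (simp add: fourier_translate [OF \<phi>] conv_def add_diff_eq mult_ac)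
qed

lemma almost_periodic_dist_apu:
  "almost_periodic_dist f \<Longrightarrow> \<phi> \<in> test_functions \<Longrightarrow> apu (conv f \<phi>)"
  by (auto simp: almost_periodic_dist_def intro: almost_periodic_imp_apu)

text \<open>Averaging against \<open>fourier \<eta>\<close> multiplies the coefficient at
  \<open>\<xi>\<close> by the inverse transform of \<open>fourier \<eta>\<close>, which Fourier
  inversion identifies with \<open>\<eta> \<xi>\<close>.\<close>

lemma
  fixes f :: "('a::euclidean_space \<Rightarrow> complex) \<Rightarrow> complex"
  assumes f: "temperate f" and ap: "almost_periodic_dist f" and \<phi>: "\<phi> \<in> test_functions" and \<eta>: "\<eta> \<in> test_functions"
  defines "u \<equiv> \<lambda>t. f (fourier (\<lambda>y. fourier \<phi> y * \<eta> y * ec (y \<bullet> t)))"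
  shows apu_regularised: "apu u"
    and mean_coeff_regularised: "mean_coeff \<xi> u = mean_coeff \<xi> (conv f \<phi>) * \<eta> \<xi>"
proof -
  have g: "apu (conv f \<phi>)" by (rule almost_periodic_dist_apu [OF ap \<phi>])
  have u: "u = (\<lambda>t. LINT s|lborel. conv f \<phi> (t + s) * fourier \<eta> s)"
    unfolding u_def by (intro ext temperate_fourier_conv_translate assms)
  show "apu u" unfolding u by (rule apu_conv [OF g fourier_integrable [OF \<eta>]])
  show "mean_coeff \<xi> u = mean_coeff \<xi> (conv f \<phi>) * \<eta> \<xi>"
    unfolding u by (simp add: mean_coeff_conv [OF g fourier_integrable [OF \<eta>]] fourier_inversion [OF \<eta>])
qed

section \<open>Bump functions and the coefficients of a distribution\<close>

lemma bump_exists: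
  assumes "\<delta> > 0"
  obtains \<beta> :: "'a::euclidean_space \<Rightarrow> real" where "(\<lambda>x. complex_of_real (\<beta> x)) \<in> test_functions"
    "\<And>x. \<beta> x \<ge> 0" "\<And>x. \<beta> x > 0 \<longleftrightarrow> norm x < \<delta>" "integrable lborel \<beta>" "(LINT x|lborel. \<beta> x) = 1"
proof -
  define \<beta> :: "'a \<Rightarrow> real" where "\<beta> x = flat 0 (\<delta>\<^sup>2 - x \<bullet> x)" for x
  have pos: "\<beta> x > 0 \<longleftrightarrow> norm x < \<delta>" and nn: "\<beta> x \<ge> 0" for x
    using assms power_mono_iff [of \<delta> "norm x" 2]
    by (auto simp: \<beta>_def flat_def power2_norm_eq_inner [symmetric] not_le [symmetric])
  have t: "(\<lambda>x. complex_of_real (\<beta> x)) \<in> test_functions"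
    unfolding test_functions_iff
  proof (intro conjI exI [of _ \<delta>] allI impI)
    show "smooth (\<lambda>x. complex_of_real (\<beta> x))" unfolding \<beta>_def by (rule smooth_flat)
    show "complex_of_real (\<beta> x) = 0" if "\<delta> < norm x" for x
      using pos [of x] nn [of x] that by simp
  qed (rule assms)
  have i: "integrable lborel \<beta>" using integrable_Re [OF test_functions_integrable [OF t]] by simp
  have "(LINT x|lborel. \<beta> x) \<noteq> 0"
  proof
    assume "(LINT x|lborel. \<beta> x) = 0"
    then have "AE x in lborel. \<beta> x = 0" using integral_nonneg_eq_0_iff_AE [OF i] nn by simp
    then have "AE x in lborel. x \<notin> ball (0::'a) \<delta>" by (rule AE_mp) (rule AE_I2, metis pos less_irrefl mem_ball_0)
    then have "ball (0::'a) \<delta> \<in> null_sets lborel" by (subst AE_iff_null_sets) auto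
    then have "measure lborel (ball (0::'a) \<delta>) = 0" by (simp add: measure_eq_0_null_sets)
    then show False using measure_ball [of \<delta> "0::'a"] bvol_pos [OF assms, where 'a='a] assms by simp
  qed
  moreover have "(LINT x|lborel. \<beta> x) \<ge> 0" using nn by simp
  ultimately have I: "(LINT x|lborel. \<beta> x) > 0" by simp
  show ?thesis
  proof (rule that [of "\<lambda>x. \<beta> x / (LINT x|lborel. \<beta> x)"])
    show "(\<lambda>x. complex_of_real (\<beta> x / (LINT x|lborel. \<beta> x))) \<in> test_functions"
      using test_functions_cmult [OF t, of "1 / of_real (LINT x|lborel. \<beta> x)"] by simp
  qed (use I nn pos i in \<open>auto simp: zero_less_divide_iff\<close>)
qed

text \<open>The character deviates from 1 by at most \<open>2 * pi * norm \<xi> * \<delta>\<close>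
  on the support, and \<open>\<beta>\<close> has mass 1. The explicit rate is used for removing the
  regularisation and for lower bounds of the transform.\<close>

lemma fourier_bump_near:
  fixes \<beta> :: "'a::euclidean_space \<Rightarrow> real"
  assumes t: "(\<lambda>x. complex_of_real (\<beta> x)) \<in> test_functions" and nn: "\<And>x. \<beta> x \<ge> 0"
    and supp: "\<And>x. \<beta> x > 0 \<longleftrightarrow> norm x < \<delta>" and i: "integrable lborel \<beta>" and one: "(LINT x|lborel. \<beta> x) = 1"
  shows "norm (fourier (\<lambda>x. of_real (\<beta> x)) \<xi> - 1) \<le> 2 * pi * norm \<xi> * \<delta>"
proof -
  let ?b = "\<lambda>x. complex_of_real (\<beta> x)"
  have ib: "integrable lborel (\<lambda>x. ?b x * ec (- (x \<bullet> \<xi>)))" "integrable lborel ?b"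
    using i by (auto intro!: integrable_mult_ec)
  have "fourier ?b \<xi> - 1 = (LINT x|lborel. ?b x * ec (- (x \<bullet> \<xi>))) - (LINT x|lborel. ?b x)"
    by (simp add: fourier_ec one)
  also have "\<dots> = (LINT x|lborel. ?b x * (ec (- (x \<bullet> \<xi>)) - ec 0))"
    using ib by (simp add: right_diff_distrib)
  also have "norm \<dots> \<le> (LINT x|lborel. (2 * pi * norm \<xi> * \<delta>) * \<beta> x)"
  proof (rule Bochner_Integration.integral_norm_bound_integral)
    show "integrable lborel (\<lambda>x. ?b x * (ec (- (x \<bullet> \<xi>)) - ec 0))" using ib by (simp add: right_diff_distrib)
    show "integrable lborel (\<lambda>x. (2 * pi * norm \<xi> * \<delta>) * \<beta> x)" using i by simp
    fix x
    show "norm (?b x * (ec (- (x \<bullet> \<xi>)) - ec 0)) \<le> (2 * pi * norm \<xi> * \<delta>) * \<beta> x"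
    proof (cases "norm x < \<delta>")
      case True
      have "norm (ec (- (x \<bullet> \<xi>)) - ec 0) \<le> 2 * pi * \<bar>x \<bullet> \<xi>\<bar>" using norm_ec_diff_le [of "- (x \<bullet> \<xi>)" 0] by simp
      also have "\<dots> \<le> 2 * pi * (norm x * norm \<xi>)" by (intro mult_left_mono Cauchy_Schwarz_ineq2) auto
      also have "\<dots> \<le> 2 * pi * (\<delta> * norm \<xi>)" using True by (intro mult_left_mono mult_right_mono) auto
      finally have "\<beta> x * norm (ec (- (x \<bullet> \<xi>)) - ec 0) \<le> \<beta> x * (2 * pi * (\<delta> * norm \<xi>))"
        by (intro mult_left_mono nn)
      then show ?thesis using nn [of x] by (simp add: norm_mult mult_ac)
    next
      case False
      then have "\<beta> x = 0" using supp [of x] nn [of x] by simp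
      then show ?thesis by simp
    qed
  qed
  also have "\<dots> = 2 * pi * norm \<xi> * \<delta>" by (simp add: one)
  finally show ?thesis .
qed

lemma test_function_fourier_nonzero:
  "\<exists>\<phi>\<in>test_functions. fourier \<phi> (\<xi>::'a::euclidean_space) \<noteq> 0"
proof -
  \<comment> \<open>Makes the deviation from 1 at most one half. The added 1 in the denominator
    covers \<open>\<xi> = 0\<close>.\<close>
  define \<delta> where "\<delta> = 1 / (2 * pi * norm \<xi> + 1) / 2"
  have p: "2 * pi * norm \<xi> + 1 > 0" by (intro add_nonneg_pos) auto
  then have \<delta>: "\<delta> > 0" by (simp add: \<delta>_def)
  obtain \<beta> :: "'a \<Rightarrow> real" where \<beta>: "(\<lambda>x. complex_of_real (\<beta> x)) \<in> test_functions"
    "\<And>x. \<beta> x \<ge> 0" "\<And>x. \<beta> x > 0 \<longleftrightarrow> norm x < \<delta>" "integrable lborel \<beta>" "(LINT x|lborel. \<beta> x) = 1"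
    using bump_exists [OF \<delta>] by metis
  have "norm (fourier (\<lambda>x. of_real (\<beta> x)) \<xi> - 1) \<le> 2 * pi * norm \<xi> * \<delta>" by (rule fourier_bump_near [OF \<beta>])
  also have "\<dots> \<le> (2 * pi * norm \<xi> + 1) * \<delta>" using \<delta> by (intro mult_right_mono) auto
  also have "\<dots> = 1 / 2" using p by (simp add: \<delta>_def)
  finally have "fourier (\<lambda>x. complex_of_real (\<beta> x)) \<xi> \<noteq> 0" by auto
  with \<beta>(1) show ?thesis by blast
qed

text \<open>Independence of the choice of \<open>\<phi>\<^sub>0\<close> follows from a symmetry:
  regularising with \<open>\<phi>\<close> and the multiplier
  \<open>fourier \<phi>\<^sub>0 y * \<eta> y\<close> gives the same function as regularising with
  \<open>\<phi>\<^sub>0\<close> and \<open>fourier \<phi> y * \<eta> y\<close>. Comparison of the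
  two expressions for its coefficient yields the proportionality.\<close>

lemma mean_coeff_conv_dist:
  fixes f :: "('a::euclidean_space \<Rightarrow> complex) \<Rightarrow> complex"
  assumes f: "temperate f" and ap: "almost_periodic_dist f" and \<phi>: "\<phi> \<in> test_functions"
  shows "mean_coeff \<xi> (conv f \<phi>) = fourier_coeff \<xi> f * fourier \<phi> \<xi>"
proof -
  define \<phi>\<^sub>0 where "\<phi>\<^sub>0 = (SOME \<phi>. \<phi> \<in> test_functions \<and> fourier \<phi> \<xi> \<noteq> 0)"
  have "\<exists>\<phi>. \<phi> \<in> test_functions \<and> fourier \<phi> \<xi> \<noteq> 0" using test_function_fourier_nonzero [of \<xi>] by blast
  then have \<phi>0: "\<phi>\<^sub>0 \<in> test_functions" "fourier \<phi>\<^sub>0 \<xi> \<noteq> 0"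
    unfolding \<phi>\<^sub>0_def by (metis (mono_tags, lifting) someI_ex)+
  have a: "fourier_coeff \<xi> f = mean_coeff \<xi> (conv f \<phi>\<^sub>0) / fourier \<phi>\<^sub>0 \<xi>"
    by (simp add: fourier_coeff_def \<phi>\<^sub>0_def Let_def)
  obtain \<beta> :: "'a \<Rightarrow> real" where \<beta>: "(\<lambda>x. complex_of_real (\<beta> x)) \<in> test_functions" "\<And>x. \<beta> x > 0 \<longleftrightarrow> norm x < 1"
    using bump_exists [of 1, where 'a='a] zero_less_one by metis
  \<comment> \<open>The cut-off around \<open>\<xi>\<close> makes both multipliers test functions,
    and its value at \<open>\<xi>\<close> is nonzero and cancels.\<close>
  define \<eta> where "\<eta> y = complex_of_real (\<beta> (- \<xi> + y))" for y
  have \<eta>: "\<eta> \<in> test_functions" unfolding \<eta>_def [abs_def] by (rule test_functions_translate [OF \<beta>(1)])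
  have \<eta>\<xi>: "\<eta> \<xi> \<noteq> 0" using \<beta>(2) [of 0] by (simp add: \<eta>_def)
  have t: "(\<lambda>y. fourier \<psi> y * \<eta> y) \<in> test_functions" if "\<psi> \<in> test_functions" for \<psi>
    by (intro test_functions_mult_smooth(1) \<eta> fourier_smooth that)
  have "mean_coeff \<xi> (conv f \<phi>) * (fourier \<phi>\<^sub>0 \<xi> * \<eta> \<xi>) = mean_coeff \<xi> (conv f \<phi>\<^sub>0) * (fourier \<phi> \<xi> * \<eta> \<xi>)"
    using mean_coeff_regularised [OF f ap \<phi> t [OF \<phi>0(1)], of \<xi>] mean_coeff_regularised [OF f ap \<phi>0(1) t [OF \<phi>], of \<xi>]
    by (simp add: mult_ac)
  then show ?thesis using \<phi>0(2) \<eta>\<xi> by (simp add: a field_simps)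
qed

section \<open>Absolutely convergent exponential sums\<close>

lemma infsum_tail_le:
  fixes c :: "'b \<Rightarrow> complex"
  assumes c: "(\<lambda>x. norm (c x)) summable_on UNIV" and \<epsilon>: "\<epsilon> > 0"
  obtains F where "finite F" "\<And>F'. finite F' \<Longrightarrow> F \<subseteq> F' \<Longrightarrow> infsum (\<lambda>x. norm (c x)) (- F') \<le> \<epsilon>"
proof -
  obtain F where F: "finite F" "dist (sum (\<lambda>x. norm (c x)) F) (infsum (\<lambda>x. norm (c x)) UNIV) \<le> \<epsilon>"
    using infsum_finite_approximation [OF c \<epsilon>] by blast
  have "infsum (\<lambda>x. norm (c x)) (- F') \<le> \<epsilon>" if F': "finite F'" "F \<subseteq> F'" for F'
  proof -
    have "infsum (\<lambda>x. norm (c x)) (- F') = infsum (\<lambda>x. norm (c x)) UNIV - sum (\<lambda>x. norm (c x)) F'"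
      using infsum_Diff [OF c, of F'] F' by (simp add: Compl_eq_Diff_UNIV)
    moreover have "sum (\<lambda>x. norm (c x)) F' \<ge> sum (\<lambda>x. norm (c x)) F" using F' by (intro sum_mono2) auto
    ultimately show ?thesis using F(2) unfolding dist_real_def by linarith
  qed
  with F(1) show ?thesis using that by blast
qed

text \<open>Finite partial sums approximate \<open>h\<close> uniformly with error at most the tail
  of the absolute series, and both almost periodicity and the coefficients are stable under uniform
  approximation.\<close>

lemma
  fixes c :: "'a::euclidean_space \<Rightarrow> complex"
  assumes c: "(\<lambda>\<xi>. norm (c \<xi>)) summable_on UNIV"
  defines "h \<equiv> \<lambda>t. infsum (\<lambda>\<xi>. c \<xi> * ec (\<xi> \<bullet> t)) UNIV"
  shows apu_exponential_sum: "apu h" and mean_coeff_exponential_sum: "mean_coeff \<xi> h = c \<xi>"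
proof -
  let ?s = "\<lambda>F t. \<Sum>\<xi>\<in>F. c \<xi> * ec (\<xi> \<bullet> t)"
  have s: "apu (?s F)" for F by (intro apu_sum apu_cmult apu_ec)
  have approx: "norm (h t - ?s F t) \<le> infsum (\<lambda>\<xi>. norm (c \<xi>)) (- F)" if F: "finite F" for F t
  proof -
    have n: "(\<lambda>\<xi>. norm (c \<xi> * ec (\<xi> \<bullet> t))) summable_on A" for A
      using summable_on_subset_banach [OF c, of A] by (simp add: norm_mult)
    have "h t - ?s F t = infsum (\<lambda>\<xi>. c \<xi> * ec (\<xi> \<bullet> t)) (- F)"
      unfolding h_def Compl_eq_Diff_UNIV using F abs_summable_summable [OF n]
      by (subst infsum_Diff) auto
    also have "norm \<dots> \<le> infsum (\<lambda>\<xi>. norm (c \<xi> * ec (\<xi> \<bullet> t))) (- F)" by (rule norm_infsum_bound [OF n])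
    finally show ?thesis by (simp add: norm_mult)
  qed
  show h: "apu h"
  proof (rule apu_uniform_limit)
    fix \<epsilon> :: real assume "\<epsilon> > 0"
    then obtain F where F: "finite F" "\<And>F'. finite F' \<Longrightarrow> F \<subseteq> F' \<Longrightarrow> infsum (\<lambda>x. norm (c x)) (- F') \<le> \<epsilon>"
      using infsum_tail_le [OF c] by metis
    show "\<exists>k. apu k \<and> (\<forall>x. norm (h x - k x) \<le> \<epsilon>)"
      using order_trans [OF approx [OF F(1)] F(2) [OF F(1) order_refl]] s [of F] by (intro exI [of _ "?s F"]) simp
  qed
  have "norm (mean_coeff \<xi> h - c \<xi>) \<le> \<epsilon>" if \<epsilon>: "\<epsilon> > 0" for \<epsilon>
  proof -
    obtain F where F: "finite F" "\<And>F'. finite F' \<Longrightarrow> F \<subseteq> F' \<Longrightarrow> infsum (\<lambda>x. norm (c x)) (- F') \<le> \<epsilon>"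
      using infsum_tail_le [OF c \<epsilon>] by metis
    \<comment> \<open>Adding \<open>\<xi>\<close> ensures that the coefficient of the finite sum at
      \<open>\<xi>\<close> is exactly \<open>c \<xi>\<close>.\<close>
    let ?F = "insert \<xi> F"
    have "mean_coeff \<xi> (?s ?F) = (\<Sum>\<eta>\<in>?F. if \<xi> = \<eta> then c \<eta> else 0)"
      by (subst mean_coeff_sum)
         (auto simp: mean_coeff_cmult [OF apu_ec] mean_coeff_ec intro!: apu_cmult apu_ec sum.cong)
    also have "\<dots> = c \<xi>" using F(1) by (subst sum.delta') auto
    finally have "mean_coeff \<xi> h - c \<xi> = mean_coeff \<xi> (\<lambda>t. h t - ?s ?F t)"
      by (simp only: mean_coeff_diff [OF h s])
    also have "norm \<dots> \<le> \<epsilon>"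
      using F by (intro mean_coeff_le apu_diff h s order_trans [OF approx]) auto
    finally show ?thesis .
  qed
  then have "norm (mean_coeff \<xi> h - c \<xi>) \<le> 0 + \<epsilon>" if "\<epsilon> > 0" for \<epsilon> using that by simp
  then have "norm (mean_coeff \<xi> h - c \<xi>) \<le> 0" by (rule field_le_epsilon)
  then show "mean_coeff \<xi> h = c \<xi>" by simp
qed

lemma test_times_coeff_summable:
  fixes f :: "('a::euclidean_space \<Rightarrow> complex) \<Rightarrow> complex"
  assumes sum: "\<And>R. (\<lambda>\<xi>. norm (fourier_coeff \<xi> f)) summable_on {\<xi> \<in> dist_spectrum f. norm \<xi> < R}"
    and \<eta>: "\<eta> \<in> test_functions"
  shows "(\<lambda>\<xi>. norm (fourier_coeff \<xi> f * \<eta> \<xi>)) summable_on UNIV"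
proof -
  obtain R where R: "R > 0" "\<And>x. norm x > R \<Longrightarrow> \<eta> x = 0" using \<eta> by (auto simp: test_functions_iff)
  obtain M where M: "M > 0" "\<And>x. norm (\<eta> x) \<le> M" using test_functions_bounded [OF \<eta>] by metis
  \<comment> \<open>The radius exceeds \<open>R\<close> because the inequality here is strict, while
    \<open>\<eta>\<close> is known to vanish only where \<open>norm x > R\<close>.\<close>
  let ?S = "{\<xi> \<in> dist_spectrum f. norm \<xi> < R + 1}"
  have "(\<lambda>\<xi>. norm (fourier_coeff \<xi> f * \<eta> \<xi>)) summable_on ?S"
  proof (rule summable_on_comparison_test)
    show "(\<lambda>\<xi>. norm (fourier_coeff \<xi> f) * M) summable_on ?S" by (rule summable_on_cmult_left [OF sum])
  qed (auto simp: norm_mult intro!: mult_left_mono M)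
  moreover have "(\<lambda>\<xi>. norm (fourier_coeff \<xi> f * \<eta> \<xi>)) summable_on ?S \<longleftrightarrow> (\<lambda>\<xi>. norm (fourier_coeff \<xi> f * \<eta> \<xi>)) summable_on UNIV"
    using R by (intro summable_on_cong_neutral) (auto simp: dist_spectrum_def)
  ultimately show ?thesis by simp
qed

lemma regularised_eq_sum:
  fixes f :: "('a::euclidean_space \<Rightarrow> complex) \<Rightarrow> complex"
  assumes f: "temperate f" and ap: "almost_periodic_dist f"
    and sum: "\<And>R. (\<lambda>\<xi>. norm (fourier_coeff \<xi> f)) summable_on {\<xi> \<in> dist_spectrum f. norm \<xi> < R}"
    and \<phi>: "\<phi> \<in> test_functions" and \<eta>: "\<eta> \<in> test_functions"
  shows "f (fourier (\<lambda>y. fourier \<phi> y * \<eta> y)) = infsum (\<lambda>\<xi>. fourier_coeff \<xi> f * (fourier \<phi> \<xi> * \<eta> \<xi>)) UNIV"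
proof -
  let ?c = "\<lambda>\<xi>. fourier_coeff \<xi> f * (fourier \<phi> \<xi> * \<eta> \<xi>)"
  let ?u = "\<lambda>t. f (fourier (\<lambda>y. fourier \<phi> y * \<eta> y * ec (y \<bullet> t)))"
  let ?h = "\<lambda>t. infsum (\<lambda>\<xi>. ?c \<xi> * ec (\<xi> \<bullet> t)) UNIV"
  have c: "(\<lambda>\<xi>. norm (?c \<xi>)) summable_on UNIV"
    by (intro test_times_coeff_summable sum test_functions_mult_smooth(1) \<eta> fourier_smooth \<phi>)
  note u = apu_regularised [OF f ap \<phi> \<eta>]
  note h = apu_exponential_sum [OF c]
  have "mean_coeff \<xi> (\<lambda>t. ?u t - ?h t) = 0" for \<xi>
    unfolding mean_coeff_diff [OF u h] mean_coeff_regularised [OF f ap \<phi> \<eta>]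
      mean_coeff_exponential_sum [OF c] mean_coeff_conv_dist [OF f ap \<phi>] by (simp add: mult.assoc)
  from apu_eq_zero [OF apu_diff [OF u h] this, of 0] show ?thesis by simp
qed

section \<open>Removing the regularisation\<close>

lemma foldr_coord_mult: "foldr coord_mult bs (\<lambda>y. g y * \<eta> y) = (\<lambda>y. g y * foldr coord_mult bs \<eta> y)"
  by (induction bs) (auto simp: coord_mult_def fun_eq_iff)

lemma coord_mult_expand:
  fixes h :: "'a::euclidean_space"
  shows "coord_mult h \<phi> = (\<lambda>x. \<Sum>b\<in>Basis. of_real (h \<bullet> b) * coord_mult b \<phi> x)"
proof
  fix x
  have "x \<bullet> h = (\<Sum>b\<in>Basis. (h \<bullet> b) * (x \<bullet> b))" by (subst euclidean_inner) (simp add: mult.commute)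
  then show "coord_mult h \<phi> x = (\<Sum>b\<in>Basis. of_real (h \<bullet> b) * coord_mult b \<phi> x)"
    by (simp add: coord_mult_def sum_distrib_left sum_distrib_right mult_ac sum_negf)
qed

text \<open>Mean value inequality on the unit ball around \<open>x\<close>, where the weights at
  \<open>z\<close> and \<open>x\<close> differ by at most the factor \<open>2 ^ n\<close>. The
  derivative is again the transform of a test function and decays.\<close>

lemma fourier_weighted_lipschitz:
  fixes \<phi> :: "'a::euclidean_space \<Rightarrow> complex"
  assumes \<phi>: "\<phi> \<in> test_functions"
  shows "\<exists>C\<ge>0. \<forall>x r. norm r \<le> 1 \<longrightarrow> (1 + norm x) ^ n * norm (fourier \<phi> (r + x) - fourier \<phi> x) \<le> C * norm r"
proof -
  have "\<exists>c. \<forall>y. (1 + norm y) ^ n * norm (fourier (coord_mult b \<phi>) y) \<le> c" for b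
    by (intro fourier_decay coord_mult_test \<phi>)
  then obtain c where c: "\<And>b y. (1 + norm y) ^ n * norm (fourier (coord_mult b \<phi>) y) \<le> c b" by metis
  define K where "K = (\<Sum>b\<in>(Basis::'a set). c b)"
  have "c b \<ge> 0" for b using c [of 0 b] by (rule order_trans [rotated]) simp
  then have K: "K \<ge> 0" by (simp add: K_def sum_nonneg)
  have D: "(1 + norm z) ^ n * norm (fourier (coord_mult h \<phi>) z) \<le> K * norm h" for h z
  proof -
    have "fourier (coord_mult h \<phi>) z = (\<Sum>b\<in>Basis. of_real (h \<bullet> b) * fourier (coord_mult b \<phi>) z)"
      by (subst coord_mult_expand, subst fourier_sum)
         (auto simp: fourier_cmult intro!: test_functions_integrable test_functions_cmult coord_mult_test \<phi>)
    then have "norm (fourier (coord_mult h \<phi>) z) \<le> (\<Sum>b\<in>Basis. \<bar>h \<bullet> b\<bar> * norm (fourier (coord_mult b \<phi>) z))"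
      by (simp add: norm_mult order_trans [OF norm_sum])
    also have "\<dots> \<le> (\<Sum>b\<in>Basis. norm h * norm (fourier (coord_mult b \<phi>) z))"
      by (intro sum_mono mult_right_mono) (auto intro: Basis_le_norm)
    finally have "(1 + norm z) ^ n * norm (fourier (coord_mult h \<phi>) z) \<le>
        (1 + norm z) ^ n * (\<Sum>b\<in>Basis. norm h * norm (fourier (coord_mult b \<phi>) z))"
      by (intro mult_left_mono) auto
    also have "\<dots> = norm h * (\<Sum>b\<in>Basis. (1 + norm z) ^ n * norm (fourier (coord_mult b \<phi>) z))"
      by (simp add: sum_distrib_left mult_ac)
    also have "\<dots> \<le> norm h * K" unfolding K_def by (intro mult_left_mono sum_mono c) auto
    finally show ?thesis by (simp add: mult.commute)
  qed
  have "(1 + norm x) ^ n * norm (fourier \<phi> (r + x) - fourier \<phi> x) \<le> (2 ^ n * K) * norm r" if r: "norm r \<le> 1" for x r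
  proof -
    have pos: "(1 + norm x) ^ n > 0" by (intro zero_less_power) (simp add: add_pos_nonneg)
    have "norm (fourier \<phi> (r + x) - fourier \<phi> x) \<le> (2 ^ n * K / (1 + norm x) ^ n) * norm ((r + x) - x)"
    proof (rule differentiable_bound [of "cball x 1" _ "\<lambda>z h. fourier (coord_mult h \<phi>) z"])
      show "(fourier \<phi> has_derivative (\<lambda>h. fourier (coord_mult h \<phi>) z)) (at z within cball x 1)" for z
        by (rule has_derivative_at_withinI [OF fourier_has_derivative [OF \<phi>]])
      fix z assume "z \<in> cball x 1"
      then have "norm (z - x) \<le> 1" by (simp add: dist_norm norm_minus_commute)
      then have w: "(1 + norm x) ^ n \<le> (1 + 1) ^ n * (1 + norm z) ^ n" by (intro weight_le) auto
      show "onorm (\<lambda>h. fourier (coord_mult h \<phi>) z) \<le> 2 ^ n * K / (1 + norm x) ^ n"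
      proof (rule onorm_le)
        fix h :: 'a
        have "(1 + norm x) ^ n * norm (fourier (coord_mult h \<phi>) z) \<le> 2 ^ n * (1 + norm z) ^ n * norm (fourier (coord_mult h \<phi>) z)"
          using w by (intro mult_right_mono) auto
        also have "\<dots> \<le> 2 ^ n * (K * norm h)" using D [of z h] by (simp add: mult.assoc)
        finally show "norm (fourier (coord_mult h \<phi>) z) \<le> 2 ^ n * K / (1 + norm x) ^ n * norm h"
          using pos by (simp add: field_simps)
      qed
    qed (use r in \<open>auto simp: dist_norm\<close>)
    then show ?thesis using pos by (simp add: field_simps)
  qed
  with K show ?thesis by (intro exI [of _ "2 ^ n * K"]) auto
qed

text \<open>The transform of the product at \<open>x\<close> is the mean of
  \<open>fourier \<eta> (r + x)\<close> with respect to the density \<open>\<beta> r\<close>, hence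
  within order \<open>\<delta>\<close> of \<open>fourier \<eta>\<close> in every weighted seminorm.
  The constant \<open>K\<close> is fixed before \<open>\<beta>\<close>, so that
  \<open>\<delta>\<close> can tend to 0 afterwards.\<close>

lemma regularised_near:
  fixes f :: "('a::euclidean_space \<Rightarrow> complex) \<Rightarrow> complex"
  assumes f: "temperate f" and \<eta>: "\<eta> \<in> test_functions"
  shows "\<exists>K\<ge>0. \<forall>\<delta> \<beta>. \<delta> \<le> 1 \<longrightarrow> (\<lambda>x. complex_of_real (\<beta> x)) \<in> test_functions \<longrightarrow> (\<forall>x. \<beta> x \<ge> 0) \<longrightarrow>
    (\<forall>x. \<beta> x > 0 \<longleftrightarrow> norm x < \<delta>) \<longrightarrow> integrable lborel \<beta> \<longrightarrow> (LINT x|lborel. \<beta> x) = 1 \<longrightarrow>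
    norm (f (fourier (\<lambda>y. fourier (\<lambda>x. of_real (\<beta> x)) y * \<eta> y)) - f (fourier \<eta>)) \<le> K * \<delta>"
proof -
  obtain A n m where A: "A > 0" "\<And>\<phi> c. \<phi> \<in> schwartz_space \<Longrightarrow> schwartz_le n m \<phi> c \<Longrightarrow> norm (f \<phi>) \<le> A * c"
    using temperate_bound [OF f] by metis
  have "\<exists>C\<ge>0. \<forall>x r. norm r \<le> 1 \<longrightarrow> (1 + norm x) ^ n * norm (partials bs (fourier \<eta>) (r + x) - partials bs (fourier \<eta>) x) \<le> C * norm r" for bs :: "'a list"
    unfolding fourier_partials(1) [OF \<eta>] by (intro fourier_weighted_lipschitz fourier_partials(2) \<eta>)
  then obtain C where C: "\<And>bs :: 'a list. C bs \<ge> 0"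
    "\<And>(bs :: 'a list) x r. norm r \<le> 1 \<Longrightarrow> (1 + norm x) ^ n * norm (partials bs (fourier \<eta>) (r + x) - partials bs (fourier \<eta>) x) \<le> C bs * norm r"
    by metis
  let ?L = "{bs :: 'a list. set bs \<subseteq> Basis \<and> length bs \<le> m}"
  have fin: "finite ?L" by (rule finite_lists_length_le) simp
  define K where "K = (\<Sum>bs\<in>?L. C bs)"
  have K: "K \<ge> 0" "\<And>bs. bs \<in> ?L \<Longrightarrow> C bs \<le> K"
    using C(1) fin by (auto simp: K_def intro!: sum_nonneg member_le_sum)
  have "norm (f (fourier (\<lambda>y. fourier (\<lambda>x. of_real (\<beta> x)) y * \<eta> y)) - f (fourier \<eta>)) \<le> A * K * \<delta>"
    if \<delta>: "\<delta> \<le> 1" and t: "(\<lambda>x. complex_of_real (\<beta> x)) \<in> test_functions" and nn: "\<And>x. \<beta> x \<ge> 0"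
      and supp: "\<And>x. \<beta> x > 0 \<longleftrightarrow> norm x < \<delta>" and i: "integrable lborel \<beta>" and one: "(LINT x|lborel. \<beta> x) = 1" for \<delta> and \<beta> :: "'a \<Rightarrow> real"
  proof -
    let ?b = "\<lambda>x. complex_of_real (\<beta> x)"
    let ?\<Psi> = "fourier (\<lambda>y. fourier ?b y * \<eta> y)"
    have t1: "(\<lambda>y. fourier ?b y * \<eta> y) \<in> test_functions" by (intro test_functions_mult_smooth(1) \<eta> fourier_smooth t)
    have s: "?\<Psi> \<in> schwartz_space" "fourier \<eta> \<in> schwartz_space" by (intro fourier_schwartz t1 \<eta>)+
    have "schwartz_le n m (\<lambda>x. ?\<Psi> x - fourier \<eta> x) (K * \<delta>)"
      unfolding schwartz_le_def
    proof (intro allI impI)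
      fix x :: 'a and bs :: "'a list" assume bs: "set bs \<subseteq> Basis" "length bs \<le> m"
      let ?P = "partials bs (fourier \<eta>)"
      have Pm [measurable]: "?P \<in> borel_measurable borel"
        unfolding fourier_partials(1) [OF \<eta>] by (intro fourier_measurable fourier_partials(2) \<eta>)
      have Pb: "norm (?P y) \<le> (LINT x|lborel. norm (foldr coord_mult bs \<eta> x))" for y
        unfolding fourier_partials(1) [OF \<eta>] by (rule norm_fourier_le)
      have ib: "integrable lborel ?b" using i by simp
      have i1: "integrable lborel (\<lambda>r. ?b r * ?P (r + x))"
        using integrable_bounded_mult [of "\<lambda>r. ?P (r + x)", OF _ Pb ib] by (simp add: mult.commute)
      have pd: "partials bs (\<lambda>x. ?\<Psi> x - fourier \<eta> x) x = partials bs ?\<Psi> x - ?P x"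
        using partials_add [OF schwartz_smooth [OF s(1)] smooth_mult [OF smooth_const schwartz_smooth [OF s(2)]] bs(1), of "- 1"]
          partials_cmult [OF schwartz_smooth [OF s(2)] bs(1), of "- 1"] by simp
      have "partials bs ?\<Psi> x = (LINT r|lborel. ?b r * ?P (r + x))"
        unfolding fourier_partials(1) [OF t1] foldr_coord_mult fourier_partials(1) [OF \<eta>]
        by (intro fourier_fourier_mult t fourier_partials(2) \<eta>)
      then have "partials bs ?\<Psi> x - ?P x = (LINT r|lborel. ?b r * ?P (r + x)) - (LINT r|lborel. ?b r * ?P x)"
        by (simp add: one)
      also have "\<dots> = (LINT r|lborel. ?b r * (?P (r + x) - ?P x))" using i1 ib by (simp add: right_diff_distrib)
      finally have pd': "partials bs (\<lambda>x. ?\<Psi> x - fourier \<eta> x) x = (LINT r|lborel. ?b r * (?P (r + x) - ?P x))"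
        by (simp only: pd)
      have "(1 + norm x) ^ n * norm (partials bs (\<lambda>x. ?\<Psi> x - fourier \<eta> x) x) =
          norm (LINT r|lborel. of_real ((1 + norm x) ^ n) * (?b r * (?P (r + x) - ?P x)))"
        unfolding pd' by (simp only: integral_mult_right_zero norm_mult norm_of_real) simp
      also have "\<dots> \<le> (LINT r|lborel. K * \<delta> * \<beta> r)"
      proof (rule Bochner_Integration.integral_norm_bound_integral)
        show "integrable lborel (\<lambda>r. of_real ((1 + norm x) ^ n) * (?b r * (?P (r + x) - ?P x)))"
          using i1 ib by (intro integrable_mult_right) (simp add: right_diff_distrib)
        show "integrable lborel (\<lambda>r. K * \<delta> * \<beta> r)" using i by simp
        fix r
        show "norm (of_real ((1 + norm x) ^ n) * (?b r * (?P (r + x) - ?P x))) \<le> K * \<delta> * \<beta> r"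
        proof (cases "norm r < \<delta>")
          case True
          have "(1 + norm x) ^ n * norm (?P (r + x) - ?P x) \<le> C bs * norm r" using True \<delta> by (intro C(2)) auto
          also have "\<dots> \<le> K * \<delta>" using K C(1) True bs by (intro mult_mono) auto
          finally have "\<beta> r * ((1 + norm x) ^ n * norm (?P (r + x) - ?P x)) \<le> \<beta> r * (K * \<delta>)"
            by (intro mult_left_mono nn)
          moreover have "norm (of_real ((1 + norm x) ^ n) * (?b r * (?P (r + x) - ?P x))) = \<beta> r * ((1 + norm x) ^ n * norm (?P (r + x) - ?P x))"
            using nn [of r] by (simp only: norm_mult norm_of_real) simp
          ultimately show ?thesis by (simp only: mult_ac)
        next
          case False
          then have "\<beta> r = 0" using supp [of r] nn [of r] by simp
          then show ?thesis by simp
        qed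
      qed
      also have "\<dots> = K * \<delta>" by (simp add: one)
      finally show "(1 + norm x) ^ n * norm (partials bs (\<lambda>x. ?\<Psi> x - fourier \<eta> x) x) \<le> K * \<delta>" .
    qed
    from A(2) [OF schwartz_diff [OF s] this] show ?thesis by (simp add: temperate_diff [OF f s] mult.assoc)
  qed
  moreover have "A * K \<ge> 0" using A K by simp
  ultimately show ?thesis by blast
qed

lemma fourier_dist_eq_sum:
  fixes f :: "('a::euclidean_space \<Rightarrow> complex) \<Rightarrow> complex"
  assumes f: "temperate f" and ap: "almost_periodic_dist f"
    and sum: "\<And>R. (\<lambda>\<xi>. norm (fourier_coeff \<xi> f)) summable_on {\<xi> \<in> dist_spectrum f. norm \<xi> < R}"
    and \<eta>: "\<eta> \<in> test_functions"
  shows "f (fourier \<eta>) = infsum (\<lambda>\<xi>. fourier_coeff \<xi> f * \<eta> \<xi>) UNIV"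
proof -
  let ?c = "\<lambda>\<xi>. fourier_coeff \<xi> f * \<eta> \<xi>"
  obtain K where K: "K \<ge> 0" "\<And>\<delta> \<beta>. \<delta> \<le> 1 \<Longrightarrow> (\<lambda>x. complex_of_real (\<beta> x)) \<in> test_functions \<Longrightarrow> (\<forall>x. \<beta> x \<ge> 0) \<Longrightarrow>
    (\<forall>x. \<beta> x > 0 \<longleftrightarrow> norm x < \<delta>) \<Longrightarrow> integrable lborel \<beta> \<Longrightarrow> (LINT x|lborel. \<beta> x) = 1 \<Longrightarrow>
    norm (f (fourier (\<lambda>y. fourier (\<lambda>x. of_real (\<beta> x)) y * \<eta> y)) - f (fourier \<eta>)) \<le> K * \<delta>"
    using regularised_near [OF f \<eta>] by blast
  obtain R where R: "R > 0" "\<And>x. norm x > R \<Longrightarrow> \<eta> x = 0" using \<eta> by (auto simp: test_functions_iff)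
  have c: "(\<lambda>\<xi>. norm (?c \<xi>)) summable_on UNIV" by (rule test_times_coeff_summable [OF sum \<eta>])
  define S where "S = infsum (\<lambda>\<xi>. norm (?c \<xi>)) UNIV"
  have S: "S \<ge> 0" unfolding S_def by (rule infsum_nonneg) simp
  \<comment> \<open>\<open>K\<close> comes from the regularised value of \<open>f\<close>, the
    second term from the deviation of the multiplier from 1 on the ball of radius \<open>R\<close>,
    and the 1 ensures positivity.\<close>
  define B where "B = K + 2 * pi * R * S + 1"
  have B: "B > 0" using K R S by (auto simp: B_def intro!: add_nonneg_pos add_nonneg_nonneg mult_nonneg_nonneg)
  have close: "norm (f (fourier \<eta>) - infsum ?c UNIV) \<le> B * \<delta>" if \<delta>: "\<delta> > 0" "\<delta> \<le> 1" for \<delta>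
  proof -
    obtain \<beta> :: "'a \<Rightarrow> real" where \<beta>: "(\<lambda>x. complex_of_real (\<beta> x)) \<in> test_functions"
      "\<And>x. \<beta> x \<ge> 0" "\<And>x. \<beta> x > 0 \<longleftrightarrow> norm x < \<delta>" "integrable lborel \<beta>" "(LINT x|lborel. \<beta> x) = 1"
      using bump_exists [OF \<delta>(1)] by metis
    let ?b = "fourier (\<lambda>x. of_real (\<beta> x))"
    let ?d = "\<lambda>\<xi>. fourier_coeff \<xi> f * (?b \<xi> * \<eta> \<xi>)"
    have "norm (f (fourier (\<lambda>y. ?b y * \<eta> y)) - f (fourier \<eta>)) \<le> K * \<delta>"
      using K(2) [OF \<delta>(2) \<beta>(1)] \<beta> by blast
    then have 1: "norm (f (fourier \<eta>) - infsum ?d UNIV) \<le> K * \<delta>"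
      by (simp add: regularised_eq_sum [OF f ap sum \<beta>(1) \<eta>] norm_minus_commute)
    have d: "(\<lambda>\<xi>. norm (?d \<xi>)) summable_on UNIV"
      by (intro test_times_coeff_summable sum test_functions_mult_smooth(1) \<eta> fourier_smooth \<beta>)
    have le: "norm (?d \<xi> - ?c \<xi>) \<le> (2 * pi * R * \<delta>) * norm (?c \<xi>)" for \<xi>
    proof (cases "norm \<xi> > R")
      case True with R(2) [of \<xi>] show ?thesis by simp
    next
      case False
      have "norm (?b \<xi> - 1) \<le> 2 * pi * norm \<xi> * \<delta>" by (rule fourier_bump_near [OF \<beta>])
      also have "\<dots> \<le> 2 * pi * R * \<delta>" using False \<delta> by (intro mult_right_mono mult_left_mono) auto
      finally have "norm (?b \<xi> - 1) * norm (?c \<xi>) \<le> (2 * pi * R * \<delta>) * norm (?c \<xi>)" by (intro mult_right_mono) auto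
      moreover have "?d \<xi> - ?c \<xi> = (?b \<xi> - 1) * ?c \<xi>" by (simp add: algebra_simps)
      ultimately show ?thesis by (simp only: norm_mult)
    qed
    have sR: "(\<lambda>\<xi>. (2 * pi * R * \<delta>) * norm (?c \<xi>)) summable_on UNIV" by (rule summable_on_cmult_right [OF c])
    have dn: "(\<lambda>\<xi>. norm (?d \<xi> - ?c \<xi>)) summable_on UNIV"
      by (rule summable_on_comparison_test [OF sR]) (use le in auto)
    have "infsum ?d UNIV - infsum ?c UNIV = infsum (\<lambda>\<xi>. ?d \<xi> - ?c \<xi>) UNIV"
      using infsum_add [OF abs_summable_summable [OF dn] abs_summable_summable [OF c]] by simp
    also have "norm \<dots> \<le> infsum (\<lambda>\<xi>. norm (?d \<xi> - ?c \<xi>)) UNIV" by (rule norm_infsum_bound [OF dn])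
    also have "\<dots> \<le> infsum (\<lambda>\<xi>. (2 * pi * R * \<delta>) * norm (?c \<xi>)) UNIV" by (rule infsum_mono [OF dn sR le])
    also have "\<dots> = 2 * pi * R * \<delta> * S" by (simp add: S_def infsum_cmult_right')
    finally have 2: "norm (infsum ?d UNIV - infsum ?c UNIV) \<le> 2 * pi * R * \<delta> * S" .
    have "norm (f (fourier \<eta>) - infsum ?c UNIV) \<le> K * \<delta> + 2 * pi * R * \<delta> * S"
      by (rule norm_diff_triangle_le [OF 1 2])
    also have "\<dots> \<le> B * \<delta>" using \<delta> by (simp add: B_def algebra_simps)
    finally show ?thesis .
  qed
  have "norm (f (fourier \<eta>) - infsum ?c UNIV) \<le> \<epsilon>" if \<epsilon>: "\<epsilon> > 0" for \<epsilon>
  proof -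
    define \<delta> where "\<delta> = min 1 (\<epsilon> / B)"
    have \<delta>: "\<delta> > 0" "\<delta> \<le> 1" "\<delta> \<le> \<epsilon> / B" using \<epsilon> B by (auto simp: \<delta>_def)
    have "norm (f (fourier \<eta>) - infsum ?c UNIV) \<le> B * \<delta>" by (rule close [OF \<delta>(1,2)])
    also have "\<dots> \<le> \<epsilon>" using \<delta>(3) B by (simp add: field_simps)
    finally show ?thesis .
  qed
  then have "norm (f (fourier \<eta>) - infsum ?c UNIV) \<le> 0 + \<epsilon>" if "\<epsilon> > 0" for \<epsilon> using that by simp
  then have "norm (f (fourier \<eta>) - infsum ?c UNIV) \<le> 0" by (rule field_le_epsilon)
  then show ?thesis by simp
qed

section \<open>Radon measures\<close>

lemma cm_countably_additive:
  "complex_radon_measure \<mu> \<Longrightarrow> range A \<subseteq> sets borel \<Longrightarrow> disjoint_family A \<Longrightarrow> bounded (\<Union>i. A i) \<Longrightarrow>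
    (\<lambda>i. \<mu> (A i)) sums \<mu> (\<Union>i. A i)" for A :: "nat \<Rightarrow> 'a::euclidean_space set"
  by (simp add: complex_radon_measure_def)

text \<open>A constant series converges only if its terms vanish.\<close>

lemma cm_empty:
  assumes "complex_radon_measure \<mu>"
  shows "\<mu> {} = 0"
proof -
  have "(\<lambda>i::nat. \<mu> {}) sums \<mu> (\<Union>i::nat. {})"
    by (rule cm_countably_additive [OF assms]) (auto simp: disjoint_family_on_def)
  then have "summable (\<lambda>i::nat. \<mu> {})" by (simp add: sums_iff)
  then show ?thesis by (simp add: summable_const_iff)
qed

lemma cm_additive:
  assumes \<mu>: "complex_radon_measure \<mu>" and A: "A \<in> sets borel" "B \<in> sets borel" "A \<inter> B = {}" "bounded (A \<union> B)"
  shows "\<mu> (A \<union> B) = \<mu> A + \<mu> B"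
proof -
  let ?A = "\<lambda>i::nat. if i = 0 then A else if i = 1 then B else {}"
  have U: "(\<Union>i. ?A i) = A \<union> B" by (auto split: if_splits)
  have "(\<lambda>i. \<mu> (?A i)) sums \<mu> (\<Union>i. ?A i)"
    by (rule cm_countably_additive [OF \<mu>]) (use A in \<open>auto simp: disjoint_family_on_def U\<close>)
  moreover have "(\<lambda>i. \<mu> (?A i)) sums (\<Sum>i\<in>{0, 1}. \<mu> (?A i))"
    by (rule sums_finite) (auto simp: cm_empty [OF \<mu>])
  ultimately have "\<mu> (\<Union>i. ?A i) = (\<Sum>i\<in>{0, 1}. \<mu> (?A i))" by (rule sums_unique2)
  then show ?thesis unfolding U by simp
qed

text \<open>The variation bound in the form in which simple integrals present it, for fibres indexed
  by values rather than for a set of sets.\<close>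

lemma cm_variation:
  fixes \<mu> :: "'a::euclidean_space set \<Rightarrow> complex"
  assumes \<mu>: "complex_radon_measure \<mu>" and K: "compact K"
  obtains V where "V \<ge> 0" "\<And>(C :: complex set) E. finite C \<Longrightarrow> (\<And>c. c \<in> C \<Longrightarrow> E c \<in> sets borel \<and> E c \<subseteq> K) \<Longrightarrow>
    (\<And>c d. c \<in> C \<Longrightarrow> d \<in> C \<Longrightarrow> c \<noteq> d \<Longrightarrow> E c \<inter> E d = {}) \<Longrightarrow> (\<Sum>c\<in>C. norm (\<mu> (E c))) \<le> V"
proof -
  let ?X = "{\<Sum>B\<in>P. norm (\<mu> B) | P. finite P \<and> disjoint P \<and> P \<subseteq> sets borel \<and> \<Union>P \<subseteq> K}"
  have "bdd_above ?X" using \<mu> K by (simp add: complex_radon_measure_def)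
  then obtain V where V: "\<And>x. x \<in> ?X \<Longrightarrow> x \<le> V" by (auto simp: bdd_above_def)
  show ?thesis
  proof (rule that [of V])
    show "V \<ge> 0" by (rule V) (auto intro!: exI [of _ "{}"])
    fix C :: "complex set" and E :: "complex \<Rightarrow> 'a set"
    assume fin: "finite C" and E: "\<And>c. c \<in> C \<Longrightarrow> E c \<in> sets borel \<and> E c \<subseteq> K"
      and disj: "\<And>c d. c \<in> C \<Longrightarrow> d \<in> C \<Longrightarrow> c \<noteq> d \<Longrightarrow> E c \<inter> E d = {}"
    \<comment> \<open>Empty fibres may repeat but contribute nothing. Among the nonempty ones
      disjointness implies injectivity, so the sum can be reindexed.\<close>
    let ?C = "{c \<in> C. E c \<noteq> {}}"
    have inj: "inj_on E ?C" using disj by (auto simp: inj_on_def)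
    have "(\<Sum>c\<in>C. norm (\<mu> (E c))) = (\<Sum>c\<in>?C. norm (\<mu> (E c)))"
      using fin by (intro sum.mono_neutral_right) (auto simp: cm_empty [OF \<mu>])
    also have "\<dots> = (\<Sum>B\<in>E ` ?C. norm (\<mu> B))" by (simp add: sum.reindex [OF inj])
    also have "\<dots> \<le> V"
    proof (rule V, rule CollectI, intro exI conjI)
      show "disjoint (E ` ?C)" using disj by (auto simp: disjoint_def)
    qed (use fin E in auto)
    finally show "(\<Sum>c\<in>C. norm (\<mu> (E c))) \<le> V" .
  qed
qed

text \<open>The approximating simple functions may spill over \<open>K\<close> into a larger compact
  set that depends on the sequence. There their values are at most the approximation error, so the
  variation \<open>W\<close> of that set disappears in the limit and only the variation
  \<open>V\<close> on \<open>K\<close> remains.\<close>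

lemma has_integral_cm_bound:
  fixes \<mu> :: "'a::euclidean_space set \<Rightarrow> complex"
  assumes \<mu>: "complex_radon_measure \<mu>" and K: "compact K"
  obtains V where "V \<ge> 0" "\<And>\<eta> I c. has_integral_cm \<eta> I \<mu> \<Longrightarrow> (\<And>x. norm (\<eta> x) \<le> c) \<Longrightarrow> (\<And>x. x \<notin> K \<Longrightarrow> \<eta> x = 0) \<Longrightarrow> norm I \<le> V * c"
proof -
  obtain V where V: "V \<ge> 0" "\<And>(C :: complex set) E. finite C \<Longrightarrow> (\<And>c. c \<in> C \<Longrightarrow> E c \<in> sets borel \<and> E c \<subseteq> K) \<Longrightarrow>
    (\<And>c d. c \<in> C \<Longrightarrow> d \<in> C \<Longrightarrow> c \<noteq> d \<Longrightarrow> E c \<inter> E d = {}) \<Longrightarrow> (\<Sum>c\<in>C. norm (\<mu> (E c))) \<le> V"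
    using cm_variation [OF \<mu> K] by blast
  have Kb: "K \<in> sets borel" using K by (intro borel_closed compact_imp_closed)
  have "norm I \<le> V * c" if hi: "has_integral_cm \<eta> I \<mu>" and c: "\<And>x. norm (\<eta> x) \<le> c" and 0: "\<And>x. x \<notin> K \<Longrightarrow> \<eta> x = 0" for \<eta> I c
  proof -
    obtain s :: "nat \<Rightarrow> 'a \<Rightarrow> complex" where s: "\<And>n. simple_function borel (s n)" "bounded (\<Union>n. {x. s n x \<noteq> 0})"
      "uniform_limit UNIV s \<eta> sequentially" "(\<lambda>n. simple_integral_cm \<mu> (s n)) \<longlonglongrightarrow> I"
      using hi unfolding has_integral_cm_def by blast
    define L where "L = closure (\<Union>n. {x. s n x \<noteq> 0})"
    have L: "compact L" using s(2) by (simp add: L_def compact_closure)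
    have sL: "x \<in> L" if "s n x \<noteq> 0" for n x
      using that closure_subset [of "\<Union>n. {x. s n x \<noteq> 0}"] unfolding L_def by blast
    obtain W where W: "W \<ge> 0" "\<And>(C :: complex set) E. finite C \<Longrightarrow> (\<And>c. c \<in> C \<Longrightarrow> E c \<in> sets borel \<and> E c \<subseteq> L) \<Longrightarrow>
      (\<And>c d. c \<in> C \<Longrightarrow> d \<in> C \<Longrightarrow> c \<noteq> d \<Longrightarrow> E c \<inter> E d = {}) \<Longrightarrow> (\<Sum>c\<in>C. norm (\<mu> (E c))) \<le> W"
      using cm_variation [OF \<mu> L] by blast
    \<comment> \<open>Each fibre is cut along \<open>K\<close>: inside, its value is at most
      \<open>c + \<epsilon>\<close>; outside, where \<open>\<eta>\<close> vanishes, at most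
      \<open>\<epsilon>\<close>.\<close>
    have step: "norm (simple_integral_cm \<mu> (s n)) \<le> (c + \<epsilon>) * V + \<epsilon> * W"
      if \<epsilon>: "\<epsilon> > 0" and near: "\<And>x. norm (s n x - \<eta> x) \<le> \<epsilon>" for n \<epsilon>
    proof -
      let ?C = "range (s n) - {0}"
      have fin: "finite ?C" using simple_functionD(1) [OF s(1), of n] by simp
      have E: "s n -` {d} \<in> sets borel" for d using simple_functionD(2) [OF s(1), of n "{d}"] by simp
      have EL: "s n -` {d} \<subseteq> L" if "d \<in> ?C" for d using sL that by auto
      have split: "\<mu> (s n -` {d}) = \<mu> (s n -` {d} \<inter> K) + \<mu> (s n -` {d} - K)" if "d \<in> ?C" for d
      proof -
        have "s n -` {d} = (s n -` {d} \<inter> K) \<union> (s n -` {d} - K)" by blast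
        moreover have "bounded (s n -` {d})" using EL [OF that] compact_imp_bounded [OF L] by (rule bounded_subset [rotated])
        ultimately show ?thesis
          using cm_additive [OF \<mu>, of "s n -` {d} \<inter> K" "s n -` {d} - K"] E Kb by (metis Diff_disjoint Int_Diff sets.Diff sets.Int inf.assoc inf_bot_right)
      qed
      have cn: "norm d \<le> c + \<epsilon>" if "d \<in> ?C" for d
      proof -
        obtain x where x: "s n x = d" using \<open>d \<in> ?C\<close> by auto
        show ?thesis using norm_triangle_sub [of d "\<eta> x"] near [of x, unfolded x] c [of x] by linarith
      qed
      have "norm (simple_integral_cm \<mu> (s n)) \<le> (\<Sum>d\<in>?C. norm (d * \<mu> (s n -` {d})))"
        unfolding simple_integral_cm_def by (rule norm_sum)
      also have "\<dots> \<le> (\<Sum>d\<in>?C. (c + \<epsilon>) * norm (\<mu> (s n -` {d} \<inter> K)) + \<epsilon> * norm (\<mu> (s n -` {d} - K)))"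
      proof (rule sum_mono)
        fix d assume d: "d \<in> ?C"
        have "norm (d * \<mu> (s n -` {d})) \<le> norm d * norm (\<mu> (s n -` {d} \<inter> K)) + norm d * norm (\<mu> (s n -` {d} - K))"
          unfolding split [OF d] norm_mult distrib_left [symmetric] by (intro mult_left_mono norm_triangle_ineq) auto
        moreover have "norm d * norm (\<mu> (s n -` {d} \<inter> K)) \<le> (c + \<epsilon>) * norm (\<mu> (s n -` {d} \<inter> K))"
          by (intro mult_right_mono cn d) auto
        moreover have "norm d * norm (\<mu> (s n -` {d} - K)) \<le> \<epsilon> * norm (\<mu> (s n -` {d} - K))"
        proof (cases "s n -` {d} - K = {}")
          case True
          show ?thesis unfolding True by (simp add: cm_empty [OF \<mu>])
        next
          case False
          then obtain x where "s n x = d" "x \<notin> K" by auto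
          then have "norm d \<le> \<epsilon>" using near [of x] 0 [of x] by simp
          then show ?thesis by (intro mult_right_mono) auto
        qed
        ultimately show "norm (d * \<mu> (s n -` {d})) \<le> (c + \<epsilon>) * norm (\<mu> (s n -` {d} \<inter> K)) + \<epsilon> * norm (\<mu> (s n -` {d} - K))"
          by linarith
      qed
      also have "\<dots> = (c + \<epsilon>) * (\<Sum>d\<in>?C. norm (\<mu> (s n -` {d} \<inter> K))) + \<epsilon> * (\<Sum>d\<in>?C. norm (\<mu> (s n -` {d} - K)))"
        by (simp add: sum.distrib sum_distrib_left)
      also have "\<dots> \<le> (c + \<epsilon>) * V + \<epsilon> * W"
      proof (intro add_mono mult_left_mono)
        show "(\<Sum>d\<in>?C. norm (\<mu> (s n -` {d} \<inter> K))) \<le> V"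
          by (rule V(2) [OF fin]) (use E Kb in auto)
        have "E' - K \<subseteq> L" if "E' \<subseteq> L" for E' using that by blast
        then show "(\<Sum>d\<in>?C. norm (\<mu> (s n -` {d} - K))) \<le> W"
          using E Kb EL by (intro W(2) [OF fin]) auto
        show "0 \<le> c + \<epsilon>" using order_trans [OF norm_ge_zero c [of 0]] \<epsilon> by simp
      qed (use \<epsilon> in auto)
      finally show ?thesis .
    qed
    have le: "norm I \<le> (c + \<epsilon>) * V + \<epsilon> * W" if \<epsilon>: "\<epsilon> > 0" for \<epsilon>
    proof (rule tendsto_upperbound)
      show "(\<lambda>n. norm (simple_integral_cm \<mu> (s n))) \<longlonglongrightarrow> norm I" by (intro tendsto_norm s(4))
      show "\<forall>\<^sub>F n in sequentially. norm (simple_integral_cm \<mu> (s n)) \<le> (c + \<epsilon>) * V + \<epsilon> * W"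
        using uniform_limitD [OF s(3) \<epsilon>]
        by eventually_elim (intro step \<epsilon>, auto simp: dist_norm intro: less_imp_le)
    qed simp
    have "norm I \<le> V * c + \<epsilon>" if \<epsilon>: "\<epsilon> > 0" for \<epsilon>
    proof -
      have p: "V + W + 1 > 0" using V W by simp
      have "norm I \<le> (c + \<epsilon> / (V + W + 1)) * V + \<epsilon> / (V + W + 1) * W" using \<epsilon> p by (intro le) simp
      also have "\<dots> = V * c + \<epsilon> * ((V + W) / (V + W + 1))"
        by (simp add: algebra_simps add_divide_distrib)
      also have "\<dots> \<le> V * c + \<epsilon> * 1" using \<epsilon> p by (intro add_left_mono mult_left_mono) auto
      finally show ?thesis by simp
    qed
    then show ?thesis by (rule field_le_epsilon)
  qed
  with V(1) show ?thesis using that by blast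
qed

subsection \<open>Atomic measures\<close>

lemma infsum_disjoint_sets:
  fixes g :: "'a \<Rightarrow> 'b::banach"
  assumes "finite C" "\<And>c. c \<in> C \<Longrightarrow> g summable_on L \<inter> E c"
    and "\<And>c d. c \<in> C \<Longrightarrow> d \<in> C \<Longrightarrow> c \<noteq> d \<Longrightarrow> E c \<inter> E d = {}"
  shows "(\<Sum>c\<in>C. infsum g (L \<inter> E c)) = infsum g (L \<inter> (\<Union>c\<in>C. E c)) \<and> g summable_on L \<inter> (\<Union>c\<in>C. E c)"
  using assms
proof (induction C)
  case (insert c C)
  have IH: "(\<Sum>c\<in>C. infsum g (L \<inter> E c)) = infsum g (L \<inter> (\<Union>c\<in>C. E c))" "g summable_on L \<inter> (\<Union>c\<in>C. E c)"
    using insert by auto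
  have U: "L \<inter> (\<Union>c\<in>insert c C. E c) = (L \<inter> E c) \<union> (L \<inter> (\<Union>c\<in>C. E c))" by auto
  have d: "(L \<inter> E c) \<inter> (L \<inter> (\<Union>c\<in>C. E c)) = {}" using insert(2,5) by fastforce
  have sc: "g summable_on L \<inter> E c" using insert(4) by simp
  show ?case
    unfolding U using insert(1,2) IH sc infsum_Un_disjoint [OF sc IH(2) d] summable_on_Un_disjoint [OF sc IH(2) d]
    by simp
qed simp

context
  fixes a :: "'a::euclidean_space \<Rightarrow> complex" and L :: "'a set"
  assumes sum: "\<And>R. (\<lambda>\<xi>. norm (a \<xi>)) summable_on {\<xi> \<in> L. norm \<xi> < R}"
begin

text \<open>On unbounded sets the sum may diverge, and \<open>infsum\<close> then takes the default
  value 0. Such values do not enter \<open>complex_radon_measure\<close>.\<close>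

definition atoms :: "'a set \<Rightarrow> complex" where
  "atoms A = infsum a (L \<inter> A)"

lemma atoms_abs_summable: "bounded A \<Longrightarrow> (\<lambda>\<xi>. norm (a \<xi>)) summable_on L \<inter> A"
proof -
  assume "bounded A"
  then obtain R where "\<And>x. x \<in> A \<Longrightarrow> norm x \<le> R" by (auto simp: bounded_iff)
  then have "L \<inter> A \<subseteq> {\<xi> \<in> L. norm \<xi> < R + 1}" by force
  then show ?thesis using summable_on_subset_banach [OF sum] by blast
qed

lemma atoms_summable: "bounded A \<Longrightarrow> a summable_on L \<inter> A"
  by (rule abs_summable_summable [OF atoms_abs_summable])

text \<open>Countable additivity is the associativity of unordered summation, once the disjoint
  union is written as a \<open>Sigma\<close> set.\<close>

lemma atoms_sums:
  fixes A :: "nat \<Rightarrow> 'a set"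
  assumes "disjoint_family A" "bounded (\<Union>i. A i)"
  shows "(\<lambda>i. atoms (A i)) sums atoms (\<Union>i. A i)"
proof -
  let ?S = "Sigma UNIV (\<lambda>i. L \<inter> A i)"
  have bij: "bij_betw snd ?S (L \<inter> (\<Union>i. A i))"
    using assms(1) by (fastforce simp: bij_betw_def inj_on_def disjoint_family_on_def image_def)
  have b: "bounded (A i)" for i using assms(2) by (rule bounded_subset) auto
  have "((\<lambda>p. a (snd p)) has_sum atoms (\<Union>i. A i)) ?S"
    unfolding has_sum_reindex_bij_betw [OF bij] atoms_def
    by (rule has_sum_infsum [OF atoms_summable [OF assms(2)]])
  then have "((\<lambda>i. atoms (A i)) has_sum atoms (\<Union>i. A i)) UNIV"
    by (rule has_sum_SigmaD) (simp add: atoms_def atoms_summable [OF b])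
  then show ?thesis by (rule has_sum_imp_sums)
qed

lemma atoms_radon_measure: "complex_radon_measure atoms"
  unfolding complex_radon_measure_def
proof (intro conjI allI impI)
  fix A :: "nat \<Rightarrow> 'a set"
  assume "range A \<subseteq> sets borel \<and> disjoint_family A \<and> bounded (\<Union>i. A i)"
  then show "(\<lambda>i. atoms (A i)) sums atoms (\<Union>i. A i)" using atoms_sums by blast
next
  fix K :: "'a set" assume K: "compact K"
  show "bdd_above {\<Sum>B\<in>P. norm (atoms B) | P. finite P \<and> disjoint P \<and> P \<subseteq> sets borel \<and> \<Union>P \<subseteq> K}"
  proof (rule bdd_aboveI [of _ "infsum (\<lambda>\<xi>. norm (a \<xi>)) (L \<inter> K)"], elim CollectE exE conjE)
    fix x P assume P: "x = (\<Sum>B\<in>P. norm (atoms B))" "finite P" "disjoint P" "\<Union>P \<subseteq> K"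
    have b: "bounded B" if "B \<subseteq> K" for B using compact_imp_bounded [OF K] that by (rule bounded_subset)
    have "x \<le> (\<Sum>B\<in>P. infsum (\<lambda>\<xi>. norm (a \<xi>)) (L \<inter> B))"
      unfolding P(1) atoms_def using P(4) by (intro sum_mono norm_infsum_bound atoms_abs_summable b) auto
    also have "\<dots> = infsum (\<lambda>\<xi>. norm (a \<xi>)) (L \<inter> (\<Union>B\<in>P. B))"
      using infsum_disjoint_sets [OF P(2), of "\<lambda>\<xi>. norm (a \<xi>)" L "\<lambda>B. B"] P(3,4)
      by (auto simp: disjoint_def intro!: atoms_abs_summable b)
    also have "\<dots> \<le> infsum (\<lambda>\<xi>. norm (a \<xi>)) (L \<inter> K)"
      using P(4) by (intro infsum_mono2 atoms_abs_summable b) auto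
    finally show "x \<le> infsum (\<lambda>\<xi>. norm (a \<xi>)) (L \<inter> K)" .
  qed
qed

lemma atoms_atomic_sum: "atomic_sum atoms a L"
  unfolding atomic_sum_def
proof (intro ballI impI)
  fix A :: "'a set" assume "bounded A"
  then have "(a has_sum atoms A) (L \<inter> A)" unfolding atoms_def by (intro has_sum_infsum atoms_summable)
  moreover have "(a has_sum atoms A) (L \<inter> A) \<longleftrightarrow> ((\<lambda>\<xi>. a \<xi> * unit_mass \<xi> A) has_sum atoms A) L"
    by (rule has_sum_cong_neutral) (auto simp: unit_mass_def)
  ultimately show "((\<lambda>\<xi>. a \<xi> * unit_mass \<xi> A) has_sum atoms A) L" by simp
qed

lemma simple_integral_atoms:
  assumes s: "finite (range s)" and b: "bounded {x. s x \<noteq> 0}"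
  shows "simple_integral_cm atoms s = infsum (\<lambda>\<xi>. a \<xi> * s \<xi>) L"
proof -
  let ?C = "range s - {0}"
  have bc: "bounded (s -` {c})" if "c \<in> ?C" for c
    using b by (rule bounded_subset) (use that in auto)
  have eq: "c * atoms (s -` {c}) = infsum (\<lambda>\<xi>. a \<xi> * s \<xi>) (L \<inter> s -` {c})" for c
    unfolding atoms_def infsum_cmult_right' [symmetric] by (rule infsum_cong) (simp add: mult.commute)
  have sm: "(\<lambda>\<xi>. a \<xi> * s \<xi>) summable_on L \<inter> s -` {c}" if "c \<in> ?C" for c
  proof -
    have "(\<lambda>\<xi>. a \<xi> * c) summable_on L \<inter> s -` {c}" by (intro summable_on_cmult_left atoms_summable bc that)
    then show ?thesis by (rule summable_on_cong [THEN iffD1, rotated]) simp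
  qed
  have "simple_integral_cm atoms s = (\<Sum>c\<in>?C. infsum (\<lambda>\<xi>. a \<xi> * s \<xi>) (L \<inter> s -` {c}))"
    unfolding simple_integral_cm_def by (simp only: eq)
  also have "\<dots> = infsum (\<lambda>\<xi>. a \<xi> * s \<xi>) (L \<inter> (\<Union>c\<in>?C. s -` {c}))"
    using infsum_disjoint_sets [of ?C "\<lambda>\<xi>. a \<xi> * s \<xi>" L "\<lambda>c. s -` {c}"] s sm by auto
  also have "\<dots> = infsum (\<lambda>\<xi>. a \<xi> * s \<xi>) L"
    by (rule infsum_cong_neutral) auto
  finally show ?thesis .
qed

lemma has_integral_atoms:
  assumes \<eta>: "\<eta> \<in> test_functions"
  shows "has_integral_cm \<eta> (infsum (\<lambda>\<xi>. a \<xi> * \<eta> \<xi>) L) atoms"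
proof -
  obtain R where R: "R > 0" "\<And>x. norm x > R \<Longrightarrow> \<eta> x = 0" using \<eta> by (auto simp: test_functions_iff)
  obtain M where M: "M > 0" "\<And>x. norm (\<eta> x) \<le> M" using test_functions_bounded [OF \<eta>] by metis
  note [measurable] = test_functions_measurable [OF \<eta>]
  \<comment> \<open>The real and imaginary parts are rounded down to multiples of
    \<open>1 / Suc n\<close>. Boundedness makes the range finite, and since 0 is rounded to 0 the
    supports do not grow.\<close>
  define q where "q n t = of_int \<lfloor>real (Suc n) * t\<rfloor> / real (Suc n)" for n and t :: real
  define s where "s n x = Complex (q n (Re (\<eta> x))) (q n (Im (\<eta> x)))" for n x
  have q: "\<bar>q n t - t\<bar> \<le> 1 / real (Suc n)" for n t
  proof -
    have "real_of_int \<lfloor>real (Suc n) * t\<rfloor> \<le> real (Suc n) * t" "real (Suc n) * t < real_of_int \<lfloor>real (Suc n) * t\<rfloor> + 1"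
      by linarith+
    then have "\<bar>real_of_int \<lfloor>real (Suc n) * t\<rfloor> - real (Suc n) * t\<bar> \<le> 1" by linarith
    moreover have "q n t - t = (real_of_int \<lfloor>real (Suc n) * t\<rfloor> - real (Suc n) * t) / real (Suc n)"
      unfolding q_def diff_divide_distrib by (simp del: of_nat_Suc)
    ultimately show ?thesis by (simp add: divide_right_mono del: of_nat_Suc)
  qed
  have s_near: "norm (s n x - \<eta> x) \<le> 2 / real (Suc n)" for n x
  proof -
    have "norm (s n x - \<eta> x) \<le> \<bar>Re (s n x - \<eta> x)\<bar> + \<bar>Im (s n x - \<eta> x)\<bar>" by (rule cmod_le)
    then show ?thesis using q [of n "Re (\<eta> x)"] q [of n "Im (\<eta> x)"] by (simp add: s_def)
  qed
  have s0: "s n x = 0" if "norm x > R" for n x using R(2) [OF that] by (simp add: s_def q_def Complex_eq_0)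
  have fin: "finite (range (s n))" for n
  proof -
    let ?Z = "{- \<lceil>real (Suc n) * M\<rceil> - 1 .. \<lceil>real (Suc n) * M\<rceil> + 1}"
    have fl: "\<lfloor>real (Suc n) * t\<rfloor> \<in> ?Z" if "\<bar>t\<bar> \<le> M" for t
    proof -
      have "\<bar>real (Suc n) * t\<bar> \<le> real (Suc n) * M" using that by (simp add: abs_mult mult_left_mono del: of_nat_Suc)
      then show ?thesis by (auto simp del: of_nat_Suc) linarith+
    qed
    have "range (s n) \<subseteq> (\<lambda>(j, k). Complex (of_int j / real (Suc n)) (of_int k / real (Suc n))) ` (?Z \<times> ?Z)"
    proof
      fix z assume "z \<in> range (s n)"
      then obtain x where x: "z = s n x" by auto
      have "\<bar>Re (\<eta> x)\<bar> \<le> M" "\<bar>Im (\<eta> x)\<bar> \<le> M"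
        using abs_Re_le_cmod [of "\<eta> x"] abs_Im_le_cmod [of "\<eta> x"] M(2) [of x] by linarith+
      then show "z \<in> (\<lambda>(j, k). Complex (of_int j / real (Suc n)) (of_int k / real (Suc n))) ` (?Z \<times> ?Z)"
        using fl by (intro image_eqI [of _ _ "(\<lfloor>real (Suc n) * Re (\<eta> x)\<rfloor>, \<lfloor>real (Suc n) * Im (\<eta> x)\<rfloor>)"])
          (simp_all add: x s_def q_def del: of_nat_Suc)
    qed
    then show ?thesis by (rule finite_subset) simp
  qed
  have sf: "simple_function borel (s n)" for n
  proof (rule simple_function_borel_measurable)
    have "s n = (\<lambda>x. of_real (q n (Re (\<eta> x))) + \<i> * of_real (q n (Im (\<eta> x))))"
      by (auto simp: s_def complex_eq_iff)
    then show "s n \<in> borel_measurable borel" unfolding q_def by simp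
  qed (simp add: fin)
  have bs: "{x. s n x \<noteq> 0} \<subseteq> cball 0 R" for n
    using s0 [of _ n] by (auto simp: not_less [symmetric])
  have lim: "(\<lambda>n. simple_integral_cm atoms (s n)) \<longlonglongrightarrow> infsum (\<lambda>\<xi>. a \<xi> * \<eta> \<xi>) L"
  proof -
    let ?B = "L \<inter> cball 0 R"
    let ?S = "infsum (\<lambda>\<xi>. norm (a \<xi>)) ?B"
    have as: "(\<lambda>\<xi>. norm (a \<xi>)) summable_on ?B" by (rule atoms_abs_summable) simp
    have sm: "(\<lambda>\<xi>. norm (a \<xi> * h \<xi>)) summable_on ?B" if "\<And>\<xi>. norm (h \<xi>) \<le> D" for h :: "'a \<Rightarrow> complex" and D
      by (rule Infinite_Sum.abs_summable_on_comparison_test' [OF summable_on_cmult_left [OF as, of D]])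
         (simp add: norm_mult mult_left_mono that)
    have "norm (simple_integral_cm atoms (s n) - infsum (\<lambda>\<xi>. a \<xi> * \<eta> \<xi>) L) \<le> 2 * ?S * inverse (real (Suc n))" for n
    proof -
      have b: "bounded {x. s n x \<noteq> 0}" using bounded_cball bs [of n] by (rule bounded_subset)
      have sm2: "(\<lambda>\<xi>. a \<xi> * \<eta> \<xi>) summable_on ?B" by (rule abs_summable_summable [OF sm [OF M(2)]])
      have smd: "(\<lambda>\<xi>. norm (a \<xi> * (s n \<xi> - \<eta> \<xi>))) summable_on ?B" by (rule sm [OF s_near])
      have "simple_integral_cm atoms (s n) = infsum (\<lambda>\<xi>. a \<xi> * s n \<xi>) ?B"
        unfolding simple_integral_atoms [OF fin b] using bs [of n] by (intro infsum_cong_neutral) auto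
      moreover have "infsum (\<lambda>\<xi>. a \<xi> * \<eta> \<xi>) L = infsum (\<lambda>\<xi>. a \<xi> * \<eta> \<xi>) ?B"
        using R(2) by (intro infsum_cong_neutral) (auto simp: not_le)
      moreover have "infsum (\<lambda>\<xi>. a \<xi> * s n \<xi>) ?B = infsum (\<lambda>\<xi>. a \<xi> * (s n \<xi> - \<eta> \<xi>)) ?B + infsum (\<lambda>\<xi>. a \<xi> * \<eta> \<xi>) ?B"
        using infsum_add [OF abs_summable_summable [OF smd] sm2] by (simp add: right_diff_distrib)
      ultimately have "simple_integral_cm atoms (s n) - infsum (\<lambda>\<xi>. a \<xi> * \<eta> \<xi>) L = infsum (\<lambda>\<xi>. a \<xi> * (s n \<xi> - \<eta> \<xi>)) ?B"
        by simp
      also have "norm \<dots> \<le> infsum (\<lambda>\<xi>. norm (a \<xi> * (s n \<xi> - \<eta> \<xi>))) ?B" by (rule norm_infsum_bound [OF smd])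
      also have "\<dots> \<le> infsum (\<lambda>\<xi>. norm (a \<xi>) * (2 / real (Suc n))) ?B"
        by (rule infsum_mono [OF smd summable_on_cmult_left [OF as]])
           (simp only: norm_mult, intro mult_left_mono s_near norm_ge_zero)
      also have "\<dots> = 2 * ?S * inverse (real (Suc n))"
        by (simp add: infsum_cmult_left' divide_inverse)
      finally show ?thesis .
    qed
    then have ev: "\<forall>\<^sub>F n in sequentially. norm (simple_integral_cm atoms (s n) - infsum (\<lambda>\<xi>. a \<xi> * \<eta> \<xi>) L)
        \<le> 2 * ?S * inverse (real (Suc n))"
      by (rule always_eventually [OF allI])
    have "(\<lambda>n. 2 * ?S * inverse (real (Suc n))) \<longlonglongrightarrow> 0"
      by (rule tendsto_mult_right_zero [OF LIMSEQ_inverse_real_of_nat])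
    then have "(\<lambda>n. simple_integral_cm atoms (s n) - infsum (\<lambda>\<xi>. a \<xi> * \<eta> \<xi>) L) \<longlonglongrightarrow> 0"
      by (rule Lim_null_comparison [OF ev])
    then show ?thesis by (rule LIM_zero_cancel)
  qed
  have ul: "uniform_limit UNIV s \<eta> sequentially"
    unfolding uniform_limit_iff
  proof (intro allI impI)
    fix e :: real assume "e > 0"
    then have "\<forall>\<^sub>F n in sequentially. inverse (real (Suc n)) < e / 2"
      by (intro order_tendstoD(2) [OF LIMSEQ_inverse_real_of_nat]) simp
    then show "\<forall>\<^sub>F n in sequentially. \<forall>x\<in>UNIV. dist (s n x) (\<eta> x) < e"
    proof eventually_elim
      case (elim n)
      then have "2 / real (Suc n) < e"
        using divide_inverse [of 2 "real (Suc n)"] by linarith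
      then have "norm (s n x - \<eta> x) < e" for x by (rule le_less_trans [OF s_near])
      then show ?case unfolding dist_norm by blast
    qed
  qed
  have "bounded (\<Union>n. {x. s n x \<noteq> 0})" using bounded_cball by (rule bounded_subset) (use bs in blast)
  then show ?thesis
    unfolding has_integral_cm_def using sf ul lim by blast
qed

end

lemma summable_imp_atomic:
  fixes f :: "('a::euclidean_space \<Rightarrow> complex) \<Rightarrow> complex"
  assumes f: "temperate f" and ap: "almost_periodic_dist f"
    and sum: "\<And>R. (\<lambda>\<xi>. norm (fourier_coeff \<xi> f)) summable_on {\<xi> \<in> dist_spectrum f. norm \<xi> < R}"
  shows "\<exists>\<mu>. equals_measure (fourier_dist f) \<mu> \<and> atomic_sum \<mu> (\<lambda>\<xi>. fourier_coeff \<xi> f) (dist_spectrum f)"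
proof -
  let ?\<mu> = "atoms (\<lambda>\<xi>. fourier_coeff \<xi> f) (dist_spectrum f)"
  have "has_integral_cm \<eta> (fourier_dist f \<eta>) ?\<mu>" if \<eta>: "\<eta> \<in> test_functions" for \<eta>
  proof -
    have "fourier_dist f \<eta> = infsum (\<lambda>\<xi>. fourier_coeff \<xi> f * \<eta> \<xi>) UNIV"
      unfolding fourier_dist_def by (rule fourier_dist_eq_sum [OF f ap sum \<eta>])
    also have "\<dots> = infsum (\<lambda>\<xi>. fourier_coeff \<xi> f * \<eta> \<xi>) (dist_spectrum f)"
      by (rule infsum_cong_neutral) (auto simp: dist_spectrum_def)
    finally show ?thesis using has_integral_atoms [OF sum \<eta>] by simp
  qed
  then show ?thesis
    using atoms_radon_measure [OF sum] atoms_atomic_sum [OF sum] unfolding equals_measure_def by blast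
qed

section \<open>Summability of the coefficients\<close>

text \<open>A shift by half a period \<open>h\<close> reverses the sign of the average, whereas
  \<open>bavg_shift\<close> says that it changes the average by at most a multiple of
  \<open>norm h / T\<close>.\<close>

lemma norm_bavg_ec_le:
  fixes z :: "'a::euclidean_space"
  assumes "z \<noteq> 0" "T > 0"
  shows "norm (bavg (\<lambda>t. ec (z \<bullet> t)) T 0) \<le> shell_const TYPE('a) / (4 * T * norm z)"
proof -
  let ?g = "\<lambda>t. ec (z \<bullet> t)"
  define h where "h = (1 / (2 * (norm z)\<^sup>2)) *\<^sub>R z"
  have zh: "z \<bullet> h = 1 / 2" using assms by (simp add: h_def power2_norm_eq_inner)
  have nh: "norm h = 1 / (2 * norm z)" using assms by (simp add: h_def power2_eq_square)
  have half: "ec (1 / 2) = - 1" by (simp add: ec_def)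
  have "?g (t + h) = - 1 * ?g t" for t
    by (simp only: inner_add_right ec_add zh half) simp
  then have "bavg ?g T h = bavg (\<lambda>t. - 1 * ?g t) T 0" unfolding bavg_def by simp
  then have "bavg ?g T h = - bavg ?g T 0" by (simp only: bavg_cmult) simp
  then have "2 * norm (bavg ?g T 0) = norm (bavg ?g T h - bavg ?g T 0)"
    by (simp add: norm_mult [symmetric] del: norm_mult)
  also have "\<dots> \<le> 1 * shell_const TYPE('a) * norm h / T" by (rule bavg_shift) (use assms in auto)
  finally show ?thesis using assms by (simp add: nh field_simps)
qed

text \<open>At most one frequency lies within half of the minimal distance \<open>\<sigma>\<close>
  from \<open>y\<close>, and it contributes at most 1. Every other term decays like
  \<open>1 / T\<close> at a rate that depends on \<open>\<sigma>\<close> but not on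
  \<open>y\<close>.\<close>

lemma separated_sum_bavg:
  fixes \<Lambda> :: "'a::euclidean_space set"
  assumes fin: "finite \<Lambda>" and \<epsilon>: "\<epsilon> > 0"
  shows "\<exists>T\<^sub>0>0. \<forall>T\<ge>T\<^sub>0. \<forall>y. (\<Sum>\<xi>\<in>\<Lambda>. norm (bavg (\<lambda>t. ec ((y - \<xi>) \<bullet> t)) T 0)) \<le> 1 + \<epsilon>"
proof -
  obtain \<sigma> where \<sigma>: "\<sigma> > 0" "\<And>\<xi> \<eta>. \<xi> \<in> \<Lambda> \<Longrightarrow> \<eta> \<in> \<Lambda> \<Longrightarrow> \<xi> \<noteq> \<eta> \<Longrightarrow> \<sigma> \<le> dist \<xi> \<eta>"
  proof -
    \<comment> \<open>The element 1 keeps the minimum meaningful when there are no two distinct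
      frequencies.\<close>
    let ?D = "insert 1 ((\<lambda>(\<xi>, \<eta>). dist \<xi> \<eta>) ` {p \<in> \<Lambda> \<times> \<Lambda>. fst p \<noteq> snd p})"
    have "finite ?D" using fin by simp
    then have pos: "Min ?D > 0" by (subst Min_gr_iff) auto
    show ?thesis
    proof (rule that [OF pos])
      fix \<xi> \<eta> assume "\<xi> \<in> \<Lambda>" "\<eta> \<in> \<Lambda>" "\<xi> \<noteq> \<eta>"
      then have "dist \<xi> \<eta> \<in> ?D" by (intro insertI2 image_eqI [of _ _ "(\<xi>, \<eta>)"]) auto
      with \<open>finite ?D\<close> show "Min ?D \<le> dist \<xi> \<eta>" by (rule Min_le)
    qed
  qed
  let ?K = "shell_const TYPE('a)"
  have K: "?K > 0" using shell_const_ge [where 'a='a] by simp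
  \<comment> \<open>Solves the requirement that \<open>card \<Lambda> + 1\<close> far terms add up
    to \<open>\<epsilon>\<close>. The added 1 keeps \<open>T\<^sub>0\<close> positive for empty
    \<open>\<Lambda>\<close>.\<close>
  define T\<^sub>0 where "T\<^sub>0 = (real (card \<Lambda>) + 1) * ?K / (2 * \<sigma> * \<epsilon>)"
  have T0: "T\<^sub>0 > 0" using K \<sigma> \<epsilon> by (simp add: T\<^sub>0_def)
  have "(\<Sum>\<xi>\<in>\<Lambda>. norm (bavg (\<lambda>t. ec ((y - \<xi>) \<bullet> t)) T 0)) \<le> 1 + \<epsilon>" if T: "T \<ge> T\<^sub>0" for T y
  proof -
    let ?f = "\<lambda>\<xi>. norm (bavg (\<lambda>t. ec ((y - \<xi>) \<bullet> t)) T 0)"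
    let ?N = "{\<xi> \<in> \<Lambda>. norm (y - \<xi>) < \<sigma> / 2}"
    have Tp: "T > 0" using T T0 by simp
    have one: "?f \<xi> \<le> 1" for \<xi> using Tp by (intro norm_bavg_le) auto
    have card1: "card ?N \<le> 1"
    proof (rule ccontr)
      assume "\<not> card ?N \<le> 1"
      then obtain \<xi> \<eta> where "\<xi> \<in> ?N" "\<eta> \<in> ?N" "\<xi> \<noteq> \<eta>"
        using fin by (metis (no_types, lifting) card_le_Suc0_iff_eq finite_Collect_conjI One_nat_def finite_subset Collect_subset mem_Collect_eq subsetI)
      then have "\<sigma> \<le> dist \<xi> \<eta>" "norm (y - \<xi>) < \<sigma> / 2" "norm (y - \<eta>) < \<sigma> / 2" using \<sigma>(2) by auto
      moreover have "dist \<xi> \<eta> \<le> norm (y - \<xi>) + norm (y - \<eta>)"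
        using norm_triangle_ineq4 [of "y - \<eta>" "y - \<xi>"] by (simp add: dist_norm)
      ultimately show False by simp
    qed
    have far: "?f \<xi> \<le> ?K / (2 * T * \<sigma>)" if "\<xi> \<in> \<Lambda> - ?N" for \<xi>
    proof -
      have n: "norm (y - \<xi>) \<ge> \<sigma> / 2" using that by auto
      then have "y - \<xi> \<noteq> 0" using \<sigma>(1) by auto
      then have "?f \<xi> \<le> ?K / (4 * T * norm (y - \<xi>))" by (rule norm_bavg_ec_le [OF _ Tp])
      also have "\<dots> \<le> ?K / (4 * T * (\<sigma> / 2))"
        using n Tp \<sigma> K by (intro divide_left_mono mult_left_mono mult_pos_pos) auto
      finally show ?thesis by simp
    qed
    have "sum ?f \<Lambda> = sum ?f (\<Lambda> - ?N) + sum ?f ?N"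
      by (rule sum.subset_diff) (use fin in auto)
    also have "\<dots> = sum ?f ?N + sum ?f (\<Lambda> - ?N)" by (rule add.commute)
    also have "\<dots> \<le> real (card ?N) * 1 + real (card (\<Lambda> - ?N)) * (?K / (2 * T * \<sigma>))"
      by (intro add_mono sum_bounded_above one far)
    also have "\<dots> \<le> 1 + (real (card \<Lambda>) + 1) * (?K / (2 * T\<^sub>0 * \<sigma>))"
    proof (intro add_mono mult_mono)
      show "real (card ?N) * 1 \<le> 1" using card1 by simp
      show "real (card (\<Lambda> - ?N)) \<le> real (card \<Lambda>) + 1" using fin card_mono [of \<Lambda> "\<Lambda> - ?N"] by simp
      show "?K / (2 * T * \<sigma>) \<le> ?K / (2 * T\<^sub>0 * \<sigma>)"
        using T T0 Tp \<sigma> K by (intro divide_left_mono mult_right_mono mult_left_mono mult_pos_pos) auto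
    qed (use K Tp \<sigma> in auto)
    also have "(real (card \<Lambda>) + 1) * (?K / (2 * T\<^sub>0 * \<sigma>)) = \<epsilon>"
    proof -
      have "n * (k / (2 * (n * k / (2 * s * e)) * s)) = e"
        if "n > 0" "k > 0" "s > 0" "e > 0" for n k s e :: real
        using that by (simp add: field_simps)
      then show ?thesis unfolding T\<^sub>0_def using K \<sigma>(1) \<epsilon> by simp
    qed
    finally show ?thesis .
  qed
  with T0 show ?thesis by blast
qed

text \<open>The mean of \<open>u\<close> against \<open>\<Sum> c\<^sub>\<xi> e\<^sub>-\<^sub>\<xi>\<close> is a limit of Riemann sums, to which the hypothesis
  applies; the kernel \<open>\<Sum> c\<^sub>\<xi> D\<^sub>T(y - \<xi>)\<close> that arises is bounded by \<open>1 + o(1)\<close> since the finitely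
  many frequencies are separated.\<close>

lemma coeff_sum_bound:
  fixes u :: "'a::euclidean_space \<Rightarrow> complex"
  assumes u: "apu u" and fin: "finite \<Lambda>" and B: "B \<ge> 0" and K: "\<And>y. y \<in> K \<Longrightarrow> norm y \<le> \<rho>" and \<rho>: "\<rho> \<ge> 0"
    and lin: "\<And>P w C. finite P \<Longrightarrow> C \<ge> 0 \<Longrightarrow> (\<And>y. y \<in> K \<Longrightarrow> norm (\<Sum>p\<in>P. w p * ec (y \<bullet> p)) \<le> C) \<Longrightarrow>
      norm (\<Sum>p\<in>P. w p * u p) \<le> B * C"
  shows "(\<Sum>\<xi>\<in>\<Lambda>. norm (mean_coeff \<xi> u)) \<le> B"
proof -
  define b where "b \<xi> = mean_coeff \<xi> u" for \<xi>
  \<comment> \<open>The phases that turn each coefficient into its modulus, with the value 0 where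
    the coefficient vanishes.\<close>
  define c where "c \<xi> = (if b \<xi> = 0 then 0 else cnj (b \<xi>) / of_real (norm (b \<xi>)))" for \<xi>
  have c1: "norm (c \<xi>) \<le> 1" for \<xi> by (simp add: c_def norm_divide)
  have cb: "c \<xi> * b \<xi> = of_real (norm (b \<xi>))" for \<xi>
    by (simp add: c_def) (simp add: mult.commute complex_norm_square [symmetric] power2_eq_square)
  define P where "P t = (\<Sum>\<xi>\<in>\<Lambda>. c \<xi> * ec (- (\<xi> \<bullet> t)))" for t
  have Pap: "apu P"
    unfolding P_def [abs_def] using apu_ec [of "- \<xi>" for \<xi>] by (intro apu_sum apu_cmult) simp
  note [measurable] = apu_measurable [OF u] apu_measurable [OF Pap]
  have cont: "isCont (\<lambda>t. u t * P t) x" for x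
    using apu_continuous [OF apu_mult [OF u Pap]] by (simp add: continuous_on_eq_continuous_at)
  obtain C where C: "C > 0" "\<And>x. norm (u x * P x) \<le> C" using apu_bounded [OF apu_mult [OF u Pap]] by metis
  obtain CP where CP: "CP > 0" "\<And>x. norm (P x) \<le> CP" using apu_bounded [OF Pap] by metis
  have mc: "mean_coeff 0 (\<lambda>t. u t * ec (- (\<xi> \<bullet> t))) = b \<xi>" for \<xi>
    unfolding b_def using apu_mean_coeff [OF u, of \<xi>] by (intro has_mean_imp_mean_coeff) simp
  have "mean_coeff 0 (\<lambda>t. u t * P t) = mean_coeff 0 (\<lambda>t. \<Sum>\<xi>\<in>\<Lambda>. c \<xi> * (u t * ec (- (\<xi> \<bullet> t))))"
    by (simp add: P_def sum_distrib_left mult_ac)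
  also have "\<dots> = (\<Sum>\<xi>\<in>\<Lambda>. of_real (norm (b \<xi>)))"
    by (subst mean_coeff_sum)
       (auto simp: mean_coeff_cmult [OF apu_modulate [OF u]] mc cb intro!: apu_cmult apu_modulate u)
  finally have mean: "mean_coeff 0 (\<lambda>t. u t * P t) = of_real (\<Sum>\<xi>\<in>\<Lambda>. norm (b \<xi>))" by simp
  have lim: "((\<lambda>T. norm (bavg (\<lambda>t. u t * P t) T 0)) \<longlongrightarrow> (\<Sum>\<xi>\<in>\<Lambda>. norm (b \<xi>))) at_top"
  proof -
    have "((\<lambda>T. norm (bavg (\<lambda>t. u t * P t) T 0)) \<longlongrightarrow> norm (mean_coeff 0 (\<lambda>t. u t * P t))) at_top"
      using has_mean_tendsto [OF apu_mean_coeff [OF apu_mult [OF u Pap], of 0], of 0] by (intro tendsto_norm) simp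
    moreover have "norm (mean_coeff 0 (\<lambda>t. u t * P t)) = (\<Sum>\<xi>\<in>\<Lambda>. norm (b \<xi>))"
      unfolding mean norm_of_real by (simp add: sum_nonneg)
    ultimately show ?thesis by simp
  qed
  \<comment> \<open>A Lipschitz constant of the modulated kernel that holds for all \<open>y\<close>
    in \<open>K\<close> at once, so that the rounding error is uniform over
    \<open>K\<close>.\<close>
  define Lip where "Lip = (\<Sum>\<xi>\<in>\<Lambda>. 2 * pi * (\<rho> + norm \<xi>))"
  have Lip: "Lip \<ge> 0" using \<rho> by (auto simp: Lip_def intro!: sum_nonneg)
  have bound: "norm (bavg (\<lambda>t. u t * P t) T 0) \<le> B * (1 + \<epsilon>)"
    if T: "T > 0" and sep: "\<And>y. (\<Sum>\<xi>\<in>\<Lambda>. norm (bavg (\<lambda>t. ec ((y - \<xi>) \<bullet> t)) T 0)) \<le> 1 + \<epsilon>" and \<epsilon>: "\<epsilon> > 0" for T \<epsilon>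
  proof -
    let ?v = "bvol TYPE('a) T"
    let ?B = "ball (0::'a) T"
    have v: "?v > 0" by (rule bvol_pos [OF T])
    let ?k = "\<lambda>s::'a. complex_of_real (indicator ?B s)"
    have k: "integrable lborel ?k" using integrable_ball [of "0::'a" T] by simp
    have "\<exists>r :: 'a \<Rightarrow> 'a. r \<in> borel_measurable borel \<and> finite (range r) \<and> (\<forall>s\<in>?B. norm (r s - s) < 1 / real (Suc N))" for N
      by (rule finite_valued_approx) simp
    then obtain r :: "nat \<Rightarrow> 'a \<Rightarrow> 'a" where r: "\<And>N. r N \<in> borel_measurable borel" "\<And>N. finite (range (r N))"
      "\<And>N s. s \<in> ?B \<Longrightarrow> norm (r N s - s) < 1 / real (Suc N)"
      by metis
    note [measurable] = r(1)
    define w where "w N p = (LINT s|lborel. indicator (?B \<inter> r N -` {p}) s *\<^sub>R ?k s)" for N p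
    have w: "(\<Sum>p\<in>range (r N). w N p * h p) = (LINT s|lborel. indicator ?B s *\<^sub>R h (r N s))" for N h
    proof -
      have "(\<Sum>p\<in>range (r N). w N p * h p) = (LINT s|lborel. indicator ?B s *\<^sub>R (h (r N s) * ?k s))"
        unfolding w_def by (rule integral_finite_valued [OF r(1,2) k]) simp
      also have "\<dots> = (LINT s|lborel. indicator ?B s *\<^sub>R h (r N s))"
        by (intro Bochner_Integration.integral_cong) (auto simp: indicator_def)
      finally show ?thesis .
    qed
    define J where "J N = (LINT s|lborel. indicator ?B s *\<^sub>R (u (r N s) * P (r N s)))" for N
    have Jle: "norm (J N) \<le> B * (?v * (1 + \<epsilon>) + ?v * Lip * inverse (real (Suc N)))" for N
    proof -
      have "J N = (\<Sum>p\<in>range (r N). (w N p * P p) * u p)"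
        using w [of N "\<lambda>p. u p * P p"] by (simp add: J_def mult_ac)
      also have "norm \<dots> \<le> B * (?v * (1 + \<epsilon>) + ?v * Lip * inverse (real (Suc N)))"
      proof (rule lin [OF r(2)])
        show "0 \<le> ?v * (1 + \<epsilon>) + ?v * Lip * inverse (real (Suc N))" using v \<epsilon> Lip by simp
        fix y assume y: "y \<in> K"
        \<comment> \<open>Modulation by \<open>y\<close> turns the frequencies into
          \<open>y - \<xi>\<close>. The integral of this kernel over the ball is therefore bounded
          by the volume times the sum estimated in \<open>sep\<close>.\<close>
        define \<Psi> where "\<Psi> t = P t * ec (y \<bullet> t)" for t
        have \<Psi>: "\<Psi> t = (\<Sum>\<xi>\<in>\<Lambda>. c \<xi> * ec ((y - \<xi>) \<bullet> t))" for t
          unfolding \<Psi>_def P_def sum_distrib_right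
          by (intro sum.cong refl) (simp add: mult.assoc ec_add [symmetric] inner_diff_left)
        have \<Psi>m [measurable]: "\<Psi> \<in> borel_measurable borel" unfolding \<Psi>_def [abs_def] by measurable
        have \<Psi>b: "norm (\<Psi> t) \<le> CP" for t using CP(2) by (simp add: \<Psi>_def norm_mult)
        have lip: "norm (\<Psi> s - \<Psi> t) \<le> Lip * norm (s - t)" for s t
        proof -
          have "\<Psi> s - \<Psi> t = (\<Sum>\<xi>\<in>\<Lambda>. c \<xi> * (ec ((y - \<xi>) \<bullet> s) - ec ((y - \<xi>) \<bullet> t)))"
            by (simp add: \<Psi> sum_subtractf right_diff_distrib)
          also have "norm \<dots> \<le> (\<Sum>\<xi>\<in>\<Lambda>. 2 * pi * (\<rho> + norm \<xi>) * norm (s - t))"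
          proof (rule sum_norm_le)
            fix \<xi>
            have "norm (ec ((y - \<xi>) \<bullet> s) - ec ((y - \<xi>) \<bullet> t)) \<le> 2 * pi * \<bar>(y - \<xi>) \<bullet> (s - t)\<bar>"
              using norm_ec_diff_le [of "(y - \<xi>) \<bullet> s" "(y - \<xi>) \<bullet> t"] by (simp add: inner_diff_right)
            also have "\<dots> \<le> 2 * pi * (norm (y - \<xi>) * norm (s - t))"
              by (intro mult_left_mono Cauchy_Schwarz_ineq2) auto
            also have "\<dots> \<le> 2 * pi * ((\<rho> + norm \<xi>) * norm (s - t))"
              using norm_triangle_ineq4 [of y \<xi>] K [OF y] by (intro mult_left_mono mult_right_mono) auto
            finally have "norm (c \<xi>) * norm (ec ((y - \<xi>) \<bullet> s) - ec ((y - \<xi>) \<bullet> t)) \<le> 1 * (2 * pi * ((\<rho> + norm \<xi>) * norm (s - t)))"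
              using c1 by (intro mult_mono) auto
            then show "norm (c \<xi> * (ec ((y - \<xi>) \<bullet> s) - ec ((y - \<xi>) \<bullet> t))) \<le> 2 * pi * (\<rho> + norm \<xi>) * norm (s - t)"
              by (simp add: norm_mult mult.assoc)
          qed
          also have "\<dots> = Lip * norm (s - t)" by (simp add: Lip_def sum_distrib_right)
          finally show ?thesis .
        qed
        have i1: "integrable lborel (\<lambda>s. indicator ?B s *\<^sub>R \<Psi> s)" "integrable lborel (\<lambda>s. indicator ?B s *\<^sub>R \<Psi> (r N s))"
          using set_integrable_ball [OF \<Psi>m \<Psi>b, of 0 T] set_integrable_ball [of "\<lambda>s. \<Psi> (r N s)" CP 0 T] \<Psi>b
          by (simp_all add: set_integrable_def)
        have "norm (LINT s|lborel. indicator ?B s *\<^sub>R \<Psi> s) \<le> ?v * (1 + \<epsilon>)"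
        proof -
          have ib: "integrable lborel (\<lambda>t. indicator ?B t *\<^sub>R ec ((y - \<xi>) \<bullet> t))" for \<xi>
            using set_integrable_ball [of "\<lambda>t. ec ((y - \<xi>) \<bullet> t)" 1 0 T] by (simp add: set_integrable_def)
          have "(LINT s|lborel. indicator ?B s *\<^sub>R \<Psi> s) = (LINT s|lborel. (\<Sum>\<xi>\<in>\<Lambda>. c \<xi> * (indicator ?B s *\<^sub>R ec ((y - \<xi>) \<bullet> s))))"
            by (simp add: \<Psi> scaleR_sum_right)
          also have "\<dots> = (\<Sum>\<xi>\<in>\<Lambda>. c \<xi> * (of_real ?v * bavg (\<lambda>t. ec ((y - \<xi>) \<bullet> t)) T 0))"
            using ib v by (simp add: bavg_def set_lebesgue_integral_def del: mult_scaleR_right)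
          also have "norm \<dots> \<le> (\<Sum>\<xi>\<in>\<Lambda>. ?v * norm (bavg (\<lambda>t. ec ((y - \<xi>) \<bullet> t)) T 0))"
          proof (rule sum_norm_le)
            fix \<xi>
            have "norm (c \<xi>) * (?v * norm (bavg (\<lambda>t. ec ((y - \<xi>) \<bullet> t)) T 0)) \<le> 1 * (?v * norm (bavg (\<lambda>t. ec ((y - \<xi>) \<bullet> t)) T 0))"
              using c1 v by (intro mult_right_mono) auto
            then show "norm (c \<xi> * (of_real ?v * bavg (\<lambda>t. ec ((y - \<xi>) \<bullet> t)) T 0)) \<le> ?v * norm (bavg (\<lambda>t. ec ((y - \<xi>) \<bullet> t)) T 0)"
              using v by (simp add: norm_mult)
          qed
          also have "\<dots> \<le> ?v * (1 + \<epsilon>)"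
            unfolding sum_distrib_left [symmetric] using v sep [of y] by (intro mult_left_mono) auto
          finally show ?thesis .
        qed
        moreover have "norm ((LINT s|lborel. indicator ?B s *\<^sub>R \<Psi> (r N s)) - (LINT s|lborel. indicator ?B s *\<^sub>R \<Psi> s)) \<le> ?v * Lip * inverse (real (Suc N))"
        proof -
          have "(LINT s|lborel. indicator ?B s *\<^sub>R \<Psi> (r N s)) - (LINT s|lborel. indicator ?B s *\<^sub>R \<Psi> s) =
              (LINT s|lborel. indicator ?B s *\<^sub>R \<Psi> (r N s) - indicator ?B s *\<^sub>R \<Psi> s)"
            using i1 by simp
          also have "norm \<dots> \<le> (LINT s|lborel. (Lip * inverse (real (Suc N))) * indicator ?B s)"
          proof (rule Bochner_Integration.integral_norm_bound_integral)
            show "integrable lborel (\<lambda>s. indicator ?B s *\<^sub>R \<Psi> (r N s) - indicator ?B s *\<^sub>R \<Psi> s)" using i1 by simp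
            show "integrable lborel (\<lambda>s. (Lip * inverse (real (Suc N))) * indicator ?B s)"
              by (intro integrable_mult_right integrable_ball)
            fix s
            have "norm (\<Psi> (r N s) - \<Psi> s) \<le> Lip * inverse (real (Suc N))" if "s \<in> ?B"
            proof -
              have "norm (\<Psi> (r N s) - \<Psi> s) \<le> Lip * norm (r N s - s)" by (rule lip)
              also have "\<dots> \<le> Lip * inverse (real (Suc N))"
                using r(3) [OF that, of N] Lip by (intro mult_left_mono) (auto simp: inverse_eq_divide)
              finally show ?thesis .
            qed
            then show "norm (indicator ?B s *\<^sub>R \<Psi> (r N s) - indicator ?B s *\<^sub>R \<Psi> s) \<le> (Lip * inverse (real (Suc N))) * indicator ?B s"
              by (simp add: indicator_def del: of_nat_Suc)
          qed
          also have "\<dots> = ?v * Lip * inverse (real (Suc N))"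
            using measure_ball [of T "0::'a"] T by (simp del: of_nat_Suc)
          finally show ?thesis .
        qed
        moreover have "(\<Sum>p\<in>range (r N). w N p * P p * ec (y \<bullet> p)) = (LINT s|lborel. indicator ?B s *\<^sub>R \<Psi> (r N s))"
          using w [of N \<Psi>] by (simp add: \<Psi>_def mult.assoc)
        ultimately show "norm (\<Sum>p\<in>range (r N). w N p * P p * ec (y \<bullet> p)) \<le> ?v * (1 + \<epsilon>) + ?v * Lip * inverse (real (Suc N))"
          using norm_triangle_sub [of "LINT s|lborel. indicator ?B s *\<^sub>R \<Psi> (r N s)" "LINT s|lborel. indicator ?B s *\<^sub>R \<Psi> s"]
          by (simp del: of_nat_Suc)
      qed
      finally show ?thesis .
    qed
    have r_lim: "(\<lambda>N. r N s) \<longlonglongrightarrow> s" if "s \<in> ?B" for s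
    proof (rule LIM_zero_cancel, rule Lim_null_comparison [OF always_eventually LIMSEQ_inverse_real_of_nat], rule allI)
      show "norm (r N s - s) \<le> inverse (real (Suc N))" for N
        using r(3) [OF that, of N] by (simp add: inverse_eq_divide)
    qed
    have "J \<longlonglongrightarrow> (LINT s|lborel. indicator ?B s *\<^sub>R (u s * P s))"
      unfolding J_def [abs_def]
    proof (rule integral_dominated_convergence)
      show "integrable lborel (\<lambda>s. C * indicator ?B s)" by (intro integrable_mult_right integrable_ball)
      show "AE s in lborel. (\<lambda>N. indicator ?B s *\<^sub>R (u (r N s) * P (r N s))) \<longlonglongrightarrow> indicator ?B s *\<^sub>R (u s * P s)"
      proof (rule AE_I2)
        fix s
        have "(\<lambda>N. u (r N s) * P (r N s)) \<longlonglongrightarrow> u s * P s" if "s \<in> ?B"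
          by (rule isCont_tendsto_compose [OF cont r_lim [OF that]])
        then show "(\<lambda>N. indicator ?B s *\<^sub>R (u (r N s) * P (r N s))) \<longlonglongrightarrow> indicator ?B s *\<^sub>R (u s * P s)"
          by (cases "s \<in> ?B") auto
      qed
      show "AE s in lborel. norm (indicator ?B s *\<^sub>R (u (r N s) * P (r N s))) \<le> C * indicator ?B s" for N
        using C by (auto simp: indicator_def)
    qed measurable
    then have "(\<lambda>N. norm (J N)) \<longlonglongrightarrow> norm (LINT s|lborel. indicator ?B s *\<^sub>R (u s * P s))" by (rule tendsto_norm)
    moreover have "(\<lambda>N. B * (?v * (1 + \<epsilon>) + ?v * Lip * inverse (real (Suc N)))) \<longlonglongrightarrow> B * (?v * (1 + \<epsilon>) + ?v * Lip * 0)"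
      by (intro tendsto_intros LIMSEQ_inverse_real_of_nat)
    ultimately have "norm (LINT s|lborel. indicator ?B s *\<^sub>R (u s * P s)) \<le> B * (?v * (1 + \<epsilon>) + ?v * Lip * 0)"
      by (rule LIMSEQ_le) (use Jle in blast)
    then show ?thesis
      using v by (simp add: bavg_def set_lebesgue_integral_def norm_divide divide_le_eq mult_ac)
  qed
  have "(\<Sum>\<xi>\<in>\<Lambda>. norm (b \<xi>)) \<le> B * (1 + \<epsilon>)" if \<epsilon>: "\<epsilon> > 0" for \<epsilon>
  proof (rule tendsto_upperbound [OF lim])
    obtain T\<^sub>0 where T0: "T\<^sub>0 > 0" "\<And>T y. T \<ge> T\<^sub>0 \<Longrightarrow> (\<Sum>\<xi>\<in>\<Lambda>. norm (bavg (\<lambda>t. ec ((y - \<xi>) \<bullet> t)) T 0)) \<le> 1 + \<epsilon>"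
      using separated_sum_bavg [OF fin \<epsilon>] by blast
    show "\<forall>\<^sub>F T in at_top. norm (bavg (\<lambda>t. u t * P t) T 0) \<le> B * (1 + \<epsilon>)"
      unfolding eventually_at_top_linorder
    proof (intro exI [of _ T\<^sub>0] allI impI)
      fix T assume "T \<ge> T\<^sub>0"
      with T0 \<epsilon> show "norm (bavg (\<lambda>t. u t * P t) T 0) \<le> B * (1 + \<epsilon>)" by (intro bound) auto
    qed
  qed simp
  note le = this
  have "(\<Sum>\<xi>\<in>\<Lambda>. norm (b \<xi>)) \<le> B + \<epsilon>" if \<epsilon>: "\<epsilon> > 0" for \<epsilon>
  proof -
    \<comment> \<open>The denominator \<open>B + 1\<close> covers the case
      \<open>B = 0\<close>.\<close>
    have "(\<Sum>\<xi>\<in>\<Lambda>. norm (b \<xi>)) \<le> B * (1 + \<epsilon> / (B + 1))" using \<epsilon> B by (intro le) simp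
    also have "\<dots> = B + \<epsilon> * (B / (B + 1))" by (simp add: algebra_simps)
    also have "\<dots> \<le> B + \<epsilon> * 1" using \<epsilon> B by (intro add_left_mono mult_left_mono) auto
    finally show ?thesis by simp
  qed
  then show ?thesis unfolding b_def by (rule field_le_epsilon)
qed

lemma measure_imp_summable:
  fixes f :: "('a::euclidean_space \<Rightarrow> complex) \<Rightarrow> complex"
  assumes f: "temperate f" and ap: "almost_periodic_dist f" and \<mu>: "equals_measure (fourier_dist f) \<mu>"
  shows "(\<lambda>\<xi>. norm (fourier_coeff \<xi> f)) summable_on {\<xi> \<in> dist_spectrum f. norm \<xi> < R}"
proof -
  \<comment> \<open>A positive radius that dominates \<open>R\<close> also when \<open>R\<close> is
    negative or zero.\<close>
  define S where "S = \<bar>R\<bar> + 1"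
  have S: "S > 0" "R \<le> S" by (auto simp: S_def)
  obtain \<beta> :: "'a \<Rightarrow> real" where \<beta>: "(\<lambda>x. complex_of_real (\<beta> x)) \<in> test_functions"
    "\<And>x. \<beta> x \<ge> 0" "\<And>x. \<beta> x > 0 \<longleftrightarrow> norm x < S + 1"
    using bump_exists [of "S + 1", where 'a='a] S by (metis add_pos_pos zero_less_one)
  let ?\<eta> = "\<lambda>x. complex_of_real (\<beta> x)"
  \<comment> \<open>\<open>\<beta>\<close> is positive on a ball of radius \<open>S + 1\<close>, so
    its minimum over the smaller compact ball is positive. This provides the lower bound by which
    the coefficients are recovered.\<close>
  have "continuous_on (cball 0 S) \<beta>"
    using continuous_on_Re [OF test_functions_continuous [OF \<beta>(1), of "cball 0 S"]] by simp
  then obtain x\<^sub>0 where x0: "x\<^sub>0 \<in> cball 0 S" "\<And>x. x \<in> cball 0 S \<Longrightarrow> \<beta> x\<^sub>0 \<le> \<beta> x"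
    using continuous_attains_inf [of "cball (0::'a) S" \<beta>] S by auto
  define c where "c = \<beta> x\<^sub>0"
  have c: "c > 0" "\<And>x. norm x \<le> S \<Longrightarrow> c \<le> \<beta> x" using x0 \<beta>(3) [of x\<^sub>0] by (auto simp: c_def)
  \<comment> \<open>Gives \<open>2 * pi * S * \<delta> = 1 / 2\<close>, so that the transform of the
    bump stays at least one half in modulus on the ball of radius \<open>S\<close>.\<close>
  define \<delta> where "\<delta> = 1 / (4 * pi * S)"
  have \<delta>: "\<delta> > 0" using S by (simp add: \<delta>_def)
  obtain \<gamma> :: "'a \<Rightarrow> real" where \<gamma>: "(\<lambda>x. complex_of_real (\<gamma> x)) \<in> test_functions"
    "\<And>x. \<gamma> x \<ge> 0" "\<And>x. \<gamma> x > 0 \<longleftrightarrow> norm x < \<delta>" "integrable lborel \<gamma>" "(LINT x|lborel. \<gamma> x) = 1"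
    using bump_exists [OF \<delta>] by metis
  let ?\<phi> = "\<lambda>x. complex_of_real (\<gamma> x)"
  define \<eta>\<^sub>0 where "\<eta>\<^sub>0 y = fourier ?\<phi> y * ?\<eta> y" for y
  have \<eta>0: "\<eta>\<^sub>0 \<in> test_functions"
    unfolding \<eta>\<^sub>0_def [abs_def] by (intro test_functions_mult_smooth(1) \<beta>(1) fourier_smooth \<gamma>(1))
  have \<phi>_ge: "norm (fourier ?\<phi> \<xi>) \<ge> 1 / 2" if "norm \<xi> \<le> S" for \<xi>
  proof -
    have "norm (fourier ?\<phi> \<xi> - 1) \<le> 2 * pi * norm \<xi> * \<delta>" by (rule fourier_bump_near [OF \<gamma>])
    also have "\<dots> \<le> 2 * pi * S * \<delta>" using that \<delta> by (intro mult_right_mono mult_left_mono) auto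
    also have "\<dots> = 1 / 2" using S by (simp add: \<delta>_def)
    finally show ?thesis using norm_triangle_sub [of 1 "fourier ?\<phi> \<xi>"] by (simp add: norm_minus_commute)
  qed
  have \<eta>0_ge: "norm (\<eta>\<^sub>0 \<xi>) \<ge> c / 2" if "norm \<xi> \<le> S" for \<xi>
  proof -
    have "1 / 2 * c \<le> norm (fourier ?\<phi> \<xi>) * \<beta> \<xi>"
      using \<phi>_ge [OF that] c that by (intro mult_mono) auto
    then show ?thesis using \<beta>(2) [of \<xi>] by (simp add: \<eta>\<^sub>0_def norm_mult)
  qed
  obtain M where M: "M > 0" "\<And>x. norm (\<eta>\<^sub>0 x) \<le> M" using test_functions_bounded [OF \<eta>0] by metis
  let ?K = "cball (0::'a) (S + 1)"
  have \<eta>0_out: "\<eta>\<^sub>0 x = 0" if "x \<notin> ?K" for x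
    using that \<beta>(2,3) [of x] by (simp add: \<eta>\<^sub>0_def)
  have \<mu>r: "complex_radon_measure \<mu>" and \<mu>i: "\<And>\<phi>. \<phi> \<in> test_functions \<Longrightarrow> has_integral_cm \<phi> (f (fourier \<phi>)) \<mu>"
    using \<mu> by (auto simp: equals_measure_def fourier_dist_def)
  obtain V where V: "V \<ge> 0" "\<And>\<eta> I c. has_integral_cm \<eta> I \<mu> \<Longrightarrow> (\<And>x. norm (\<eta> x) \<le> c) \<Longrightarrow> (\<And>x. x \<notin> ?K \<Longrightarrow> \<eta> x = 0) \<Longrightarrow> norm I \<le> V * c"
    using has_integral_cm_bound [OF \<mu>r compact_cball, of "0::'a" "S + 1"] by blast
  let ?u = "\<lambda>t. f (fourier (\<lambda>y. fourier ?\<phi> y * ?\<eta> y * ec (y \<bullet> t)))"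
  have u: "apu ?u" by (rule apu_regularised [OF f ap \<gamma>(1) \<beta>(1)])
  have mc: "mean_coeff \<xi> ?u = fourier_coeff \<xi> f * \<eta>\<^sub>0 \<xi>" for \<xi>
    unfolding mean_coeff_regularised [OF f ap \<gamma>(1) \<beta>(1)] mean_coeff_conv_dist [OF f ap \<gamma>(1)]
    by (simp add: \<eta>\<^sub>0_def)
  \<comment> \<open>A finite combination of values of \<open>?u\<close> is the value of
    \<open>fourier_dist f\<close> at \<open>\<eta>\<^sub>0\<close> times an exponential sum. This
    product is a test function supported in \<open>?K\<close>, and the measure bounds it by the
    supremum.\<close>
  have lin: "norm (\<Sum>p\<in>P. w p * ?u p) \<le> (V * M) * C"
    if P: "finite P" and C: "C \<ge> 0" and le: "\<And>y. y \<in> ?K \<Longrightarrow> norm (\<Sum>p\<in>P. w p * ec (y \<bullet> p)) \<le> C" for P w C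
  proof -
    have t: "(\<lambda>y. \<eta>\<^sub>0 y * ec (y \<bullet> p)) \<in> test_functions" for p
      by (intro test_functions_mult_smooth(2) \<eta>0 smooth_ec)
    let ?F = "\<lambda>y. \<Sum>p\<in>P. w p * (\<eta>\<^sub>0 y * ec (y \<bullet> p))"
    have F: "?F \<in> test_functions" by (intro test_functions_sum test_functions_cmult t)
    have "fourier ?F = (\<lambda>x. \<Sum>p\<in>P. w p * fourier (\<lambda>y. \<eta>\<^sub>0 y * ec (y \<bullet> p)) x)"
      by (rule ext, subst fourier_sum [OF P])
         (auto simp: fourier_cmult intro!: test_functions_integrable test_functions_cmult t)
    then have "(\<Sum>p\<in>P. w p * ?u p) = f (fourier ?F)"
      using temperate_sum [OF f, of P "\<lambda>p. fourier (\<lambda>y. \<eta>\<^sub>0 y * ec (y \<bullet> p))" w] fourier_schwartz [OF t]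
      by (simp add: \<eta>\<^sub>0_def)
    also have "norm \<dots> \<le> V * (M * C)"
    proof (rule V(2) [OF \<mu>i [OF F]])
      have eq: "?F x = \<eta>\<^sub>0 x * (\<Sum>p\<in>P. w p * ec (x \<bullet> p))" for x by (simp add: sum_distrib_left mult_ac)
      show "norm (?F x) \<le> M * C" for x
      proof (cases "x \<in> ?K")
        case True
        then show ?thesis unfolding eq norm_mult using M C le by (intro mult_mono) auto
      next
        case False
        then show ?thesis unfolding eq \<eta>0_out [OF False] using M C by simp
      qed
      show "?F x = 0" if "x \<notin> ?K" for x using \<eta>0_out [OF that] by simp
    qed
    finally show ?thesis by (simp add: mult.assoc)
  qed
  \<comment> \<open>The sum bound for the coefficients of \<open>?u\<close> is divided by the lower
    bound \<open>c / 2\<close> of the multiplier \<open>\<eta>\<^sub>0\<close>. The result does not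
    depend on the finite set, which gives summability.\<close>
  have bound: "(\<Sum>\<xi>\<in>\<Lambda>. norm (fourier_coeff \<xi> f)) \<le> 2 / c * (V * M)"
    if \<Lambda>: "finite \<Lambda>" "\<Lambda> \<subseteq> {\<xi> \<in> dist_spectrum f. norm \<xi> < R}" for \<Lambda>
  proof -
    have "(\<Sum>\<xi>\<in>\<Lambda>. norm (fourier_coeff \<xi> f)) \<le> (\<Sum>\<xi>\<in>\<Lambda>. 2 / c * norm (mean_coeff \<xi> ?u))"
    proof (rule sum_mono)
      fix \<xi> assume "\<xi> \<in> \<Lambda>"
      then have "norm \<xi> \<le> S" using \<Lambda>(2) S by auto
      then have "norm (fourier_coeff \<xi> f) * (c / 2) \<le> norm (fourier_coeff \<xi> f) * norm (\<eta>\<^sub>0 \<xi>)"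
        by (intro mult_left_mono \<eta>0_ge) auto
      moreover have "norm (mean_coeff \<xi> ?u) = norm (fourier_coeff \<xi> f) * norm (\<eta>\<^sub>0 \<xi>)"
        unfolding mc by (simp add: norm_mult)
      ultimately have "norm (fourier_coeff \<xi> f) * (c / 2) \<le> norm (mean_coeff \<xi> ?u)" by linarith
      then have "2 / c * (norm (fourier_coeff \<xi> f) * (c / 2)) \<le> 2 / c * norm (mean_coeff \<xi> ?u)"
        using c(1) by (intro mult_left_mono) auto
      then show "norm (fourier_coeff \<xi> f) \<le> 2 / c * norm (mean_coeff \<xi> ?u)"
        using c(1) by simp
    qed
    also have "\<dots> = 2 / c * (\<Sum>\<xi>\<in>\<Lambda>. norm (mean_coeff \<xi> ?u))" by (simp add: sum_distrib_left)
    also have "\<dots> \<le> 2 / c * (V * M)"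
    proof (intro mult_left_mono)
      show "(\<Sum>\<xi>\<in>\<Lambda>. norm (mean_coeff \<xi> ?u)) \<le> V * M"
      proof (rule coeff_sum_bound [OF u \<Lambda>(1), of "V * M" ?K "S + 1"])
        show "norm y \<le> S + 1" if "y \<in> ?K" for y using that by simp
      qed (use V(1) M(1) S lin in auto)
    qed (use c in simp)
    finally show ?thesis .
  qed
  show ?thesis
    by (rule nonneg_bdd_above_summable_on) (auto intro!: bdd_aboveI2 bound)
qed

text \<open>The three conditions form a cycle: summability yields the atomic form, which is in
  particular a measure, and a measure forces summability.\<close>

theorem theorem7:
  fixes f :: "('a::euclidean_space \<Rightarrow> complex) \<Rightarrow> complex"
  assumes "temperate f" and "almost_periodic_dist f"
  shows "((\<forall>R::real. (\<lambda>\<xi>. norm (fourier_coeff \<xi> f)) summable_on {\<xi> \<in> dist_spectrum f. norm \<xi> < R})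
            \<longleftrightarrow> is_radon_measure (fourier_dist f))
       \<and> (is_radon_measure (fourier_dist f)
            \<longleftrightarrow> (\<exists>\<mu>. equals_measure (fourier_dist f) \<mu> \<and>
                     atomic_sum \<mu> (\<lambda>\<xi>. fourier_coeff \<xi> f) (dist_spectrum f)))"
  unfolding is_radon_measure_def
  using summable_imp_atomic [OF assms] measure_imp_summable [OF assms] by blast

end
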